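(* Let $G$ be an inverse semigroup, let $\beta$ be a partial action of $G$ on a $C^*$-algebra $B$, and let $\tilde\beta$ be the corresponding action of $\mathbf{Pr}(G)$ on $B$. Then $$B\rtimes_{\beta}G\cong B\rtimes_{\tilde\beta}\mathbf{Pr}(G)\quad\text{and}\quad B\rtimes^{\mathrm r}_{\beta}G\cong B\rtimes^{\mathrm r}_{\tilde\beta}\mathbf{Pr}(G).$$
   Context: For an inverse semigroup $G$, $s^*$ is the inverse of $s$, $E(G)$ the set of idempotents, $\le$ the natural partial order. $\mathbf{Pr}(G)$ is the universal semigroup with one generator $[s]$ for each $s\in G$ and, for all $s,t\in G$, the relations $[s][t][t^*]=[st][t^*]$, $[s^*][s][t]=[s^*][st]$, $[s][s^*][s]=[s]$; it is an inverse semigroup. A map $\pi$ from $G$ to a semigroup $T$ is a partial homomorphism if for all $s,t\in G$: $\pi(s)\pi(t)\pi(t^* )=\pi(st)\pi(t^* )$, $\pi(s^* )\pi(s)\pi(t)=\pi(s^* )\pi(st)$, $\pi(s)\pi(s^* )\pi(s)=\pi(s)$. Each such $\pi$ induces a unique homomorphism $\tilde\pi\colon\mathbf{Pr}(G)\to T$ with $\tilde\pi([s])=\pi(s)$. A partial automorphism of $B$ is a $*$-isomorphism between closed two-sided ideals of $B$; these form an inverse semigroup under composition of partial maps. A partial action of $G$ on $B$ is a partial homomorphism $\beta$ from $G$ into the inverse semigroup of partial automorphisms of $B$, $\beta_s\colon\mathcal D_{s^*}\to\mathcal D_s$, such that $\bigcup_s\mathcal D_s$ spans a dense subspace of $B$;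 it is an action if $\beta$ is a homomorphism. The action $\tilde\beta$ of $\mathbf{Pr}(G)$ corresponding to $\beta$ is the induced homomorphism, $\tilde\beta_{[s]}=\beta_s$. Fell bundles. A Fell bundle over an inverse semigroup $S$ is a family $\mathcal A=\{\mathcal A_s\}_{s\in S}$ of Banach spaces with bilinear multiplications $\mathcal A_s\times\mathcal A_t\to\mathcal A_{st}$, conjugate-linear isometric involutions $\mathcal A_s\to\mathcal A_{s^*}$, and linear isometric inclusions $j_{t,s}\colon\mathcal A_s\to\mathcal A_t$ for $s\le t$, such that multiplication is associative, $(ab)^*=b^*a^*$, $a^{**}=a$, $\|ab\|\le\|a\|\|b\|$, $\|a^*a\|=\|a\|^2$, $a^*a\ge0$ in the $C^*$-algebra $\mathcal A_{s^*s}$ for $a\in\mathcal A_s$, $j_{t,r}=j_{t,s}j_{s,r}$ for $r\le s\le t$, and the inclusions are compatible with multiplication and involution. The full cross-sectional $C^*$-algebra $C^*(\mathcal A)$ is the universal $C^*$-algebra for representations of $\mathcal A$, i.e. families of linear maps $\pi_s\colon\mathcal A_s\to C$ into a $C^*$-algebra with $\pi_s(a)\pi_t(b)=\pi_{st}(ab)$, $\pi_s(a)^*=\pi_{s^*}(a^* )$, $\pi_t\circ j_{t,s}=\pi_s$. The fibers over idempotents generate in it $C^*(\mathcal E)$, $\mathcal E$ the restriction of $\mathcal A$ to $E(S)$. For a pure state $\varphi$ of $C^*(\mathcal E)$ there is a state $\tilde\varphi$ of $C^*(\mathcal A)$ with, for $a\in\mathcal A_s$, $\tilde\varphi(a)=\lim_i\varphi(au_i)$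 if there is $e\in E(S)$, $e\le s$, with $\varphi|_{\mathcal A_e}\neq0$ ($(u_i)$ an approximate unit of $\mathcal A_e$), and $\tilde\varphi(a)=0$ otherwise. The reduced cross-sectional $C^*$-algebra $C^*_{\mathrm r}(\mathcal A)$ is the quotient of $C^*(\mathcal A)$ by the intersection of the kernels of the GNS representations of all such $\tilde\varphi$. Crossed products. The Fell bundle of a partial action $\beta$ of $S$ on $B$ has fibers $\mathcal A_s=\mathcal D_s\delta_s=\{a\delta_s:a\in\mathcal D_s\}$ and operations $(a\delta_s)(b\delta_t)=\beta_s(\beta_s^{-1}(a)b)\delta_{st}$, $(a\delta_s)^*=\beta_s^{-1}(a^* )\delta_{s^*}$, and $j_{t,s}(a\delta_s)=a\delta_t$ for $s\le t$. The full and reduced crossed products are $B\rtimes_\beta S=C^*(\mathcal A)$ and $B\rtimes^{\mathrm r}_\beta S=C^*_{\mathrm r}(\mathcal A)$ (canonical identifications). *)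

theory Defs
  imports "HOL-Analysis.Analysis"
begin

section \<open>Inverse semigroups\<close>

record 'a semigroup_str =
  elts :: "'a set"
  sop :: "'a \<Rightarrow> 'a \<Rightarrow> 'a" (infixl "\<cdot>\<index>" 70)

locale inverse_semigroup =
  fixes S :: "'a semigroup_str" (structure)
  assumes closed: "\<lbrakk>s \<in> elts S; t \<in> elts S\<rbrakk> \<Longrightarrow> s \<cdot> t \<in> elts S"
    and assoc: "\<lbrakk>r \<in> elts S; s \<in> elts S; t \<in> elts S\<rbrakk> \<Longrightarrow> (r \<cdot> s) \<cdot> t = r \<cdot> (s \<cdot> t)"
    and inverse: "s \<in> elts S \<Longrightarrow> \<exists>!t. t \<in> elts S \<and> s \<cdot> t \<cdot> s = s \<and> t \<cdot> s \<cdot> t = t"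

definition inv_of :: "'a semigroup_str \<Rightarrow> 'a \<Rightarrow> 'a" where
  "inv_of S s = (THE t. t \<in> elts S \<and> s \<cdot>\<^bsub>S\<^esub> t \<cdot>\<^bsub>S\<^esub> s = s \<and> t \<cdot>\<^bsub>S\<^esub> s \<cdot>\<^bsub>S\<^esub> t = t)"

definition idempotents :: "'a semigroup_str \<Rightarrow> 'a set" where
  "idempotents S = {e \<in> elts S. e \<cdot>\<^bsub>S\<^esub> e = e}"

definition nat_le :: "'a semigroup_str \<Rightarrow> 'a \<Rightarrow> 'a \<Rightarrow> bool" where
  "nat_le S s t \<longleftrightarrow> s \<in> elts S \<and> t \<in> elts S \<and> (\<exists>e \<in> idempotents S. s = t \<cdot>\<^bsub>S\<^esub> e)"

definition semigroup_hom :: "'a semigroup_str \<Rightarrow> 'b semigroup_str \<Rightarrow> ('a \<Rightarrow> 'b) \<Rightarrow> bool" where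
  "semigroup_hom S T h \<longleftrightarrow> (\<forall>s \<in> elts S. h s \<in> elts T) \<and>
     (\<forall>s \<in> elts S. \<forall>t \<in> elts S. h (s \<cdot>\<^bsub>S\<^esub> t) = h s \<cdot>\<^bsub>T\<^esub> h t)"

definition partial_hom :: "'a semigroup_str \<Rightarrow> 'b semigroup_str \<Rightarrow> ('a \<Rightarrow> 'b) \<Rightarrow> bool" where
  "partial_hom G T \<pi> \<longleftrightarrow> (\<forall>s \<in> elts G. \<pi> s \<in> elts T) \<and>
     (\<forall>s \<in> elts G. \<forall>t \<in> elts G.
        \<pi> s \<cdot>\<^bsub>T\<^esub> \<pi> t \<cdot>\<^bsub>T\<^esub> \<pi> (inv_of G t) = \<pi> (s \<cdot>\<^bsub>G\<^esub> t) \<cdot>\<^bsub>T\<^esub> \<pi> (inv_of G t) \<and>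
        \<pi> (inv_of G s) \<cdot>\<^bsub>T\<^esub> \<pi> s \<cdot>\<^bsub>T\<^esub> \<pi> t = \<pi> (inv_of G s) \<cdot>\<^bsub>T\<^esub> \<pi> (s \<cdot>\<^bsub>G\<^esub> t) \<and>
        \<pi> s \<cdot>\<^bsub>T\<^esub> \<pi> (inv_of G s) \<cdot>\<^bsub>T\<^esub> \<pi> s = \<pi> s)"


section \<open>The semigroup \<open>Pr(G)\<close>\<close>

text \<open>\<open>Pr(G)\<close> is the free semigroup on the set \<open>G\<close> (nonempty words) modulo the congruence
  generated by the defining relations.\<close>

definition pr_words :: "'g semigroup_str \<Rightarrow> 'g list set" where
  "pr_words G = {w. w \<noteq> [] \<and> set w \<subseteq> elts G}"

inductive pr_rel :: "'g semigroup_str \<Rightarrow> 'g list \<Rightarrow> 'g list \<Rightarrow> bool" for G where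
  "\<lbrakk>s \<in> elts G; t \<in> elts G\<rbrakk> \<Longrightarrow> pr_rel G [s, t, inv_of G t] [s \<cdot>\<^bsub>G\<^esub> t, inv_of G t]"
| "\<lbrakk>s \<in> elts G; t \<in> elts G\<rbrakk> \<Longrightarrow> pr_rel G [inv_of G s, s, t] [inv_of G s, s \<cdot>\<^bsub>G\<^esub> t]"
| "s \<in> elts G \<Longrightarrow> pr_rel G [s, inv_of G s, s] [s]"

inductive pr_cong :: "'g semigroup_str \<Rightarrow> 'g list \<Rightarrow> 'g list \<Rightarrow> bool" for G where
  step: "\<lbrakk>pr_rel G v w; x \<in> lists (elts G); y \<in> lists (elts G)\<rbrakk> \<Longrightarrow> pr_cong G (x @ v @ y) (x @ w @ y)"
| refl: "v \<in> pr_words G \<Longrightarrow> pr_cong G v v"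
| sym: "pr_cong G v w \<Longrightarrow> pr_cong G w v"
| trans: "\<lbrakk>pr_cong G u v; pr_cong G v w\<rbrakk> \<Longrightarrow> pr_cong G u w"

definition pr_class :: "'g semigroup_str \<Rightarrow> 'g list \<Rightarrow> 'g list set" where
  "pr_class G v = {w. pr_cong G v w}"

definition Pr :: "'g semigroup_str \<Rightarrow> 'g list set semigroup_str" where
  "Pr G = \<lparr>elts = pr_class G ` pr_words G,
           sop = (\<lambda>X Y. \<Union>v \<in> X. \<Union>w \<in> Y. pr_class G (v @ w))\<rparr>"

definition pr_gen :: "'g semigroup_str \<Rightarrow> 'g \<Rightarrow> 'g list set" where
  "pr_gen G s = pr_class G [s]"

text \<open>The homomorphism out of \<open>Pr(G)\<close> induced by a partial homomorphism.\<close>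

definition induced_hom ::
    "'g semigroup_str \<Rightarrow> 't semigroup_str \<Rightarrow> ('g \<Rightarrow> 't) \<Rightarrow> 'g list set \<Rightarrow> 't" where
  "induced_hom G T \<pi> =
     (THE h. h \<in> extensional (elts (Pr G)) \<and> semigroup_hom (Pr G) T h \<and>
             (\<forall>s \<in> elts G. h (pr_gen G s) = \<pi> s))"


section \<open>Banach spaces and \<open>C\<^sup>*\<close>-algebras with explicit carriers\<close>

record 'a complex_space =
  carrier :: "'a set"
  vadd :: "'a \<Rightarrow> 'a \<Rightarrow> 'a" (infixl "\<oplus>\<index>" 65)
  vzero :: "'a" ("\<zero>\<index>")
  vscale :: "complex \<Rightarrow> 'a \<Rightarrow> 'a" (infixr "\<odot>\<index>" 75)
  vnorm :: "'a \<Rightarrow> real"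

record 'a star_algebra = "'a complex_space" +
  amult :: "'a \<Rightarrow> 'a \<Rightarrow> 'a" (infixl "\<otimes>\<index>" 70)
  adj :: "'a \<Rightarrow> 'a"

definition vminus :: "('a, 'm) complex_space_scheme \<Rightarrow> 'a \<Rightarrow> 'a \<Rightarrow> 'a" (infixl "\<ominus>\<index>" 65) where
  "vminus V x y = x \<oplus>\<^bsub>V\<^esub> (- 1) \<odot>\<^bsub>V\<^esub> y"

text \<open>Metric spaces in the library carry a total distance function, hence the value \<open>0\<close> outside
  the carrier.\<close>

definition norm_dist :: "('a, 'm) complex_space_scheme \<Rightarrow> 'a \<Rightarrow> 'a \<Rightarrow> real" where
  "norm_dist V x y = (if x \<in> carrier V \<and> y \<in> carrier V then vnorm V (x \<ominus>\<^bsub>V\<^esub> y) else 0)"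

definition norm_topology :: "('a, 'm) complex_space_scheme \<Rightarrow> 'a topology" where
  "norm_topology V = Metric_space.mtopology (carrier V) (norm_dist V)"

locale banach_space =
  fixes V :: "('a, 'm) complex_space_scheme" (structure)
  assumes add_closed: "\<lbrakk>x \<in> carrier V; y \<in> carrier V\<rbrakk> \<Longrightarrow> x \<oplus> y \<in> carrier V"
    and zero_closed: "\<zero> \<in> carrier V"
    and scale_closed: "x \<in> carrier V \<Longrightarrow> c \<odot> x \<in> carrier V"
    and add_assoc: "\<lbrakk>x \<in> carrier V; y \<in> carrier V; z \<in> carrier V\<rbrakk> \<Longrightarrow> (x \<oplus> y) \<oplus> z = x \<oplus> (y \<oplus> z)"
    and add_commute: "\<lbrakk>x \<in> carrier V; y \<in> carrier V\<rbrakk> \<Longrightarrow> x \<oplus> y = y \<oplus> x"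
    and add_zero: "x \<in> carrier V \<Longrightarrow> x \<oplus> \<zero> = x"
    and add_minus: "x \<in> carrier V \<Longrightarrow> x \<ominus> x = \<zero>"
    and scale_add_right: "\<lbrakk>x \<in> carrier V; y \<in> carrier V\<rbrakk> \<Longrightarrow> c \<odot> (x \<oplus> y) = c \<odot> x \<oplus> c \<odot> y"
    and scale_add_left: "x \<in> carrier V \<Longrightarrow> (c + d) \<odot> x = c \<odot> x \<oplus> d \<odot> x"
    and scale_scale: "x \<in> carrier V \<Longrightarrow> c \<odot> (d \<odot> x) = (c * d) \<odot> x"
    and scale_one: "x \<in> carrier V \<Longrightarrow> 1 \<odot> x = x"
    and norm_eq_zero: "x \<in> carrier V \<Longrightarrow> vnorm V x = 0 \<longleftrightarrow> x = \<zero>"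
    and norm_triangle: "\<lbrakk>x \<in> carrier V; y \<in> carrier V\<rbrakk> \<Longrightarrow> vnorm V (x \<oplus> y) \<le> vnorm V x + vnorm V y"
    and norm_scale: "x \<in> carrier V \<Longrightarrow> vnorm V (c \<odot> x) = cmod c * vnorm V x"
    and complete: "Metric_space.mcomplete (carrier V) (norm_dist V)"

locale cstar_algebra = banach_space A for A :: "('a, 'm) star_algebra_scheme" (structure) +
  assumes mult_closed: "\<lbrakk>x \<in> carrier A; y \<in> carrier A\<rbrakk> \<Longrightarrow> x \<otimes> y \<in> carrier A"
    and mult_assoc: "\<lbrakk>x \<in> carrier A; y \<in> carrier A; z \<in> carrier A\<rbrakk> \<Longrightarrow> (x \<otimes> y) \<otimes> z = x \<otimes> (y \<otimes> z)"
    and mult_add_left: "\<lbrakk>x \<in> carrier A; y \<in> carrier A; z \<in> carrier A\<rbrakk> \<Longrightarrow> (x \<oplus> y) \<otimes> z = x \<otimes> z \<oplus> y \<otimes> z"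
    and mult_add_right: "\<lbrakk>x \<in> carrier A; y \<in> carrier A; z \<in> carrier A\<rbrakk> \<Longrightarrow> x \<otimes> (y \<oplus> z) = x \<otimes> y \<oplus> x \<otimes> z"
    and mult_scale_left: "\<lbrakk>x \<in> carrier A; y \<in> carrier A\<rbrakk> \<Longrightarrow> (c \<odot> x) \<otimes> y = c \<odot> (x \<otimes> y)"
    and mult_scale_right: "\<lbrakk>x \<in> carrier A; y \<in> carrier A\<rbrakk> \<Longrightarrow> x \<otimes> (c \<odot> y) = c \<odot> (x \<otimes> y)"
    and adj_closed: "x \<in> carrier A \<Longrightarrow> adj A x \<in> carrier A"
    and adj_adj: "x \<in> carrier A \<Longrightarrow> adj A (adj A x) = x"
    and adj_add: "\<lbrakk>x \<in> carrier A; y \<in> carrier A\<rbrakk> \<Longrightarrow> adj A (x \<oplus> y) = adj A x \<oplus> adj A y"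
    and adj_scale: "x \<in> carrier A \<Longrightarrow> adj A (c \<odot> x) = cnj c \<odot> adj A x"
    and adj_mult: "\<lbrakk>x \<in> carrier A; y \<in> carrier A\<rbrakk> \<Longrightarrow> adj A (x \<otimes> y) = adj A y \<otimes> adj A x"
    and norm_mult: "\<lbrakk>x \<in> carrier A; y \<in> carrier A\<rbrakk> \<Longrightarrow> vnorm A (x \<otimes> y) \<le> vnorm A x * vnorm A y"
    and cstar_identity: "x \<in> carrier A \<Longrightarrow> vnorm A (adj A x \<otimes> x) = (vnorm A x)\<^sup>2"

definition linear_map ::
    "('a, 'm) complex_space_scheme \<Rightarrow> ('b, 'n) complex_space_scheme \<Rightarrow> ('a \<Rightarrow> 'b) \<Rightarrow> bool" where
  "linear_map V W f \<longleftrightarrow> (\<forall>x \<in> carrier V. f x \<in> carrier W) \<and>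
     (\<forall>x \<in> carrier V. \<forall>y \<in> carrier V. f (x \<oplus>\<^bsub>V\<^esub> y) = f x \<oplus>\<^bsub>W\<^esub> f y) \<and>
     (\<forall>c. \<forall>x \<in> carrier V. f (c \<odot>\<^bsub>V\<^esub> x) = c \<odot>\<^bsub>W\<^esub> f x)"

definition star_hom ::
    "('a, 'm) star_algebra_scheme \<Rightarrow> ('b, 'n) star_algebra_scheme \<Rightarrow> ('a \<Rightarrow> 'b) \<Rightarrow> bool" where
  "star_hom A B f \<longleftrightarrow> linear_map A B f \<and>
     (\<forall>x \<in> carrier A. \<forall>y \<in> carrier A. f (x \<otimes>\<^bsub>A\<^esub> y) = f x \<otimes>\<^bsub>B\<^esub> f y) \<and>
     (\<forall>x \<in> carrier A. f (adj A x) = adj B (f x))"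

definition star_iso ::
    "('a, 'm) star_algebra_scheme \<Rightarrow> ('b, 'n) star_algebra_scheme \<Rightarrow> ('a \<Rightarrow> 'b) \<Rightarrow> bool" where
  "star_iso A B f \<longleftrightarrow> star_hom A B f \<and> bij_betw f (carrier A) (carrier B)"

definition star_isomorphic ::
    "('a, 'm) star_algebra_scheme \<Rightarrow> ('b, 'n) star_algebra_scheme \<Rightarrow> bool" (infix "\<cong>\<^sup>*" 50) where
  "A \<cong>\<^sup>* B \<longleftrightarrow> (\<exists>f. star_iso A B f)"

definition lin_subspace :: "('a, 'm) complex_space_scheme \<Rightarrow> 'a set \<Rightarrow> bool" where
  "lin_subspace V W \<longleftrightarrow> W \<subseteq> carrier V \<and> \<zero>\<^bsub>V\<^esub> \<in> W \<and>
     (\<forall>x \<in> W. \<forall>y \<in> W. x \<oplus>\<^bsub>V\<^esub> y \<in> W) \<and> (\<forall>c. \<forall>x \<in> W. c \<odot>\<^bsub>V\<^esub> x \<in> W)"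

definition lin_span :: "('a, 'm) complex_space_scheme \<Rightarrow> 'a set \<Rightarrow> 'a set" where
  "lin_span V X = \<Inter>{W. lin_subspace V W \<and> X \<subseteq> W}"

definition closed_ideal :: "('a, 'm) star_algebra_scheme \<Rightarrow> 'a set \<Rightarrow> bool" where
  "closed_ideal B J \<longleftrightarrow> lin_subspace B J \<and> closedin (norm_topology B) J \<and>
     (\<forall>b \<in> carrier B. \<forall>x \<in> J. b \<otimes>\<^bsub>B\<^esub> x \<in> J \<and> x \<otimes>\<^bsub>B\<^esub> b \<in> J)"

definition cstar_subalgebra :: "('a, 'm) star_algebra_scheme \<Rightarrow> 'a set \<Rightarrow> bool" where
  "cstar_subalgebra A M \<longleftrightarrow> lin_subspace A M \<and> closedin (norm_topology A) M \<and>
     (\<forall>x \<in> M. \<forall>y \<in> M. x \<otimes>\<^bsub>A\<^esub> y \<in> M) \<and> (\<forall>x \<in> M. adj A x \<in> M)"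

definition generated_cstar :: "'a star_algebra \<Rightarrow> 'a set \<Rightarrow> 'a star_algebra" where
  "generated_cstar A X = A\<lparr>carrier := \<Inter>{M. cstar_subalgebra A M \<and> X \<subseteq> M}\<rparr>"

text \<open>The \<open>\<ell>\<^sup>\<infinity>\<close>-product of a family of \<open>C\<^sup>*\<close>-algebras (used for a nonempty index set).\<close>

definition cstar_product :: "'i set \<Rightarrow> ('i \<Rightarrow> 'c star_algebra) \<Rightarrow> ('i \<Rightarrow> 'c) star_algebra" where
  "cstar_product I C =
     \<lparr>carrier = {x \<in> (\<Pi>\<^sub>E i \<in> I. carrier (C i)). bdd_above ((\<lambda>i. vnorm (C i) (x i)) ` I)},
      vadd = (\<lambda>x y. \<lambda>i \<in> I. x i \<oplus>\<^bsub>C i\<^esub> y i),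
      vzero = (\<lambda>i \<in> I. \<zero>\<^bsub>C i\<^esub>),
      vscale = (\<lambda>c x. \<lambda>i \<in> I. c \<odot>\<^bsub>C i\<^esub> x i),
      vnorm = (\<lambda>x. SUP i \<in> I. vnorm (C i) (x i)),
      amult = (\<lambda>x y. \<lambda>i \<in> I. x i \<otimes>\<^bsub>C i\<^esub> y i),
      adj = (\<lambda>x. \<lambda>i \<in> I. adj (C i) (x i))\<rparr>"

definition coset :: "('a, 'm) complex_space_scheme \<Rightarrow> 'a set \<Rightarrow> 'a \<Rightarrow> 'a set" where
  "coset V N x = {y \<in> carrier V. y \<ominus>\<^bsub>V\<^esub> x \<in> N}"

definition cstar_quotient :: "'a star_algebra \<Rightarrow> 'a set \<Rightarrow> 'a set star_algebra" where
  "cstar_quotient A J =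
     \<lparr>carrier = coset A J ` carrier A,
      vadd = (\<lambda>X Y. \<Union>x \<in> X. \<Union>y \<in> Y. coset A J (x \<oplus>\<^bsub>A\<^esub> y)),
      vzero = coset A J \<zero>\<^bsub>A\<^esub>,
      vscale = (\<lambda>c X. \<Union>x \<in> X. coset A J (c \<odot>\<^bsub>A\<^esub> x)),
      vnorm = (\<lambda>X. INF x \<in> X. vnorm A x),
      amult = (\<lambda>X Y. \<Union>x \<in> X. \<Union>y \<in> Y. coset A J (x \<otimes>\<^bsub>A\<^esub> y)),
      adj = (\<lambda>X. \<Union>x \<in> X. coset A J (adj A x))\<rparr>"

definition positive_elements :: "('a, 'm) star_algebra_scheme \<Rightarrow> 'a set" where
  "positive_elements A = {adj A x \<otimes>\<^bsub>A\<^esub> x | x. x \<in> carrier A}"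

text \<open>Approximate units are nets of positive contractions; a net is represented by its filter of
  eventuality on the algebra.\<close>

definition approximate_unit :: "('a, 'm) star_algebra_scheme \<Rightarrow> 'a filter \<Rightarrow> bool" where
  "approximate_unit A F \<longleftrightarrow> F \<noteq> bot \<and>
     (\<forall>\<^sub>F u in F. u \<in> carrier A \<and> u \<in> positive_elements A \<and> vnorm A u \<le> 1) \<and>
     (\<forall>b \<in> carrier A. ((\<lambda>u. vnorm A (u \<otimes>\<^bsub>A\<^esub> b \<ominus>\<^bsub>A\<^esub> b)) \<longlongrightarrow> 0) F \<and>
                      ((\<lambda>u. vnorm A (b \<otimes>\<^bsub>A\<^esub> u \<ominus>\<^bsub>A\<^esub> b)) \<longlongrightarrow> 0) F)"


section \<open>States and the GNS construction\<close>

definition linear_functional :: "('a, 'm) complex_space_scheme \<Rightarrow> ('a \<Rightarrow> complex) \<Rightarrow> bool" where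
  "linear_functional V \<phi> \<longleftrightarrow>
     (\<forall>x \<in> carrier V. \<forall>y \<in> carrier V. \<phi> (x \<oplus>\<^bsub>V\<^esub> y) = \<phi> x + \<phi> y) \<and>
     (\<forall>c. \<forall>x \<in> carrier V. \<phi> (c \<odot>\<^bsub>V\<^esub> x) = c * \<phi> x)"

definition positive_functional :: "('a, 'm) star_algebra_scheme \<Rightarrow> ('a \<Rightarrow> complex) \<Rightarrow> bool" where
  "positive_functional A \<phi> \<longleftrightarrow> linear_functional A \<phi> \<and>
     (\<forall>x \<in> positive_elements A. \<phi> x \<in> \<real>\<^sub>\<ge>\<^sub>0)"

definition is_state :: "('a, 'm) star_algebra_scheme \<Rightarrow> ('a \<Rightarrow> complex) \<Rightarrow> bool" where
  "is_state A \<phi> \<longleftrightarrow> positive_functional A \<phi> \<and>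
     bdd_above {cmod (\<phi> x) | x. x \<in> carrier A \<and> vnorm A x \<le> 1} \<and>
     Sup {cmod (\<phi> x) | x. x \<in> carrier A \<and> vnorm A x \<le> 1} = 1"

text \<open>A state is pure if the positive functionals it dominates are its multiples.\<close>

definition pure_state :: "('a, 'm) star_algebra_scheme \<Rightarrow> ('a \<Rightarrow> complex) \<Rightarrow> bool" where
  "pure_state A \<phi> \<longleftrightarrow> is_state A \<phi> \<and>
     (\<forall>\<rho>. positive_functional A \<rho> \<and> positive_functional A (\<lambda>x. \<phi> x - \<rho> x) \<longrightarrow>
          (\<exists>t \<in> {0..1::real}. \<forall>x \<in> carrier A. \<rho> x = of_real t * \<phi> x))"

text \<open>The GNS representation of \<open>\<psi>\<close> acts on the completion of the pre-Hilbert space \<open>A / N\<close>, with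
  \<open>N = {x. \<psi> (x\<^sup>* x) = 0}\<close>, by \<open>a (x + N) = a x + N\<close>. An operator on the completion vanishes iff
  it vanishes on \<open>A / N\<close>, so the kernel is computed there.\<close>

definition gns_null :: "('a, 'm) star_algebra_scheme \<Rightarrow> ('a \<Rightarrow> complex) \<Rightarrow> 'a set" where
  "gns_null A \<psi> = {x \<in> carrier A. \<psi> (adj A x \<otimes>\<^bsub>A\<^esub> x) = 0}"

definition gns_space :: "('a, 'm) star_algebra_scheme \<Rightarrow> ('a \<Rightarrow> complex) \<Rightarrow> 'a set set" where
  "gns_space A \<psi> = coset A (gns_null A \<psi>) ` carrier A"

definition gns_rep :: "('a, 'm) star_algebra_scheme \<Rightarrow> ('a \<Rightarrow> complex) \<Rightarrow> 'a \<Rightarrow> 'a set \<Rightarrow> 'a set" where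
  "gns_rep A \<psi> a X = (\<Union>x \<in> X. coset A (gns_null A \<psi>) (a \<otimes>\<^bsub>A\<^esub> x))"

definition gns_kernel :: "('a, 'm) star_algebra_scheme \<Rightarrow> ('a \<Rightarrow> complex) \<Rightarrow> 'a set" where
  "gns_kernel A \<psi> = {a \<in> carrier A. \<forall>X \<in> gns_space A \<psi>.
     gns_rep A \<psi> a X = coset A (gns_null A \<psi>) \<zero>\<^bsub>A\<^esub>}"


section \<open>Fell bundles and their cross-sectional algebras\<close>

text \<open>\<open>fmult A s t\<close> maps \<open>A\<^sub>s \<times> A\<^sub>t\<close> to \<open>A\<^sub>s\<^sub>t\<close>, \<open>fadj A s\<close> maps \<open>A\<^sub>s\<close> to the fiber at
  the inverse of \<open>s\<close>, and \<open>incl A t s\<close> is the inclusion of \<open>A\<^sub>s\<close> into \<open>A\<^sub>t\<close> for \<open>s \<le> t\<close>.\<close>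

record ('s, 'f) fell_data =
  base :: "'s semigroup_str"
  fiber :: "'s \<Rightarrow> 'f complex_space"
  fmult :: "'s \<Rightarrow> 's \<Rightarrow> 'f \<Rightarrow> 'f \<Rightarrow> 'f"
  fadj :: "'s \<Rightarrow> 'f \<Rightarrow> 'f"
  incl :: "'s \<Rightarrow> 's \<Rightarrow> 'f \<Rightarrow> 'f"

text \<open>The \<open>*\<close>-algebra structure of the fiber over an idempotent \<open>e\<close>.\<close>

definition fiber_algebra :: "('s, 'f) fell_data \<Rightarrow> 's \<Rightarrow> 'f star_algebra" where
  "fiber_algebra A e =
     \<lparr>carrier = carrier (fiber A e), vadd = vadd (fiber A e), vzero = vzero (fiber A e),
      vscale = vscale (fiber A e), vnorm = vnorm (fiber A e),
      amult = fmult A e e, adj = fadj A e\<rparr>"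

text \<open>The axioms of a Fell bundle. The bundle of a partial action, defined below, satisfies them, so
  they do not reappear as hypotheses in the constructions.\<close>

locale fell_bundle = inverse_semigroup "base A" for A :: "('s, 'f) fell_data" +
  assumes fiber_banach: "s \<in> elts (base A) \<Longrightarrow> banach_space (fiber A s)"
    and fmult_linear_left: "\<lbrakk>s \<in> elts (base A); t \<in> elts (base A); b \<in> carrier (fiber A t)\<rbrakk> \<Longrightarrow>
      linear_map (fiber A s) (fiber A (s \<cdot>\<^bsub>base A\<^esub> t)) (\<lambda>a. fmult A s t a b)"
    and fmult_linear_right: "\<lbrakk>s \<in> elts (base A); t \<in> elts (base A); a \<in> carrier (fiber A s)\<rbrakk> \<Longrightarrow>
      linear_map (fiber A t) (fiber A (s \<cdot>\<^bsub>base A\<^esub> t)) (\<lambda>b. fmult A s t a b)"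
    and fmult_assoc: "\<lbrakk>r \<in> elts (base A); s \<in> elts (base A); t \<in> elts (base A);
        a \<in> carrier (fiber A r); b \<in> carrier (fiber A s); c \<in> carrier (fiber A t)\<rbrakk> \<Longrightarrow>
      fmult A (r \<cdot>\<^bsub>base A\<^esub> s) t (fmult A r s a b) c = fmult A r (s \<cdot>\<^bsub>base A\<^esub> t) a (fmult A s t b c)"
    and fadj_closed: "\<lbrakk>s \<in> elts (base A); a \<in> carrier (fiber A s)\<rbrakk> \<Longrightarrow>
      fadj A s a \<in> carrier (fiber A (inv_of (base A) s))"
    and fadj_add: "\<lbrakk>s \<in> elts (base A); a \<in> carrier (fiber A s); b \<in> carrier (fiber A s)\<rbrakk> \<Longrightarrow>
      fadj A s (a \<oplus>\<^bsub>fiber A s\<^esub> b) = fadj A s a \<oplus>\<^bsub>fiber A (inv_of (base A) s)\<^esub> fadj A s b"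
    and fadj_scale: "\<lbrakk>s \<in> elts (base A); a \<in> carrier (fiber A s)\<rbrakk> \<Longrightarrow>
      fadj A s (\<zeta> \<odot>\<^bsub>fiber A s\<^esub> a) = cnj \<zeta> \<odot>\<^bsub>fiber A (inv_of (base A) s)\<^esub> fadj A s a"
    and fadj_norm: "\<lbrakk>s \<in> elts (base A); a \<in> carrier (fiber A s)\<rbrakk> \<Longrightarrow>
      vnorm (fiber A (inv_of (base A) s)) (fadj A s a) = vnorm (fiber A s) a"
    and fadj_fadj: "\<lbrakk>s \<in> elts (base A); a \<in> carrier (fiber A s)\<rbrakk> \<Longrightarrow>
      fadj A (inv_of (base A) s) (fadj A s a) = a"
    and fadj_fmult: "\<lbrakk>s \<in> elts (base A); t \<in> elts (base A);
        a \<in> carrier (fiber A s); b \<in> carrier (fiber A t)\<rbrakk> \<Longrightarrow>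
      fadj A (s \<cdot>\<^bsub>base A\<^esub> t) (fmult A s t a b)
        = fmult A (inv_of (base A) t) (inv_of (base A) s) (fadj A t b) (fadj A s a)"
    and fmult_norm: "\<lbrakk>s \<in> elts (base A); t \<in> elts (base A);
        a \<in> carrier (fiber A s); b \<in> carrier (fiber A t)\<rbrakk> \<Longrightarrow>
      vnorm (fiber A (s \<cdot>\<^bsub>base A\<^esub> t)) (fmult A s t a b) \<le> vnorm (fiber A s) a * vnorm (fiber A t) b"
    and fiber_cstar_identity: "\<lbrakk>s \<in> elts (base A); a \<in> carrier (fiber A s)\<rbrakk> \<Longrightarrow>
      vnorm (fiber A (inv_of (base A) s \<cdot>\<^bsub>base A\<^esub> s)) (fmult A (inv_of (base A) s) s (fadj A s a) a)
        = (vnorm (fiber A s) a)\<^sup>2"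
    and fiber_positive: "\<lbrakk>s \<in> elts (base A); a \<in> carrier (fiber A s)\<rbrakk> \<Longrightarrow>
      fmult A (inv_of (base A) s) s (fadj A s a) a
        \<in> positive_elements (fiber_algebra A (inv_of (base A) s \<cdot>\<^bsub>base A\<^esub> s))"
    and incl_linear: "nat_le (base A) s t \<Longrightarrow> linear_map (fiber A s) (fiber A t) (incl A t s)"
    and incl_norm: "\<lbrakk>nat_le (base A) s t; a \<in> carrier (fiber A s)\<rbrakk> \<Longrightarrow>
      vnorm (fiber A t) (incl A t s a) = vnorm (fiber A s) a"
    and incl_incl: "\<lbrakk>nat_le (base A) r s; nat_le (base A) s t; a \<in> carrier (fiber A r)\<rbrakk> \<Longrightarrow>
      incl A t r a = incl A t s (incl A s r a)"
    and incl_fmult: "\<lbrakk>nat_le (base A) s s'; nat_le (base A) t t';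
        a \<in> carrier (fiber A s); b \<in> carrier (fiber A t)\<rbrakk> \<Longrightarrow>
      fmult A s' t' (incl A s' s a) (incl A t' t b)
        = incl A (s' \<cdot>\<^bsub>base A\<^esub> t') (s \<cdot>\<^bsub>base A\<^esub> t) (fmult A s t a b)"
    and incl_fadj: "\<lbrakk>nat_le (base A) s t; a \<in> carrier (fiber A s)\<rbrakk> \<Longrightarrow>
      fadj A t (incl A t s a) = incl A (inv_of (base A) t) (inv_of (base A) s) (fadj A s a)"

definition representation ::
    "('s, 'f) fell_data \<Rightarrow> 'c star_algebra \<Rightarrow> ('s \<Rightarrow> 'f \<Rightarrow> 'c) \<Rightarrow> bool" where
  "representation A C \<pi> \<longleftrightarrow>
     \<pi> \<in> (\<Pi>\<^sub>E s \<in> elts (base A). carrier (fiber A s) \<rightarrow>\<^sub>E carrier C) \<and>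
     (\<forall>s \<in> elts (base A). linear_map (fiber A s) C (\<pi> s)) \<and>
     (\<forall>s \<in> elts (base A). \<forall>t \<in> elts (base A). \<forall>a \<in> carrier (fiber A s). \<forall>b \<in> carrier (fiber A t).
        \<pi> s a \<otimes>\<^bsub>C\<^esub> \<pi> t b = \<pi> (s \<cdot>\<^bsub>base A\<^esub> t) (fmult A s t a b)) \<and>
     (\<forall>s \<in> elts (base A). \<forall>a \<in> carrier (fiber A s).
        adj C (\<pi> s a) = \<pi> (inv_of (base A) s) (fadj A s a)) \<and>
     (\<forall>s t. nat_le (base A) s t \<longrightarrow> (\<forall>a \<in> carrier (fiber A s). \<pi> t (incl A t s a) = \<pi> s a))"

text \<open>The universal \<open>C\<^sup>*\<close>-algebra is realized inside the product of all representations, the target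
  algebras being carried by subsets of a type \<open>'c\<close>. Up to isomorphism of the algebra generated by
  its image, every representation is of this kind as soon as \<open>nat \<Rightarrow> 's \<Rightarrow> 'f\<close> injects into \<open>'c\<close>:
  each element of the generated algebra is the limit of a sequence of finite sums of elements
  \<open>\<pi>\<^sub>s(a\<^sub>s)\<close>, that is, it is determined by a sequence of finitely supported sections. Then
  \<open>full_cstar TYPE('c) A\<close> with the maps \<open>canonical_rep TYPE('c) A s\<close> has the universal property with
  respect to representations in arbitrary \<open>C\<^sup>*\<close>-algebras.\<close>

definition all_reps ::
    "'c itself \<Rightarrow> ('s, 'f) fell_data \<Rightarrow> ('c star_algebra \<times> ('s \<Rightarrow> 'f \<Rightarrow> 'c)) set" where
  "all_reps _ A = {(C, \<pi>). cstar_algebra C \<and> representation A C \<pi>}"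

type_synonym ('s, 'f, 'c) rep_family = "'c star_algebra \<times> ('s \<Rightarrow> 'f \<Rightarrow> 'c) \<Rightarrow> 'c"

definition canonical_rep ::
    "'c itself \<Rightarrow> ('s, 'f) fell_data \<Rightarrow> 's \<Rightarrow> 'f \<Rightarrow> ('s, 'f, 'c) rep_family" where
  "canonical_rep U A s a = (\<lambda>\<rho> \<in> all_reps U A. snd \<rho> s a)"

definition full_cstar ::
    "'c itself \<Rightarrow> ('s, 'f) fell_data \<Rightarrow> ('s, 'f, 'c) rep_family star_algebra" where
  "full_cstar U A = generated_cstar (cstar_product (all_reps U A) fst)
     {canonical_rep U A s a | s a. s \<in> elts (base A) \<and> a \<in> carrier (fiber A s)}"

definition idempotent_cstar ::
    "'c itself \<Rightarrow> ('s, 'f) fell_data \<Rightarrow> ('s, 'f, 'c) rep_family star_algebra" where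
  "idempotent_cstar U A = generated_cstar (full_cstar U A)
     {canonical_rep U A e a | e a. e \<in> idempotents (base A) \<and> a \<in> carrier (fiber A e)}"

text \<open>\<open>e\<close> lies below \<open>s\<close> and \<open>\<phi>\<close> does not vanish on the fiber over \<open>e\<close>.\<close>

definition supports ::
    "'c itself \<Rightarrow> ('s, 'f) fell_data \<Rightarrow> (('s, 'f, 'c) rep_family \<Rightarrow> complex)
      \<Rightarrow> 's \<Rightarrow> 's \<Rightarrow> bool" where
  "supports U A \<phi> s e \<longleftrightarrow> e \<in> idempotents (base A) \<and> nat_le (base A) e s \<and>
     (\<exists>a \<in> carrier (fiber A e). \<phi> (canonical_rep U A e a) \<noteq> 0)"

definition extended_state ::
    "'c itself \<Rightarrow> ('s, 'f) fell_data
      \<Rightarrow> (('s, 'f, 'c) rep_family \<Rightarrow> complex)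
      \<Rightarrow> (('s, 'f, 'c) rep_family \<Rightarrow> complex) \<Rightarrow> bool" where
  "extended_state U A \<phi> \<psi> \<longleftrightarrow> is_state (full_cstar U A) \<psi> \<and>
     (\<forall>s \<in> elts (base A). \<forall>a \<in> carrier (fiber A s).
        (\<forall>e F. supports U A \<phi> s e \<and> approximate_unit (fiber_algebra A e) F \<longrightarrow>
           ((\<lambda>u. \<phi> (canonical_rep U A s a \<otimes>\<^bsub>full_cstar U A\<^esub> canonical_rep U A e u))
              \<longlongrightarrow> \<psi> (canonical_rep U A s a)) F) \<and>
        ((\<nexists>e. supports U A \<phi> s e) \<longrightarrow> \<psi> (canonical_rep U A s a) = 0))"

definition reduced_cstar ::
    "'c itself \<Rightarrow> ('s, 'f) fell_data
      \<Rightarrow> ('s, 'f, 'c) rep_family set star_algebra" where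
  "reduced_cstar U A = cstar_quotient (full_cstar U A)
     {x \<in> carrier (full_cstar U A). \<forall>\<phi> \<psi>.
        pure_state (idempotent_cstar U A) \<phi> \<and> extended_state U A \<phi> \<psi> \<longrightarrow>
        x \<in> gns_kernel (full_cstar U A) \<psi>}"


section \<open>Partial actions and crossed products\<close>

definition partial_automorphism :: "'b star_algebra \<Rightarrow> ('b \<rightharpoonup> 'b) \<Rightarrow> bool" where
  "partial_automorphism B f \<longleftrightarrow> closed_ideal B (dom f) \<and> closed_ideal B (ran f) \<and>
     star_iso (B\<lparr>carrier := dom f\<rparr>) (B\<lparr>carrier := ran f\<rparr>) (\<lambda>x. the (f x))"

definition PAut :: "'b star_algebra \<Rightarrow> ('b \<rightharpoonup> 'b) semigroup_str" where
  "PAut B = \<lparr>elts = {f. partial_automorphism B f}, sop = (\<circ>\<^sub>m)\<rparr>"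

text \<open>The ideal \<open>D\<^sub>s\<close> is \<open>ran (\<beta> s)\<close>.\<close>

definition partial_action ::
    "'g semigroup_str \<Rightarrow> 'b star_algebra \<Rightarrow> ('g \<Rightarrow> 'b \<rightharpoonup> 'b) \<Rightarrow> bool" where
  "partial_action G B \<beta> \<longleftrightarrow> partial_hom G (PAut B) \<beta> \<and>
     norm_topology B closure_of lin_span B (\<Union>s \<in> elts G. ran (\<beta> s)) = carrier B"

definition partial_inv :: "('a \<rightharpoonup> 'b) \<Rightarrow> 'b \<Rightarrow> 'a" where
  "partial_inv f y = (THE x. f x = Some y)"

text \<open>The element \<open>a\<close> of the fiber over \<open>s\<close> stands for \<open>a \<delta>\<^sub>s\<close>.\<close>

definition action_bundle ::
    "'s semigroup_str \<Rightarrow> 'b star_algebra \<Rightarrow> ('s \<Rightarrow> 'b \<rightharpoonup> 'b) \<Rightarrow> ('s, 'b) fell_data" where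
  "action_bundle S B \<beta> =
     \<lparr>base = S,
      fiber = (\<lambda>s. \<lparr>carrier = ran (\<beta> s), vadd = vadd B, vzero = vzero B,
                    vscale = vscale B, vnorm = vnorm B\<rparr>),
      fmult = (\<lambda>s t a b. the (\<beta> s (partial_inv (\<beta> s) a \<otimes>\<^bsub>B\<^esub> b))),
      fadj = (\<lambda>s a. partial_inv (\<beta> s) (adj B a)),
      incl = (\<lambda>t s a. a)\<rparr>"

definition full_crossed_product ::
    "'c itself \<Rightarrow> 's semigroup_str \<Rightarrow> 'b star_algebra \<Rightarrow> ('s \<Rightarrow> 'b \<rightharpoonup> 'b)
      \<Rightarrow> ('s, 'b, 'c) rep_family star_algebra" where
  "full_crossed_product U S B \<beta> = full_cstar U (action_bundle S B \<beta>)"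

definition reduced_crossed_product ::
    "'c itself \<Rightarrow> 's semigroup_str \<Rightarrow> 'b star_algebra \<Rightarrow> ('s \<Rightarrow> 'b \<rightharpoonup> 'b)
      \<Rightarrow> ('s, 'b, 'c) rep_family set star_algebra" where
  "reduced_crossed_product U S B \<beta> = reduced_cstar U (action_bundle S B \<beta>)"

text \<open>A carrier type large enough, in the sense explained above, both for bundles over \<open>G\<close> and for
  bundles over \<open>Pr(G)\<close> with fibers in \<open>'b\<close>, since \<open>'g\<close> injects into \<open>'g list set\<close>.\<close>

type_synonym ('g, 'b) rep_univ = "nat \<Rightarrow> 'g list set \<Rightarrow> 'b"

end

theory Submission
  imports Defs
begin

text \<open>The retraction \<open>d\<close> of \<open>Pr(G)\<close> onto \<open>G\<close> with \<open>d [s] = s\<close> satisfies \<open>x \<le> [d x]\<close>, so the action induced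
  by \<open>\<beta>\<close> is at \<open>x\<close> a restriction of \<open>\<beta>\<^bsub>d x\<^esub>\<close>. A representation \<open>\<pi>\<close> of the Fell bundle over \<open>G\<close> therefore
  extends uniquely to the bundle over \<open>Pr(G)\<close> by \<open>\<pi>\<^sub>x(a) = \<pi>\<^bsub>d x\<^esub>(a)\<close>, and both bundles have the same
  representations, with the same images of the idempotent fibers. For the reduced algebras one
  compares the states extending a pure state \<open>\<phi>\<close> of the idempotent part: the limits over approximate
  units now also run over smaller ideals \<open>J\<close> on which \<open>\<phi>\<close> does not vanish. Compressing \<open>\<phi>\<close> to \<open>J\<close> gives
  a nonzero positive functional dominated by \<open>\<phi>\<close>, hence a multiple of \<open>\<phi>\<close>; so \<open>\<phi>\<close> tends to \<open>1\<close> along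
  every approximate unit of \<open>J\<close>, and the limits agree.\<close>

section \<open>Inverse semigroups\<close>

text \<open>The full algebras are compared without computing them: both are generated inside
  products over all representations in algebras carried by one type, so the bijection of
  representations is a reindexing of components, which is isometric and carries generators to
  generators. The weight lies in the reduced case. An extended state is constrained at every
  idempotent below an element and along every approximate unit, and an idempotent of
  \<open>Pr G\<close> may carry a much smaller ideal than its image in \<open>G\<close>. Identifying
  the two prescribed values requires some approximate unit of the larger ideal to exist. The
  opposite danger, support below \<open>d x\<close> but nowhere below \<open>x\<close>, must force
  the value \<open>0\<close>. Existence of approximate units, self-adjointness of closed ideals and
  contractivity of star homomorphisms are derived from the axioms alone. As the algebras may have no
  unit, expressions such as \<open>1 - c\<close> are read as operators on the algebra, and
  positivity is replaced by estimates of the form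
  \<open>vnorm A (y \<ominus> w \<otimes> y) \<le> vnorm A y\<close>.\<close>

context inverse_semigroup
begin

lemma inv_of_properties:
  assumes "s \<in> elts S"
  shows "inv_of S s \<in> elts S" "s \<cdot> inv_of S s \<cdot> s = s" "inv_of S s \<cdot> s \<cdot> inv_of S s = inv_of S s"
  using theI'[OF inverse[OF assms]] unfolding inv_of_def by auto

lemma inv_of_unique:
  assumes "s \<in> elts S" "t \<in> elts S" "s \<cdot> t \<cdot> s = s" "t \<cdot> s \<cdot> t = t"
  shows "inv_of S s = t"
  using inverse[OF assms(1)] inv_of_properties[OF assms(1)] assms(2-) by blast

lemma inv_of_closed [simp]: "s \<in> elts S \<Longrightarrow> inv_of S s \<in> elts S"
  by (rule inv_of_properties)

lemma inv_of_inv_of [simp]: "s \<in> elts S \<Longrightarrow> inv_of S (inv_of S s) = s"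
  by (rule inv_of_unique) (auto simp: inv_of_properties)

lemma idempotents_closed: "e \<in> idempotents S \<Longrightarrow> e \<in> elts S"
  by (simp add: idempotents_def)

lemma idempotents_idem: "e \<in> idempotents S \<Longrightarrow> e \<cdot> e = e"
  by (simp add: idempotents_def)

lemma inv_of_idempotent: "e \<in> idempotents S \<Longrightarrow> inv_of S e = e"
  by (rule inv_of_unique) (auto simp: idempotents_def)

lemma mult_inv_of_idempotent: "s \<in> elts S \<Longrightarrow> s \<cdot> inv_of S s \<in> idempotents S"
  unfolding idempotents_def using inv_of_properties[of s]
  by (auto simp: closed assoc[symmetric])

lemma inv_of_mult_idempotent: "s \<in> elts S \<Longrightarrow> inv_of S s \<cdot> s \<in> idempotents S"
  using mult_inv_of_idempotent[of "inv_of S s"] by simp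

text \<open>If \<open>x\<close> is the inverse of \<open>e \<cdot> f\<close>, then
  \<open>f \<cdot> x \<cdot> e\<close> is an inverse of it too, so
  \<open>x = f \<cdot> x \<cdot> e\<close> by uniqueness. This makes \<open>x\<close> idempotent,
  hence its own inverse, and so \<open>x = e \<cdot> f\<close>.\<close>

lemma idempotents_mult:
  assumes "e \<in> idempotents S" "f \<in> idempotents S"
  shows "e \<cdot> f \<in> idempotents S"
proof -
  have c: "e \<in> elts S" "f \<in> elts S" and i: "e \<cdot> e = e" "f \<cdot> f = f"
    using assms by (auto simp: idempotents_def)
  define x where "x = inv_of S (e \<cdot> f)"
  have x: "x \<in> elts S" "e \<cdot> f \<cdot> x \<cdot> (e \<cdot> f) = e \<cdot> f" "x \<cdot> (e \<cdot> f) \<cdot> x = x"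
    unfolding x_def using inv_of_properties[of "e \<cdot> f"] c closed by auto
  have i': "e \<cdot> (e \<cdot> y) = e \<cdot> y" "f \<cdot> (f \<cdot> y) = f \<cdot> y" if "y \<in> elts S" for y
    using that c i assoc by metis+
  have "inv_of S (e \<cdot> f) = f \<cdot> x \<cdot> e"
  proof (rule inv_of_unique)
    show "e \<cdot> f \<cdot> (f \<cdot> x \<cdot> e) \<cdot> (e \<cdot> f) = e \<cdot> f"
      using x c by (simp add: assoc closed i')
    have "f \<cdot> (x \<cdot> (e \<cdot> f) \<cdot> x) \<cdot> e = f \<cdot> x \<cdot> e" by (simp only: x)
    then show "f \<cdot> x \<cdot> e \<cdot> (e \<cdot> f) \<cdot> (f \<cdot> x \<cdot> e) = f \<cdot> x \<cdot> e"
      using x(1) c by (simp add: assoc closed i')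
  qed (use c x closed in auto)
  then have xe: "x = f \<cdot> x \<cdot> e" by (simp add: x_def)
  have "x \<cdot> x = f \<cdot> (x \<cdot> (e \<cdot> f) \<cdot> x) \<cdot> e"
    using xe x(1) c by (metis assoc closed)
  then have xx: "x \<cdot> x = x" using x(3) xe by simp
  then have "inv_of S x = x" by (intro inv_of_idempotent) (auto simp: idempotents_def x)
  moreover have "inv_of S x = e \<cdot> f" unfolding x_def using c closed by simp
  ultimately show ?thesis using xx x(1) by (simp add: idempotents_def)
qed

text \<open>Once products of idempotents are idempotent, \<open>f \<cdot> e\<close> is an inverse of
  \<open>e \<cdot> f\<close>; but an idempotent is its own inverse.\<close>

lemma idempotents_commute:
  assumes "e \<in> idempotents S" "f \<in> idempotents S"
  shows "e \<cdot> f = f \<cdot> e"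
proof -
  have c: "e \<in> elts S" "f \<in> elts S" and i: "e \<cdot> e = e" "f \<cdot> f = f"
    using assms by (auto simp: idempotents_def)
  have i': "e \<cdot> (e \<cdot> y) = e \<cdot> y" "f \<cdot> (f \<cdot> y) = f \<cdot> y" if "y \<in> elts S" for y
    using that c i assoc by metis+
  have ef: "e \<cdot> f \<cdot> (e \<cdot> f) = e \<cdot> f" "f \<cdot> e \<cdot> (f \<cdot> e) = f \<cdot> e"
    using idempotents_mult assms by (auto simp: idempotents_def)
  have "inv_of S (e \<cdot> f) = f \<cdot> e"
    using c ef i' by (intro inv_of_unique) (simp_all add: assoc closed)
  moreover have "inv_of S (e \<cdot> f) = e \<cdot> f"
    by (intro inv_of_idempotent idempotents_mult assms)
  ultimately show ?thesis by simp
qed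

lemma inv_of_mult:
  assumes "s \<in> elts S" "t \<in> elts S"
  shows "inv_of S (s \<cdot> t) = inv_of S t \<cdot> inv_of S s"
proof (rule inv_of_unique)
  let ?i = "inv_of S"
  have c: "?i s \<in> elts S" "?i t \<in> elts S" "t \<cdot> ?i t \<in> elts S" "?i s \<cdot> s \<in> elts S"
    using assms closed by auto
  have e: "t \<cdot> ?i t \<in> idempotents S" "?i s \<cdot> s \<in> idempotents S"
    using mult_inv_of_idempotent inv_of_mult_idempotent assms by auto
  have "s \<cdot> t \<cdot> (?i t \<cdot> ?i s) \<cdot> (s \<cdot> t) = s \<cdot> ((t \<cdot> ?i t) \<cdot> (?i s \<cdot> s)) \<cdot> t"
    using assms c by (simp add: assoc closed)
  also have "\<dots> = (s \<cdot> ?i s \<cdot> s) \<cdot> (t \<cdot> ?i t \<cdot> t)"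
    unfolding idempotents_commute[OF e] using assms c by (simp add: assoc closed)
  finally show "s \<cdot> t \<cdot> (?i t \<cdot> ?i s) \<cdot> (s \<cdot> t) = s \<cdot> t"
    using assms by (simp add: inv_of_properties)
  have "?i t \<cdot> ?i s \<cdot> (s \<cdot> t) \<cdot> (?i t \<cdot> ?i s) = ?i t \<cdot> ((?i s \<cdot> s) \<cdot> (t \<cdot> ?i t)) \<cdot> ?i s"
    using assms c by (simp add: assoc closed)
  also have "\<dots> = (?i t \<cdot> t \<cdot> ?i t) \<cdot> (?i s \<cdot> s \<cdot> ?i s)"
    unfolding idempotents_commute[OF e(2,1)] using assms c by (simp add: assoc closed)
  finally show "?i t \<cdot> ?i s \<cdot> (s \<cdot> t) \<cdot> (?i t \<cdot> ?i s) = ?i t \<cdot> ?i s"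
    using assms by (simp add: inv_of_properties)
qed (use assms closed in auto)

text \<open>Trades an idempotent on the left of \<open>s\<close> for one on the right. The natural
  order is defined by right multiplication with idempotents, so this is what makes it compatible
  with multiplication by \<open>s\<close> on the right.\<close>

lemma conj_idempotent:
  assumes "e \<in> idempotents S" "s \<in> elts S"
  shows "inv_of S s \<cdot> e \<cdot> s \<in> idempotents S" "s \<cdot> (inv_of S s \<cdot> e \<cdot> s) = e \<cdot> s"
proof -
  let ?i = "inv_of S s"
  have c: "e \<in> elts S" "?i \<in> elts S" using assms by (auto simp: idempotents_def)
  have f: "s \<cdot> ?i \<in> idempotents S" using assms mult_inv_of_idempotent by auto
  have *: "s \<cdot> (?i \<cdot> e \<cdot> s) = (s \<cdot> ?i) \<cdot> e \<cdot> s"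
    using assms c by (simp add: assoc closed)
  also have "\<dots> = e \<cdot> (s \<cdot> ?i \<cdot> s)"
    unfolding idempotents_commute[OF f assms(1)] using assms c by (simp add: assoc closed)
  finally show **: "s \<cdot> (?i \<cdot> e \<cdot> s) = e \<cdot> s" using assms by (simp add: inv_of_properties)
  have "?i \<cdot> e \<cdot> s \<cdot> (?i \<cdot> e \<cdot> s) = ?i \<cdot> e \<cdot> (s \<cdot> (?i \<cdot> e \<cdot> s))"
    using assms c by (simp add: assoc closed)
  also have "\<dots> = ?i \<cdot> (e \<cdot> e) \<cdot> s" unfolding ** using assms c by (simp add: assoc closed)
  finally show "?i \<cdot> e \<cdot> s \<in> idempotents S"
    using assms c by (simp add: idempotents_def closed)
qed

lemma nat_leI: "\<lbrakk>t \<in> elts S; e \<in> idempotents S\<rbrakk> \<Longrightarrow> nat_le S (t \<cdot> e) t"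
  by (auto simp: nat_le_def closed idempotents_closed)

lemma nat_le_refl: "s \<in> elts S \<Longrightarrow> nat_le S s s"
  using nat_leI[of s "inv_of S s \<cdot> s"] inv_of_mult_idempotent[of s]
  by (simp add: assoc[symmetric] inv_of_properties)

lemma nat_le_trans: "\<lbrakk>nat_le S r s; nat_le S s t\<rbrakk> \<Longrightarrow> nat_le S r t"
  unfolding nat_le_def by (metis assoc idempotents_closed idempotents_commute idempotents_mult)

lemma nat_le_mult_right:
  assumes "nat_le S s t" "r \<in> elts S"
  shows "nat_le S (s \<cdot> r) (t \<cdot> r)"
proof -
  obtain e where e: "e \<in> idempotents S" "s = t \<cdot> e" "t \<in> elts S"
    using assms by (auto simp: nat_le_def)
  have "s \<cdot> r = t \<cdot> r \<cdot> (inv_of S r \<cdot> e \<cdot> r)"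
    using e assms conj_idempotent[OF e(1) assms(2)] idempotents_closed
    by (simp add: assoc closed)
  then show ?thesis
    using nat_leI[of "t \<cdot> r" "inv_of S r \<cdot> e \<cdot> r"] conj_idempotent[OF e(1) assms(2)] e assms
    by (simp add: closed)
qed

lemma idempotent_nat_le:
  assumes "e \<in> idempotents S" "f \<in> idempotents S"
  shows "nat_le S (e \<cdot> f) e" "nat_le S (e \<cdot> f) f"
  using nat_leI[of e f] nat_leI[of f e] assms idempotents_closed
  by (auto simp: idempotents_commute[of e f])

lemma nat_le_idempotent_mult:
  assumes "nat_le S e s" "e \<in> idempotents S"
  shows "s \<cdot> e = e"
proof -
  obtain f where f: "f \<in> idempotents S" "e = s \<cdot> f" "s \<in> elts S"
    using assms by (auto simp: nat_le_def)
  then have fe: "e \<cdot> f = e" by (metis assoc idempotents_closed idempotents_idem)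
  have "s \<cdot> e = s \<cdot> (f \<cdot> e)"
    using fe idempotents_commute[OF assms(2) f(1)] by simp
  also have "\<dots> = e"
    using f assms by (metis assoc idempotents_closed idempotents_idem)
  finally show ?thesis .
qed

end

section \<open>Homomorphisms and partial homomorphisms of semigroups\<close>

lemma semigroup_hom_closed: "\<lbrakk>semigroup_hom S T h; s \<in> elts S\<rbrakk> \<Longrightarrow> h s \<in> elts T"
  by (simp add: semigroup_hom_def)

lemma semigroup_hom_mult:
  "\<lbrakk>semigroup_hom S T h; s \<in> elts S; t \<in> elts S\<rbrakk> \<Longrightarrow> h (s \<cdot>\<^bsub>S\<^esub> t) = h s \<cdot>\<^bsub>T\<^esub> h t"
  by (simp add: semigroup_hom_def)

lemma semigroup_hom_idempotent:
  "\<lbrakk>semigroup_hom S T h; e \<in> idempotents S\<rbrakk> \<Longrightarrow> h e \<in> idempotents T"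
  by (auto simp: semigroup_hom_def idempotents_def) metis

lemma semigroup_hom_nat_le:
  "\<lbrakk>semigroup_hom S T h; nat_le S s t\<rbrakk> \<Longrightarrow> nat_le T (h s) (h t)"
  unfolding nat_le_def using semigroup_hom_idempotent
  by (metis (no_types, lifting) idempotents_def mem_Collect_eq semigroup_hom_def)

lemma semigroup_hom_inv_of:
  assumes "inverse_semigroup S" "inverse_semigroup T" "semigroup_hom S T h" "s \<in> elts S"
  shows "h (inv_of S s) = inv_of T (h s)"
proof -
  interpret S: inverse_semigroup S by fact
  interpret T: inverse_semigroup T by fact
  have c: "inv_of S s \<in> elts S" using assms by simp
  have "h (s \<cdot>\<^bsub>S\<^esub> inv_of S s \<cdot>\<^bsub>S\<^esub> s) = h s"
    "h (inv_of S s \<cdot>\<^bsub>S\<^esub> s \<cdot>\<^bsub>S\<^esub> inv_of S s) = h (inv_of S s)"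
    using S.inv_of_properties[OF assms(4)] by auto
  then show ?thesis
    using assms(3,4) c S.closed
    by (intro T.inv_of_unique[symmetric]) (auto simp: semigroup_hom_def)
qed

lemma partial_hom_rules:
  assumes "partial_hom G T \<pi>" "s \<in> elts G" "t \<in> elts G"
  shows "\<pi> s \<in> elts T"
    and "\<pi> s \<cdot>\<^bsub>T\<^esub> \<pi> t \<cdot>\<^bsub>T\<^esub> \<pi> (inv_of G t) = \<pi> (s \<cdot>\<^bsub>G\<^esub> t) \<cdot>\<^bsub>T\<^esub> \<pi> (inv_of G t)"
    and "\<pi> (inv_of G s) \<cdot>\<^bsub>T\<^esub> \<pi> s \<cdot>\<^bsub>T\<^esub> \<pi> t = \<pi> (inv_of G s) \<cdot>\<^bsub>T\<^esub> \<pi> (s \<cdot>\<^bsub>G\<^esub> t)"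
    and "\<pi> s \<cdot>\<^bsub>T\<^esub> \<pi> (inv_of G s) \<cdot>\<^bsub>T\<^esub> \<pi> s = \<pi> s"
  using assms by (auto simp: partial_hom_def)

text \<open>The target is only a semigroup, so that the results apply to \<open>Pr G\<close> before
  it is known to be inverse, and to the partial automorphisms of \<open>B\<close>.\<close>

locale semigroup_partial_hom = G: inverse_semigroup G
  for G :: "'g semigroup_str" +
  fixes T :: "'t semigroup_str" (structure) and \<pi> :: "'g \<Rightarrow> 't"
  assumes T_closed: "\<lbrakk>x \<in> elts T; y \<in> elts T\<rbrakk> \<Longrightarrow> x \<cdot> y \<in> elts T"
    and T_assoc: "\<lbrakk>x \<in> elts T; y \<in> elts T; z \<in> elts T\<rbrakk> \<Longrightarrow> (x \<cdot> y) \<cdot> z = x \<cdot> (y \<cdot> z)"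
    and partial_hom: "partial_hom G T \<pi>"
begin

abbreviation i where "i \<equiv> inv_of G"

lemma pi_closed [simp]: "s \<in> elts G \<Longrightarrow> \<pi> s \<in> elts T"
  using partial_hom by (simp add: partial_hom_def)

lemma rel_right: "\<lbrakk>s \<in> elts G; t \<in> elts G\<rbrakk> \<Longrightarrow> \<pi> s \<cdot> (\<pi> t \<cdot> \<pi> (i t)) = \<pi> (s \<cdot>\<^bsub>G\<^esub> t) \<cdot> \<pi> (i t)"
  using partial_hom_rules(2)[OF partial_hom] by (simp add: T_assoc)

lemma rel_left: "\<lbrakk>s \<in> elts G; t \<in> elts G\<rbrakk> \<Longrightarrow> \<pi> (i s) \<cdot> (\<pi> s \<cdot> \<pi> t) = \<pi> (i s) \<cdot> \<pi> (s \<cdot>\<^bsub>G\<^esub> t)"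
  using partial_hom_rules(3)[OF partial_hom] by (simp add: T_assoc)

lemma rel_inv: "s \<in> elts G \<Longrightarrow> \<pi> s \<cdot> (\<pi> (i s) \<cdot> \<pi> s) = \<pi> s"
  using partial_hom_rules(4)[OF partial_hom, of s s] by (simp add: T_assoc)

lemma rel_left': "\<lbrakk>s \<in> elts G; t \<in> elts G\<rbrakk> \<Longrightarrow> \<pi> s \<cdot> (\<pi> (i s) \<cdot> \<pi> t) = \<pi> s \<cdot> \<pi> (i s \<cdot>\<^bsub>G\<^esub> t)"
  using rel_left[of "i s" t] by simp

lemma pi_idempotent: "e \<in> idempotents G \<Longrightarrow> \<pi> e \<cdot> \<pi> e = \<pi> e"
  using rel_right[of e e] rel_inv[of e] G.inv_of_idempotent[of e]
  by (simp add: idempotents_def)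

text \<open>The relations fuse two factors only next to a suitable inverse. As \<open>e\<close> is
  its own inverse, \<open>\<pi> t \<cdot> \<pi> e = \<pi> s \<cdot> \<pi> e\<close> for
  \<open>s = t \<cdot> e\<close>; the surplus \<open>\<pi> e\<close> is absorbed by writing
  \<open>\<pi> s\<close> as \<open>\<pi> s \<cdot> \<pi> (i s) \<cdot> \<pi> s\<close> and fusing on
  the right.\<close>

lemma pi_mult_idempotent:
  assumes "t \<in> elts G" "e \<in> idempotents G"
  shows "\<pi> (t \<cdot>\<^bsub>G\<^esub> e) = \<pi> t \<cdot> \<pi> e"
proof -
  have e: "e \<in> elts G" "e \<cdot>\<^bsub>G\<^esub> e = e" using assms by (auto simp: idempotents_def)
  let ?s = "t \<cdot>\<^bsub>G\<^esub> e"
  have s: "?s \<in> elts G" using assms e G.closed by auto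
  have se: "?s \<cdot>\<^bsub>G\<^esub> e = ?s" using assms e by (simp add: G.assoc)
  have "\<pi> t \<cdot> \<pi> e = \<pi> ?s \<cdot> \<pi> e"
    using rel_right[OF assms(1) e(1)] pi_idempotent[OF assms(2)] G.inv_of_idempotent[OF assms(2)]
    by simp
  also have "\<dots> = \<pi> ?s \<cdot> (\<pi> (i ?s) \<cdot> (\<pi> ?s \<cdot> \<pi> e))"
    using rel_inv[OF s] s e T_assoc by (metis G.inv_of_closed T_closed pi_closed)
  also have "\<dots> = \<pi> ?s"
    unfolding rel_left[OF s e(1)] se using rel_inv[OF s] .
  finally show ?thesis by simp
qed

lemma pi_idempotent_mult:
  assumes "t \<in> elts G" "e \<in> idempotents G"
  shows "\<pi> (e \<cdot>\<^bsub>G\<^esub> t) = \<pi> e \<cdot> \<pi> t"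
proof -
  have e: "e \<in> elts G" "e \<cdot>\<^bsub>G\<^esub> e = e" using assms by (auto simp: idempotents_def)
  let ?s = "e \<cdot>\<^bsub>G\<^esub> t"
  have s: "?s \<in> elts G" using assms e G.closed by auto
  have se: "e \<cdot>\<^bsub>G\<^esub> ?s = ?s" using assms e by (metis G.assoc)
  have "\<pi> e \<cdot> \<pi> t = \<pi> e \<cdot> (\<pi> e \<cdot> \<pi> t)"
    using pi_idempotent[OF assms(2)] assms e by (metis T_assoc pi_closed)
  also have "\<dots> = \<pi> e \<cdot> \<pi> ?s"
    using rel_left[OF e(1) assms(1)] G.inv_of_idempotent[OF assms(2)] by simp
  also have "\<dots> = \<pi> e \<cdot> (\<pi> ?s \<cdot> \<pi> (i ?s)) \<cdot> \<pi> ?s"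
    using rel_inv[OF s] s e T_assoc by (metis G.inv_of_closed T_closed pi_closed)
  also have "\<dots> = \<pi> ?s"
    unfolding rel_right[OF e(1) s] se using rel_inv[OF s] s by (simp add: T_assoc)
  finally show ?thesis by simp
qed

text \<open>Expand \<open>\<pi> t\<close> as
  \<open>\<pi> t \<cdot> \<pi> (i t) \<cdot> \<pi> t\<close> and fuse. The failure of
  multiplicativity is thus measured by an idempotent on the right, which is the source of
  \<open>[s][t] \<le> [st]\<close> in \<open>Pr G\<close>.\<close>

lemma pi_mult:
  assumes "s \<in> elts G" "t \<in> elts G"
  shows "\<pi> s \<cdot> \<pi> t = \<pi> (s \<cdot>\<^bsub>G\<^esub> t) \<cdot> (\<pi> (i t) \<cdot> \<pi> t)"
proof -
  have "\<pi> s \<cdot> \<pi> t = \<pi> s \<cdot> (\<pi> t \<cdot> \<pi> (i t)) \<cdot> \<pi> t"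
    using rel_inv[of t] assms by (simp add: T_assoc T_closed)
  then show ?thesis using assms by (simp add: rel_right T_assoc G.closed)
qed

text \<open>The range idempotent of \<open>\<pi> r\<close>. It need not equal the image of
  \<open>r \<cdot> i r\<close>, which is how \<open>Pr G\<close> can have more idempotents than
  \<open>G\<close>.\<close>

definition eps :: "'g \<Rightarrow> 't" where "eps r = \<pi> r \<cdot> \<pi> (i r)"

lemma eps_closed [simp]: "r \<in> elts G \<Longrightarrow> eps r \<in> elts T"
  by (simp add: eps_def T_closed)

lemma eps_idempotent: "r \<in> elts G \<Longrightarrow> eps r \<cdot> eps r = eps r"
  using rel_inv[of "i r"] by (simp add: eps_def T_assoc T_closed)

lemma eps_pi: "s \<in> elts G \<Longrightarrow> eps s \<cdot> \<pi> s = \<pi> s"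
  by (simp add: eps_def T_assoc rel_inv)

lemma eps_of_idempotent: "e \<in> idempotents G \<Longrightarrow> eps e = \<pi> e"
  by (simp add: eps_def G.inv_of_idempotent pi_idempotent)

text \<open>Moving a generator past a range idempotent only changes the index of the idempotent.
  Every product of generators can therefore be sorted into idempotents followed by a single
  generator.\<close>

lemma pi_eps:
  assumes "s \<in> elts G" "t \<in> elts G"
  shows "\<pi> s \<cdot> eps t = eps (s \<cdot>\<^bsub>G\<^esub> t) \<cdot> \<pi> s"
proof -
  \<comment> \<open>\<open>?e\<close> is the range idempotent of \<open>?u\<close> in
    \<open>G\<close>. It satisfies \<open>?e \<cdot> s = ?u \<cdot> i t\<close>, which allows
    \<open>\<pi> s\<close> to be split off on the right.\<close>
  let ?u = "s \<cdot>\<^bsub>G\<^esub> t" and ?e = "s \<cdot>\<^bsub>G\<^esub> t \<cdot>\<^bsub>G\<^esub> i t \<cdot>\<^bsub>G\<^esub> i s"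
  have u: "?u \<in> elts G" and c: "i s \<in> elts G" "i t \<in> elts G" using assms G.closed by auto
  have ui: "i ?u = i t \<cdot>\<^bsub>G\<^esub> i s" using assms by (simp add: G.inv_of_mult)
  have e: "?e \<in> idempotents G"
    using G.mult_inv_of_idempotent[OF u] assms c by (simp add: ui G.assoc G.closed)
  have ee: "?e = ?u \<cdot>\<^bsub>G\<^esub> i ?u" using assms c by (simp add: ui G.assoc G.closed)
  have f: "t \<cdot>\<^bsub>G\<^esub> i t \<in> idempotents G" by (rule G.mult_inv_of_idempotent) fact
  have es: "?e \<cdot>\<^bsub>G\<^esub> s = ?u \<cdot>\<^bsub>G\<^esub> i t"
  proof -
    have "?e \<cdot>\<^bsub>G\<^esub> s = s \<cdot>\<^bsub>G\<^esub> ((t \<cdot>\<^bsub>G\<^esub> i t) \<cdot>\<^bsub>G\<^esub> (i s \<cdot>\<^bsub>G\<^esub> s))"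
      using assms c by (simp add: G.assoc G.closed)
    also have "\<dots> = (s \<cdot>\<^bsub>G\<^esub> i s \<cdot>\<^bsub>G\<^esub> s) \<cdot>\<^bsub>G\<^esub> (t \<cdot>\<^bsub>G\<^esub> i t)"
      unfolding G.idempotents_commute[OF f G.inv_of_mult_idempotent[OF assms(1)]]
      using assms c by (simp add: G.assoc G.closed)
    finally have "?e \<cdot>\<^bsub>G\<^esub> s = s \<cdot>\<^bsub>G\<^esub> (t \<cdot>\<^bsub>G\<^esub> i t)"
      unfolding G.inv_of_properties(2)[OF assms(1)] .
    then show ?thesis using assms c by (simp add: G.assoc)
  qed
  have "\<pi> s \<cdot> eps t = \<pi> ?u \<cdot> \<pi> (i t)" using assms by (simp add: eps_def rel_right)
  also have "\<dots> = \<pi> ?u \<cdot> (\<pi> (i ?u) \<cdot> \<pi> ?u) \<cdot> \<pi> (i t)" by (simp add: rel_inv u)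
  also have "\<dots> = \<pi> ?u \<cdot> (\<pi> (i ?u) \<cdot> (\<pi> ?u \<cdot> \<pi> (i t)))"
    using u c by (simp add: T_assoc T_closed)
  also have "\<dots> = \<pi> ?u \<cdot> (\<pi> (i ?u) \<cdot> \<pi> (?e \<cdot>\<^bsub>G\<^esub> s))" by (simp add: rel_left u c es)
  also have "\<dots> = \<pi> ?u \<cdot> (\<pi> (i ?u) \<cdot> \<pi> ?e) \<cdot> \<pi> s"
    using assms e u G.idempotents_closed[OF e] by (simp add: pi_idempotent_mult T_assoc T_closed)
  also have "\<pi> ?u \<cdot> (\<pi> (i ?u) \<cdot> \<pi> ?e) = eps ?u"
  proof -
    have "i ?u \<cdot>\<^bsub>G\<^esub> ?e = i ?u"
      unfolding ee using G.inv_of_properties(3)[OF u] u by (simp add: G.assoc G.closed)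
    then show ?thesis using rel_left'[OF u G.idempotents_closed[OF e]] by (simp add: eps_def)
  qed
  finally show ?thesis .
qed

text \<open>Pulling \<open>eps t\<close> through \<open>\<pi> (i s)\<close> and then through
  \<open>\<pi> s\<close> does not give back \<open>eps t\<close> but
  \<open>eps (s \<cdot> i s \<cdot> t)\<close>; the fact \<open>one\<close> records the resulting
  discrepancy \<open>\<pi> (s \<cdot> i s)\<close>.\<close>

lemma eps_commute:
  assumes "s \<in> elts G" "t \<in> elts G"
  shows "eps s \<cdot> eps t = eps t \<cdot> eps s"
proof -
  have one: "eps s \<cdot> eps t = \<pi> (s \<cdot>\<^bsub>G\<^esub> i s) \<cdot> (eps t \<cdot> eps s)"
    if st: "s \<in> elts G" "t \<in> elts G" for s t
  proof -
    let ?f = "s \<cdot>\<^bsub>G\<^esub> i s"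
    have f: "?f \<in> idempotents G" "?f \<in> elts G"
      using st G.mult_inv_of_idempotent G.idempotents_closed by auto
    have fs: "\<pi> ?f \<cdot> \<pi> s = \<pi> s"
      using pi_idempotent_mult[OF st(1) f(1)] st by (simp add: G.inv_of_properties)
    have "eps s \<cdot> eps t = \<pi> s \<cdot> (\<pi> (i s) \<cdot> eps t)" using st by (simp add: eps_def T_assoc T_closed)
    also have "\<dots> = (\<pi> s \<cdot> eps (i s \<cdot>\<^bsub>G\<^esub> t)) \<cdot> \<pi> (i s)"
      using st by (simp add: pi_eps[of "i s" t] T_assoc G.closed)
    also have "\<pi> s \<cdot> eps (i s \<cdot>\<^bsub>G\<^esub> t) = eps (?f \<cdot>\<^bsub>G\<^esub> t) \<cdot> \<pi> s"
      using pi_eps[of s "i s \<cdot>\<^bsub>G\<^esub> t"] st by (simp add: G.closed G.assoc)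
    also have "eps (?f \<cdot>\<^bsub>G\<^esub> t) \<cdot> \<pi> s \<cdot> \<pi> (i s) = eps (?f \<cdot>\<^bsub>G\<^esub> t) \<cdot> (\<pi> s \<cdot> \<pi> (i s))"
      using st f by (simp add: T_assoc G.closed)
    also have "\<dots> = eps (?f \<cdot>\<^bsub>G\<^esub> t) \<cdot> (\<pi> ?f \<cdot> eps s)"
      using st f fs by (simp add: eps_def T_assoc[symmetric] T_closed)
    also have "\<dots> = \<pi> ?f \<cdot> (eps t \<cdot> eps s)"
      using st f pi_eps[of ?f t] by (simp add: T_assoc[symmetric] G.closed)
    finally show ?thesis .
  qed
  let ?f = "s \<cdot>\<^bsub>G\<^esub> i s" and ?g = "t \<cdot>\<^bsub>G\<^esub> i t"
  have f: "?f \<in> idempotents G" "?g \<in> idempotents G" "?f \<in> elts G" "?g \<in> elts G"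
    using assms G.mult_inv_of_idempotent G.idempotents_closed by auto
  have fg: "\<pi> ?f \<cdot> \<pi> ?g = \<pi> ?g \<cdot> \<pi> ?f"
    using pi_mult_idempotent[OF f(3,2)] pi_mult_idempotent[OF f(4,1)] G.idempotents_commute[OF f(1,2)]
    by simp
  \<comment> \<open>Here \<open>\<pi> ?g\<close> is idempotent and hence fixes \<open>b\<close>.
    Since it commutes with \<open>\<pi> ?f\<close>, one gets \<open>a = \<pi> ?f \<cdot> \<pi> ?g
    \<cdot> b = \<pi> ?g \<cdot> a = b\<close>.\<close>
  have "a = b" if ab: "a \<in> elts T" "b \<in> elts T" "a = \<pi> ?f \<cdot> b" "b = \<pi> ?g \<cdot> a" for a b
  proof -
    have "\<pi> ?g \<cdot> b = \<pi> ?g \<cdot> (\<pi> ?g \<cdot> a)" using arg_cong[OF ab(4), of "\<lambda>z. \<pi> ?g \<cdot> z"] .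
    also have "\<dots> = \<pi> ?g \<cdot> a"
      using ab(1) f pi_idempotent[OF f(2)] by (simp only: T_assoc[symmetric] pi_closed)
    also have "\<dots> = b" by (rule ab(4)[symmetric])
    finally have gb: "\<pi> ?g \<cdot> b = b" .
    have "a = \<pi> ?f \<cdot> (\<pi> ?g \<cdot> b)" using ab(3) by (simp only: gb)
    also have "\<dots> = \<pi> ?g \<cdot> (\<pi> ?f \<cdot> b)"
      using fg ab(2) f by (simp only: T_assoc[symmetric] pi_closed)
    also have "\<dots> = \<pi> ?g \<cdot> a" using ab(3) by (simp only:)
    also have "\<dots> = b" by (rule ab(4)[symmetric])
    finally show ?thesis .
  qed
  from this[OF _ _ one[OF assms] one[OF assms(2,1)]] show ?thesis
    using assms by (simp add: T_closed)
qed

text \<open>When \<open>T\<close> is generated by the \<open>\<pi> s\<close> and retracts onto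
  \<open>G\<close>, these turn out to be all the idempotents of \<open>T\<close>.\<close>

inductive_set eps_products where
  eps: "r \<in> elts G \<Longrightarrow> eps r \<in> eps_products"
| mult: "\<lbrakk>\<alpha> \<in> eps_products; r \<in> elts G\<rbrakk> \<Longrightarrow> eps r \<cdot> \<alpha> \<in> eps_products"

lemma eps_products_closed: "\<alpha> \<in> eps_products \<Longrightarrow> \<alpha> \<in> elts T"
  by (induction rule: eps_products.induct) (auto simp: T_closed)

lemma eps_products_mult: "\<lbrakk>\<alpha> \<in> eps_products; \<gamma> \<in> eps_products\<rbrakk> \<Longrightarrow> \<alpha> \<cdot> \<gamma> \<in> eps_products"
proof (induction rule: eps_products.induct)
  case (eps r) then show ?case by (rule eps_products.mult[rotated])
next
  case (mult \<alpha> r)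
  then show ?case
    using eps_products.mult[of "\<alpha> \<cdot> \<gamma>" r] by (simp add: T_assoc eps_products_closed)
qed

lemma eps_eps_products_commute:
  "\<alpha> \<in> eps_products \<Longrightarrow> r \<in> elts G \<Longrightarrow> eps r \<cdot> \<alpha> = \<alpha> \<cdot> eps r"
proof (induction rule: eps_products.induct)
  case (eps s) then show ?case by (simp add: eps_commute)
next
  case (mult \<alpha> s)
  then have "eps r \<cdot> (eps s \<cdot> \<alpha>) = eps s \<cdot> eps r \<cdot> \<alpha>"
    using eps_commute[of r s] eps_products_closed by (simp add: T_assoc[symmetric])
  also have "\<dots> = eps s \<cdot> \<alpha> \<cdot> eps r" using mult eps_products_closed by (simp add: T_assoc)
  finally show ?case .
qed

lemma eps_products_commute:
  "\<alpha> \<in> eps_products \<Longrightarrow> \<gamma> \<in> eps_products \<Longrightarrow> \<alpha> \<cdot> \<gamma> = \<gamma> \<cdot> \<alpha>"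
proof (induction rule: eps_products.induct)
  case (eps s) then show ?case by (simp add: eps_eps_products_commute)
next
  case (mult \<alpha> s)
  then have c: "\<alpha> \<in> elts T" "\<gamma> \<in> elts T" using eps_products_closed by auto
  have "eps s \<cdot> \<alpha> \<cdot> \<gamma> = eps s \<cdot> \<gamma> \<cdot> \<alpha>" using mult c by (simp add: T_assoc)
  also have "\<dots> = \<gamma> \<cdot> (eps s \<cdot> \<alpha>)" using mult c by (simp add: eps_eps_products_commute T_assoc)
  finally show ?case .
qed

lemma eps_products_idempotent: "\<alpha> \<in> eps_products \<Longrightarrow> \<alpha> \<cdot> \<alpha> = \<alpha>"
proof (induction rule: eps_products.induct)
  case (eps s) then show ?case by (simp add: eps_idempotent)
next
  case (mult \<alpha> s)
  then have c: "\<alpha> \<in> elts T" using eps_products_closed by auto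
  have "eps s \<cdot> \<alpha> \<cdot> (eps s \<cdot> \<alpha>) = eps s \<cdot> (\<alpha> \<cdot> eps s) \<cdot> \<alpha>"
    using mult c by (simp add: T_assoc T_closed)
  also have "\<dots> = (eps s \<cdot> eps s) \<cdot> (\<alpha> \<cdot> \<alpha>)"
    using mult c by (simp add: eps_eps_products_commute[symmetric] T_assoc T_closed)
  finally show ?case using mult by (simp add: eps_idempotent)
qed

text \<open>Multiplication by one more generator fuses it with \<open>\<pi> t\<close> at the cost of
  a range idempotent on the right, which \<open>pi_eps\<close> moves to the left. That the
  \<open>\<pi> s\<close> generate \<open>T\<close> is expressed as an induction principle, the form
  in which it is available for \<open>Pr G\<close>.\<close>

lemma eps_products_decompose:
  assumes gen: "x \<in> elts T"
    and induct: "\<And>P x. \<lbrakk>x \<in> elts T; \<And>s. s \<in> elts G \<Longrightarrow> P (\<pi> s);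
      \<And>x s. \<lbrakk>x \<in> elts T; P x; s \<in> elts G\<rbrakk> \<Longrightarrow> P (x \<cdot> \<pi> s)\<rbrakk> \<Longrightarrow> P x"
  shows "\<exists>\<alpha> \<in> eps_products. \<exists>s \<in> elts G. x = \<alpha> \<cdot> \<pi> s"
  using gen
proof (rule induct)
  show "\<exists>\<alpha> \<in> eps_products. \<exists>t \<in> elts G. \<pi> s = \<alpha> \<cdot> \<pi> t" if "s \<in> elts G" for s
    using that eps_pi[of s] eps_products.eps[of s] by metis
next
  fix x s assume "\<exists>\<alpha> \<in> eps_products. \<exists>t \<in> elts G. x = \<alpha> \<cdot> \<pi> t" and s: "s \<in> elts G"
  then obtain \<alpha> t where a: "\<alpha> \<in> eps_products" "t \<in> elts G" "x = \<alpha> \<cdot> \<pi> t" by blast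
  have "x \<cdot> \<pi> s = \<alpha> \<cdot> (\<pi> (t \<cdot>\<^bsub>G\<^esub> s) \<cdot> eps (i s))"
    using a s pi_mult[of t s] eps_products_closed by (simp add: T_assoc eps_def)
  also have "\<dots> = (\<alpha> \<cdot> eps (t \<cdot>\<^bsub>G\<^esub> s \<cdot>\<^bsub>G\<^esub> i s)) \<cdot> \<pi> (t \<cdot>\<^bsub>G\<^esub> s)"
    using a s eps_products_closed by (simp add: pi_eps T_assoc G.closed)
  finally show "\<exists>\<alpha> \<in> eps_products. \<exists>t \<in> elts G. x \<cdot> \<pi> s = \<alpha> \<cdot> \<pi> t"
    using a s G.closed eps_products_mult eps_products.eps by (metis G.inv_of_closed)
qed

end

text \<open>If \<open>t\<close> and \<open>t'\<close> are inverses of \<open>s\<close>, commuting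
  idempotents give \<open>s \<cdot> t = s \<cdot> t'\<close> and
  \<open>t \<cdot> s = t' \<cdot> s\<close>, whence
  \<open>t = t \<cdot> s \<cdot> t' = t'\<close>.\<close>

lemma inverse_semigroup_if_regular:
  assumes closed: "\<And>s t. \<lbrakk>s \<in> elts S; t \<in> elts S\<rbrakk> \<Longrightarrow> s \<cdot>\<^bsub>S\<^esub> t \<in> elts S"
    and assoc: "\<And>r s t. \<lbrakk>r \<in> elts S; s \<in> elts S; t \<in> elts S\<rbrakk> \<Longrightarrow>
      (r \<cdot>\<^bsub>S\<^esub> s) \<cdot>\<^bsub>S\<^esub> t = r \<cdot>\<^bsub>S\<^esub> (s \<cdot>\<^bsub>S\<^esub> t)"
    and regular: "\<And>s. s \<in> elts S \<Longrightarrow> \<exists>t \<in> elts S. s \<cdot>\<^bsub>S\<^esub> t \<cdot>\<^bsub>S\<^esub> s = s \<and> t \<cdot>\<^bsub>S\<^esub> s \<cdot>\<^bsub>S\<^esub> t = t"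
    and commute: "\<And>e f. \<lbrakk>e \<in> idempotents S; f \<in> idempotents S\<rbrakk> \<Longrightarrow> e \<cdot>\<^bsub>S\<^esub> f = f \<cdot>\<^bsub>S\<^esub> e"
  shows "inverse_semigroup S"
proof
  fix s assume s: "s \<in> elts S"
  have "t = t'" if t: "t \<in> elts S" "s \<cdot>\<^bsub>S\<^esub> t \<cdot>\<^bsub>S\<^esub> s = s" "t \<cdot>\<^bsub>S\<^esub> s \<cdot>\<^bsub>S\<^esub> t = t"
    and t': "t' \<in> elts S" "s \<cdot>\<^bsub>S\<^esub> t' \<cdot>\<^bsub>S\<^esub> s = s" "t' \<cdot>\<^bsub>S\<^esub> s \<cdot>\<^bsub>S\<^esub> t' = t'" for t t'
  proof -
    have id: "s \<cdot>\<^bsub>S\<^esub> t \<in> idempotents S" "s \<cdot>\<^bsub>S\<^esub> t' \<in> idempotents S"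
      "t \<cdot>\<^bsub>S\<^esub> s \<in> idempotents S" "t' \<cdot>\<^bsub>S\<^esub> s \<in> idempotents S"
      unfolding idempotents_def using s t t' by (simp_all add: closed assoc[symmetric])
    have c: "s \<cdot>\<^bsub>S\<^esub> t \<in> elts S" "s \<cdot>\<^bsub>S\<^esub> t' \<in> elts S" "t \<cdot>\<^bsub>S\<^esub> s \<in> elts S" "t' \<cdot>\<^bsub>S\<^esub> s \<in> elts S"
      using s t t' closed by auto
    have 1: "(s \<cdot>\<^bsub>S\<^esub> t') \<cdot>\<^bsub>S\<^esub> (s \<cdot>\<^bsub>S\<^esub> t) = s \<cdot>\<^bsub>S\<^esub> t" "(s \<cdot>\<^bsub>S\<^esub> t) \<cdot>\<^bsub>S\<^esub> (s \<cdot>\<^bsub>S\<^esub> t') = s \<cdot>\<^bsub>S\<^esub> t'"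
      using s t t' c by (simp_all add: assoc[symmetric])
    have 2: "(t \<cdot>\<^bsub>S\<^esub> s) \<cdot>\<^bsub>S\<^esub> (t' \<cdot>\<^bsub>S\<^esub> s) = t \<cdot>\<^bsub>S\<^esub> (s \<cdot>\<^bsub>S\<^esub> t' \<cdot>\<^bsub>S\<^esub> s)"
      "(t' \<cdot>\<^bsub>S\<^esub> s) \<cdot>\<^bsub>S\<^esub> (t \<cdot>\<^bsub>S\<^esub> s) = t' \<cdot>\<^bsub>S\<^esub> (s \<cdot>\<^bsub>S\<^esub> t \<cdot>\<^bsub>S\<^esub> s)"
      using s t t' c by (simp_all add: assoc)
    have st: "s \<cdot>\<^bsub>S\<^esub> t = s \<cdot>\<^bsub>S\<^esub> t'" using 1 commute[OF id(2,1)] by simp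
    have ts: "t \<cdot>\<^bsub>S\<^esub> s = t' \<cdot>\<^bsub>S\<^esub> s" using 2 t t' commute[OF id(3,4)] by simp
    have "t = t \<cdot>\<^bsub>S\<^esub> (s \<cdot>\<^bsub>S\<^esub> t)" using s t assoc by simp
    also have "\<dots> = (t \<cdot>\<^bsub>S\<^esub> s) \<cdot>\<^bsub>S\<^esub> t'" unfolding st using s t t' assoc by simp
    also have "\<dots> = t'" unfolding ts using t' by simp
    finally show ?thesis .
  qed
  with regular[OF s] show "\<exists>!t. t \<in> elts S \<and> s \<cdot>\<^bsub>S\<^esub> t \<cdot>\<^bsub>S\<^esub> s = s \<and> t \<cdot>\<^bsub>S\<^esub> s \<cdot>\<^bsub>S\<^esub> t = t"
    by blast
qed (use closed assoc in auto)

text \<open>The retraction \<open>d\<close> forces an idempotent \<open>\<alpha> [s]\<close> to be a product of the \<open>\<epsilon>\<^sub>r\<close>, since it maps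
  the idempotent to an idempotent of \<open>G\<close>.\<close>

lemma (in semigroup_partial_hom) inverse_semigroup_if_generated:
  assumes induct: "\<And>P x. \<lbrakk>x \<in> elts T; \<And>s. s \<in> elts G \<Longrightarrow> P (\<pi> s);
      \<And>x s. \<lbrakk>x \<in> elts T; P x; s \<in> elts G\<rbrakk> \<Longrightarrow> P (x \<cdot> \<pi> s)\<rbrakk> \<Longrightarrow> P x"
    and d: "semigroup_hom T G d" "\<And>s. s \<in> elts G \<Longrightarrow> d (\<pi> s) = s"
  shows "inverse_semigroup T"
proof -
  have decompose: "\<exists>\<alpha> \<in> eps_products. \<exists>s \<in> elts G. x = \<alpha> \<cdot> \<pi> s" if "x \<in> elts T" for x
    using that by (rule eps_products_decompose) (fact induct)
  \<comment> \<open>The absorbed factor \<open>\<pi> (d \<alpha>)\<close> can be inserted between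
    \<open>\<alpha>\<close> and \<open>\<pi> s\<close>. It fuses with \<open>\<pi> s\<close> into
    the image of \<open>d \<alpha> \<cdot> s\<close>, which is the value of \<open>d\<close> at
    \<open>\<alpha> \<cdot> \<pi> s\<close>.\<close>
  have d_eps: "d \<alpha> \<in> idempotents G \<and> \<alpha> \<cdot> \<pi> (d \<alpha>) = \<alpha>" if "\<alpha> \<in> eps_products" for \<alpha>
    using that
  proof induction
    case (eps r)
    have dr: "d (eps r) = r \<cdot>\<^bsub>G\<^esub> i r"
      using eps d by (simp add: eps_def semigroup_hom_def)
    have e: "r \<cdot>\<^bsub>G\<^esub> i r \<in> idempotents G" "r \<cdot>\<^bsub>G\<^esub> i r \<in> elts G"
      using eps G.mult_inv_of_idempotent G.closed by auto
    have "i r \<cdot>\<^bsub>G\<^esub> (r \<cdot>\<^bsub>G\<^esub> i r) = i r" using eps by (simp add: G.inv_of_properties G.assoc[symmetric])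
    then have "eps r \<cdot> \<pi> (r \<cdot>\<^bsub>G\<^esub> i r) = eps r"
      using eps e pi_mult_idempotent[OF _ e(1), of "i r"] by (simp add: eps_def T_assoc)
    then show ?case using dr e by simp
  next
    case (mult \<alpha> r)
    have da: "d (eps r \<cdot> \<alpha>) = r \<cdot>\<^bsub>G\<^esub> i r \<cdot>\<^bsub>G\<^esub> d \<alpha>"
      using mult d eps_products_closed by (simp add: eps_def semigroup_hom_def T_closed)
    have e: "r \<cdot>\<^bsub>G\<^esub> i r \<in> idempotents G" "r \<cdot>\<^bsub>G\<^esub> i r \<in> elts G"
      using mult G.mult_inv_of_idempotent G.closed by auto
    have "i r \<cdot>\<^bsub>G\<^esub> (r \<cdot>\<^bsub>G\<^esub> i r) = i r" using mult by (simp add: G.inv_of_properties G.assoc[symmetric])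
    then have er: "eps r \<cdot> \<pi> (r \<cdot>\<^bsub>G\<^esub> i r) = eps r"
      using mult e pi_mult_idempotent[OF _ e(1), of "i r"] by (simp add: eps_def T_assoc)
    have c: "\<alpha> \<in> elts T" "d \<alpha> \<in> elts G" using mult eps_products_closed G.idempotents_closed by auto
    have ee: "\<alpha> \<cdot> \<pi> (r \<cdot>\<^bsub>G\<^esub> i r) = \<pi> (r \<cdot>\<^bsub>G\<^esub> i r) \<cdot> \<alpha>"
      using eps_eps_products_commute[OF mult.hyps(1) e(2)] e(1) by (simp add: eps_of_idempotent)
    have "eps r \<cdot> \<alpha> \<cdot> \<pi> (r \<cdot>\<^bsub>G\<^esub> i r \<cdot>\<^bsub>G\<^esub> d \<alpha>) = eps r \<cdot> (\<alpha> \<cdot> \<pi> (r \<cdot>\<^bsub>G\<^esub> i r)) \<cdot> \<pi> (d \<alpha>)"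
      using c e mult by (simp add: pi_idempotent_mult T_assoc T_closed)
    also have "\<dots> = (eps r \<cdot> \<pi> (r \<cdot>\<^bsub>G\<^esub> i r)) \<cdot> (\<alpha> \<cdot> \<pi> (d \<alpha>))"
      unfolding ee using c e mult by (simp add: T_assoc T_closed)
    finally show ?case using er mult da e G.idempotents_mult by simp
  qed
  have idem: "x \<in> eps_products" if x: "x \<in> idempotents T" for x
  proof -
    have xT: "x \<in> elts T" using x by (simp add: idempotents_def)
    obtain \<alpha> s where a: "\<alpha> \<in> eps_products" "s \<in> elts G" "x = \<alpha> \<cdot> \<pi> s"
      using decompose[OF xT] by blast
    have c: "\<alpha> \<in> elts T" "d \<alpha> \<in> elts G" "d \<alpha> \<in> idempotents G" "\<alpha> \<cdot> \<pi> (d \<alpha>) = \<alpha>"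
      using a eps_products_closed d_eps G.idempotents_closed by auto
    have "d x \<in> idempotents G" by (rule semigroup_hom_idempotent[OF d(1) x])
    moreover have "d x = d \<alpha> \<cdot>\<^bsub>G\<^esub> s" using a c d by (simp add: semigroup_hom_def)
    ultimately have e: "d \<alpha> \<cdot>\<^bsub>G\<^esub> s \<in> idempotents G" by simp
    have "x = \<alpha> \<cdot> (\<pi> (d \<alpha>) \<cdot> \<pi> s)" using a c by (simp add: T_assoc[symmetric])
    also have "\<dots> = \<alpha> \<cdot> eps (d \<alpha> \<cdot>\<^bsub>G\<^esub> s)" using e a c by (simp add: pi_idempotent_mult eps_of_idempotent)
    finally show ?thesis
      using a e eps_products_mult eps_products.eps G.idempotents_closed by metis
  qed
  show ?thesis
  proof (rule inverse_semigroup_if_regular)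
    fix x assume x: "x \<in> elts T"
    obtain \<alpha> s where a: "\<alpha> \<in> eps_products" "s \<in> elts G" "x = \<alpha> \<cdot> \<pi> s"
      using decompose[OF x] by blast
    have c: "\<alpha> \<in> elts T" "\<pi> s \<in> elts T" "\<pi> (i s) \<in> elts T"
      using a eps_products_closed by auto
    have aa: "\<alpha> \<cdot> \<alpha> = \<alpha>" "\<alpha> \<cdot> eps s = eps s \<cdot> \<alpha>" "\<alpha> \<cdot> eps (i s) = eps (i s) \<cdot> \<alpha>"
      using a eps_products_idempotent eps_eps_products_commute by auto
    let ?y = "\<pi> (i s) \<cdot> \<alpha>"
    have "x \<cdot> ?y \<cdot> x = \<alpha> \<cdot> eps s \<cdot> (\<alpha> \<cdot> \<alpha>) \<cdot> \<pi> s"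
      using c by (simp add: a eps_def T_assoc T_closed)
    also have "\<dots> = (\<alpha> \<cdot> eps s) \<cdot> \<alpha> \<cdot> \<pi> s" using aa by simp
    also have "\<dots> = eps s \<cdot> (\<alpha> \<cdot> \<alpha>) \<cdot> \<pi> s" unfolding aa(2) using c a by (simp add: T_assoc T_closed)
    also have "\<dots> = (eps s \<cdot> \<alpha>) \<cdot> \<pi> s" using aa by simp
    also have "\<dots> = x" unfolding aa(2)[symmetric] using c a by (simp add: T_assoc eps_pi)
    finally have 1: "x \<cdot> ?y \<cdot> x = x" .
    have "?y \<cdot> x \<cdot> ?y = \<pi> (i s) \<cdot> (\<alpha> \<cdot> \<alpha>) \<cdot> eps s \<cdot> \<alpha>"
      using c by (simp add: a eps_def T_assoc T_closed)
    also have "\<dots> = \<pi> (i s) \<cdot> (\<alpha> \<cdot> eps s) \<cdot> \<alpha>" using aa c a by (simp add: T_assoc T_closed)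
    also have "\<dots> = (\<pi> (i s) \<cdot> eps s) \<cdot> (\<alpha> \<cdot> \<alpha>)" unfolding aa(2) using c a by (simp add: T_assoc T_closed)
    also have "\<dots> = ?y"
      using aa a c rel_inv[of "i s"] by (simp add: eps_def)
    finally have 2: "?y \<cdot> x \<cdot> ?y = ?y" .
    show "\<exists>t \<in> elts T. x \<cdot> t \<cdot> x = x \<and> t \<cdot> x \<cdot> t = t"
      using 1 2 c by (intro bexI[of _ ?y]) (auto simp: T_closed)
  next
    fix e f assume "e \<in> idempotents T" "f \<in> idempotents T"
    then show "e \<cdot> f = f \<cdot> e" using idem eps_products_commute by blast
  qed (use T_closed T_assoc in auto)
qed

section \<open>Words modulo the congruence as a semigroup\<close>

context inverse_semigroup
begin

lemma pr_rel_words: "pr_rel S v w \<Longrightarrow> v \<in> pr_words S \<and> w \<in> pr_words S"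
  by (induction rule: pr_rel.induct) (auto simp: pr_words_def closed)

lemma pr_cong_words: "pr_cong S v w \<Longrightarrow> v \<in> pr_words S \<and> w \<in> pr_words S"
proof (induction rule: pr_cong.induct)
  case (step v w x y)
  then show ?case using pr_rel_words[OF step(1)] by (auto simp: pr_words_def in_lists_conv_set)
qed auto

lemma pr_cong_context:
  "pr_cong S v w \<Longrightarrow> x \<in> lists (elts S) \<Longrightarrow> y \<in> lists (elts S) \<Longrightarrow> pr_cong S (x @ v @ y) (x @ w @ y)"
proof (induction rule: pr_cong.induct)
  case (step v w x' y')
  then have "pr_cong S ((x @ x') @ v @ (y' @ y)) ((x @ x') @ w @ (y' @ y))"
    by (intro pr_cong.step) auto
  then show ?case by simp
next
  case (refl v)
  then show ?case by (intro pr_cong.refl) (auto simp: pr_words_def)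
next
  case (sym v w)
  then show ?case by (blast intro: pr_cong.sym)
next
  case (trans u v w)
  then show ?case by (blast intro: pr_cong.trans)
qed

lemma pr_cong_append:
  assumes "pr_cong S v v'" "pr_cong S w w'"
  shows "pr_cong S (v @ w) (v' @ w')"
proof -
  have l: "v \<in> lists (elts S)" "w \<in> lists (elts S)" "v' \<in> lists (elts S)" "w' \<in> lists (elts S)"
    using pr_cong_words[OF assms(1)] pr_cong_words[OF assms(2)] by (auto simp: pr_words_def)
  show ?thesis
    using pr_cong_context[OF assms(1), of "[]" w] pr_cong_context[OF assms(2), of v' "[]"] l
    by (auto intro: pr_cong.trans)
qed

lemma pr_class_eq: "pr_cong S v w \<Longrightarrow> pr_class S v = pr_class S w"
  unfolding pr_class_def by (blast intro: pr_cong.sym pr_cong.trans)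

lemma pr_class_self: "v \<in> pr_words S \<Longrightarrow> v \<in> pr_class S v"
  unfolding pr_class_def by (blast intro: pr_cong.refl)

lemma pr_words_append: "\<lbrakk>v \<in> pr_words S; w \<in> pr_words S\<rbrakk> \<Longrightarrow> v @ w \<in> pr_words S"
  by (auto simp: pr_words_def)

lemma Pr_mult:
  assumes "v \<in> pr_words S" "w \<in> pr_words S"
  shows "pr_class S v \<cdot>\<^bsub>Pr S\<^esub> pr_class S w = pr_class S (v @ w)"
proof -
  have "pr_class S (v' @ w') = pr_class S (v @ w)" if "v' \<in> pr_class S v" "w' \<in> pr_class S w" for v' w'
    using that pr_class_eq[OF pr_cong_append] by (auto simp: pr_class_def)
  then have "(\<Union>v' \<in> pr_class S v. \<Union>w' \<in> pr_class S w. pr_class S (v' @ w')) = pr_class S (v @ w)"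
    using pr_class_self[OF assms(1)] pr_class_self[OF assms(2)] by blast
  then show ?thesis by (simp add: Pr_def)
qed

lemma Pr_elts: "elts (Pr S) = pr_class S ` pr_words S"
  by (simp add: Pr_def)

lemma Pr_closed: "\<lbrakk>x \<in> elts (Pr S); y \<in> elts (Pr S)\<rbrakk> \<Longrightarrow> x \<cdot>\<^bsub>Pr S\<^esub> y \<in> elts (Pr S)"
  by (auto simp: Pr_elts Pr_mult pr_words_append)

lemma Pr_assoc: "\<lbrakk>x \<in> elts (Pr S); y \<in> elts (Pr S); z \<in> elts (Pr S)\<rbrakk> \<Longrightarrow>
    (x \<cdot>\<^bsub>Pr S\<^esub> y) \<cdot>\<^bsub>Pr S\<^esub> z = x \<cdot>\<^bsub>Pr S\<^esub> (y \<cdot>\<^bsub>Pr S\<^esub> z)"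
  by (auto simp: Pr_elts Pr_mult pr_words_append)

lemma pr_gen_closed: "s \<in> elts S \<Longrightarrow> pr_gen S s \<in> elts (Pr S)"
  by (auto simp: Pr_elts pr_gen_def pr_words_def)

lemma pr_gen_partial_hom: "partial_hom S (Pr S) (pr_gen S)"
proof -
  have w: "[s] \<in> pr_words S" "[s, t] \<in> pr_words S" if "s \<in> elts S" "t \<in> elts S" for s t
    using that by (auto simp: pr_words_def)
  have r: "pr_class S v = pr_class S w" if "pr_rel S v w" for v w
    using pr_class_eq[OF pr_cong.step[OF that, of "[]" "[]"]] by simp
  show ?thesis
    unfolding partial_hom_def using w
    by (auto simp: pr_gen_closed) (simp_all add: pr_gen_def Pr_mult closed r[OF pr_rel.intros(1)]
        r[OF pr_rel.intros(2)] r[OF pr_rel.intros(3)])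
qed

lemma Pr_induct [consumes 1, case_names gen mult]:
  assumes "x \<in> elts (Pr S)"
    and "\<And>s. s \<in> elts S \<Longrightarrow> P (pr_gen S s)"
    and "\<And>x s. \<lbrakk>x \<in> elts (Pr S); P x; s \<in> elts S\<rbrakk> \<Longrightarrow> P (x \<cdot>\<^bsub>Pr S\<^esub> pr_gen S s)"
  shows "P x"
proof -
  have "P (pr_class S v)" if "v \<noteq> []" "set v \<subseteq> elts S" for v
    using that
  proof (induction v rule: rev_nonempty_induct)
    case (single s)
    then show ?case using assms(2) by (simp add: pr_gen_def)
  next
    case (snoc s v)
    then have "P (pr_class S v \<cdot>\<^bsub>Pr S\<^esub> pr_gen S s)"
      by (intro assms(3)) (auto simp: Pr_elts pr_words_def)
    then show ?case using snoc by (simp add: pr_gen_def Pr_mult pr_words_def)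
  qed
  then show ?thesis using assms(1) by (auto simp: Pr_elts pr_words_def)
qed

end

section \<open>The universal property of \<open>Pr G\<close>\<close>

context semigroup_partial_hom
begin

text \<open>\<open>T\<close> need not have a unit, so the recursion ends at one letter; the value at
  the empty word is arbitrary, and only nonempty words are ever evaluated.\<close>

fun word_product :: "'g list \<Rightarrow> 't" where
  "word_product [] = undefined"
| "word_product [s] = \<pi> s"
| "word_product (s # t # w) = \<pi> s \<cdot> word_product (t # w)"

lemma word_product_closed: "w \<in> pr_words G \<Longrightarrow> word_product w \<in> elts T"
  by (induction w rule: word_product.induct) (auto simp: pr_words_def T_closed)

lemma word_product_append:
  "v \<in> pr_words G \<Longrightarrow> w \<in> pr_words G \<Longrightarrow> word_product (v @ w) = word_product v \<cdot> word_product w"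
proof (induction v rule: word_product.induct)
  case (2 s)
  then show ?case by (cases w) (auto simp: pr_words_def)
next
  case (3 s t v)
  then have "word_product ((t # v) @ w) = word_product (t # v) \<cdot> word_product w"
    by (auto simp: pr_words_def)
  moreover have "word_product (t # v) \<in> elts T" "word_product w \<in> elts T"
    using 3 by (auto intro!: word_product_closed simp: pr_words_def)
  ultimately show ?case using 3 by (simp add: T_assoc pr_words_def)
qed (simp add: pr_words_def)

lemma word_product_pr_rel: "pr_rel G v w \<Longrightarrow> word_product v = word_product w"
  by (induction rule: pr_rel.induct) (auto simp: rel_right rel_left rel_inv)

lemma word_product_cong: "pr_cong G v w \<Longrightarrow> word_product v = word_product w"
proof (induction rule: pr_cong.induct)
  case (step v w x y)
  have vw: "v \<in> pr_words G" "w \<in> pr_words G" "word_product v = word_product w"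
    using G.pr_rel_words word_product_pr_rel step by auto
  \<comment> \<open>The context of a rewriting step may be empty on either side, and an empty word
    has no product in \<open>T\<close>.\<close>
  have xy: "x = [] \<or> x \<in> pr_words G" "y = [] \<or> y \<in> pr_words G"
    using step by (auto simp: pr_words_def)
  then have "v @ y \<in> pr_words G" "w @ y \<in> pr_words G" "word_product (v @ y) = word_product (w @ y)"
    using vw by (auto simp: word_product_append G.pr_words_append)
  then show ?case using xy by (auto simp: word_product_append)
qed auto

lemma ex1_lift:
  "\<exists>!h. h \<in> extensional (elts (Pr G)) \<and> semigroup_hom (Pr G) T h \<and> (\<forall>s \<in> elts G. h (pr_gen G s) = \<pi> s)"
proof (rule ex_ex1I)
  define h where "h = (\<lambda>X \<in> elts (Pr G). word_product (SOME v. v \<in> X))"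
  have h: "h (pr_class G v) = word_product v" if "v \<in> pr_words G" for v
  proof -
    have "(SOME w. w \<in> pr_class G v) \<in> pr_class G v"
      using G.pr_class_self[OF that] by (rule someI)
    then have "word_product v = word_product (SOME w. w \<in> pr_class G v)"
      by (intro word_product_cong) (simp add: pr_class_def)
    then show ?thesis using that by (simp add: h_def G.Pr_elts)
  qed
  show "\<exists>h. h \<in> extensional (elts (Pr G)) \<and> semigroup_hom (Pr G) T h \<and> (\<forall>s \<in> elts G. h (pr_gen G s) = \<pi> s)"
  proof (intro exI[of _ h] conjI ballI)
    show "h \<in> extensional (elts (Pr G))" by (simp add: h_def)
    show "semigroup_hom (Pr G) T h"
      by (auto simp: semigroup_hom_def G.Pr_elts G.Pr_mult h G.pr_words_append
          word_product_append word_product_closed)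
    show "h (pr_gen G s) = \<pi> s" if "s \<in> elts G" for s
      using that by (simp add: pr_gen_def h pr_words_def)
  qed
next
  fix h k
  assume h: "h \<in> extensional (elts (Pr G)) \<and> semigroup_hom (Pr G) T h \<and> (\<forall>s \<in> elts G. h (pr_gen G s) = \<pi> s)"
    and k: "k \<in> extensional (elts (Pr G)) \<and> semigroup_hom (Pr G) T k \<and> (\<forall>s \<in> elts G. k (pr_gen G s) = \<pi> s)"
  have "h x = k x" if "x \<in> elts (Pr G)" for x
    using that
  proof (induction rule: G.Pr_induct)
    case (mult x s)
    then show ?case
      using h k G.pr_gen_closed semigroup_hom_mult[of "Pr G" T h x "pr_gen G s"]
        semigroup_hom_mult[of "Pr G" T k x "pr_gen G s"] by simp
  qed (use h k in auto)
  then show "h = k" using h k by (auto intro: extensionalityI)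
qed

lemma induced_hom:
  "semigroup_hom (Pr G) T (induced_hom G T \<pi>)"
  "s \<in> elts G \<Longrightarrow> induced_hom G T \<pi> (pr_gen G s) = \<pi> s"
  using theI'[OF ex1_lift] unfolding induced_hom_def by auto

end

section \<open>The retraction onto \<open>G\<close> and the order of \<open>Pr G\<close>\<close>

context inverse_semigroup
begin

definition Pr_retract :: "'a list set \<Rightarrow> 'a" where
  "Pr_retract = induced_hom S S (\<lambda>s. s)"

lemma identity_semigroup_partial_hom: "semigroup_partial_hom S S (\<lambda>s. s)"
proof unfold_locales
  show "partial_hom S S (\<lambda>s. s)"
    by (auto simp: partial_hom_def inv_of_properties assoc[symmetric] closed)
qed (auto simp: closed assoc)

lemma Pr_semigroup_partial_hom: "semigroup_partial_hom S (Pr S) (pr_gen S)"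
  by unfold_locales (simp_all add: Pr_closed Pr_assoc pr_gen_partial_hom)

lemma Pr_retract_hom: "semigroup_hom (Pr S) S Pr_retract"
  and Pr_retract_gen: "s \<in> elts S \<Longrightarrow> Pr_retract (pr_gen S s) = s"
  using semigroup_partial_hom.induced_hom[OF identity_semigroup_partial_hom]
  by (auto simp: Pr_retract_def)

lemma Pr_retract_closed: "x \<in> elts (Pr S) \<Longrightarrow> Pr_retract x \<in> elts S"
  by (rule semigroup_hom_closed[OF Pr_retract_hom])

theorem Pr_inverse_semigroup: "inverse_semigroup (Pr S)"
  by (rule semigroup_partial_hom.inverse_semigroup_if_generated
      [OF Pr_semigroup_partial_hom _ Pr_retract_hom Pr_retract_gen])
    (rule Pr_induct)

lemma Pr_inv_of_gen:
  assumes "s \<in> elts S"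
  shows "inv_of (Pr S) (pr_gen S s) = pr_gen S (inv_of S s)"
proof (rule inverse_semigroup.inv_of_unique[OF Pr_inverse_semigroup])
  show "pr_gen S s \<cdot>\<^bsub>Pr S\<^esub> pr_gen S (inv_of S s) \<cdot>\<^bsub>Pr S\<^esub> pr_gen S s = pr_gen S s"
    using partial_hom_rules(4)[OF pr_gen_partial_hom assms assms] .
  show "pr_gen S (inv_of S s) \<cdot>\<^bsub>Pr S\<^esub> pr_gen S s \<cdot>\<^bsub>Pr S\<^esub> pr_gen S (inv_of S s) = pr_gen S (inv_of S s)"
    using partial_hom_rules(4)[OF pr_gen_partial_hom, of "inv_of S s" s] assms by simp
qed (use assms pr_gen_closed in auto)

lemma Pr_gen_idempotent: "e \<in> idempotents S \<Longrightarrow> pr_gen S e \<in> idempotents (Pr S)"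
  using semigroup_partial_hom.pi_idempotent[OF Pr_semigroup_partial_hom, of e]
  by (auto simp: idempotents_def pr_gen_closed)

lemma Pr_gen_nat_le:
  assumes "nat_le S s t"
  shows "nat_le (Pr S) (pr_gen S s) (pr_gen S t)"
  using assms semigroup_partial_hom.pi_mult_idempotent[OF Pr_semigroup_partial_hom]
    inverse_semigroup.nat_leI[OF Pr_inverse_semigroup] Pr_gen_idempotent pr_gen_closed
  by (auto simp: nat_le_def)

lemma Pr_gen_mult_nat_le:
  assumes "s \<in> elts S" "t \<in> elts S"
  shows "nat_le (Pr S) (pr_gen S s \<cdot>\<^bsub>Pr S\<^esub> pr_gen S t) (pr_gen S (s \<cdot> t))"
proof -
  interpret P: inverse_semigroup "Pr S" by (rule Pr_inverse_semigroup)
  have "pr_gen S (inv_of S t) \<cdot>\<^bsub>Pr S\<^esub> pr_gen S t \<in> idempotents (Pr S)"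
    using P.inv_of_mult_idempotent[OF pr_gen_closed[OF assms(2)]] assms by (simp add: Pr_inv_of_gen)
  then show ?thesis
    using semigroup_partial_hom.pi_mult[OF Pr_semigroup_partial_hom assms] assms
      P.nat_leI pr_gen_closed closed by simp
qed

text \<open>By induction on words: \<open>x \<le> [d x]\<close> gives
  \<open>x [s] \<le> [d x] [s] \<le> [d x \<cdot> s]\<close>, the last step by
  \<open>Pr_gen_mult_nat_le\<close>.\<close>

lemma nat_le_Pr_gen_retract: "x \<in> elts (Pr S) \<Longrightarrow> nat_le (Pr S) x (pr_gen S (Pr_retract x))"
proof (induction rule: Pr_induct)
  case (gen s)
  then show ?case
    using inverse_semigroup.nat_le_refl[OF Pr_inverse_semigroup pr_gen_closed[OF gen]]
    by (simp add: Pr_retract_gen)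
next
  case (mult x s)
  interpret P: inverse_semigroup "Pr S" by (rule Pr_inverse_semigroup)
  have d: "Pr_retract (x \<cdot>\<^bsub>Pr S\<^esub> pr_gen S s) = Pr_retract x \<cdot> s"
    using mult pr_gen_closed by (simp add: semigroup_hom_mult[OF Pr_retract_hom] Pr_retract_gen)
  show ?case
    unfolding d
    using P.nat_le_trans[OF P.nat_le_mult_right[OF mult.IH pr_gen_closed] Pr_gen_mult_nat_le]
      mult.hyps Pr_retract_closed by blast
qed

lemma Pr_retract_inv_of:
  "x \<in> elts (Pr S) \<Longrightarrow> Pr_retract (inv_of (Pr S) x) = inv_of S (Pr_retract x)"
  by (rule semigroup_hom_inv_of[OF Pr_inverse_semigroup _ Pr_retract_hom]) unfold_locales

end

section \<open>Normed spaces and \<open>C\<^sup>*\<close>-algebras\<close>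

lemma vminus_carrier_update [simp]: "vminus (A\<lparr>carrier := M\<rparr>) = vminus A"
  by (simp add: vminus_def fun_eq_iff)

context banach_space
begin

declare add_closed [simp] zero_closed [simp] scale_closed [simp] scale_one [simp]

lemma minus_closed [simp]: "\<lbrakk>x \<in> carrier V; y \<in> carrier V\<rbrakk> \<Longrightarrow> x \<ominus> y \<in> carrier V"
  by (simp add: vminus_def)

lemma add_left_commute:
  "\<lbrakk>x \<in> carrier V; y \<in> carrier V; z \<in> carrier V\<rbrakk> \<Longrightarrow> x \<oplus> (y \<oplus> z) = y \<oplus> (x \<oplus> z)"
  by (metis add_assoc add_commute)

lemma zero_add [simp]: "x \<in> carrier V \<Longrightarrow> \<zero> \<oplus> x = x"
  and add_zero' [simp]: "x \<in> carrier V \<Longrightarrow> x \<oplus> \<zero> = x"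
  by (simp_all add: add_zero add_commute[of \<zero>])

lemma scale_zero_left [simp]:
  assumes "x \<in> carrier V"
  shows "0 \<odot> x = \<zero>"
  using scale_add_left[OF assms, of 1 "- 1"] add_minus[OF assms] assms by (simp add: vminus_def)

lemma scale_zero_right [simp]: "c \<odot> \<zero> = \<zero>"
  using scale_scale[of \<zero> c 0] by simp

text \<open>Linear identities between at most six vectors are checked coefficientwise: \<open>L\<close> is the linear
  combination with the given coefficients.\<close>

lemma linear_identity6:
  assumes "x1 \<in> carrier V" "x2 \<in> carrier V" "x3 \<in> carrier V" "x4 \<in> carrier V" "x5 \<in> carrier V"
    "x6 \<in> carrier V"
    and "\<And>L. \<lbrakk>x1 = L 1 0 0 0 0 0; x2 = L 0 1 0 0 0 0; x3 = L 0 0 1 0 0 0; x4 = L 0 0 0 1 0 0;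
      x5 = L 0 0 0 0 1 0; x6 = L 0 0 0 0 0 1; \<zero> = L 0 0 0 0 0 0;
      \<And>a b c d e f a' b' c' d' e' f'. L a b c d e f \<oplus> L a' b' c' d' e' f'
        = L (a + a') (b + b') (c + c') (d + d') (e + e') (f + f');
      \<And>k a b c d e f. k \<odot> L a b c d e f = L (k * a) (k * b) (k * c) (k * d) (k * e) (k * f)\<rbrakk>
      \<Longrightarrow> thesis"
  shows thesis
proof (rule assms(7)[of "\<lambda>a b c d e f. a \<odot> x1 \<oplus> (b \<odot> x2 \<oplus> (c \<odot> x3 \<oplus> (d \<odot> x4 \<oplus> (e \<odot> x5 \<oplus> f \<odot> x6))))"])
qed (simp_all add: assms(1-6) scale_add_left scale_add_right scale_scale add_assoc add_commute
    add_left_commute)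

lemma linear_identity4:
  assumes c: "x1 \<in> carrier V" "x2 \<in> carrier V" "x3 \<in> carrier V" "x4 \<in> carrier V"
    and t: "\<And>L. \<lbrakk>x1 = L 1 0 0 0; x2 = L 0 1 0 0; x3 = L 0 0 1 0; x4 = L 0 0 0 1; \<zero> = L 0 0 0 0;
      \<And>a b c d a' b' c' d'. L a b c d \<oplus> L a' b' c' d' = L (a + a') (b + b') (c + c') (d + d');
      \<And>k a b c d. k \<odot> L a b c d = L (k * a) (k * b) (k * c) (k * d)\<rbrakk> \<Longrightarrow> thesis"
  shows thesis
proof (rule linear_identity6[OF c zero_closed zero_closed])
  fix L :: "complex \<Rightarrow> complex \<Rightarrow> complex \<Rightarrow> complex \<Rightarrow> complex \<Rightarrow> complex \<Rightarrow> 'a"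
  assume *: "x1 = L 1 0 0 0 0 0" "x2 = L 0 1 0 0 0 0" "x3 = L 0 0 1 0 0 0" "x4 = L 0 0 0 1 0 0"
    "\<zero> = L 0 0 0 0 0 0"
    "\<And>a b c d e f a' b' c' d' e' f'. L a b c d e f \<oplus> L a' b' c' d' e' f'
        = L (a + a') (b + b') (c + c') (d + d') (e + e') (f + f')"
    "\<And>k a b c d e f. k \<odot> L a b c d e f = L (k * a) (k * b) (k * c) (k * d) (k * e) (k * f)"
  show thesis
    by (rule t[of "\<lambda>a b c d. L a b c d 0 0"]) (simp_all add: *(1-4,6,7), rule *(5))
qed

lemma linear_identity3:
  assumes c: "x1 \<in> carrier V" "x2 \<in> carrier V" "x3 \<in> carrier V"
    and t: "\<And>L. \<lbrakk>x1 = L 1 0 0; x2 = L 0 1 0; x3 = L 0 0 1; \<zero> = L 0 0 0;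
      \<And>a b c a' b' c'. L a b c \<oplus> L a' b' c' = L (a + a') (b + b') (c + c');
      \<And>k a b c. k \<odot> L a b c = L (k * a) (k * b) (k * c)\<rbrakk> \<Longrightarrow> thesis"
  shows thesis
proof (rule linear_identity4[OF c zero_closed])
  fix L :: "complex \<Rightarrow> complex \<Rightarrow> complex \<Rightarrow> complex \<Rightarrow> 'a"
  assume *: "x1 = L 1 0 0 0" "x2 = L 0 1 0 0" "x3 = L 0 0 1 0" "\<zero> = L 0 0 0 0"
    "\<And>a b c d a' b' c' d'. L a b c d \<oplus> L a' b' c' d' = L (a + a') (b + b') (c + c') (d + d')"
    "\<And>k a b c d. k \<odot> L a b c d = L (k * a) (k * b) (k * c) (k * d)"
  show thesis
    by (rule t[of "\<lambda>a b c. L a b c 0"]) (simp_all add: *(1-3,5,6), rule *(4))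
qed

lemma minus_self [simp]: "x \<in> carrier V \<Longrightarrow> x \<ominus> x = \<zero>"
  by (rule add_minus)

lemma minus_zero [simp]: "x \<in> carrier V \<Longrightarrow> x \<ominus> \<zero> = x"
  by (simp add: vminus_def)

lemma minus_add_cancel: "\<lbrakk>x \<in> carrier V; y \<in> carrier V\<rbrakk> \<Longrightarrow> (x \<ominus> y) \<oplus> y = x"
  by (rule linear_identity3[of x y y]) (simp_all add: vminus_def)

lemma minus_minus: "\<lbrakk>x \<in> carrier V; y \<in> carrier V\<rbrakk> \<Longrightarrow> x \<ominus> (x \<ominus> y) = y"
  by (rule linear_identity3[of x y y]) (simp_all add: vminus_def)

lemma minus_eq_zero: "\<lbrakk>x \<in> carrier V; y \<in> carrier V; x \<ominus> y = \<zero>\<rbrakk> \<Longrightarrow> x = y"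
  using minus_add_cancel[of x y] by simp

lemma minus_diff: "\<lbrakk>x \<in> carrier V; y \<in> carrier V; z \<in> carrier V\<rbrakk> \<Longrightarrow> (x \<ominus> y) \<oplus> (y \<ominus> z) = x \<ominus> z"
  by (rule linear_identity3[of x y z]) (simp_all add: vminus_def)

lemma norm_zero [simp]: "vnorm V \<zero> = 0"
  by (simp add: norm_eq_zero)

lemma norm_minus_commute: "\<lbrakk>x \<in> carrier V; y \<in> carrier V\<rbrakk> \<Longrightarrow> vnorm V (x \<ominus> y) = vnorm V (y \<ominus> x)"
proof -
  assume c: "x \<in> carrier V" "y \<in> carrier V"
  have "x \<ominus> y = (- 1) \<odot> (y \<ominus> x)"
    by (rule linear_identity3[of x y y]) (simp_all add: vminus_def c)
  then show ?thesis using norm_scale[of "y \<ominus> x" "- 1"] c by simp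
qed

lemma norm_nonneg [simp]: "x \<in> carrier V \<Longrightarrow> 0 \<le> vnorm V x"
  using norm_triangle[of x "(- 1) \<odot> x"] norm_scale[of x "- 1"] add_minus[of x]
  by (simp add: vminus_def)

lemma norm_minus_le: "\<lbrakk>x \<in> carrier V; y \<in> carrier V\<rbrakk> \<Longrightarrow> vnorm V (x \<ominus> y) \<le> vnorm V x + vnorm V y"
  using norm_triangle[of x "(- 1) \<odot> y"] norm_scale[of y "- 1"] by (simp add: vminus_def)

lemma norm_minus_triangle: "\<lbrakk>x \<in> carrier V; y \<in> carrier V; z \<in> carrier V\<rbrakk> \<Longrightarrow>
    vnorm V (x \<ominus> z) \<le> vnorm V (x \<ominus> y) + vnorm V (y \<ominus> z)"
  using norm_triangle[of "x \<ominus> y" "y \<ominus> z"] by (simp add: minus_diff)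

lemma norm_le_minus: "\<lbrakk>x \<in> carrier V; y \<in> carrier V\<rbrakk> \<Longrightarrow> vnorm V x \<le> vnorm V (x \<ominus> y) + vnorm V y"
  using norm_triangle[of "x \<ominus> y" y] by (simp add: minus_add_cancel)

lemma Metric_space_norm: "Metric_space (carrier V) (norm_dist V)"
proof
  show "norm_dist V x y = norm_dist V y x" for x y
    by (simp add: norm_dist_def norm_minus_commute)
  show "(norm_dist V x y = 0) = (x = y)" if "x \<in> carrier V" "y \<in> carrier V" for x y
    using that minus_eq_zero by (auto simp: norm_dist_def norm_eq_zero)
qed (auto simp: norm_dist_def norm_minus_triangle)

lemma closedin_norm_iff:
  "closedin (norm_topology V) W \<longleftrightarrow> W \<subseteq> carrier V \<and>
     (\<forall>x \<in> carrier V. (\<forall>\<epsilon>>0. \<exists>y \<in> W. vnorm V (x \<ominus> y) < \<epsilon>) \<longrightarrow> x \<in> W)"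
proof -
  interpret M: Metric_space "carrier V" "norm_dist V" by (rule Metric_space_norm)
  show ?thesis
    unfolding norm_topology_def M.closedin_metric
    by (auto simp: disjnt_iff norm_dist_def M.mball_def) (metis subsetD)+
qed

lemma Cauchy_limit:
  fixes X :: "nat \<Rightarrow> 'a"
  assumes "\<And>n. X n \<in> carrier V"
    and "\<And>\<epsilon>. \<epsilon> > 0 \<Longrightarrow> \<exists>N. \<forall>m\<ge>N. \<forall>n\<ge>N. vnorm V (X m \<ominus> X n) < \<epsilon>"
  shows "\<exists>x \<in> carrier V. \<forall>\<epsilon>>0. \<exists>N. \<forall>n\<ge>N. vnorm V (X n \<ominus> x) < \<epsilon>"
proof -
  interpret M: Metric_space "carrier V" "norm_dist V" by (rule Metric_space_norm)
  have "M.MCauchy X"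
    using assms by (auto simp: M.MCauchy_def norm_dist_def image_subset_iff)
  then obtain x where "limitin M.mtopology X x sequentially"
    using complete by (auto simp: M.mcomplete_def)
  then have "x \<in> carrier V" "\<forall>\<epsilon>>0. \<exists>N. \<forall>n\<ge>N. vnorm V (X n \<ominus> x) < \<epsilon>"
    using assms(1) by (auto simp: M.limit_metric_sequentially norm_dist_def)
  then show ?thesis by blast
qed

text \<open>The distance of the restricted space is \<open>0\<close> outside \<open>W\<close>, so it
  is a different function from \<open>norm_dist V\<close>, and completeness has to be carried from
  one to the other. \<open>W\<close> is merely a closed set: the lemma also serves for the ball-like
  set in a fixpoint argument.\<close>

lemma mcomplete_closed:
  assumes "closedin (norm_topology V) W"
  shows "Metric_space.mcomplete W (norm_dist (V\<lparr>carrier := W\<rparr>))"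
proof -
  interpret M: Metric_space "carrier V" "norm_dist V" by (rule Metric_space_norm)
  have W: "W \<subseteq> carrier V" using assms by (simp add: closedin_norm_iff)
  have eq: "norm_dist (V\<lparr>carrier := W\<rparr>) x y = norm_dist V x y" if "x \<in> W" "y \<in> W" for x y
    using that W by (auto simp: norm_dist_def)
  have MW: "Metric_space W (norm_dist (V\<lparr>carrier := W\<rparr>))"
  proof
    show "norm_dist (V\<lparr>carrier := W\<rparr>) x y = norm_dist (V\<lparr>carrier := W\<rparr>) y x" for x y
      using W by (auto simp: norm_dist_def norm_minus_commute subset_iff)
    show "0 \<le> norm_dist (V\<lparr>carrier := W\<rparr>) x y" for x y
      using W by (auto simp: norm_dist_def subset_iff)
    show "norm_dist (V\<lparr>carrier := W\<rparr>) x y = 0 \<longleftrightarrow> x = y" if "x \<in> W" "y \<in> W" for x y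
      unfolding eq[OF that] using that W by (intro M.zero) auto
    show "norm_dist (V\<lparr>carrier := W\<rparr>) x z
        \<le> norm_dist (V\<lparr>carrier := W\<rparr>) x y + norm_dist (V\<lparr>carrier := W\<rparr>) y z"
      if "x \<in> W" "y \<in> W" "z \<in> W" for x y z
      unfolding eq[OF that(1,3)] eq[OF that(1,2)] eq[OF that(2,3)]
      using that W by (intro M.triangle) auto
  qed
  interpret SM: Submetric "carrier V" "norm_dist V" W
    using W by unfold_locales
  have c: "Metric_space.mcomplete W (norm_dist V)"
    using SM.closedin_mcomplete_imp_mcomplete assms complete by (simp add: norm_topology_def)
  interpret N': Metric_space W "norm_dist (V\<lparr>carrier := W\<rparr>)" by fact
  show ?thesis
    unfolding N'.mcomplete_def
  proof (intro allI impI)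
    fix \<sigma> assume \<sigma>: "N'.MCauchy \<sigma>"
    then have "SM.sub.MCauchy \<sigma>"
      by (auto simp: N'.MCauchy_def SM.sub.MCauchy_def image_subset_iff eq)
    then obtain x where x: "limitin SM.sub.mtopology \<sigma> x sequentially"
      using c by (auto simp: SM.sub.mcomplete_def)
    then have "limitin N'.mtopology \<sigma> x sequentially"
      unfolding SM.sub.limit_metric_sequentially N'.limit_metric_sequentially by (metis eq)
    then show "\<exists>x. limitin N'.mtopology \<sigma> x sequentially" by blast
  qed
qed

lemma banach_space_closed_subspace:
  assumes "lin_subspace V W" "closedin (norm_topology V) W"
  shows "banach_space (V\<lparr>carrier := W\<rparr>)"
proof -
  have W: "\<And>x. x \<in> W \<Longrightarrow> x \<in> carrier V" using assms(1) by (auto simp: lin_subspace_def)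
  show ?thesis
    using assms(1) mcomplete_closed[OF assms(2)]
    by unfold_locales
      (simp_all add: W lin_subspace_def add_assoc add_left_commute add_commute scale_add_left scale_add_right
        scale_scale norm_triangle norm_scale norm_eq_zero)
qed

end

section \<open>Norm estimates and square roots without a unit\<close>

context cstar_algebra
begin

declare mult_closed [simp] adj_closed [simp] adj_adj [simp]

lemma mult_minus_left: "\<lbrakk>x \<in> carrier A; y \<in> carrier A; z \<in> carrier A\<rbrakk> \<Longrightarrow> (x \<ominus> y) \<otimes> z = x \<otimes> z \<ominus> y \<otimes> z"
  by (simp add: vminus_def mult_add_left mult_scale_left)

lemma mult_minus_right: "\<lbrakk>x \<in> carrier A; y \<in> carrier A; z \<in> carrier A\<rbrakk> \<Longrightarrow> x \<otimes> (y \<ominus> z) = x \<otimes> y \<ominus> x \<otimes> z"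
  by (simp add: vminus_def mult_add_right mult_scale_right)

lemma mult_zero_left [simp]: "x \<in> carrier A \<Longrightarrow> \<zero> \<otimes> x = \<zero>"
  using mult_scale_left[of \<zero> x 0] by simp

lemma mult_zero_right [simp]: "x \<in> carrier A \<Longrightarrow> x \<otimes> \<zero> = \<zero>"
  using mult_scale_right[of x \<zero> 0] by simp

lemma adj_minus: "\<lbrakk>x \<in> carrier A; y \<in> carrier A\<rbrakk> \<Longrightarrow> adj A (x \<ominus> y) = adj A x \<ominus> adj A y"
  by (simp add: vminus_def adj_add adj_scale)

lemma adj_zero [simp]: "adj A \<zero> = \<zero>"
  using adj_scale[of \<zero> 0] by simp

lemma norm_adj [simp]: assumes "x \<in> carrier A" shows "vnorm A (adj A x) = vnorm A x"
proof -
  have le: "vnorm A x \<le> vnorm A (adj A x)" if "x \<in> carrier A" for x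
  proof (cases "vnorm A x = 0")
    case False
    then have "0 < vnorm A x" using norm_nonneg[OF that] by linarith
    moreover have "vnorm A x * vnorm A x \<le> vnorm A (adj A x) * vnorm A x"
      using norm_mult[of "adj A x" x] cstar_identity[OF that] that by (simp add: power2_eq_square)
    ultimately show ?thesis by simp
  qed (use that in simp)
  show ?thesis using le[OF assms] le[of "adj A x"] assms by simp
qed

lemma cstar_identity': "x \<in> carrier A \<Longrightarrow> vnorm A (x \<otimes> adj A x) = (vnorm A x)\<^sup>2"
  using cstar_identity[of "adj A x"] by simp

lemma norm_eqI_cstar:
  assumes "x \<in> carrier A" "vnorm A (adj A x \<otimes> x) \<le> r\<^sup>2" "0 \<le> r"
  shows "vnorm A x \<le> r"
  using power2_le_imp_le[OF _ assms(3)] assms(2) unfolding cstar_identity[OF assms(1)] by blast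

lemma cstar_algebra_subalgebra:
  assumes "cstar_subalgebra A M"
  shows "cstar_algebra (A\<lparr>carrier := M\<rparr>)"
proof -
  have M: "\<And>x. x \<in> M \<Longrightarrow> x \<in> carrier A"
    using assms by (auto simp: lin_subspace_def cstar_subalgebra_def)
  interpret B: banach_space "A\<lparr>carrier := M\<rparr>"
    using banach_space_closed_subspace assms by (simp add: cstar_subalgebra_def)
  show ?thesis
    using assms
    by unfold_locales
      (simp_all add: M cstar_subalgebra_def mult_assoc mult_add_left mult_add_right mult_scale_left
        mult_scale_right adj_add adj_scale adj_mult norm_mult cstar_identity)
qed

end

context cstar_algebra
begin

lemma eq_if_close:
  assumes "x \<in> carrier A" "y \<in> carrier A" "\<And>\<epsilon>. \<epsilon> > 0 \<Longrightarrow> vnorm A (x \<ominus> y) \<le> K * \<epsilon>"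
  shows "x = y"
proof -
  have "vnorm A (x \<ominus> y) \<le> 0 + \<delta>" if "\<delta> > 0" for \<delta>
  proof -
    have "vnorm A (x \<ominus> y) \<le> K * (\<delta> / (\<bar>K\<bar> + 1))" using that by (intro assms(3)) auto
    also have "\<dots> \<le> (\<bar>K\<bar> + 1) * (\<delta> / (\<bar>K\<bar> + 1))" using that by (intro mult_right_mono) auto
    finally show ?thesis by simp
  qed
  then have "vnorm A (x \<ominus> y) \<le> 0" by (rule field_le_epsilon)
  then have "vnorm A (x \<ominus> y) = 0" using assms by (intro antisym norm_nonneg minus_closed)
  then show ?thesis using assms minus_eq_zero by (simp add: norm_eq_zero)
qed

text \<open>Testing at \<open>y = adj A x\<close> and using the norm of
  \<open>x \<otimes> adj A x\<close> turns a bound for left multiplication into a bound for the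
  element. This is how operator estimates return to the algebra.\<close>

lemma norm_le_if_left_mult:
  assumes "x \<in> carrier A" "0 \<le> r" "\<And>y. y \<in> carrier A \<Longrightarrow> vnorm A (x \<otimes> y) \<le> r * vnorm A y"
  shows "vnorm A x \<le> r"
proof (cases "vnorm A x = 0")
  case False
  have "vnorm A x * vnorm A x \<le> r * vnorm A x"
    using assms(3)[of "adj A x"] assms(1) cstar_identity'[of x] by (simp add: power2_eq_square)
  then show ?thesis using False norm_nonneg[OF assms(1)] by simp
qed (use assms in simp)

text \<open>Symmetry with respect to the algebra-valued inner product
  \<open>adj A x \<otimes> y\<close>. Operators are used because \<open>1 - c\<close> makes sense
  for them even if the algebra has no unit.\<close>

definition self_adjoint_op :: "('a \<Rightarrow> 'a) \<Rightarrow> bool" where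
  "self_adjoint_op p \<longleftrightarrow> linear_map A A p \<and>
     (\<forall>x \<in> carrier A. \<forall>y \<in> carrier A. adj A (p x) \<otimes> y = adj A x \<otimes> p y)"

lemma self_adjoint_op_linear:
  assumes "self_adjoint_op p"
  shows "\<And>x. x \<in> carrier A \<Longrightarrow> p x \<in> carrier A"
    and "\<And>x y. \<lbrakk>x \<in> carrier A; y \<in> carrier A\<rbrakk> \<Longrightarrow> p (x \<oplus> y) = p x \<oplus> p y"
    and "\<And>c x. x \<in> carrier A \<Longrightarrow> p (c \<odot> x) = c \<odot> p x"
    and "\<And>x y. \<lbrakk>x \<in> carrier A; y \<in> carrier A\<rbrakk> \<Longrightarrow> p (x \<ominus> y) = p x \<ominus> p y"
    and "\<And>x y. \<lbrakk>x \<in> carrier A; y \<in> carrier A\<rbrakk> \<Longrightarrow> adj A (p x) \<otimes> y = adj A x \<otimes> p y"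
  using assms by (auto simp: self_adjoint_op_def linear_map_def vminus_def)

lemma self_adjoint_op_left_mult:
  "\<lbrakk>h \<in> carrier A; adj A h = h\<rbrakk> \<Longrightarrow> self_adjoint_op ((\<otimes>) h)"
  by (auto simp: self_adjoint_op_def linear_map_def mult_add_right mult_scale_right adj_mult mult_assoc)

text \<open>The reason is that \<open>(1 - c) \<plusminus> i p\<close> are unitary up to \<open>\<epsilon>\<close>.\<close>

lemma self_adjoint_op_contractive:
  assumes c: "self_adjoint_op c" and p: "self_adjoint_op p"
    and cp: "\<And>x. x \<in> carrier A \<Longrightarrow> c (p x) = p (c x)"
    and err: "\<And>x. x \<in> carrier A \<Longrightarrow>
      vnorm A ((c (c x) \<oplus> p (p x)) \<ominus> 2 \<odot> c x) \<le> \<epsilon> * vnorm A x"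
    and eps: "0 \<le> \<epsilon>" and x: "x \<in> carrier A"
  shows "vnorm A (x \<ominus> c x) \<le> sqrt (1 + \<epsilon>) * vnorm A x" "vnorm A (p x) \<le> sqrt (1 + \<epsilon>) * vnorm A x"
proof -
  note cl = self_adjoint_op_linear[OF c] and pl = self_adjoint_op_linear[OF p]
  define U where "U \<sigma> = (x \<ominus> c x) \<oplus> \<sigma> \<odot> p x" for \<sigma> :: complex
  let ?e = "(c (c x) \<oplus> p (p x)) \<ominus> 2 \<odot> c x"
  have mem: "U \<sigma> \<in> carrier A" "c x \<in> carrier A" "p x \<in> carrier A" "c (c x) \<in> carrier A"
    "p (c x) \<in> carrier A" "p (p x) \<in> carrier A" "?e \<in> carrier A" for \<sigma>
    using x cl(1) pl(1) by (auto simp: U_def)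
  have U: "vnorm A (U \<sigma>) \<le> sqrt (1 + \<epsilon>) * vnorm A x" if s: "cnj \<sigma> = - \<sigma>" "\<sigma> * \<sigma> = - 1" for \<sigma>
  proof (rule norm_eqI_cstar[OF mem(1)])
    have "adj A (U \<sigma>) \<otimes> U \<sigma> = adj A x \<otimes> ((U \<sigma> \<ominus> c (U \<sigma>)) \<oplus> (- \<sigma>) \<odot> p (U \<sigma>))"
    proof -
      have "adj A (U \<sigma>) \<otimes> y = adj A x \<otimes> ((y \<ominus> c y) \<oplus> (- \<sigma>) \<odot> p y)" if "y \<in> carrier A" for y
        using that x mem s cl(1,5) pl(1,5)
        by (simp add: U_def adj_add adj_minus adj_scale mult_add_left mult_minus_left mult_scale_left
            mult_add_right mult_minus_right mult_scale_right)
      then show ?thesis using mem by blast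
    qed
    \<comment> \<open>As \<open>c\<close> and \<open>p\<close> commute, the cross terms cancel and
      \<open>- \<sigma> * \<sigma> = 1\<close>. What remains is
      \<open>(1 - c)^2 + p^2 = 1 + (c^2 + p^2 - 2 c)\<close> applied to \<open>x\<close>.\<close>
    also have "(U \<sigma> \<ominus> c (U \<sigma>)) \<oplus> (- \<sigma>) \<odot> p (U \<sigma>) = x \<oplus> ?e"
    proof -
      have cU: "c (U \<sigma>) = (c x \<ominus> c (c x)) \<oplus> \<sigma> \<odot> p (c x)"
        using x mem by (simp add: U_def cl cp)
      have pU: "p (U \<sigma>) = (p x \<ominus> p (c x)) \<oplus> \<sigma> \<odot> p (p x)"
        using x mem by (simp add: U_def pl)
      show ?thesis
        unfolding cU pU unfolding U_def
        by (rule linear_identity6[of x "c x" "p x" "c (c x)" "p (c x)" "p (p x)"])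
          (simp_all add: mem x vminus_def algebra_simps s)
    qed
    finally have "vnorm A (adj A (U \<sigma>) \<otimes> U \<sigma>) \<le> vnorm A x * (vnorm A x + \<epsilon> * vnorm A x)"
      using x mem norm_mult[of "adj A x" "x \<oplus> ?e"] norm_triangle[of x ?e] err[OF x]
        mult_left_mono[of "vnorm A (x \<oplus> ?e)" "vnorm A x + \<epsilon> * vnorm A x" "vnorm A x"]
      by simp
    also have "\<dots> = (sqrt (1 + \<epsilon>) * vnorm A x)\<^sup>2"
      using eps by (simp add: power_mult_distrib) (simp add: power2_eq_square algebra_simps)
    finally show "vnorm A (adj A (U \<sigma>) \<otimes> U \<sigma>) \<le> (sqrt (1 + \<epsilon>) * vnorm A x)\<^sup>2" .
    show "0 \<le> sqrt (1 + \<epsilon>) * vnorm A x" using x eps by simp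
  qed
  have U1: "vnorm A (U \<i>) \<le> sqrt (1 + \<epsilon>) * vnorm A x" and U2: "vnorm A (U (- \<i>)) \<le> sqrt (1 + \<epsilon>) * vnorm A x"
    by (rule U; simp)+
  have "x \<ominus> c x = (1 / 2) \<odot> (U \<i> \<oplus> U (- \<i>))"
    unfolding U_def by (rule linear_identity3[of x "c x" "p x"]) (simp_all add: mem x vminus_def)
  then have "vnorm A (x \<ominus> c x) = (1 / 2) * vnorm A (U \<i> \<oplus> U (- \<i>))"
    using norm_scale[of "U \<i> \<oplus> U (- \<i>)" "1 / 2"] mem by simp
  then show "vnorm A (x \<ominus> c x) \<le> sqrt (1 + \<epsilon>) * vnorm A x"
    using norm_triangle[of "U \<i>" "U (- \<i>)"] mem U1 U2 by simp
  have "p x = (1 / (2 * \<i>)) \<odot> (U \<i> \<ominus> U (- \<i>))"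
    unfolding U_def
    by (rule linear_identity3[of x "c x" "p x"]) (simp_all add: mem x vminus_def divide_simps)
  then have "vnorm A (p x) = (1 / 2) * vnorm A (U \<i> \<ominus> U (- \<i>))"
    using norm_scale[of "U \<i> \<ominus> U (- \<i>)" "1 / (2 * \<i>)"] mem by (simp add: norm_divide)
  then show "vnorm A (p x) \<le> sqrt (1 + \<epsilon>) * vnorm A x"
    using norm_minus_le[of "U \<i>" "U (- \<i>)"] mem U1 U2 by simp
qed

text \<open>The equation says that \<open>1 - c\<close> is a square root of \<open>1 - h\<^sup>2\<close>.\<close>

lemma square_root_fixpoint:
  assumes h: "h \<in> carrier A" "adj A h = h" "vnorm A h < 1"
  obtains c where "c \<in> carrier A" "adj A c = c" "c \<otimes> h = h \<otimes> c" "c = (1 / 2) \<odot> (h \<otimes> h \<oplus> c \<otimes> c)"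
proof -
  define r where "r = vnorm A h"
  have r: "0 \<le> r" "r < 1" using h by (auto simp: r_def)
  \<comment> \<open>Self-adjointness and commutation with \<open>h\<close> are built into the closed
    set so that the fixpoint inherits them. The norm \<open>r\<close> of \<open>h\<close> is at once
    the radius of \<open>W\<close> and the contraction constant of \<open>f\<close>.\<close>
  define W where "W = {c \<in> carrier A. vnorm A c \<le> r \<and> adj A c = c \<and> c \<otimes> h = h \<otimes> c}"
  define f where "f c = (1 / 2) \<odot> (h \<otimes> h \<oplus> c \<otimes> c)" for c
  have W: "W \<subseteq> carrier A" by (auto simp: W_def)
  have "closedin (norm_topology A) W"
    unfolding closedin_norm_iff
  proof (intro conjI W ballI impI)
    fix x assume x: "x \<in> carrier A" and lim: "\<forall>\<epsilon>>0. \<exists>y \<in> W. vnorm A (x \<ominus> y) < \<epsilon>"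
    have "vnorm A x \<le> r + \<epsilon>" if e: "\<epsilon> > 0" for \<epsilon>
    proof -
      obtain y where y: "y \<in> W" "vnorm A (x \<ominus> y) < \<epsilon>" using lim e by blast
      then show ?thesis using norm_le_minus[of x y] x by (auto simp: W_def)
    qed
    then have 1: "vnorm A x \<le> r" by (rule field_le_epsilon)
    have 2: "adj A x = x"
    proof (rule eq_if_close[where K = 2])
      fix \<epsilon> :: real assume "\<epsilon> > 0"
      then obtain y where y: "y \<in> W" "vnorm A (x \<ominus> y) < \<epsilon>" using lim by blast
      then have yc: "y \<in> carrier A" "adj A y = y" by (auto simp: W_def)
      have "vnorm A (adj A x \<ominus> y) = vnorm A (x \<ominus> y)"
        using norm_adj[of "x \<ominus> y"] adj_minus[of x y] x yc by simp
      then show "vnorm A (adj A x \<ominus> x) \<le> 2 * \<epsilon>"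
        using norm_minus_triangle[of "adj A x" y x] norm_minus_commute[of y x] x yc y by simp
    qed (use x in auto)
    have 3: "x \<otimes> h = h \<otimes> x"
    proof (rule eq_if_close[where K = "2 * r"])
      fix \<epsilon> :: real assume "\<epsilon> > 0"
      then obtain y where y: "y \<in> W" "vnorm A (x \<ominus> y) < \<epsilon>" using lim by blast
      then have yc: "y \<in> carrier A" "y \<otimes> h = h \<otimes> y" by (auto simp: W_def)
      have "x \<otimes> h \<ominus> h \<otimes> x = (x \<ominus> y) \<otimes> h \<ominus> h \<otimes> (x \<ominus> y)"
        by (rule linear_identity3[of "x \<otimes> h" "h \<otimes> x" "h \<otimes> y"])
          (use x h yc in \<open>simp_all add: vminus_def mult_add_left mult_add_right mult_scale_left
            mult_scale_right\<close>)
      then have "vnorm A (x \<otimes> h \<ominus> h \<otimes> x) \<le> vnorm A (x \<ominus> y) * r + r * vnorm A (x \<ominus> y)"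
        using norm_minus_le[of "(x \<ominus> y) \<otimes> h" "h \<otimes> (x \<ominus> y)"] norm_mult[of "x \<ominus> y" h]
          norm_mult[of h "x \<ominus> y"] x h yc by (simp add: r_def mult.commute)
      also have "\<dots> \<le> 2 * r * \<epsilon>" using y r mult_left_mono[of "vnorm A (x \<ominus> y)" \<epsilon> r] by simp
      finally show "vnorm A (x \<otimes> h \<ominus> h \<otimes> x) \<le> 2 * r * \<epsilon>" .
    qed (use x h in auto)
    show "x \<in> W" using x 1 2 3 by (simp add: W_def)
  qed
  then have complete: "Metric_space.mcomplete W (norm_dist (A\<lparr>carrier := W\<rparr>))"
    by (rule mcomplete_closed)
  have fW: "f c \<in> W" if "c \<in> W" for c
  proof -
    have c: "c \<in> carrier A" "vnorm A c \<le> r" "adj A c = c" "c \<otimes> h = h \<otimes> c"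
      using that by (auto simp: W_def)
    have "vnorm A (h \<otimes> h \<oplus> c \<otimes> c) \<le> r * r + r * r"
      using norm_triangle[of "h \<otimes> h" "c \<otimes> c"] norm_mult[of h h] norm_mult[of c c] h(1) c(1,2) r
        mult_mono[of "vnorm A c" r "vnorm A c" r] by (simp add: r_def)
    also have "\<dots> \<le> 2 * r" using r mult_left_mono[of r 1 r] by simp
    finally have "vnorm A (f c) \<le> r"
      using norm_scale[of "h \<otimes> h \<oplus> c \<otimes> c" "1 / 2"] h(1) c(1) by (simp add: f_def)
    moreover have "adj A (f c) = f c"
      using h c by (simp add: f_def adj_scale adj_add adj_mult)
    moreover have "c \<otimes> c \<otimes> h = h \<otimes> (c \<otimes> c)"
      using h c by (metis mult_assoc)
    then have "f c \<otimes> h = h \<otimes> f c"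
      using h c
      by (simp add: f_def mult_scale_left mult_scale_right mult_add_left mult_add_right mult_assoc)
    ultimately show ?thesis using h c by (simp add: W_def f_def)
  qed
  have zero: "\<zero> \<in> W" using r h by (simp add: W_def)
  interpret M: Metric_space "carrier A" "norm_dist A" by (rule Metric_space_norm)
  have eq: "norm_dist (A\<lparr>carrier := W\<rparr>) x y = vnorm A (x \<ominus> y)" if "x \<in> W" "y \<in> W" for x y
    using that by (simp add: norm_dist_def)
  interpret W: Metric_space W "norm_dist (A\<lparr>carrier := W\<rparr>)"
  proof
    show "0 \<le> norm_dist (A\<lparr>carrier := W\<rparr>) x y" for x y
      using W by (auto simp: norm_dist_def subset_iff)
    show "norm_dist (A\<lparr>carrier := W\<rparr>) x y = norm_dist (A\<lparr>carrier := W\<rparr>) y x" for x y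
      using W by (auto simp: norm_dist_def norm_minus_commute subset_iff)
    show "norm_dist (A\<lparr>carrier := W\<rparr>) x y = 0 \<longleftrightarrow> x = y" if "x \<in> W" "y \<in> W" for x y
      using that W minus_eq_zero[of x y] by (auto simp: eq norm_eq_zero subset_iff)
    show "norm_dist (A\<lparr>carrier := W\<rparr>) x z
        \<le> norm_dist (A\<lparr>carrier := W\<rparr>) x y + norm_dist (A\<lparr>carrier := W\<rparr>) y z"
      if "x \<in> W" "y \<in> W" "z \<in> W" for x y z
      using that W by (auto simp: eq intro!: norm_minus_triangle)
  qed
  have "norm_dist (A\<lparr>carrier := W\<rparr>) (f c) (f d) \<le> r * norm_dist (A\<lparr>carrier := W\<rparr>) c d"
    if cd: "c \<in> W" "d \<in> W" for c d
  proof -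
    have c: "c \<in> carrier A" "d \<in> carrier A" "vnorm A c \<le> r" "vnorm A d \<le> r"
      using cd by (auto simp: W_def)
    \<comment> \<open>\<open>c\<close> and \<open>d\<close> need not commute, so the difference of
      squares is split as \<open>c (c - d) + (c - d) d\<close>; each summand contributes a factor
      \<open>r\<close>, and the \<open>1 / 2\<close> compensates for having two of them.\<close>
    have "f c \<ominus> f d = (1 / 2) \<odot> (c \<otimes> (c \<ominus> d) \<oplus> (c \<ominus> d) \<otimes> d)"
      unfolding f_def
      by (rule linear_identity4[of "h \<otimes> h" "c \<otimes> c" "d \<otimes> d" "c \<otimes> d"])
        (use h c in \<open>simp_all add: vminus_def mult_add_left mult_add_right mult_scale_left
          mult_scale_right\<close>)
    then have "vnorm A (f c \<ominus> f d) = (1 / 2) * vnorm A (c \<otimes> (c \<ominus> d) \<oplus> (c \<ominus> d) \<otimes> d)"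
      using norm_scale[of "c \<otimes> (c \<ominus> d) \<oplus> (c \<ominus> d) \<otimes> d" "1 / 2"] c by simp
    also have "\<dots> \<le> (1 / 2) * (vnorm A c * vnorm A (c \<ominus> d) + vnorm A (c \<ominus> d) * vnorm A d)"
      using norm_triangle[of "c \<otimes> (c \<ominus> d)" "(c \<ominus> d) \<otimes> d"] norm_mult[of c "c \<ominus> d"]
        norm_mult[of "c \<ominus> d" d] c by simp
    also have "\<dots> \<le> r * vnorm A (c \<ominus> d)"
      using mult_right_mono[OF c(3), of "vnorm A (c \<ominus> d)"] mult_left_mono[OF c(4), of "vnorm A (c \<ominus> d)"] c
      by (simp add: algebra_simps)
    finally show ?thesis using cd fW by (simp add: eq)
  qed
  then obtain c where "c \<in> W" "f c = c"
    using zero fW by (auto intro: W.Banach_fixedpoint_thm[OF complete _ _ r(2), of f])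
  then show ?thesis using that[of c] by (simp add: W_def f_def)
qed

end

lemma star_homD:
  assumes "star_hom A B f"
  shows "\<And>x. x \<in> carrier A \<Longrightarrow> f x \<in> carrier B"
    and "\<And>x y. \<lbrakk>x \<in> carrier A; y \<in> carrier A\<rbrakk> \<Longrightarrow> f (x \<oplus>\<^bsub>A\<^esub> y) = f x \<oplus>\<^bsub>B\<^esub> f y"
    and "\<And>c x. x \<in> carrier A \<Longrightarrow> f (c \<odot>\<^bsub>A\<^esub> x) = c \<odot>\<^bsub>B\<^esub> f x"
    and "\<And>x y. \<lbrakk>x \<in> carrier A; y \<in> carrier A\<rbrakk> \<Longrightarrow> f (x \<otimes>\<^bsub>A\<^esub> y) = f x \<otimes>\<^bsub>B\<^esub> f y"
    and "\<And>x. x \<in> carrier A \<Longrightarrow> f (adj A x) = adj B (f x)"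
  using assms by (auto simp: star_hom_def linear_map_def)

text \<open>For \<open>h = h\<^sup>*\<close> with \<open>\<parallel>h\<parallel> < 1\<close> the square root of \<open>1 - h\<^sup>2\<close> is mapped to a square root of
  \<open>1 - f(h)\<^sup>2\<close>, so that \<open>f(h)\<close> is the imaginary part of a unitary.\<close>

theorem star_hom_contractive:
  assumes "cstar_algebra A" "cstar_algebra B" and f: "star_hom A B f" and x: "x \<in> carrier A"
  shows "vnorm B (f x) \<le> vnorm A x"
proof -
  interpret A: cstar_algebra A by fact
  interpret B: cstar_algebra B by fact
  note fD = star_homD[OF f]
  have one: "vnorm B (f h) \<le> 1" if h: "h \<in> carrier A" "adj A h = h" "vnorm A h < 1" for h
  proof -
    obtain c where c: "c \<in> carrier A" "adj A c = c" "c \<otimes>\<^bsub>A\<^esub> h = h \<otimes>\<^bsub>A\<^esub> c"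
      "c = (1 / 2) \<odot>\<^bsub>A\<^esub> (h \<otimes>\<^bsub>A\<^esub> h \<oplus>\<^bsub>A\<^esub> c \<otimes>\<^bsub>A\<^esub> c)"
      using A.square_root_fixpoint[OF h] by blast
    let ?c = "f c" and ?h = "f h"
    have m: "?c \<in> carrier B" "?h \<in> carrier B" "adj B ?c = ?c" "adj B ?h = ?h"
      using h c fD by (simp_all flip: fD(5))
    have ch: "?c \<otimes>\<^bsub>B\<^esub> ?h = ?h \<otimes>\<^bsub>B\<^esub> ?c"
      using c h by (simp flip: fD(4))
    have cc: "?c = (1 / 2) \<odot>\<^bsub>B\<^esub> (?h \<otimes>\<^bsub>B\<^esub> ?h \<oplus>\<^bsub>B\<^esub> ?c \<otimes>\<^bsub>B\<^esub> ?c)"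
      using arg_cong[OF c(4), of f] c(1) h(1) by (simp add: fD)
    \<comment> \<open>The fixpoint equation makes the error term of
      \<open>self_adjoint_op_contractive\<close> vanish; \<open>sqrt (1 + 0)\<close> is its bound at
      \<open>\<epsilon> = 0\<close>.\<close>
    have "vnorm B (?h \<otimes>\<^bsub>B\<^esub> y) \<le> sqrt (1 + 0) * vnorm B y" if "y \<in> carrier B" for y
    proof (rule B.self_adjoint_op_contractive(2)[OF _ _ _ _ _ that])
      show "B.self_adjoint_op ((\<otimes>\<^bsub>B\<^esub>) ?c)" "B.self_adjoint_op ((\<otimes>\<^bsub>B\<^esub>) ?h)"
        using m by (auto intro: B.self_adjoint_op_left_mult)
      show "?c \<otimes>\<^bsub>B\<^esub> (?h \<otimes>\<^bsub>B\<^esub> y) = ?h \<otimes>\<^bsub>B\<^esub> (?c \<otimes>\<^bsub>B\<^esub> y)" if "y \<in> carrier B" for y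
        using m that ch by (metis B.mult_assoc)
      fix y assume y: "y \<in> carrier B"
      have "2 \<odot>\<^bsub>B\<^esub> (?c \<otimes>\<^bsub>B\<^esub> y) = (2 \<odot>\<^bsub>B\<^esub> ?c) \<otimes>\<^bsub>B\<^esub> y"
        using m y by (simp add: B.mult_scale_left)
      also have "2 \<odot>\<^bsub>B\<^esub> ?c = 2 \<odot>\<^bsub>B\<^esub> ((1 / 2) \<odot>\<^bsub>B\<^esub> (?h \<otimes>\<^bsub>B\<^esub> ?h \<oplus>\<^bsub>B\<^esub> ?c \<otimes>\<^bsub>B\<^esub> ?c))"
        by (rule arg_cong[OF cc])
      also have "\<dots> = ?h \<otimes>\<^bsub>B\<^esub> ?h \<oplus>\<^bsub>B\<^esub> ?c \<otimes>\<^bsub>B\<^esub> ?c"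
        using m by (simp add: B.scale_scale)
      also have "(?h \<otimes>\<^bsub>B\<^esub> ?h \<oplus>\<^bsub>B\<^esub> ?c \<otimes>\<^bsub>B\<^esub> ?c) \<otimes>\<^bsub>B\<^esub> y
          = ?c \<otimes>\<^bsub>B\<^esub> (?c \<otimes>\<^bsub>B\<^esub> y) \<oplus>\<^bsub>B\<^esub> ?h \<otimes>\<^bsub>B\<^esub> (?h \<otimes>\<^bsub>B\<^esub> y)"
        using m y by (simp add: B.mult_add_left B.mult_assoc B.add_commute)
      finally show "vnorm B ((?c \<otimes>\<^bsub>B\<^esub> (?c \<otimes>\<^bsub>B\<^esub> y) \<oplus>\<^bsub>B\<^esub> ?h \<otimes>\<^bsub>B\<^esub> (?h \<otimes>\<^bsub>B\<^esub> y)) \<ominus>\<^bsub>B\<^esub> 2 \<odot>\<^bsub>B\<^esub> (?c \<otimes>\<^bsub>B\<^esub> y))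
          \<le> 0 * vnorm B y"
        using m y by simp
    qed simp
    then show ?thesis using m by (auto intro: B.norm_le_if_left_mult[of "f h" 1])
  qed
  have sa: "vnorm B (f h) \<le> vnorm A h" if h: "h \<in> carrier A" "adj A h = h" for h
  proof (rule field_le_epsilon)
    fix e :: real assume e: "e > 0"
    define t where "t = vnorm A h + e"
    have t: "t > 0" "vnorm A h < t" using e A.norm_nonneg[OF h(1)] by (simp_all add: t_def del: A.norm_nonneg)
    let ?h = "complex_of_real (1 / t) \<odot>\<^bsub>A\<^esub> h"
    have "vnorm B (f ?h) \<le> 1"
    proof (rule one)
      show "vnorm A ?h < 1" using t h by (simp add: A.norm_scale norm_divide)
    qed (use h in \<open>auto simp: A.adj_scale\<close>)
    moreover have "vnorm B (f ?h) = (1 / t) * vnorm B (f h)"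
      using t h fD B.norm_scale[of "f h" "complex_of_real (1 / t)"] by (simp add: norm_divide)
    ultimately have "(1 / t) * vnorm B (f h) \<le> 1" by simp
    then show "vnorm B (f h) \<le> vnorm A h + e" using t by (simp add: divide_simps flip: t_def)
  qed
  have "vnorm B (f (adj A x \<otimes>\<^bsub>A\<^esub> x)) \<le> (vnorm A x)\<^sup>2"
    using sa[of "adj A x \<otimes>\<^bsub>A\<^esub> x"] x A.cstar_identity[OF x] by (simp add: A.adj_mult)
  then show ?thesis using x by (intro B.norm_eqI_cstar[of "f x"]) (simp_all add: fD)
qed

context cstar_algebra
begin

text \<open>The iterates \<open>c\<^sub>n\<close> approximate \<open>1 - (1 - r\<^sup>2 p\<^sup>2)\<^sup>1\<^sup>/\<^sup>2\<close>.\<close>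

lemma self_adjoint_op_square_strict:
  assumes p: "self_adjoint_op p" and le: "\<And>x. x \<in> carrier A \<Longrightarrow> vnorm A (p x) \<le> r * vnorm A x"
    and r: "0 \<le> r" "r < 1" and x: "x \<in> carrier A"
  shows "vnorm A (x \<ominus> p (p x)) \<le> vnorm A x"
proof -
  note pl = self_adjoint_op_linear[OF p]
  \<comment> \<open>\<open>p\<close> is an operator and need not come from an element, so no
    fixpoint in the complete space \<open>carrier A\<close> is at hand. Finite stages of the same
    iteration, with a geometric error, take its place.\<close>
  define c where "c n = ((\<lambda>f x. (1 / 2) \<odot> (p (p x) \<oplus> f (f x))) ^^ n) (\<lambda>x. \<zero>)" for n
  have c0: "c 0 x = \<zero>" and cS: "c (Suc n) x = (1 / 2) \<odot> (p (p x) \<oplus> c n (c n x))" for n x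
    by (simp_all add: c_def)
  have c: "self_adjoint_op (c n) \<and> (\<forall>x \<in> carrier A. c n (p x) = p (c n x) \<and> vnorm A (c n x) \<le> r * vnorm A x)" for n
  proof (induction n)
    case 0
    then show ?case
      using pl(3)[of \<zero> 0] pl(1)[of \<zero>] r by (simp add: c0 self_adjoint_op_def linear_map_def)
  next
    case (Suc n)
    note cl = self_adjoint_op_linear[OF conjunct1[OF Suc]]
    have sa: "self_adjoint_op (c (Suc n))"
      unfolding self_adjoint_op_def linear_map_def
      by (auto simp: cS pl cl scale_add_right add_assoc add_left_commute scale_scale mult.commute
          adj_scale adj_add mult_scale_left mult_add_left mult_scale_right mult_add_right)
    have "c (Suc n) (p x) = p (c (Suc n) x)" if "x \<in> carrier A" for x
      using that Suc by (simp add: cS pl cl)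
    moreover have "vnorm A (c (Suc n) x) \<le> r * vnorm A x" if "x \<in> carrier A" for x
    proof -
      have "vnorm A (p (p x) \<oplus> c n (c n x)) \<le> r * (r * vnorm A x) + r * (r * vnorm A x)"
        using norm_triangle[of "p (p x)" "c n (c n x)"] le[of "p x"] le[of x] Suc that pl(1) cl(1) r
          mult_left_mono[of "vnorm A (p x)" "r * vnorm A x" r]
          mult_left_mono[of "vnorm A (c n x)" "r * vnorm A x" r]
        by (smt (verit, best))
      also have "\<dots> \<le> 2 * (r * vnorm A x)"
        using r mult_left_mono[of r 1 "r * vnorm A x"] that by (simp add: algebra_simps)
      finally show ?thesis
        using norm_scale[of "p (p x) \<oplus> c n (c n x)" "1 / 2"] that pl(1) cl(1) by (simp add: cS)
    qed
    ultimately show ?case using sa by blast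
  qed
  note cl = self_adjoint_op_linear[OF conjunct1[OF c]]
  have cle: "vnorm A (c n x) \<le> r * vnorm A x" and cp: "c n (p x) = p (c n x)" if "x \<in> carrier A" for n x
    using c that by blast+
  have diff: "vnorm A (c (Suc n) x \<ominus> c n x) \<le> r ^ Suc n * vnorm A x" if "x \<in> carrier A" for n x
    using that
  proof (induction n arbitrary: x)
    case 0
    then show ?case using cle[of x 1] cl(1) by (simp add: c0)
  next
    case (Suc n)
    let ?a = "c (Suc n)" and ?b = "c n"
    have m: "?a x \<in> carrier A" "?b x \<in> carrier A" "?a (?b x) \<in> carrier A" "?a (?a x) \<in> carrier A"
      "?b (?b x) \<in> carrier A" "p (p x) \<in> carrier A"
      using Suc cl(1) pl(1) by auto
    let ?s = "?a (?a x \<ominus> ?b x) \<oplus> (?a (?b x) \<ominus> ?b (?b x))"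
    have "c (Suc (Suc n)) x \<ominus> ?a x
        = (1 / 2) \<odot> (p (p x) \<oplus> ?a (?a x)) \<ominus> (1 / 2) \<odot> (p (p x) \<oplus> ?b (?b x))"
      by (rule arg_cong2[where f = "vminus A", OF cS cS])
    also have "\<dots> = (1 / 2) \<odot> ?s"
      unfolding cl(4)[OF m(1,2)]
      by (rule linear_identity4[of "p (p x)" "?a (?a x)" "?b (?b x)" "?a (?b x)"])
        (use m in \<open>simp_all add: vminus_def\<close>)
    finally have e: "c (Suc (Suc n)) x \<ominus> ?a x = (1 / 2) \<odot> ?s" .
    have "vnorm A ?s \<le> r * (r ^ Suc n * vnorm A x) + r ^ Suc n * (r * vnorm A x)"
    proof -
      have "vnorm A (?a (?a x \<ominus> ?b x)) \<le> r * vnorm A (?a x \<ominus> ?b x)" using m by (intro cle) simp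
      also have "\<dots> \<le> r * (r ^ Suc n * vnorm A x)"
        using Suc.IH[OF Suc.prems] r(1) by (rule mult_left_mono)
      finally have 1: "vnorm A (?a (?a x \<ominus> ?b x)) \<le> r * (r ^ Suc n * vnorm A x)" .
      have "vnorm A (?a (?b x) \<ominus> ?b (?b x)) \<le> r ^ Suc n * vnorm A (?b x)" using m by (intro Suc.IH)
      also have "\<dots> \<le> r ^ Suc n * (r * vnorm A x)"
        using cle[OF Suc.prems] r(1) by (intro mult_left_mono) auto
      finally have 2: "vnorm A (?a (?b x) \<ominus> ?b (?b x)) \<le> r ^ Suc n * (r * vnorm A x)" .
      show ?thesis
        using m cl(1) by (intro order_trans[OF norm_triangle add_mono[OF 1 2]]) simp_all
    qed
    then show ?case
      unfolding e using norm_scale[of ?s "1 / 2"] m cl(1) by (simp add: algebra_simps)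
  qed
  \<comment> \<open>The error \<open>c^2 + p^2 - 2 c\<close> at stage \<open>n\<close> is twice the
    difference of consecutive iterates, hence at most \<open>?\<epsilon>\<close>. Since
    \<open>1 - p^2\<close> is \<open>(1 - c)^2\<close> minus this error, its norm is at most
    \<open>sqrt (1 + ?\<epsilon>)\<close> squared plus \<open>?\<epsilon>\<close>.\<close>
  have bound: "vnorm A (x \<ominus> p (p x)) \<le> (1 + 2 * (2 * r ^ Suc n)) * vnorm A x" for n
  proof -
    let ?\<epsilon> = "2 * r ^ Suc n"
    let ?err = "\<lambda>x. (c n (c n x) \<oplus> p (p x)) \<ominus> 2 \<odot> c n x"
    have err: "?err y = 2 \<odot> (c (Suc n) y \<ominus> c n y)" if "y \<in> carrier A" for y
      unfolding cS
      by (rule linear_identity3[of "c n (c n y)" "p (p y)" "c n y"])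
        (use that cl(1) pl(1) in \<open>simp_all add: vminus_def\<close>)
    have err': "vnorm A (?err y) \<le> ?\<epsilon> * vnorm A y" if "y \<in> carrier A" for y
      unfolding err[OF that]
      using that diff[of y n] norm_scale[of "c (Suc n) y \<ominus> c n y" 2] cl(1) by simp
    have eps: "0 \<le> ?\<epsilon>" using r by simp
    have contr: "vnorm A (y \<ominus> c n y) \<le> sqrt (1 + ?\<epsilon>) * vnorm A y" if "y \<in> carrier A" for y
      by (rule self_adjoint_op_contractive(1)[OF conjunct1[OF c] p cp err' eps that])
    let ?y = "x \<ominus> c n x"
    have y: "?y \<in> carrier A" using x cl(1) by simp
    have "vnorm A (?y \<ominus> c n ?y) \<le> sqrt (1 + ?\<epsilon>) * (sqrt (1 + ?\<epsilon>) * vnorm A x)"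
      using contr[OF y] mult_left_mono[OF contr[OF x], of "sqrt (1 + ?\<epsilon>)"] eps
      by (smt (verit, best) real_sqrt_ge_zero)
    then have 1: "vnorm A (?y \<ominus> c n ?y) \<le> (1 + ?\<epsilon>) * vnorm A x"
      using eps by (simp add: mult.assoc[symmetric] del: power_Suc)
    have "x \<ominus> p (p x) = (?y \<ominus> c n ?y) \<ominus> ?err x"
      unfolding cl(4)[OF x cl(1)[OF x]]
      by (rule linear_identity4[of x "c n x" "c n (c n x)" "p (p x)"])
        (use x cl(1) pl(1) in \<open>simp_all add: vminus_def\<close>)
    then have "vnorm A (x \<ominus> p (p x)) \<le> (1 + ?\<epsilon>) * vnorm A x + ?\<epsilon> * vnorm A x"
      using norm_minus_le[of "?y \<ominus> c n ?y" "?err x"] 1 err'[OF x] y x cl(1) pl(1) by simp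
    then show ?thesis by (simp add: algebra_simps)
  qed
  have "(\<lambda>n. r ^ n) \<longlonglongrightarrow> 0" using r by (intro LIMSEQ_realpow_zero) auto
  from LIMSEQ_Suc[OF this] have "(\<lambda>n. (1 + 2 * (2 * r ^ Suc n)) * vnorm A x) \<longlonglongrightarrow> (1 + 2 * (2 * 0)) * vnorm A x"
    by (intro tendsto_intros)
  then have "vnorm A (x \<ominus> p (p x)) \<le> (1 + 2 * (2 * 0)) * vnorm A x"
    by (rule LIMSEQ_le_const) (use bound in auto)
  then show ?thesis by simp
qed

text \<open>The iteration converges only for operators of bound \<open>r < 1\<close>, so
  \<open>p\<close> is scaled by such an \<open>r\<close>, and \<open>r\<close> then tends to
  \<open>1\<close>.\<close>

lemma self_adjoint_op_square:
  assumes p: "self_adjoint_op p" and le: "\<And>x. x \<in> carrier A \<Longrightarrow> vnorm A (p x) \<le> vnorm A x"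
    and x: "x \<in> carrier A"
  shows "vnorm A (x \<ominus> p (p x)) \<le> vnorm A x"
proof -
  note pl = self_adjoint_op_linear[OF p]
  have bound: "vnorm A (x \<ominus> p (p x)) \<le> vnorm A x + (1 - r * r) * vnorm A x" if r: "0 < r" "r < 1" for r
  proof -
    define q where "q x = complex_of_real r \<odot> p x" for x
    have q: "self_adjoint_op q"
      unfolding self_adjoint_op_def linear_map_def
      by (auto simp: q_def pl scale_add_right scale_scale mult.commute adj_scale mult_scale_left
          mult_scale_right)
    have "vnorm A (q y) \<le> r * vnorm A y" if "y \<in> carrier A" for y
      using that r le[OF that] pl(1) by (simp add: q_def norm_scale)
    then have 1: "vnorm A (x \<ominus> q (q x)) \<le> vnorm A x"
      using self_adjoint_op_square_strict[OF q, of r x] r x by simp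
    have "x \<ominus> p (p x) = (x \<ominus> q (q x)) \<oplus> complex_of_real (r * r - 1) \<odot> p (p x)"
      unfolding q_def pl(3)[OF pl(1)[OF x]]
      by (rule linear_identity3[of x "p (p x)" \<zero>])
        (use x pl(1) in \<open>simp_all add: vminus_def algebra_simps\<close>)
    then have "vnorm A (x \<ominus> p (p x)) \<le> vnorm A x + \<bar>r * r - 1\<bar> * vnorm A (p (p x))"
      using norm_triangle[of "x \<ominus> q (q x)" "complex_of_real (r * r - 1) \<odot> p (p x)"] 1 x pl(1)
        norm_scale[of "p (p x)" "complex_of_real (r * r - 1)"] self_adjoint_op_linear(1)[OF q]
      by (simp del: of_real_diff of_real_mult)
    also have "\<bar>r * r - 1\<bar> = 1 - r * r" using r mult_mono[of r 1 r 1] by simp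
    also have "vnorm A x + (1 - r * r) * vnorm A (p (p x)) \<le> vnorm A x + (1 - r * r) * vnorm A x"
      using le[of x] le[of "p x"] x pl(1) r mult_mono[of r 1 r 1] by (simp add: mult_left_mono)
    finally show ?thesis .
  qed
  \<comment> \<open>The shift by two keeps every \<open>s n\<close> strictly between
    \<open>0\<close> and \<open>1\<close>.\<close>
  define s where "s n = 1 - 1 / real (Suc (Suc n))" for n
  have "s \<longlonglongrightarrow> 1 - 0"
    unfolding s_def by (intro tendsto_diff tendsto_const LIMSEQ_Suc[OF LIMSEQ_inverse_real_of_nat[unfolded inverse_eq_divide]])
  then have "(\<lambda>n. vnorm A x + (1 - s n * s n) * vnorm A x) \<longlonglongrightarrow> vnorm A x + (1 - (1 - 0) * (1 - 0)) * vnorm A x"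
    by (intro tendsto_intros)
  then have "vnorm A (x \<ominus> p (p x)) \<le> vnorm A x + (1 - (1 - 0) * (1 - 0)) * vnorm A x"
    by (rule LIMSEQ_le_const) (use bound in \<open>auto simp: s_def\<close>)
  then show ?thesis by simp
qed

end

lemma lin_subspaceD:
  assumes "lin_subspace V W"
  shows "x \<in> W \<Longrightarrow> x \<in> carrier V" "\<zero>\<^bsub>V\<^esub> \<in> W" "\<lbrakk>x \<in> W; y \<in> W\<rbrakk> \<Longrightarrow> x \<oplus>\<^bsub>V\<^esub> y \<in> W"
    "x \<in> W \<Longrightarrow> c \<odot>\<^bsub>V\<^esub> x \<in> W" "\<lbrakk>x \<in> W; y \<in> W\<rbrakk> \<Longrightarrow> x \<ominus>\<^bsub>V\<^esub> y \<in> W"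
  using assms by (auto simp: lin_subspace_def vminus_def)

section \<open>Approximate units from Cesaro means\<close>

context cstar_algebra
begin

lemmas expand = vminus_def adj_add adj_scale adj_mult mult_add_left mult_add_right mult_scale_left
  mult_scale_right mult_assoc scale_add_right

text \<open>\<open>w\<close> lies in the smallest right ideal containing \<open>x\<close>. Adjoints
  are deliberately absent: the notion is applied to closed ideals before they are known to be
  self-adjoint.\<close>

definition in_right_ideal_of :: "'a \<Rightarrow> 'a \<Rightarrow> bool" where
  "in_right_ideal_of x w \<longleftrightarrow>
     (\<forall>J. lin_subspace A J \<and> x \<in> J \<and> (\<forall>j \<in> J. \<forall>b \<in> carrier A. j \<otimes> b \<in> J) \<longrightarrow> w \<in> J)"

text \<open>With \<open>T = 1 - k\<^sup>2\<close> one has \<open>T\<^sup>j = 1 - m\<^sub>j\<close>, and the Cesaro means \<open>z\<^sub>n\<close> of the powers of \<open>T\<close> satisfy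
  \<open>k\<^sup>2 z\<^sub>n = m\<^sub>n / n\<close>.\<close>

lemma left_approximation_self_adjoint:
  assumes k: "k \<in> carrier A" "adj A k = k" "vnorm A k \<le> 1" and n: "n > 0"
  obtains w where "w \<in> carrier A" "adj A w = w" "\<And>y. y \<in> carrier A \<Longrightarrow> vnorm A (y \<ominus> w \<otimes> y) \<le> vnorm A y"
    "(vnorm A (k \<ominus> w \<otimes> k))\<^sup>2 \<le> 2 / real n" "in_right_ideal_of k w"
proof -
  have kk: "k \<otimes> k \<in> carrier A" using k by simp
  have T: "vnorm A (y \<ominus> k \<otimes> (k \<otimes> y)) \<le> vnorm A y" if "y \<in> carrier A" for y
  proof (rule self_adjoint_op_square[OF self_adjoint_op_left_mult[OF k(1,2)] _ that])
    show "vnorm A (k \<otimes> x) \<le> vnorm A x" if "x \<in> carrier A" for x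
      using norm_mult[OF k(1) that] mult_right_mono[OF k(3), of "vnorm A x"] that by simp
  qed
  \<comment> \<open>The recursion is \<open>1 - m (j + 1) = (1 - k^2) (1 - m j)\<close> multiplied
    out, since \<open>1\<close> is not an element.\<close>
  define m where "m j = ((\<lambda>x. x \<oplus> k \<otimes> (k \<ominus> k \<otimes> x)) ^^ j) \<zero>" for j
  have m0: "m 0 = \<zero>" and mS: "m (Suc j) = m j \<oplus> k \<otimes> (k \<ominus> k \<otimes> m j)" for j
    by (simp_all add: m_def)
  have mc: "m j \<in> carrier A" for j using k by (induction j) (auto simp: m0 mS)
  have mk: "m j \<otimes> k = k \<otimes> m j" for j
  proof (induction j)
    case (Suc j)
    have "k \<otimes> m j \<otimes> k = k \<otimes> (k \<otimes> m j)" using Suc k mc[of j] by (simp add: mult_assoc)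
    then show ?case
      using k mc[of j] Suc
      by (simp add: mS mult_add_left mult_add_right mult_minus_left mult_minus_right mult_assoc)
  qed (use k in \<open>simp add: m0\<close>)
  have ma: "adj A (m j) = m j" for j
  proof (induction j)
    case (Suc j)
    have "m j \<otimes> (k \<otimes> k) = k \<otimes> (k \<otimes> m j)"
      using mk[of j] mc[of j] k(1) by (metis mult_assoc)
    then show ?case
      using k mc[of j] Suc
      by (simp add: mS adj_add adj_mult adj_minus mult_minus_left mult_minus_right mult_assoc)
  qed (simp add: m0)
  have mT: "vnorm A (y \<ominus> m j \<otimes> y) \<le> vnorm A y" if "y \<in> carrier A" for y j
  proof (induction j)
    case (Suc j)
    let ?y = "y \<ominus> m j \<otimes> y"
    have "y \<ominus> m (Suc j) \<otimes> y = ?y \<ominus> k \<otimes> (k \<otimes> ?y)"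
      using k mc[of j] that
      by (simp add: expand mS) (rule linear_identity4[of y "m j \<otimes> y" "k \<otimes> (k \<otimes> y)" "k \<otimes> (k \<otimes> (m j \<otimes> y))"], simp_all)
    then show ?case using T[of ?y] Suc that mc[of j] by simp
  qed (use that in \<open>simp add: m0\<close>)
  \<comment> \<open>The pair carries the counter that selects the next summand; the second component
    is the sum of the \<open>m i\<close> with \<open>i < j\<close>.\<close>
  define s where "s j = ((\<lambda>(i, x). (Suc i, x \<oplus> m i)) ^^ j) (0, \<zero>)" for j
  have s: "fst (s j) = j" "snd (s 0) = \<zero>" "snd (s (Suc j)) = snd (s j) \<oplus> m j" for j
  proof -
    show fs: "fst (s j) = j" for j by (induction j) (auto simp: s_def split_beta)
    show "snd (s (Suc j)) = snd (s j) \<oplus> m j" using fs[of j] by (simp add: s_def split_beta)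
  qed (simp add: s_def)
  define t where "t = snd \<circ> s"
  have t0: "t 0 = \<zero>" and tS: "t (Suc j) = t j \<oplus> m j" for j by (simp_all add: t_def s)
  have tc: "t j \<in> carrier A" for j by (induction j) (auto simp: t0 tS mc)
  have ta: "adj A (t j) = t j" for j by (induction j) (auto simp: t0 tS adj_add mc tc ma)
  have tk: "t j \<otimes> k = k \<otimes> t j" for j
    using k by (induction j) (auto simp: t0 tS mc tc mk mult_add_left mult_add_right)
  have tT: "vnorm A (of_nat j \<odot> y \<ominus> t j \<otimes> y) \<le> real j * vnorm A y" if y: "y \<in> carrier A" for y j
  proof (induction j)
    case (Suc j)
    have "of_nat (Suc j) \<odot> y \<ominus> t (Suc j) \<otimes> y = (of_nat j \<odot> y \<ominus> t j \<otimes> y) \<oplus> (y \<ominus> m j \<otimes> y)"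
      using y mc tc
      by (simp add: expand tS) (rule linear_identity3[of y "t j \<otimes> y" "m j \<otimes> y"], simp_all add: add.commute)
    then show ?case
      using norm_triangle[of "of_nat j \<odot> y \<ominus> t j \<otimes> y" "y \<ominus> m j \<otimes> y"] Suc mT[OF y, of j] y mc[of j] tc[of j]
      by (simp add: algebra_simps)
  qed (use y in \<open>simp add: t0\<close>)
  \<comment> \<open>Telescoping: \<open>k^2\<close> times the sum of the first \<open>j\<close>
    powers of \<open>1 - k^2\<close> is \<open>1\<close> minus the \<open>j\<close>-th
    power.\<close>
  have kt: "of_nat j \<odot> (k \<otimes> k) \<ominus> (k \<otimes> k) \<otimes> t j = m j" for j
  proof (induction j)
    case (Suc j)
    have "of_nat (Suc j) \<odot> (k \<otimes> k) \<ominus> (k \<otimes> k) \<otimes> t (Suc j)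
      = (of_nat j \<odot> (k \<otimes> k) \<ominus> (k \<otimes> k) \<otimes> t j) \<oplus> k \<otimes> (k \<ominus> k \<otimes> m j)"
      using k mc[of j] tc[of j]
      by (simp add: expand tS) (rule linear_identity3[of "k \<otimes> k" "k \<otimes> (k \<otimes> t j)" "k \<otimes> (k \<otimes> m j)"], simp_all add: add.commute)
    then show ?case by (simp add: Suc mS)
  qed (use k in \<open>simp add: t0 m0\<close>)
  define w where "w = (1 / of_nat n) \<odot> t n"
  have wc: "w \<in> carrier A" and wa: "adj A w = w" and wk: "w \<otimes> k = k \<otimes> w"
    using tc[of n] ta[of n] tk[of n] k by (simp_all add: w_def adj_scale mult_scale_left mult_scale_right)
  have wT: "vnorm A (y \<ominus> w \<otimes> y) \<le> vnorm A y" if y: "y \<in> carrier A" for y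
  proof -
    have "y \<ominus> w \<otimes> y = (1 / of_nat n) \<odot> (of_nat n \<odot> y \<ominus> t n \<otimes> y)"
      using y n tc[of n]
      by (simp add: expand w_def) (rule linear_identity3[of y "t n \<otimes> y" \<zero>], simp_all)
    then have "vnorm A (y \<ominus> w \<otimes> y) = (1 / real n) * vnorm A (of_nat n \<odot> y \<ominus> t n \<otimes> y)"
      using norm_scale[of "of_nat n \<odot> y \<ominus> t n \<otimes> y" "1 / of_nat n"] y tc[of n] by (simp add: norm_divide)
    also have "\<dots> \<le> (1 / real n) * (real n * vnorm A y)"
      by (intro mult_left_mono tT y) simp
    finally show ?thesis using n by simp
  qed
  let ?e = "k \<ominus> w \<otimes> k" and ?g = "k \<otimes> k \<ominus> w \<otimes> (k \<otimes> k)"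
  have g: "?g = (1 / of_nat n) \<odot> m n"
  proof -
    have "t n \<otimes> (k \<otimes> k) = k \<otimes> k \<otimes> t n"
      using tk[of n] tc[of n] k by (metis mult_assoc)
    then have "?g = (1 / of_nat n) \<odot> (of_nat n \<odot> (k \<otimes> k) \<ominus> (k \<otimes> k) \<otimes> t n)"
      using k tc[of n] n by (simp add: w_def mult_scale_left vminus_def scale_add_right scale_scale)
    then show ?thesis by (simp add: kt)
  qed
  have "vnorm A (m n) \<le> 2"
  proof (rule norm_le_if_left_mult[OF mc])
    fix y assume y: "y \<in> carrier A"
    have "m n \<otimes> y = y \<ominus> (y \<ominus> m n \<otimes> y)" using y mc[of n] by (simp add: minus_minus)
    then show "vnorm A (m n \<otimes> y) \<le> 2 * vnorm A y"
      using norm_minus_le[of y "y \<ominus> m n \<otimes> y"] mT[OF y, of n] y mc[of n] by simp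
  qed simp
  then have gn: "vnorm A ?g \<le> 2 / real n"
    unfolding g using n mc[of n] by (simp add: norm_scale norm_divide divide_simps)
  \<comment> \<open>\<open>?e \<otimes> adj A ?e\<close> equals
    \<open>?g \<ominus> ?g \<otimes> w\<close>. The contractivity of \<open>1 - w\<close> from the
    left applies to it after passing to adjoints, so only \<open>?g = m n / n\<close> has to be
    small.\<close>
  have "(vnorm A ?e)\<^sup>2 = vnorm A (?e \<otimes> adj A ?e)" using k wc by (simp add: cstar_identity')
  also have "?e \<otimes> adj A ?e = ?g \<ominus> ?g \<otimes> w"
    using k wc wa
      by (simp add: expand)
  also have "vnorm A (?g \<ominus> ?g \<otimes> w) = vnorm A (adj A ?g \<ominus> w \<otimes> adj A ?g)"
    using norm_adj[of "?g \<ominus> ?g \<otimes> w"] k wc wa by (simp add: adj_minus adj_mult)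
  also have "\<dots> \<le> vnorm A (adj A ?g)" using k wc by (intro wT) simp
  also have "\<dots> \<le> 2 / real n" using gn k wc by simp
  finally have wn: "(vnorm A ?e)\<^sup>2 \<le> 2 / real n" .
  have wJ: "w \<in> J" if J: "lin_subspace A J" "k \<in> J" "\<forall>j \<in> J. \<forall>b \<in> carrier A. j \<otimes> b \<in> J" for J
  proof -
    note JD = lin_subspaceD[OF J(1)]
    have "m j \<in> J" for j
    proof (induction j)
      case (Suc j)
      have "k \<otimes> (k \<ominus> k \<otimes> m j) \<in> J" using J(2,3) k(1) mc[of j] by simp
      then show ?case using Suc JD by (simp add: mS)
    qed (use JD in \<open>simp add: m0\<close>)
    then have "t j \<in> J" for j using JD by (induction j) (auto simp: t0 tS)
    then show ?thesis using JD by (simp add: w_def)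
  qed
  then have "in_right_ideal_of k w" by (auto simp: in_right_ideal_of_def)
  then show ?thesis using that[of w] wc wa wT wn by blast
qed

text \<open>The self-adjoint case is applied to a multiple \<open>k\<close> of
  \<open>x \<otimes> adj A x\<close>. By the norm identity for \<open>x \<otimes> adj A x\<close>,
  the square of the error at \<open>x\<close> is controlled by the error at
  \<open>k\<close>.\<close>

lemma left_approximation:
  assumes x: "x \<in> carrier A" and e: "\<epsilon> > 0"
  obtains w where "w \<in> carrier A" "adj A w = w" "\<And>y. y \<in> carrier A \<Longrightarrow> vnorm A (y \<ominus> w \<otimes> y) \<le> vnorm A y"
    "vnorm A (x \<ominus> w \<otimes> x) < \<epsilon>" "in_right_ideal_of x w"
proof -
  \<comment> \<open>Adding \<open>1\<close> keeps \<open>t\<close> positive also for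
    \<open>x = \<zero>\<close>, while still making the norm of \<open>k\<close> at most
    \<open>1\<close>.\<close>
  define t where "t = (vnorm A x)\<^sup>2 + 1"
  have t: "t > 0" "(vnorm A x)\<^sup>2 \<le> t" by (simp_all add: t_def add_nonneg_pos)
  define k where "k = complex_of_real (1 / t) \<odot> (x \<otimes> adj A x)"
  have k: "k \<in> carrier A" "adj A k = k" "vnorm A k \<le> 1"
    using x t by (simp_all add: k_def adj_scale adj_mult norm_scale norm_divide cstar_identity')
  have xx: "x \<otimes> adj A x = complex_of_real t \<odot> k" using x t by (simp add: k_def scale_scale)
  \<comment> \<open>The error at \<open>k\<close> is at most \<open>sqrt (2 / n)\<close>; this
    choice of \<open>n\<close> brings it below \<open>\<epsilon>\<^sup>2 / t\<close>.\<close>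
  obtain n where n: "real n > 2 / (\<epsilon>\<^sup>2 / t)\<^sup>2" using reals_Archimedean2 by blast
  have d: "(\<epsilon>\<^sup>2 / t)\<^sup>2 > 0" using e t by simp
  then have "2 / (\<epsilon>\<^sup>2 / t)\<^sup>2 > 0" by (simp only: zero_less_divide_iff) simp
  then have n0: "n > 0" "real n > 0" using n by (cases n; auto)+
  obtain w where w: "w \<in> carrier A" "adj A w = w"
    "\<And>y. y \<in> carrier A \<Longrightarrow> vnorm A (y \<ominus> w \<otimes> y) \<le> vnorm A y"
    "(vnorm A (k \<ominus> w \<otimes> k))\<^sup>2 \<le> 2 / real n" "in_right_ideal_of k w"
    using left_approximation_self_adjoint[OF k n0(1)] by blast
  let ?e = "k \<ominus> w \<otimes> k"
  have "2 < real n * (\<epsilon>\<^sup>2 / t)\<^sup>2" using n by (simp only: pos_divide_less_eq[OF d])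
  then have "2 < (\<epsilon>\<^sup>2 / t)\<^sup>2 * real n" by (simp only: mult.commute)
  then have "2 / real n < (\<epsilon>\<^sup>2 / t)\<^sup>2"
    using pos_divide_less_eq[of "real n" 2 "(\<epsilon>\<^sup>2 / t)\<^sup>2"] n0 by blast
  then have "(vnorm A ?e)\<^sup>2 < (\<epsilon>\<^sup>2 / t)\<^sup>2" using w(4) by simp
  then have en: "vnorm A ?e < \<epsilon>\<^sup>2 / t" 
    by (rule power2_less_imp_less) (use t in simp)
  have "(vnorm A (x \<ominus> w \<otimes> x))\<^sup>2 = vnorm A ((x \<ominus> w \<otimes> x) \<otimes> adj A (x \<ominus> w \<otimes> x))"
    using x w by (simp add: cstar_identity')
  also have "(x \<ominus> w \<otimes> x) \<otimes> adj A (x \<ominus> w \<otimes> x) = complex_of_real t \<odot> (?e \<ominus> ?e \<otimes> w)"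
  proof -
    have "(x \<ominus> w \<otimes> x) \<otimes> adj A (x \<ominus> w \<otimes> x)
      = (x \<otimes> adj A x \<ominus> w \<otimes> (x \<otimes> adj A x)) \<ominus> (x \<otimes> adj A x \<ominus> w \<otimes> (x \<otimes> adj A x)) \<otimes> w"
      using x w(1,2)
      by (simp add: expand)
    also have "\<dots> = complex_of_real t \<odot> (?e \<ominus> ?e \<otimes> w)"
      unfolding xx using k w(1)
      by (simp add: vminus_def mult_add_left mult_scale_left mult_scale_right scale_add_right
          scale_scale mult.commute)
    finally show ?thesis .
  qed
  also have "vnorm A \<dots> = t * vnorm A (?e \<ominus> ?e \<otimes> w)"
    using k w t by (simp add: norm_scale)
  also have "vnorm A (?e \<ominus> ?e \<otimes> w) = vnorm A (adj A ?e \<ominus> w \<otimes> adj A ?e)"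
    using norm_adj[of "?e \<ominus> ?e \<otimes> w"] k w by (simp add: adj_minus adj_mult)
  also have "t * \<dots> \<le> t * vnorm A ?e"
    using w(3)[of "adj A ?e"] k w t by (intro mult_left_mono) simp_all
  also have "\<dots> < \<epsilon>\<^sup>2" using en t by (simp add: field_simps)
  finally have "vnorm A (x \<ominus> w \<otimes> x) < \<epsilon>" by (rule power2_less_imp_less) (use e in simp)
  moreover have "in_right_ideal_of x w"
    unfolding in_right_ideal_of_def
  proof (intro allI impI)
    fix J assume J: "lin_subspace A J \<and> x \<in> J \<and> (\<forall>j \<in> J. \<forall>b \<in> carrier A. j \<otimes> b \<in> J)"
    then have "k \<in> J" using x lin_subspaceD(4)[of A J] by (simp add: k_def)
    then show "w \<in> J" using w(5) J unfolding in_right_ideal_of_def by blast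
  qed
  ultimately show ?thesis using that w by blast
qed

text \<open>The adjoint of \<open>x\<close> is approximated by \<open>adj A x \<otimes> w\<close>,
  which lies in \<open>J\<close> because \<open>w\<close> does; its distance from
  \<open>adj A x\<close> is that of \<open>w \<otimes> x\<close> from \<open>x\<close>.\<close>

lemma closed_ideal_adj:
  assumes J: "closed_ideal A J" and x: "x \<in> J"
  shows "adj A x \<in> J"
proof -
  have Jc: "x \<in> carrier A" using J x by (auto simp: closed_ideal_def lin_subspace_def)
  have "\<exists>y \<in> J. vnorm A (adj A x \<ominus> y) < \<epsilon>" if e: "\<epsilon> > 0" for \<epsilon>
  proof -
    obtain w where w: "w \<in> carrier A" "adj A w = w"
      "\<And>y. y \<in> carrier A \<Longrightarrow> vnorm A (y \<ominus> w \<otimes> y) \<le> vnorm A y" "vnorm A (x \<ominus> w \<otimes> x) < \<epsilon>" "in_right_ideal_of x w"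
      using left_approximation[OF Jc e] by blast
    have "w \<in> J" using w(5) J x by (auto simp: closed_ideal_def in_right_ideal_of_def)
    then have "adj A x \<otimes> w \<in> J" using J Jc by (simp add: closed_ideal_def)
    moreover have "adj A x \<ominus> adj A x \<otimes> w = adj A (x \<ominus> w \<otimes> x)"
      using w(1,2) Jc by (simp add: adj_minus adj_mult)
    ultimately show ?thesis using w(1,4) Jc by (intro bexI[of _ "adj A x \<otimes> w"]) auto
  qed
  then show ?thesis
    using J Jc by (auto simp: closed_ideal_def closedin_norm_iff)
qed

lemma closed_ideal_cstar_subalgebra: "closed_ideal A J \<Longrightarrow> cstar_subalgebra A J"
  using closed_ideal_adj[of J] unfolding cstar_subalgebra_def closed_ideal_def lin_subspace_def by blast

lemma common_left_approximation:
  assumes "finite X" "X \<subseteq> carrier A" "\<epsilon> > 0"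
  shows "\<exists>g \<in> carrier A. adj A g = g \<and> (\<forall>y \<in> carrier A. vnorm A (y \<ominus> g \<otimes> y) \<le> vnorm A y) \<and>
    (\<forall>x \<in> X. vnorm A (x \<ominus> g \<otimes> x) < \<epsilon>)"
  using assms
proof (induction X rule: finite_induct)
  case empty
  then show ?case by (intro bexI[of _ \<zero>]) auto
next
  case (insert x X)
  then obtain g where g: "g \<in> carrier A" "adj A g = g"
    "\<And>y. y \<in> carrier A \<Longrightarrow> vnorm A (y \<ominus> g \<otimes> y) \<le> vnorm A y"
    "\<And>x. x \<in> X \<Longrightarrow> vnorm A (x \<ominus> g \<otimes> x) < \<epsilon>"
    by auto
  have x: "x \<in> carrier A" "X \<subseteq> carrier A" using insert by auto
  have xc: "x \<ominus> g \<otimes> x \<in> carrier A" using x(1) g(1) by simp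
  obtain w where w: "w \<in> carrier A" "adj A w = w"
    "\<And>y. y \<in> carrier A \<Longrightarrow> vnorm A (y \<ominus> w \<otimes> y) \<le> vnorm A y"
    "vnorm A ((x \<ominus> g \<otimes> x) \<ominus> w \<otimes> (x \<ominus> g \<otimes> x)) < \<epsilon>"
    using left_approximation[OF xc insert.prems(2)] by blast
  \<comment> \<open>In operator form \<open>1 - ?g = (1 - g) (1 - w) (1 - g)\<close>. The symmetric
    product keeps \<open>?g\<close> self-adjoint, stays contractive, is no larger than
    \<open>1 - g\<close> on the old elements, and is small at \<open>x\<close> because
    \<open>w\<close> was chosen for \<open>x \<ominus> g \<otimes> x\<close>.\<close>
  let ?u = "(g \<oplus> w) \<ominus> w \<otimes> g"
  let ?g = "(g \<oplus> ?u) \<ominus> g \<otimes> ?u"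
  have uc: "?u \<in> carrier A" "?g \<in> carrier A" using g w by auto
  have m: "g \<in> carrier A" "w \<in> carrier A" "w \<otimes> g \<in> carrier A" "g \<otimes> g \<in> carrier A"
    "g \<otimes> w \<in> carrier A" "g \<otimes> (w \<otimes> g) \<in> carrier A"
    using g(1) w(1) by simp_all
  have adj: "adj A ?g = ?g"
    using g(1,2) w(1,2)
    by (simp add: vminus_def adj_add adj_scale adj_mult mult_add_left mult_add_right mult_scale_left
        mult_scale_right mult_assoc) (rule linear_identity6[OF m], simp)
  have split: "y \<ominus> ?g \<otimes> y = ((y \<ominus> g \<otimes> y) \<ominus> w \<otimes> (y \<ominus> g \<otimes> y)) \<ominus> g \<otimes> ((y \<ominus> g \<otimes> y) \<ominus> w \<otimes> (y \<ominus> g \<otimes> y))"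
    if y: "y \<in> carrier A" for y
  proof -
    let ?z = "(y \<ominus> g \<otimes> y) \<ominus> w \<otimes> (y \<ominus> g \<otimes> y)"
    have 1: "?z = y \<ominus> ?u \<otimes> y"
      using g(1) w(1) y
      by (simp add: expand) (rule linear_identity4[of y "g \<otimes> y" "w \<otimes> y" "w \<otimes> (g \<otimes> y)"], simp_all)
    have "y \<ominus> ((g \<oplus> u) \<ominus> g \<otimes> u) \<otimes> y = (y \<ominus> u \<otimes> y) \<ominus> g \<otimes> (y \<ominus> u \<otimes> y)" if "u \<in> carrier A" for u
      using g(1) that y
      by (simp add: expand) (rule linear_identity4[of y "g \<otimes> y" "u \<otimes> y" "g \<otimes> (u \<otimes> y)"], simp_all)
    then show ?thesis unfolding 1 using uc(1) by blast
  qed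
  have le: "vnorm A (y \<ominus> ?g \<otimes> y) \<le> vnorm A ((y \<ominus> g \<otimes> y) \<ominus> w \<otimes> (y \<ominus> g \<otimes> y))"
    if y: "y \<in> carrier A" for y
    unfolding split[OF y] using y g(1) w(1) by (intro g(3)) simp
  have le': "vnorm A (y \<ominus> ?g \<otimes> y) \<le> vnorm A (y \<ominus> g \<otimes> y)" if y: "y \<in> carrier A" for y
    using le[OF y] w(3)[of "y \<ominus> g \<otimes> y"] g(1) y by simp
  show ?case
  proof (intro bexI[OF _ uc(2)] conjI ballI adj)
    show "vnorm A (y \<ominus> ?g \<otimes> y) \<le> vnorm A y" if "y \<in> carrier A" for y
      using le'[OF that] g(3)[OF that] by simp
    show "vnorm A (y \<ominus> ?g \<otimes> y) < \<epsilon>" if "y \<in> insert x X" for y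
      using that le[of x] le'[of y] w(4) g(4)[of y] x by auto
  qed
qed

text \<open>With \<open>1 - v = (1 - g)^2\<close> the element \<open>v\<close> is self-adjoint, and
  \<open>self_adjoint_op_square\<close> makes it a contraction, so \<open>u = v \<otimes> v\<close>
  is a positive contraction. Approximating the adjoints of \<open>X\<close> as well turns left
  approximation into right approximation.\<close>

lemma common_positive_approximation:
  assumes "finite X" "X \<subseteq> carrier A" "\<epsilon> > 0"
  shows "\<exists>u \<in> positive_elements A. vnorm A u \<le> 1 \<and>
    (\<forall>x \<in> X. vnorm A (u \<otimes> x \<ominus> x) < \<epsilon> \<and> vnorm A (x \<otimes> u \<ominus> x) < \<epsilon>)"
proof -
  obtain g where g: "g \<in> carrier A" "adj A g = g"
    "\<And>y. y \<in> carrier A \<Longrightarrow> vnorm A (y \<ominus> g \<otimes> y) \<le> vnorm A y"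
    "\<And>x. x \<in> X \<union> adj A ` X \<Longrightarrow> vnorm A (x \<ominus> g \<otimes> x) < \<epsilon> / 2"
  proof -
    have "adj A ` X \<subseteq> carrier A" using assms(2) by auto
    then have "\<exists>g \<in> carrier A. adj A g = g \<and> (\<forall>y \<in> carrier A. vnorm A (y \<ominus> g \<otimes> y) \<le> vnorm A y) \<and>
      (\<forall>x \<in> X \<union> adj A ` X. vnorm A (x \<ominus> g \<otimes> x) < \<epsilon> / 2)"
      using assms by (intro common_left_approximation) auto
    then show ?thesis using that by blast
  qed
  define p where "p y = y \<ominus> g \<otimes> y" for y
  have p: "self_adjoint_op p"
    unfolding self_adjoint_op_def linear_map_def
    using g(1,2)
    by (auto simp: p_def vminus_def mult_add_left mult_add_right mult_scale_left mult_scale_right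
        adj_add adj_scale adj_mult mult_assoc scale_add_right scale_scale add_assoc add_left_commute
        mult.commute)
  have pn: "vnorm A (p y) \<le> vnorm A y" "p y \<in> carrier A" if "y \<in> carrier A" for y
    using that g by (simp_all add: p_def)
  define v where "v = 2 \<odot> g \<ominus> g \<otimes> g"
  have v: "v \<in> carrier A" "adj A v = v"
    using g(1,2) by (simp_all add: v_def adj_minus adj_scale adj_mult)
  have pp: "y \<ominus> v \<otimes> y = p (p y)" if "y \<in> carrier A" for y
  proof -
    have m: "y \<in> carrier A" "g \<otimes> y \<in> carrier A" "g \<otimes> (g \<otimes> y) \<in> carrier A"
      using g(1) that by simp_all
    show ?thesis
      using g(1) that
      by (simp add: v_def p_def vminus_def mult_add_left mult_add_right mult_scale_left
          mult_scale_right mult_assoc) (rule linear_identity3[OF m], simp)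
  qed
  have vy: "vnorm A (v \<otimes> y) \<le> 1 * vnorm A y" if y: "y \<in> carrier A" for y
  proof -
    have "v \<otimes> y = y \<ominus> p (p y)" using pp[OF y] v y minus_minus[of y "v \<otimes> y"] by simp
    then show ?thesis using self_adjoint_op_square[OF p pn(1) y] by simp
  qed
  have v1: "vnorm A v \<le> 1" by (rule norm_le_if_left_mult[OF v(1) _ vy]) simp_all
  define u where "u = v \<otimes> v"
  have u: "u \<in> carrier A" "adj A u = u" using v by (simp_all add: u_def adj_mult)
  have left: "vnorm A (u \<otimes> x \<ominus> x) < \<epsilon>" if x: "x \<in> X \<union> adj A ` X" for x
  proof -
    have xc: "x \<in> carrier A" using x assms(2) by auto
    let ?d = "x \<ominus> v \<otimes> x"
    have "vnorm A ?d \<le> vnorm A (p x)" unfolding pp[OF xc] using pn xc by simp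
    then have d: "vnorm A ?d < \<epsilon> / 2" using g(4)[OF x] by (simp add: p_def)
    have "x \<ominus> u \<otimes> x = ?d \<oplus> v \<otimes> ?d"
      using v(1) xc
      by (simp add: expand u_def) (rule linear_identity3[of x "v \<otimes> x" "v \<otimes> (v \<otimes> x)"], simp_all)
    then have "vnorm A (x \<ominus> u \<otimes> x) \<le> vnorm A ?d + vnorm A ?d"
      using norm_triangle[of ?d "v \<otimes> ?d"] vy[of ?d] v xc by simp
    then show ?thesis using d norm_minus_commute[of x "u \<otimes> x"] u xc by simp
  qed
  have right: "vnorm A (x \<otimes> u \<ominus> x) < \<epsilon>" if x: "x \<in> X" for x
  proof -
    have xc: "x \<in> carrier A" using x assms(2) by auto
    have "x \<otimes> u \<ominus> x = adj A (u \<otimes> adj A x \<ominus> adj A x)"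
      using u xc by (simp add: adj_minus adj_mult)
    then show ?thesis using left[of "adj A x"] x u xc by simp
  qed
  have "u \<in> positive_elements A"
    unfolding positive_elements_def using v by (auto simp: u_def intro!: exI[of _ v])
  moreover have "vnorm A u \<le> 1"
    using norm_mult[OF v(1) v(1)] mult_mono[OF v1 v1] v by (simp add: u_def)
  ultimately show ?thesis using left right by blast
qed

text \<open>The net is indexed by finite sets and tolerances and is encoded by its filter. The base
  is directed, since the union of two sets with the smaller tolerance refines both.\<close>

theorem approximate_unit_exists: "\<exists>F. approximate_unit A F"
proof -
  define S where "S = (\<lambda>(X, \<epsilon> :: real). {u \<in> positive_elements A. vnorm A u \<le> 1 \<and>
    (\<forall>x \<in> X. vnorm A (u \<otimes> x \<ominus> x) < \<epsilon> \<and> vnorm A (x \<otimes> u \<ominus> x) < \<epsilon>)})"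
  define I where "I = {(X, \<epsilon> :: real). finite X \<and> X \<subseteq> carrier A \<and> \<epsilon> > 0}"
  define F where "F = (INF i \<in> I. principal (S i))"
  have ev: "eventually P F \<longleftrightarrow> (\<exists>i \<in> I. eventually P (principal (S i)))" for P
    unfolding F_def
  proof (rule eventually_INF_base)
    show "I \<noteq> {}" unfolding I_def by (auto intro!: exI[of _ "{}"] exI[of _ 1])
    fix i j assume "i \<in> I" "j \<in> I"
    then obtain X a Y b where *: "i = (X, a)" "j = (Y, b)" "finite X" "X \<subseteq> carrier A" "a > 0"
      "finite Y" "Y \<subseteq> carrier A" "b > 0" by (auto simp: I_def)
    show "\<exists>k \<in> I. principal (S k) \<le> inf (principal (S i)) (principal (S j))"
      by (rule bexI[of _ "(X \<union> Y, min a b)"]) (use * in \<open>auto simp: I_def S_def\<close>)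
  qed
  have "F \<noteq> bot"
  proof
    assume "F = bot"
    then have "eventually (\<lambda>_. False) F" by simp
    then obtain X e where "finite X" "X \<subseteq> carrier A" "e > 0" "S (X, e) = {}"
      unfolding ev by (auto simp: I_def eventually_principal)
    then show False using common_positive_approximation[of X e] by (auto simp: S_def)
  qed
  moreover have "\<forall>\<^sub>F u in F. u \<in> carrier A \<and> u \<in> positive_elements A \<and> vnorm A u \<le> 1"
    unfolding ev eventually_principal
    by (rule bexI[of _ "({}, 1)"]) (auto simp: I_def S_def positive_elements_def)
  moreover have "((\<lambda>u. vnorm A (u \<otimes> b \<ominus> b)) \<longlongrightarrow> 0) F \<and> ((\<lambda>u. vnorm A (b \<otimes> u \<ominus> b)) \<longlongrightarrow> 0) F"
    if b: "b \<in> carrier A" for b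
  proof -
    have "\<forall>\<^sub>F u in F. dist (vnorm A (u \<otimes> b \<ominus> b)) 0 < e \<and> dist (vnorm A (b \<otimes> u \<ominus> b)) 0 < e" if "e > 0" for e
      unfolding ev eventually_principal
      by (rule bexI[of _ "({b}, e)"]) (use b that in \<open>auto simp: I_def S_def positive_elements_def\<close>)
    then show ?thesis by (auto simp: tendsto_iff eventually_conj_iff)
  qed
  ultimately show ?thesis unfolding approximate_unit_def by blast
qed

end

section \<open>Closed ideals and partial automorphisms\<close>

lemma closed_idealD:
  assumes "closed_ideal A J"
  shows "x \<in> J \<Longrightarrow> x \<in> carrier A" "lin_subspace A J" "closedin (norm_topology A) J"
    "\<lbrakk>b \<in> carrier A; x \<in> J\<rbrakk> \<Longrightarrow> b \<otimes>\<^bsub>A\<^esub> x \<in> J" "\<lbrakk>b \<in> carrier A; x \<in> J\<rbrakk> \<Longrightarrow> x \<otimes>\<^bsub>A\<^esub> b \<in> J"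
  using assms by (auto simp: closed_ideal_def lin_subspace_def)

lemma (in cstar_algebra) closed_ideal_cstar_algebra:
  "closed_ideal A J \<Longrightarrow> cstar_algebra (A\<lparr>carrier := J\<rparr>)"
  by (intro cstar_algebra_subalgebra closed_ideal_cstar_subalgebra)

text \<open>Partial automorphisms are defined for plain \<open>star_algebra\<close> records, whereas
  \<open>cstar_algebra\<close> also covers record extensions.\<close>

locale plain_cstar_algebra = cstar_algebra B for B :: "'b star_algebra" (structure)
begin

lemma partial_automorphismD:
  assumes P: "partial_automorphism B f"
  shows "closed_ideal B (dom f)" "closed_ideal B (ran f)"
    "\<lbrakk>f x = Some y; f x' = Some y\<rbrakk> \<Longrightarrow> x = x'"
    "f x = Some y \<Longrightarrow> x \<in> carrier B" "f x = Some y \<Longrightarrow> y \<in> carrier B"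
    "\<lbrakk>f x = Some y; f x' = Some y'\<rbrakk> \<Longrightarrow> f (x \<oplus> x') = Some (y \<oplus> y')"
    "f x = Some y \<Longrightarrow> f (c \<odot> x) = Some (c \<odot> y)"
    "\<lbrakk>f x = Some y; f x' = Some y'\<rbrakk> \<Longrightarrow> f (x \<otimes> x') = Some (y \<otimes> y')"
    "f x = Some y \<Longrightarrow> f (adj B x) = Some (adj B y)"
    "f \<zero> = Some \<zero>"
    "\<lbrakk>f x = Some y; f x' = Some y'\<rbrakk> \<Longrightarrow> f (x \<ominus> x') = Some (y \<ominus> y')"
proof -
  show d: "closed_ideal B (dom f)" and r: "closed_ideal B (ran f)"
    using P by (auto simp: partial_automorphism_def)
  note dD = closed_idealD[OF d] and rD = closed_idealD[OF r]
  note dS = lin_subspaceD[OF dD(2)]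
  have iso: "star_iso (B\<lparr>carrier := dom f\<rparr>) (B\<lparr>carrier := ran f\<rparr>) (\<lambda>x. the (f x))"
    using P by (auto simp: partial_automorphism_def)
  then have inj: "inj_on (\<lambda>x. the (f x)) (dom f)" by (auto simp: star_iso_def bij_betw_def)
  have hom: "star_hom (B\<lparr>carrier := dom f\<rparr>) (B\<lparr>carrier := ran f\<rparr>) (\<lambda>x. the (f x))"
    using iso by (simp add: star_iso_def)
  note h = star_homD[OF hom, simplified]
  have eq: "f x = Some (the (f x))" if "x \<in> dom f" for x using that by auto
  show "\<lbrakk>f x = Some y; f x' = Some y\<rbrakk> \<Longrightarrow> x = x'"
    using inj_onD[OF inj, of x x'] by (auto simp: domI)
  show "f x = Some y \<Longrightarrow> x \<in> carrier B" "f x = Some y \<Longrightarrow> y \<in> carrier B"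
    using dD(1) rD(1) by (auto simp: dom_def ran_def)
  show 1: "f (x \<oplus> x') = Some (y \<oplus> y')" if "f x = Some y" "f x' = Some y'" for x x' y y'
    using h(2)[of x x'] eq[of "x \<oplus> x'"] that dS(3)[of x x'] by (auto simp: domI)
  show 2: "f (c \<odot> x) = Some (c \<odot> y)" if "f x = Some y" for x y c
    using h(3)[of x c] eq[of "c \<odot> x"] that dS(4)[of x c] by (auto simp: domI)
  show "f (x \<otimes> x') = Some (y \<otimes> y')" if "f x = Some y" "f x' = Some y'"
    using h(4)[of x x'] eq[of "x \<otimes> x'"] that dD(1)[of x] dD(4)[of x x'] by (auto simp: domI)
  show "f (adj B x) = Some (adj B y)" if "f x = Some y"
    using h(5)[of x] eq[of "adj B x"] that closed_ideal_adj[OF d, of x] by (auto simp: domI)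
  have "\<zero> \<in> dom f" by (rule dS(2))
  then obtain z where "f \<zero> = Some z" by auto
  moreover from this have "z \<in> carrier B" using rD(1) by (auto simp: ran_def)
  ultimately show "f \<zero> = Some \<zero>" using 2[of \<zero> z 0] by simp
  show "f (x \<ominus> x') = Some (y \<ominus> y')" if "f x = Some y" "f x' = Some y'"
    unfolding vminus_def by (intro 1 2 that)
qed

lemma partial_automorphismI:
  assumes "closed_ideal B (dom f)" "closed_ideal B (ran f)"
    "\<And>x y x'. \<lbrakk>f x = Some y; f x' = Some y\<rbrakk> \<Longrightarrow> x = x'"
    "\<And>x y x' y'. \<lbrakk>f x = Some y; f x' = Some y'\<rbrakk> \<Longrightarrow> f (x \<oplus> x') = Some (y \<oplus> y')"
    "\<And>x y c. f x = Some y \<Longrightarrow> f (c \<odot> x) = Some (c \<odot> y)"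
    "\<And>x y x' y'. \<lbrakk>f x = Some y; f x' = Some y'\<rbrakk> \<Longrightarrow> f (x \<otimes> x') = Some (y \<otimes> y')"
    "\<And>x y. f x = Some y \<Longrightarrow> f (adj B x) = Some (adj B y)"
  shows "partial_automorphism B f"
proof -
  have "inj_on (\<lambda>x. the (f x)) (dom f)"
  proof (rule inj_onI)
    fix x x' assume "x \<in> dom f" "x' \<in> dom f" "the (f x) = the (f x')"
    then obtain y where "f x = Some y" "f x' = Some y" by force
    then show "x = x'" by (rule assms(3))
  qed
  moreover have "(\<lambda>x. the (f x)) ` dom f = ran f"
    by (auto simp: ran_def image_iff dom_def) force
  ultimately have "bij_betw (\<lambda>x. the (f x)) (dom f) (ran f)" by (simp add: bij_betw_def)
  then show ?thesis
    using assms(1,2)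
    by (auto simp: partial_automorphism_def star_iso_def star_hom_def linear_map_def assms(4-7) ranI)
qed

text \<open>Both the map and its inverse are star homomorphisms between closed ideals, hence
  contractive.\<close>

lemma partial_automorphism_norm:
  assumes P: "partial_automorphism B f" and x: "f x = Some y"
  shows "vnorm B y = vnorm B x"
proof (rule antisym)
  note D = partial_automorphismD[OF P]
  let ?I = "B\<lparr>carrier := dom f\<rparr>" and ?J = "B\<lparr>carrier := ran f\<rparr>"
  have c: "cstar_algebra ?I" "cstar_algebra ?J" using D(1,2) closed_ideal_cstar_algebra by auto
  have "star_hom ?I ?J (\<lambda>x. the (f x))"
    using P by (auto simp: partial_automorphism_def star_iso_def)
  from star_hom_contractive[OF c this, of x] x show "vnorm B y \<le> vnorm B x" by (auto simp: domI)
  let ?g = "\<lambda>y. THE x. f x = Some y"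
  have g: "?g y = x" if "f x = Some y" for x y using that D(3) by blast
  have "star_hom ?J ?I ?g"
    using D(6-9) by (auto simp: star_hom_def linear_map_def ran_def g dom_def)
  from star_hom_contractive[OF c(2,1) this, of y] x show "vnorm B x \<le> vnorm B y"
    by (auto simp: ranI g)
qed

definition map_inverse :: "('b \<rightharpoonup> 'b) \<Rightarrow> 'b \<rightharpoonup> 'b" where
  "map_inverse f y = (if y \<in> ran f then Some (partial_inv f y) else None)"

lemma partial_inv_eq: "\<lbrakk>partial_automorphism B f; f x = Some y\<rbrakk> \<Longrightarrow> partial_inv f y = x"
  unfolding partial_inv_def using partial_automorphismD(3) by blast

lemma map_inverse_iff: "partial_automorphism B f \<Longrightarrow> map_inverse f y = Some x \<longleftrightarrow> f x = Some y"
  using partial_inv_eq by (auto simp: map_inverse_def ran_def)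

lemma partial_automorphism_map_inverse:
  assumes P: "partial_automorphism B f"
  shows "partial_automorphism B (map_inverse f)"
proof -
  note D = partial_automorphismD[OF P]
  have dr: "dom (map_inverse f) = ran f" "ran (map_inverse f) = dom f"
    using map_inverse_iff[OF P] by (auto simp: dom_def ran_def)
  show ?thesis
    by (rule partial_automorphismI) (use D in \<open>auto simp: dr map_inverse_iff[OF P]\<close>)
qed

text \<open>The preimage has to be an ideal of all of \<open>B\<close> and not just of
  \<open>dom f\<close>. It is closed because \<open>f\<close> is isometric and \<open>dom f\<close>
  and \<open>K\<close> are closed.\<close>

lemma preimage_closed_ideal:
  assumes P: "partial_automorphism B f" and K: "closed_ideal B K"
  shows "closed_ideal B {x. \<exists>y \<in> K. f x = Some y}" (is "closed_ideal B ?W")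
proof -
  note D = partial_automorphismD[OF P] and KD = closed_idealD[OF K]
  note KS = lin_subspaceD[OF KD(2)] and dD = closed_idealD[OF D(1)]
  have sub: "lin_subspace B ?W"
    unfolding lin_subspace_def
  proof (intro conjI ballI allI)
    show "?W \<subseteq> carrier B" using D(4) by blast
    show "\<zero> \<in> ?W" using D(10) KS(2) by blast
    show "x \<oplus> y \<in> ?W" if xy: "x \<in> ?W" "y \<in> ?W" for x y
    proof -
      obtain x' y' where "f x = Some x'" "f y = Some y'" "x' \<in> K" "y' \<in> K" using xy by blast
      then show ?thesis using D(6)[of x x' y y'] KS(3)[of x' y'] by blast
    qed
    show "c \<odot> x \<in> ?W" if cx: "x \<in> ?W" for c x
    proof -
      obtain x' where "f x = Some x'" "x' \<in> K" using cx by blast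
      then show ?thesis using D(7)[of x x' c] KS(4)[of x' c] by blast
    qed
  qed
  have clos: "closedin (norm_topology B) ?W"
    unfolding closedin_norm_iff
  proof (intro conjI ballI impI)
    show "?W \<subseteq> carrier B" using D(4) by blast
    fix x assume x: "x \<in> carrier B" and lim: "\<forall>\<epsilon>>0. \<exists>y \<in> ?W. vnorm B (x \<ominus> y) < \<epsilon>"
    then have "\<forall>\<epsilon>>0. \<exists>y \<in> dom f. vnorm B (x \<ominus> y) < \<epsilon>" by blast
    then have "x \<in> dom f" using dD(3) x unfolding closedin_norm_iff by blast
    then obtain y where y: "f x = Some y" by blast
    have "\<exists>z \<in> K. vnorm B (y \<ominus> z) < \<epsilon>" if e: "\<epsilon> > 0" for \<epsilon>
    proof -
      obtain x' z where xz: "f x' = Some z" "z \<in> K" "vnorm B (x \<ominus> x') < \<epsilon>" using lim e by blast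
      then have "vnorm B (y \<ominus> z) = vnorm B (x \<ominus> x')"
        using partial_automorphism_norm[OF P D(11)[OF y xz(1)]] by simp
      then show ?thesis using xz by (intro bexI[of _ z]) simp_all
    qed
    then have "y \<in> K" using KD(3) D(5)[OF y] unfolding closedin_norm_iff by blast
    then show "x \<in> ?W" using y by blast
  qed
  \<comment> \<open>Since \<open>b\<close> itself need not lie in \<open>dom f\<close>, it is
    replaced by \<open>b \<otimes> w\<close>, where \<open>w\<close> is in \<open>dom f\<close> and
    \<open>w \<otimes> x\<close> is close to \<open>x\<close>. Then \<open>f\<close> is
    multiplicative on \<open>b \<otimes> w\<close> and \<open>x\<close>, and closedness of
    \<open>K\<close> removes the approximation.\<close>
  have left: "b \<otimes> x \<in> ?W" if b: "b \<in> carrier B" and x: "x \<in> ?W" for b x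
  proof -
    obtain y where y: "f x = Some y" "y \<in> K" using x by blast
    have xc: "x \<in> carrier B" using D(4) y by blast
    have "b \<otimes> x \<in> dom f" using dD(4) b y by blast
    then obtain z where z: "f (b \<otimes> x) = Some z" by blast
    have "\<exists>k \<in> K. vnorm B (z \<ominus> k) < \<epsilon>" if e: "\<epsilon> > 0" for \<epsilon>
    proof -
      let ?d = "\<epsilon> / (vnorm B b + 1)"
      have d: "?d > 0" using e norm_nonneg[OF b] by (simp add: add_nonneg_pos)
      obtain w where w: "w \<in> carrier B" "vnorm B (x \<ominus> w \<otimes> x) < ?d" "in_right_ideal_of x w"
        using left_approximation[OF xc d] by blast
      have "w \<in> dom f"
        using w(3) dD(2,5) y(1) unfolding in_right_ideal_of_def by blast
      then have "b \<otimes> w \<in> dom f" using dD(4) b by blast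
      then obtain v where v: "f (b \<otimes> w) = Some v" by blast
      have vy: "v \<otimes> y \<in> K" using KD(4) D(5)[OF v] y by blast
      have "f (b \<otimes> x \<ominus> b \<otimes> w \<otimes> x) = Some (z \<ominus> v \<otimes> y)"
        by (intro D(11) z D(8) v y)
      then have "vnorm B (z \<ominus> v \<otimes> y) = vnorm B (b \<otimes> (x \<ominus> w \<otimes> x))"
        using partial_automorphism_norm[OF P] b w xc by (simp add: mult_minus_right mult_assoc)
      also have "\<dots> \<le> vnorm B b * vnorm B (x \<ominus> w \<otimes> x)" using b w xc by (intro norm_mult) simp_all
      also have "\<dots> \<le> vnorm B b * ?d" using w b by (intro mult_left_mono) simp_all
      also have "\<dots> < \<epsilon>" using e norm_nonneg[OF b] by (simp add: divide_simps add_nonneg_pos)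
      finally show ?thesis using vy by blast
    qed
    then have "z \<in> K" using KD(3) D(5)[OF z] unfolding closedin_norm_iff by blast
    then show ?thesis using z by blast
  qed
  have adjW: "adj B x \<in> ?W" if "x \<in> ?W" for x
    using that D(9) closed_ideal_adj[OF K] by blast
  have right: "x \<otimes> b \<in> ?W" if b: "b \<in> carrier B" and x: "x \<in> ?W" for b x
  proof -
    have xc: "x \<in> carrier B" using D(4) x by blast
    have "adj B (adj B b \<otimes> adj B x) \<in> ?W" using b x by (intro adjW left) simp_all
    then show ?thesis using b xc by (simp add: adj_mult)
  qed
  show ?thesis unfolding closed_ideal_def using sub clos left right by blast
qed

text \<open>The domain is the preimage of \<open>dom f\<close> under \<open>g\<close>, and the range
  is the preimage of \<open>ran g\<close> under the inverse of \<open>f\<close>; both are covered by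
  \<open>preimage_closed_ideal\<close>.\<close>

lemma partial_automorphism_comp:
  assumes P: "partial_automorphism B f" and Q: "partial_automorphism B g"
  shows "partial_automorphism B (f \<circ>\<^sub>m g)"
proof -
  note D = partial_automorphismD[OF P] and E = partial_automorphismD[OF Q]
  have "dom (f \<circ>\<^sub>m g) = {x. \<exists>y \<in> dom f. g x = Some y}"
    by (auto simp: map_comp_Some_iff dom_def)
  then have 1: "closed_ideal B (dom (f \<circ>\<^sub>m g))" using preimage_closed_ideal[OF Q D(1)] by simp
  have "ran (f \<circ>\<^sub>m g) = {z. \<exists>y \<in> ran g. map_inverse f z = Some y}"
    by (auto simp: map_comp_Some_iff ran_def map_inverse_iff[OF P])
  then have 2: "closed_ideal B (ran (f \<circ>\<^sub>m g))"
    using preimage_closed_ideal[OF partial_automorphism_map_inverse[OF P] E(2)] by simp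
  show ?thesis
  proof (rule partial_automorphismI[OF 1 2])
    fix x y x' y' c
    assume "(f \<circ>\<^sub>m g) x = Some y"
    then obtain u where u: "g x = Some u" "f u = Some y" by (auto simp: map_comp_Some_iff)
    show "(f \<circ>\<^sub>m g) (c \<odot> x) = Some (c \<odot> y)" "(f \<circ>\<^sub>m g) (adj B x) = Some (adj B y)"
      using D(7,9)[OF u(2)] E(7,9)[OF u(1)] by simp_all
    show "x = x'" if "(f \<circ>\<^sub>m g) x' = Some y"
    proof -
      obtain u' where u': "g x' = Some u'" "f u' = Some y" using \<open>(f \<circ>\<^sub>m g) x' = Some y\<close>
        by (auto simp: map_comp_Some_iff)
      then have "u = u'" using D(3) u by blast
      then show ?thesis using E(3) u u' by blast
    qed
    assume "(f \<circ>\<^sub>m g) x' = Some y'"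
    then obtain u' where u': "g x' = Some u'" "f u' = Some y'" by (auto simp: map_comp_Some_iff)
    show "(f \<circ>\<^sub>m g) (x \<oplus> x') = Some (y \<oplus> y')" "(f \<circ>\<^sub>m g) (x \<otimes> x') = Some (y \<otimes> y')"
      using D(6)[OF u(2) u'(2)] E(6)[OF u(1) u'(1)] D(8)[OF u(2) u'(2)] E(8)[OF u(1) u'(1)] by simp_all
  qed
qed

lemma PAut_closed: "\<lbrakk>f \<in> elts (PAut B); g \<in> elts (PAut B)\<rbrakk> \<Longrightarrow> f \<cdot>\<^bsub>PAut B\<^esub> g \<in> elts (PAut B)"
  by (simp add: PAut_def partial_automorphism_comp)

lemma PAut_assoc: "(f \<cdot>\<^bsub>PAut B\<^esub> g) \<cdot>\<^bsub>PAut B\<^esub> h = f \<cdot>\<^bsub>PAut B\<^esub> (g \<cdot>\<^bsub>PAut B\<^esub> h)"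
  by (auto simp: PAut_def map_comp_def fun_eq_iff split: option.split)

lemma PAut_mult_Some: "(f \<cdot>\<^bsub>PAut B\<^esub> g) x = Some z \<longleftrightarrow> (\<exists>y. g x = Some y \<and> f y = Some z)"
  by (auto simp: PAut_def map_comp_Some_iff)

lemma PAut_idempotent:
  assumes "f \<in> elts (PAut B)" "f \<cdot>\<^bsub>PAut B\<^esub> f = f" "f x = Some y"
  shows "x = y"
proof -
  have "f y = Some y" using PAut_mult_Some[of f f x y] assms by auto
  then show ?thesis using partial_automorphismD(3)[of f x y y] assms by (simp add: PAut_def)
qed

lemma PAut_inverse:
  assumes f: "f \<in> elts (PAut B)" "g \<in> elts (PAut B)" "f \<cdot>\<^bsub>PAut B\<^esub> g \<cdot>\<^bsub>PAut B\<^esub> f = f" "f x = Some y"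
  shows "g y = Some x"
proof -
  obtain u where u: "g y = Some u" "f u = Some y"
    using PAut_mult_Some[of "f \<cdot>\<^bsub>PAut B\<^esub> g" f x y] PAut_mult_Some[of f g y y] f(3,4) by auto
  then show ?thesis using partial_automorphismD(3)[of f x y u] f by (simp add: PAut_def)
qed

end

text \<open>The properties shared by a partial action of an inverse semigroup and the action that it
  induces.\<close>

locale semigroup_action = inverse_semigroup S + plain_cstar_algebra B
  for S :: "'s semigroup_str" and B :: "'b star_algebra" +
  fixes \<alpha> :: "'s \<Rightarrow> 'b \<rightharpoonup> 'b"
  assumes automorphism: "s \<in> elts S \<Longrightarrow> partial_automorphism B (\<alpha> s)"
    and action_inv: "\<lbrakk>s \<in> elts S; \<alpha> s x = Some y\<rbrakk> \<Longrightarrow> \<alpha> (inv_of S s) y = Some x"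
    and action_mult: "\<lbrakk>s \<in> elts S; t \<in> elts S; \<alpha> t x = Some y; \<alpha> s y = Some z\<rbrakk> \<Longrightarrow> \<alpha> (s \<cdot>\<^bsub>S\<^esub> t) x = Some z"
    and action_mono: "\<lbrakk>nat_le S s t; \<alpha> s x = Some y\<rbrakk> \<Longrightarrow> \<alpha> t x = Some y"
    and action_idempotent: "\<lbrakk>e \<in> idempotents S; \<alpha> e x = Some y\<rbrakk> \<Longrightarrow> x = y"

text \<open>For \<open>action_mult\<close>, \<open>pi_mult\<close> writes the composite of two of
  the maps as the map at the product after \<open>\<alpha> (inv_of S t)\<close> and
  \<open>\<alpha> t\<close>, and these two together fix every point of the domain of
  \<open>\<alpha> t\<close>.\<close>

lemma semigroup_action_of_partial_hom:
  assumes "inverse_semigroup S" "cstar_algebra B" "partial_hom S (PAut B) \<alpha>"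
  shows "semigroup_action S B \<alpha>" "semigroup_partial_hom S (PAut B) \<alpha>"
proof -
  interpret S: inverse_semigroup S by fact
  interpret B: plain_cstar_algebra B using assms(2) by (simp add: plain_cstar_algebra_def)
  show ph: "semigroup_partial_hom S (PAut B) \<alpha>"
    by unfold_locales (simp_all add: B.PAut_closed B.PAut_assoc assms(3))
  interpret P: semigroup_partial_hom S "PAut B" \<alpha> by fact
  have idem: "x = y" if "e \<in> idempotents S" "\<alpha> e x = Some y" for e x y
    using B.PAut_idempotent[OF P.pi_closed[OF S.idempotents_closed] P.pi_idempotent] that by blast
  have inv: "\<alpha> (inv_of S s) y = Some x" if "s \<in> elts S" "\<alpha> s x = Some y" for s x y
    using B.PAut_inverse[of "\<alpha> s" "\<alpha> (inv_of S s)" x y] partial_hom_rules(4)[OF assms(3) that(1) that(1)] that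
    by simp
  show "semigroup_action S B \<alpha>"
  proof
    show "partial_automorphism B (\<alpha> s)" if "s \<in> elts S" for s
      using P.pi_closed[OF that] by (simp add: PAut_def)
    show "\<alpha> (s \<cdot>\<^bsub>S\<^esub> t) x = Some z" if st: "s \<in> elts S" "t \<in> elts S" "\<alpha> t x = Some y" "\<alpha> s y = Some z" for s t x y z
    proof -
      have "(\<alpha> s \<cdot>\<^bsub>PAut B\<^esub> \<alpha> t) x = Some z" using st by (auto simp: B.PAut_mult_Some)
      then obtain u where u: "(\<alpha> (inv_of S t) \<cdot>\<^bsub>PAut B\<^esub> \<alpha> t) x = Some u" "\<alpha> (s \<cdot>\<^bsub>S\<^esub> t) u = Some z"
        unfolding P.pi_mult[OF st(1,2)] by (auto simp: B.PAut_mult_Some)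
      then have "u = x" using inv[OF st(2,3)] st(3) by (auto simp: B.PAut_mult_Some)
      then show ?thesis using u by simp
    qed
    show "\<alpha> t x = Some y" if st: "nat_le S s t" "\<alpha> s x = Some y" for s t x y
    proof -
      obtain e where e: "e \<in> idempotents S" "t \<in> elts S" "s = t \<cdot>\<^bsub>S\<^esub> e" using st by (auto simp: nat_le_def)
      then have "(\<alpha> t \<cdot>\<^bsub>PAut B\<^esub> \<alpha> e) x = Some y" using st by (simp add: P.pi_mult_idempotent)
      then show ?thesis using idem[OF e(1)] by (auto simp: B.PAut_mult_Some)
    qed
  qed (use inv idem in auto)
qed

section \<open>Pure states on ideals\<close>

text \<open>Approximate units are filters, so limits along them come from the Cauchy criterion for
  filters and completeness of the complex numbers.\<close>

lemma filter_limit_exists: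
  fixes f :: "'a \<Rightarrow> complex"
  assumes "F \<noteq> bot" "\<And>e. e > 0 \<Longrightarrow> \<exists>c. \<forall>\<^sub>F x in F. dist (f x) c < e"
  shows "\<exists>l. (f \<longlongrightarrow> l) F"
proof -
  have "cauchy_filter (filtermap f F)"
    unfolding cauchy_filter_metric_filtermap
  proof (intro allI impI)
    fix e :: real assume e: "e > 0"
    obtain c where "\<forall>\<^sub>F x in F. dist (f x) c < e / 2" using assms(2)[of "e / 2"] e by auto
    moreover have "dist (f x) (f y) < e" if "dist (f x) c < e / 2" "dist (f y) c < e / 2" for x y
      using dist_triangle2[of "f x" "f y" c] that by simp
    ultimately show "\<exists>P. eventually P F \<and> (\<forall>x y. P x \<and> P y \<longrightarrow> dist (f x) (f y) < e)" by blast
  qed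
  moreover have "filtermap f F \<noteq> bot" using assms(1) by (simp add: filtermap_bot_iff)
  ultimately show ?thesis
    using complete_uniform[where S = "UNIV :: complex set"] complete_UNIV
    by (force simp: filterlim_def)
qed

lemma tendsto_if_norm_le:
  fixes f :: "'a \<Rightarrow> complex"
  assumes "(g \<longlongrightarrow> 0) F" "\<forall>\<^sub>F x in F. cmod (f x - l) \<le> K * g x"
  shows "(f \<longlongrightarrow> l) F"
proof -
  have "((\<lambda>x. K * g x) \<longlongrightarrow> 0) F" using tendsto_mult_right_zero[OF assms(1)] by simp
  then have "((\<lambda>x. f x - l) \<longlongrightarrow> 0) F" by (rule Lim_null_comparison[OF assms(2)])
  then show ?thesis using Lim_null by blast
qed

lemma linear_functionalD:
  assumes "linear_functional V \<phi>"
  shows "\<lbrakk>x \<in> carrier V; y \<in> carrier V\<rbrakk> \<Longrightarrow> \<phi> (x \<oplus>\<^bsub>V\<^esub> y) = \<phi> x + \<phi> y"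
    "x \<in> carrier V \<Longrightarrow> \<phi> (c \<odot>\<^bsub>V\<^esub> x) = c * \<phi> x"
  using assms by (auto simp: linear_functional_def)

section \<open>Positive functionals and states\<close>

context cstar_algebra
begin

lemma linear_functional_minus:
  "\<lbrakk>linear_functional A \<phi>; x \<in> carrier A; y \<in> carrier A\<rbrakk> \<Longrightarrow> \<phi> (x \<ominus> y) = \<phi> x - \<phi> y"
  by (simp add: vminus_def linear_functionalD)

lemma positive_functional_square:
  "\<lbrakk>positive_functional A \<phi>; x \<in> carrier A\<rbrakk> \<Longrightarrow> \<phi> (adj A x \<otimes> x) \<in> \<real>\<^sub>\<ge>\<^sub>0"
  by (auto simp: positive_functional_def positive_elements_def)

text \<open>Polarisation: the mixed terms have vanishing imaginary part at \<open>c = 1\<close> and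
  at \<open>c = \<i>\<close>, and the two equations determine the conjugate.\<close>

lemma positive_functional_hermitian:
  assumes \<phi>: "positive_functional A \<phi>" and x: "x \<in> carrier A" and y: "y \<in> carrier A"
  shows "\<phi> (adj A y \<otimes> x) = cnj (\<phi> (adj A x \<otimes> y))"
proof -
  have l: "linear_functional A \<phi>" using \<phi> by (simp add: positive_functional_def)
  have *: "\<phi> (adj A (x \<oplus> c \<odot> y) \<otimes> (x \<oplus> c \<odot> y)) =
      \<phi> (adj A x \<otimes> x) + c * \<phi> (adj A x \<otimes> y) + cnj c * \<phi> (adj A y \<otimes> x) + cnj c * c * \<phi> (adj A y \<otimes> y)" for c
    using x y by (simp add: adj_add adj_scale mult_add_left mult_add_right mult_scale_left
        mult_scale_right linear_functionalD[OF l] algebra_simps)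
  have i: "Im (c * \<phi> (adj A x \<otimes> y) + cnj c * \<phi> (adj A y \<otimes> x)) = 0" if "cnj c * c = 1" for c
    using positive_functional_square[OF \<phi>, of "x \<oplus> c \<odot> y"] positive_functional_square[OF \<phi> x]
      positive_functional_square[OF \<phi> y] x y
    unfolding * that by (simp add: complex_nonneg_Reals_iff)
  show ?thesis using i[of 1] i[of \<i>] by (simp add: complex_eq_iff)
qed

lemma Cauchy_Schwarz:
  assumes \<phi>: "positive_functional A \<phi>" and x: "x \<in> carrier A" and y: "y \<in> carrier A"
  shows "(cmod (\<phi> (adj A x \<otimes> y)))\<^sup>2 \<le> Re (\<phi> (adj A x \<otimes> x)) * Re (\<phi> (adj A y \<otimes> y))"
proof -
  have l: "linear_functional A \<phi>" using \<phi> by (simp add: positive_functional_def)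
  define s where "s = \<phi> (adj A x \<otimes> y)"
  define a where "a = Re (\<phi> (adj A x \<otimes> x))"
  define b where "b = Re (\<phi> (adj A y \<otimes> y))"
  have b: "0 \<le> b" using positive_functional_square[OF \<phi> y] by (simp add: b_def complex_nonneg_Reals_iff)
  have q: "0 \<le> a + 2 * t * (cmod s)\<^sup>2 + t\<^sup>2 * (cmod s)\<^sup>2 * b" for t :: real
  proof -
    \<comment> \<open>The factor \<open>cnj s\<close> makes both mixed terms real and equal, leaving
      a real quadratic form in \<open>t\<close>.\<close>
    let ?c = "of_real t * cnj s"
    have "\<phi> (adj A (x \<oplus> ?c \<odot> y) \<otimes> (x \<oplus> ?c \<odot> y)) =
      \<phi> (adj A x \<otimes> x) + ?c * s + cnj ?c * cnj s + cnj ?c * ?c * \<phi> (adj A y \<otimes> y)"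
      using x y positive_functional_hermitian[OF \<phi> x y]
      by (simp add: adj_add adj_scale mult_add_left mult_add_right mult_scale_left
          mult_scale_right linear_functionalD[OF l] algebra_simps s_def)
    moreover have "Re (?c * s + cnj ?c * cnj s) = 2 * t * (cmod s)\<^sup>2"
      unfolding cmod_power2 by (simp add: power2_eq_square algebra_simps)
    moreover have "cnj ?c * ?c = of_real (t\<^sup>2 * (cmod s)\<^sup>2)"
      unfolding cmod_power2 by (simp add: complex_eq_iff power2_eq_square algebra_simps)
    ultimately have "Re (\<phi> (adj A (x \<oplus> ?c \<odot> y) \<otimes> (x \<oplus> ?c \<odot> y))) = a + 2 * t * (cmod s)\<^sup>2 + t\<^sup>2 * (cmod s)\<^sup>2 * b"
      by (simp add: a_def b_def)
    then show ?thesis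
      using positive_functional_square[OF \<phi>, of "x \<oplus> ?c \<odot> y"] x y by (simp add: complex_nonneg_Reals_iff)
  qed
  have "(cmod s)\<^sup>2 \<le> a * b"
  proof (cases "b = 0")
    case True
    \<comment> \<open>For \<open>b = 0\<close> the form is affine in \<open>t\<close> and would
      become negative at \<open>t = - (\<bar>a\<bar> + 1) / (cmod s)\<^sup>2\<close>.\<close>
    have "(cmod s)\<^sup>2 = 0"
    proof (rule ccontr)
      assume "(cmod s)\<^sup>2 \<noteq> 0"
      then have "- (\<bar>a\<bar> + 1) / (cmod s)\<^sup>2 * (cmod s)\<^sup>2 = - (\<bar>a\<bar> + 1)" by (rule nonzero_eq_divide_eq[THEN iffD1, OF _ HOL.refl])
      then have "0 \<le> a + 2 * - (\<bar>a\<bar> + 1)"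
        using q[of "- (\<bar>a\<bar> + 1) / (cmod s)\<^sup>2"] True by (simp only: mult.assoc mult_zero_right add_0_right)
      then have "2 * (\<bar>a\<bar> + 1) \<le> a" by simp
      then show False using abs_ge_self[of a] abs_ge_zero[of a] by argo
    qed
    then show ?thesis using True by simp
  next
    case False
    then have "b > 0" using b by simp
    have "0 \<le> a - (cmod s)\<^sup>2 / b"
      using q[of "- 1 / b"] \<open>b > 0\<close> by (simp add: field_simps power2_eq_square)
    then show ?thesis using \<open>b > 0\<close> by (simp add: field_simps)
  qed
  then show ?thesis by (simp add: s_def a_def b_def)
qed

lemma state_bound:
  assumes "is_state A \<phi>" "x \<in> carrier A"
  shows "cmod (\<phi> x) \<le> vnorm A x"
proof -
  let ?S = "{cmod (\<phi> x) | x. x \<in> carrier A \<and> vnorm A x \<le> 1}"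
  have l: "linear_functional A \<phi>" and S: "bdd_above ?S" "Sup ?S = 1"
    using assms by (auto simp: is_state_def positive_functional_def)
  have one: "cmod (\<phi> y) \<le> 1" if "y \<in> carrier A" "vnorm A y \<le> 1" for y
    using cSup_upper[OF _ S(1), of "cmod (\<phi> y)"] that S(2) by auto
  show ?thesis
  proof (cases "vnorm A x = 0")
    case True
    then have "x = \<zero>" using assms by (simp add: norm_eq_zero)
    then show ?thesis using linear_functionalD(2)[OF l, of x 0] assms by simp
  next
    case False
    then have n: "vnorm A x > 0" using norm_nonneg[OF assms(2)] by linarith
    have "cmod (\<phi> (complex_of_real (1 / vnorm A x) \<odot> x)) \<le> 1"
      using assms n by (intro one) (simp_all add: norm_scale norm_divide)
    then show ?thesis
      using assms n by (simp add: linear_functionalD(2)[OF l] norm_mult norm_divide field_simps)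
  qed
qed

end

text \<open>By \<open>ideal\<close>, the closure of the image of \<open>\<theta>\<close> is a closed ideal of \<open>A\<close>.\<close>

locale pure_state_on_ideal = A: cstar_algebra A + D: cstar_algebra D
  for A :: "'a star_algebra" (structure) and D :: "'d star_algebra" +
  fixes \<theta> :: "'d \<Rightarrow> 'a" and \<phi> :: "'a \<Rightarrow> complex" and F :: "'d filter"
  assumes hom: "star_hom D A \<theta>"
    and pure: "pure_state A \<phi>"
    and unit: "approximate_unit D F"
    and ideal: "\<lbrakk>b \<in> carrier A; d \<in> carrier D; \<epsilon> > 0\<rbrakk> \<Longrightarrow>
      \<exists>d' \<in> carrier D. vnorm A (b \<otimes> \<theta> d \<ominus> \<theta> d') < \<epsilon>"
    and nonzero: "\<exists>d \<in> carrier D. \<phi> (\<theta> d) \<noteq> 0"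
begin

lemmas \<theta> = star_homD[OF hom]

lemma \<theta>_minus: "\<lbrakk>x \<in> carrier D; y \<in> carrier D\<rbrakk> \<Longrightarrow> \<theta> (x \<ominus>\<^bsub>D\<^esub> y) = \<theta> x \<ominus> \<theta> y"
  by (simp add: vminus_def \<theta>)

lemma \<theta>_norm: "x \<in> carrier D \<Longrightarrow> vnorm A (\<theta> x) \<le> vnorm D x"
  by (rule star_hom_contractive[OF D.cstar_algebra_axioms A.cstar_algebra_axioms hom])

lemma state: "is_state A \<phi>" using pure by (simp add: pure_state_def)

lemma positive: "positive_functional A \<phi>" using state by (simp add: is_state_def)

lemma linear: "linear_functional A \<phi>" using positive by (simp add: positive_functional_def)

lemmas bound = A.state_bound[OF state]
lemmas \<phi>_simps = linear_functionalD[OF linear] A.linear_functional_minus[OF linear]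

lemma \<phi>\<theta>_bound: "x \<in> carrier D \<Longrightarrow> cmod (\<phi> (\<theta> x)) \<le> vnorm D x"
  using bound[of "\<theta> x"] \<theta>_norm[of x] \<theta>(1)[of x] by simp

definition good :: "'d \<Rightarrow> bool" where
  "good u \<longleftrightarrow> u \<in> carrier D \<and> vnorm D u \<le> 1 \<and> (\<exists>y \<in> carrier D. u = adj D y \<otimes>\<^bsub>D\<^esub> y)"

definition q :: "'d \<Rightarrow> real" where "q u = Re (\<phi> (\<theta> u))"

text \<open>The norm of the restriction of \<open>\<phi>\<close> to the ideal. Only its positivity
  is available at the start; its value \<open>1\<close> comes after \<open>\<phi>\<close> has been
  compared with its compression.\<close>

definition L :: real where "L = (SUP d \<in> {d \<in> carrier D. vnorm D d \<le> 1}. cmod (\<phi> (\<theta> d)))"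

lemma F_nontrivial: "F \<noteq> bot" using unit by (simp add: approximate_unit_def)

lemma eventually_good: "\<forall>\<^sub>F u in F. good u"
  using unit unfolding approximate_unit_def good_def positive_elements_def
  by (elim conjE) (erule eventually_mono, auto)

lemma unit_left: "d \<in> carrier D \<Longrightarrow> ((\<lambda>u. vnorm D (u \<otimes>\<^bsub>D\<^esub> d \<ominus>\<^bsub>D\<^esub> d)) \<longlongrightarrow> 0) F"
  and unit_right: "d \<in> carrier D \<Longrightarrow> ((\<lambda>u. vnorm D (d \<otimes>\<^bsub>D\<^esub> u \<ominus>\<^bsub>D\<^esub> d)) \<longlongrightarrow> 0) F"
  using unit by (auto simp: approximate_unit_def)

lemma goodD:
  assumes "good u"
  shows "u \<in> carrier D" "vnorm D u \<le> 1" "adj D u = u" "\<theta> u \<in> carrier A" "adj A (\<theta> u) = \<theta> u"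
    "vnorm A (\<theta> u) \<le> 1" "\<phi> (\<theta> u) = of_real (q u)" "0 \<le> q u"
proof -
  obtain y where y: "y \<in> carrier D" "u = adj D y \<otimes>\<^bsub>D\<^esub> y" using assms by (auto simp: good_def)
  show u: "u \<in> carrier D" "vnorm D u \<le> 1" using assms by (auto simp: good_def)
  show a: "adj D u = u" using y by (simp add: D.adj_mult)
  show "\<theta> u \<in> carrier A" "adj A (\<theta> u) = \<theta> u" using u a \<theta>(1) by (simp_all flip: \<theta>(5))
  show "vnorm A (\<theta> u) \<le> 1" using \<theta>_norm[OF u(1)] u(2) by simp
  have "\<phi> (\<theta> u) \<in> \<real>\<^sub>\<ge>\<^sub>0"
    using A.positive_functional_square[OF positive \<theta>(1)[OF y(1)]] y by (simp add: \<theta>)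
  then show "\<phi> (\<theta> u) = of_real (q u)" "0 \<le> q u"
    by (simp_all add: q_def complex_nonneg_Reals_iff complex_eq_iff)
qed

lemma L_upper: "\<lbrakk>d \<in> carrier D; vnorm D d \<le> 1\<rbrakk> \<Longrightarrow> cmod (\<phi> (\<theta> d)) \<le> L"
  unfolding L_def
  by (rule cSUP_upper) (auto intro!: bdd_aboveI[of _ 1] dest!: \<phi>\<theta>_bound)

lemma L_pos: "0 < L"
proof -
  obtain d where d: "d \<in> carrier D" "\<phi> (\<theta> d) \<noteq> 0" using nonzero by blast
  have n: "vnorm D d > 0" using \<phi>\<theta>_bound[OF d(1)] d(2) by (smt (verit) zero_less_norm_iff)
  let ?c = "complex_of_real (1 / vnorm D d)"
  have "cmod (\<phi> (\<theta> (?c \<odot>\<^bsub>D\<^esub> d))) \<le> L"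
    using d n by (intro L_upper) (simp_all add: D.norm_scale norm_divide)
  moreover have "0 < cmod (\<phi> (\<theta> (?c \<odot>\<^bsub>D\<^esub> d)))"
    using d n \<theta>(1) by (simp add: \<theta> \<phi>_simps)
  ultimately show ?thesis by linarith
qed

lemma q_le_L: "good u \<Longrightarrow> q u \<le> L"
  using L_upper[of u] goodD[of u] by simp

lemma good_square: "good u \<Longrightarrow> Re (\<phi> (\<theta> (u \<otimes>\<^bsub>D\<^esub> u))) \<le> L"
  using L_upper[of "u \<otimes>\<^bsub>D\<^esub> u"] goodD(1,2)[of u] D.norm_mult[of u u] complex_Re_le_cmod[of "\<phi> (\<theta> (u \<otimes>\<^bsub>D\<^esub> u))"]
    mult_mono[of "vnorm D u" 1 "vnorm D u" 1] by auto

text \<open>Take \<open>j\<close> in the unit ball with \<open>\<phi> (\<theta> j)\<close> almost of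
  modulus \<open>L\<close>. For late \<open>u\<close> the product of \<open>j\<close> and
  \<open>u\<close> is near \<open>j\<close>, and Cauchy-Schwarz with
  \<open>u = adj D y \<otimes> y\<close> bounds the squared value at that product by
  \<open>L * q u\<close>.\<close>

lemma q_tendsto: "(q \<longlongrightarrow> L) F"
proof (rule tendstoI)
  fix e :: real assume e: "e > 0"
  \<comment> \<open>Two demands are met: \<open>2 * \<delta> < e\<close> for the final estimate, and
    \<open>\<delta> < L\<close> so that squaring \<open>L - \<delta>\<close> preserves
    inequalities.\<close>
  define \<delta> where "\<delta> = min (e / 2) L / 2"
  have \<delta>: "0 < \<delta>" "2 * \<delta> < e" "\<delta> < L" using e L_pos by (auto simp: \<delta>_def min_def)
  have "\<exists>d \<in> {d \<in> carrier D. vnorm D d \<le> 1}. L - \<delta> < cmod (\<phi> (\<theta> d))"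
  proof (rule ccontr)
    assume "\<not> ?thesis"
    then have "L \<le> L - \<delta>" unfolding L_def
      by (intro cSUP_least) (auto intro!: exI[of _ "\<zero>\<^bsub>D\<^esub>"] simp: not_less L_def[symmetric])
    then show False using \<delta> by simp
  qed
  then obtain j where j: "j \<in> carrier D" "vnorm D j \<le> 1" "L - \<delta> < cmod (\<phi> (\<theta> j))" by auto
  have "\<forall>\<^sub>F u in F. vnorm D (j \<otimes>\<^bsub>D\<^esub> u \<ominus>\<^bsub>D\<^esub> j) < cmod (\<phi> (\<theta> j)) - (L - \<delta>)"
    using unit_right[OF j(1)] j(3) by (intro order_tendstoD) auto
  with eventually_good show "\<forall>\<^sub>F u in F. dist (q u) L < e"
  proof eventually_elim
    case (elim u)
    note u = goodD[OF elim(1)]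
    obtain y where y: "y \<in> carrier D" "u = adj D y \<otimes>\<^bsub>D\<^esub> y" using elim by (auto simp: good_def)
    have "cmod (\<phi> (\<theta> (j \<otimes>\<^bsub>D\<^esub> u)) - \<phi> (\<theta> j)) \<le> vnorm D (j \<otimes>\<^bsub>D\<^esub> u \<ominus>\<^bsub>D\<^esub> j)"
      using \<phi>\<theta>_bound[of "j \<otimes>\<^bsub>D\<^esub> u \<ominus>\<^bsub>D\<^esub> j"] j(1) u(1) \<theta>(1) by (simp add: \<theta>_minus \<phi>_simps)
    then have 1: "L - \<delta> < cmod (\<phi> (\<theta> (j \<otimes>\<^bsub>D\<^esub> u)))"
      using elim(2) norm_triangle_ineq2[of "\<phi> (\<theta> j)" "\<phi> (\<theta> (j \<otimes>\<^bsub>D\<^esub> u))"]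
      by (simp add: norm_minus_commute)
    let ?a = "\<theta> (y \<otimes>\<^bsub>D\<^esub> adj D j)"
    have aa: "adj A ?a \<otimes> \<theta> y = \<theta> (j \<otimes>\<^bsub>D\<^esub> u)" "adj A ?a \<otimes> ?a = \<theta> (j \<otimes>\<^bsub>D\<^esub> u \<otimes>\<^bsub>D\<^esub> adj D j)"
      "adj A (\<theta> y) \<otimes> \<theta> y = \<theta> u"
      using y j(1) by (simp_all add: D.adj_mult D.mult_assoc flip: \<theta>(4,5))
    have "vnorm D (j \<otimes>\<^bsub>D\<^esub> u \<otimes>\<^bsub>D\<^esub> adj D j) \<le> 1"
      using D.norm_mult[of "j \<otimes>\<^bsub>D\<^esub> u" "adj D j"] D.norm_mult[of j u] j u
        mult_mono[of "vnorm D j" 1 "vnorm D u" 1] mult_mono[of "vnorm D (j \<otimes>\<^bsub>D\<^esub> u)" 1 "vnorm D j" 1]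
      by simp
    then have "Re (\<phi> (adj A ?a \<otimes> ?a)) \<le> L"
      unfolding aa using L_upper[of "j \<otimes>\<^bsub>D\<^esub> u \<otimes>\<^bsub>D\<^esub> adj D j"] j u
        complex_Re_le_cmod[of "\<phi> (\<theta> (j \<otimes>\<^bsub>D\<^esub> u \<otimes>\<^bsub>D\<^esub> adj D j))"] by simp
    then have "(cmod (\<phi> (\<theta> (j \<otimes>\<^bsub>D\<^esub> u))))\<^sup>2 \<le> L * q u"
      using A.Cauchy_Schwarz[OF positive, of ?a "\<theta> y"] y j(1) \<theta>(1) u(8)
        mult_right_mono[of "Re (\<phi> (adj A ?a \<otimes> ?a))" L "q u"] unfolding aa by (simp add: q_def)
    moreover have "(L - \<delta>)\<^sup>2 \<le> (cmod (\<phi> (\<theta> (j \<otimes>\<^bsub>D\<^esub> u))))\<^sup>2" using 1 \<delta> by (intro power_mono) auto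
    moreover have "L * (L - 2 * \<delta>) \<le> (L - \<delta>)\<^sup>2" by (simp add: power2_eq_square algebra_simps)
    ultimately have "L * (L - 2 * \<delta>) \<le> L * q u" by linarith
    then have "L - 2 * \<delta> \<le> q u" using L_pos by simp
    then show ?case using q_le_L[OF elim(1)] \<delta> by (simp add: dist_real_def)
  qed
qed

text \<open>Expanding the square, the diagonal terms are at most \<open>L\<close> each, and the
  mixed terms tend to \<open>q v\<close> along the unit. So good elements with \<open>q v\<close>
  near \<open>L\<close> are close to the tail of the unit in the GNS seminorm.\<close>

lemma eventually_close:
  assumes v: "good v" and e: "e > 0"
  shows "\<forall>\<^sub>F u in F. good u \<and> Re (\<phi> (adj A (\<theta> u \<ominus> \<theta> v) \<otimes> (\<theta> u \<ominus> \<theta> v))) \<le> 2 * (L - q v) + e"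
proof -
  note vD = goodD[OF v]
  have "\<forall>\<^sub>F u in F. vnorm D (u \<otimes>\<^bsub>D\<^esub> v \<ominus>\<^bsub>D\<^esub> v) < e / 2" "\<forall>\<^sub>F u in F. vnorm D (v \<otimes>\<^bsub>D\<^esub> u \<ominus>\<^bsub>D\<^esub> v) < e / 2"
    using order_tendstoD(2)[OF unit_left[OF vD(1)], of "e / 2"]
      order_tendstoD(2)[OF unit_right[OF vD(1)], of "e / 2"] e by simp_all
  with eventually_good show ?thesis
  proof eventually_elim
    case (elim u)
    note uD = goodD[OF elim(1)]
    have eq: "\<phi> (adj A (\<theta> u \<ominus> \<theta> v) \<otimes> (\<theta> u \<ominus> \<theta> v))
      = \<phi> (\<theta> (u \<otimes>\<^bsub>D\<^esub> u)) - \<phi> (\<theta> (u \<otimes>\<^bsub>D\<^esub> v)) - \<phi> (\<theta> (v \<otimes>\<^bsub>D\<^esub> u)) + \<phi> (\<theta> (v \<otimes>\<^bsub>D\<^esub> v))"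
      using uD(1,4,5) vD(1,4,5)
      by (simp add: A.adj_minus A.mult_minus_left A.mult_minus_right \<phi>_simps \<theta>)
    have 1: "\<bar>Re (\<phi> (\<theta> (u \<otimes>\<^bsub>D\<^esub> v))) - q v\<bar> < e / 2"
    proof -
      have "cmod (\<phi> (\<theta> (u \<otimes>\<^bsub>D\<^esub> v)) - \<phi> (\<theta> v)) < e / 2"
        using \<phi>\<theta>_bound[of "u \<otimes>\<^bsub>D\<^esub> v \<ominus>\<^bsub>D\<^esub> v"] elim(2) uD(1) vD(1) \<theta>(1) by (simp add: \<theta>_minus \<phi>_simps)
      then show ?thesis
        using abs_Re_le_cmod[of "\<phi> (\<theta> (u \<otimes>\<^bsub>D\<^esub> v)) - \<phi> (\<theta> v)"] by (simp add: q_def)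
    qed
    have 2: "\<bar>Re (\<phi> (\<theta> (v \<otimes>\<^bsub>D\<^esub> u))) - q v\<bar> < e / 2"
    proof -
      have "cmod (\<phi> (\<theta> (v \<otimes>\<^bsub>D\<^esub> u)) - \<phi> (\<theta> v)) < e / 2"
        using \<phi>\<theta>_bound[of "v \<otimes>\<^bsub>D\<^esub> u \<ominus>\<^bsub>D\<^esub> v"] elim(3) uD(1) vD(1) \<theta>(1) by (simp add: \<theta>_minus \<phi>_simps)
      then show ?thesis
        using abs_Re_le_cmod[of "\<phi> (\<theta> (v \<otimes>\<^bsub>D\<^esub> u)) - \<phi> (\<theta> v)"] by (simp add: q_def)
    qed
    show ?case
      using elim(1) 1 2 good_square[OF elim(1)] good_square[OF v]
      unfolding eq by (simp, linarith)
  qed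
qed

lemma eventually_close_mult:
  assumes b: "b \<in> carrier A" and v: "good v" and e: "e > 0"
  shows "\<forall>\<^sub>F u in F. good u \<and>
    (cmod (\<phi> (b \<otimes> \<theta> u) - \<phi> (b \<otimes> \<theta> v)))\<^sup>2 \<le> (vnorm A b)\<^sup>2 * (2 * (L - q v) + e)"
  using eventually_close[OF v e]
proof eventually_elim
  case (elim u)
  let ?d = "\<theta> u \<ominus> \<theta> v"
  have uv: "\<theta> u \<in> carrier A" "\<theta> v \<in> carrier A" using elim v goodD(4) by auto
  have "(cmod (\<phi> (adj A (adj A b) \<otimes> ?d)))\<^sup>2 \<le> Re (\<phi> (b \<otimes> adj A b)) * Re (\<phi> (adj A ?d \<otimes> ?d))"
    using A.Cauchy_Schwarz[OF positive, of "adj A b" ?d] b uv by simp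
  also have "\<dots> \<le> (vnorm A b)\<^sup>2 * (2 * (L - q v) + e)"
  proof (rule mult_mono)
    show "Re (\<phi> (b \<otimes> adj A b)) \<le> (vnorm A b)\<^sup>2"
      using bound[of "b \<otimes> adj A b"] complex_Re_le_cmod[of "\<phi> (b \<otimes> adj A b)"] b
      by (simp add: A.cstar_identity')
    show "0 \<le> Re (\<phi> (adj A ?d \<otimes> ?d))"
      using A.positive_functional_square[OF positive, of ?d] uv by (simp add: complex_nonneg_Reals_iff)
  qed (use elim in auto)
  finally show ?case using elim b uv by (simp add: A.mult_minus_right \<phi>_simps)
qed

lemma good_close_to_L:
  assumes "e > 0"
  obtains v where "good v" "L - q v < e"
proof -
  have "\<forall>\<^sub>F u in F. good u \<and> L - e < q u"
    using eventually_good order_tendstoD(1)[OF q_tendsto, of "L - e"] assms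
    by (simp add: eventually_conj_iff)
  then obtain v where "good v" "L - e < q v"
    using eventually_happens'[OF F_nontrivial] by blast
  then show ?thesis using that[of v] by simp
qed

lemma limit_exists:
  assumes b: "b \<in> carrier A"
  shows "\<exists>l. ((\<lambda>u. \<phi> (b \<otimes> \<theta> u)) \<longlongrightarrow> l) F"
proof (rule filter_limit_exists[OF F_nontrivial])
  fix e :: real assume e: "e > 0"
  \<comment> \<open>With \<open>L - q v < d\<close> the bound of
    \<open>eventually_close_mult\<close> is below \<open>3 * d\<close> times the squared norm of
    \<open>b\<close>; the constant \<open>4\<close> and the added \<open>1\<close> make this
    strictly less than \<open>e\<^sup>2\<close>.\<close>
  define d where "d = e\<^sup>2 / (4 * ((vnorm A b)\<^sup>2 + 1))"
  have d: "d > 0" using e by (simp add: d_def add_nonneg_pos)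
  obtain v where v: "good v" "L - q v < d" using good_close_to_L[OF d] .
  have "\<forall>\<^sub>F u in F. dist (\<phi> (b \<otimes> \<theta> u)) (\<phi> (b \<otimes> \<theta> v)) < e"
    using eventually_close_mult[OF b v(1) d]
  proof eventually_elim
    case (elim u)
    have "(vnorm A b)\<^sup>2 * (2 * (L - q v) + d) \<le> (vnorm A b)\<^sup>2 * (3 * d)"
      using v by (intro mult_left_mono) auto
    also have "\<dots> < ((vnorm A b)\<^sup>2 + 1) * (4 * d)"
      using d by (intro mult_strict_mono'[of "(vnorm A b)\<^sup>2"]) simp_all
    also have "\<dots> = e\<^sup>2"
    proof -
      have "K * (4 * (x / (4 * K))) = x" if "K > 0" for K x :: real using that by simp
      from this[of "(vnorm A b)\<^sup>2 + 1" "e\<^sup>2"] show ?thesis by (simp only: d_def) (simp add: add_nonneg_pos)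
    qed
    finally have "(cmod (\<phi> (b \<otimes> \<theta> u) - \<phi> (b \<otimes> \<theta> v)))\<^sup>2 < e\<^sup>2" using elim by simp
    then have "cmod (\<phi> (b \<otimes> \<theta> u) - \<phi> (b \<otimes> \<theta> v)) < e" by (rule power2_less_imp_less) (use e in simp)
    then show ?case by (simp add: dist_norm)
  qed
  then show "\<exists>c. \<forall>\<^sub>F u in F. dist (\<phi> (b \<otimes> \<theta> u)) c < e" by blast
qed

text \<open>The compression of \<open>\<phi>\<close> to the ideal, in its one-sided form, which is
  visibly linear in \<open>b\<close>. Positivity needs the two-sided form supplied by
  \<open>tendsto_compress\<close>.\<close>

definition \<rho> :: "'a \<Rightarrow> complex" where "\<rho> b = Lim F (\<lambda>u. \<phi> (b \<otimes> \<theta> u))"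

lemma tendsto_\<rho>: "b \<in> carrier A \<Longrightarrow> ((\<lambda>u. \<phi> (b \<otimes> \<theta> u)) \<longlongrightarrow> \<rho> b) F"
  unfolding \<rho>_def using limit_exists[of b] tendsto_Lim[OF F_nontrivial] by metis

lemma \<rho>_eqI: "\<lbrakk>b \<in> carrier A; ((\<lambda>u. \<phi> (b \<otimes> \<theta> u)) \<longlongrightarrow> l) F\<rbrakk> \<Longrightarrow> \<rho> b = l"
  using tendsto_unique[OF F_nontrivial tendsto_\<rho>] by blast

text \<open>The approximate unit is a unit for \<open>D\<close> only. By \<open>ideal\<close>, the
  product of \<open>b\<close> and \<open>\<theta> d\<close> is close to some
  \<open>\<theta> d'\<close>, on which \<open>u\<close> acts as a left unit in the limit.\<close>

lemma tendsto_\<theta>_mult: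
  assumes "b \<in> carrier A" "d \<in> carrier D"
  shows "((\<lambda>u. \<phi> (\<theta> u \<otimes> (b \<otimes> \<theta> d))) \<longlongrightarrow> \<phi> (b \<otimes> \<theta> d)) F"
proof (rule tendstoI)
  fix e :: real assume e: "e > 0"
  let ?x = "b \<otimes> \<theta> d"
  obtain d' where d': "d' \<in> carrier D" "vnorm A (?x \<ominus> \<theta> d') < e / 3"
    using ideal[OF assms, of "e / 3"] e by auto
  have x: "?x \<in> carrier A" "\<theta> d' \<in> carrier A" using assms d' \<theta>(1) by auto
  have "\<forall>\<^sub>F u in F. vnorm D (u \<otimes>\<^bsub>D\<^esub> d' \<ominus>\<^bsub>D\<^esub> d') < e / 3"
    using order_tendstoD(2)[OF unit_left[OF d'(1)], of "e / 3"] e by simp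
  with eventually_good show "\<forall>\<^sub>F u in F. dist (\<phi> (\<theta> u \<otimes> ?x)) (\<phi> ?x) < e"
  proof eventually_elim
    case (elim u)
    note u = goodD[OF elim(1)]
    have m: "\<theta> u \<otimes> ?x \<in> carrier A" "\<theta> u \<otimes> \<theta> d' \<in> carrier A" using u x by auto
    have 1: "cmod (\<phi> (\<theta> u \<otimes> ?x) - \<phi> (\<theta> u \<otimes> \<theta> d')) < e / 3"
    proof -
      have "cmod (\<phi> (\<theta> u \<otimes> (?x \<ominus> \<theta> d'))) \<le> vnorm A (\<theta> u) * vnorm A (?x \<ominus> \<theta> d')"
        using bound[of "\<theta> u \<otimes> (?x \<ominus> \<theta> d')"] A.norm_mult[of "\<theta> u" "?x \<ominus> \<theta> d'"] u x by simp
      also have "\<dots> \<le> 1 * vnorm A (?x \<ominus> \<theta> d')" using u x by (intro mult_right_mono) simp_all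
      finally show ?thesis using d' u x m by (simp add: A.mult_minus_right \<phi>_simps)
    qed
    have 2: "cmod (\<phi> (\<theta> u \<otimes> \<theta> d') - \<phi> (\<theta> d')) < e / 3"
      using \<phi>\<theta>_bound[of "u \<otimes>\<^bsub>D\<^esub> d' \<ominus>\<^bsub>D\<^esub> d'"] elim(2) u(1,4) d'(1) x m by (simp add: \<theta>_minus \<phi>_simps \<theta>(4))
    have 3: "cmod (\<phi> ?x - \<phi> (\<theta> d')) < e / 3"
      using bound[of "?x \<ominus> \<theta> d'"] d'(2) x by (simp add: \<phi>_simps)
    show ?case using 1 2 3 unfolding dist_norm by norm
  qed
qed

text \<open>The difference between one- and two-sided compression is \<open>\<phi>\<close> of
  \<open>(1 - u) w u\<close>. Replacing the last \<open>u\<close> by a fixed good \<open>v\<close>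
  costs little in the GNS seminorm, and with \<open>v\<close> fixed the expression tends to
  \<open>0\<close> by \<open>tendsto_\<theta>_mult\<close>.\<close>

lemma tendsto_compress:
  assumes w: "w \<in> carrier A"
  shows "((\<lambda>u. \<phi> (\<theta> u \<otimes> (w \<otimes> \<theta> u))) \<longlongrightarrow> \<rho> w) F"
proof -
  have "((\<lambda>u. \<phi> (w \<otimes> \<theta> u) - \<phi> (\<theta> u \<otimes> (w \<otimes> \<theta> u))) \<longlongrightarrow> 0) F"
  proof (rule tendstoI)
    fix e :: real assume e: "e > 0"
    define K where "K = (2 * vnorm A w)\<^sup>2 + 1"
    have K: "K > 0" by (simp add: K_def add_nonneg_pos)
    define \<delta> where "\<delta> = (e / 2)\<^sup>2 / (4 * K)"
    have \<delta>: "\<delta> > 0" using e K by (simp add: \<delta>_def)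
    obtain v where v: "good v" "L - q v < \<delta>" using good_close_to_L[OF \<delta>] .
    note vD = goodD[OF v(1)]
    have "\<forall>\<^sub>F u in F. dist (\<phi> (\<theta> u \<otimes> (w \<otimes> \<theta> v))) (\<phi> (w \<otimes> \<theta> v)) < e / 2"
      using tendstoD[OF tendsto_\<theta>_mult[OF w vD(1)], of "e / 2"] e by simp
    with eventually_close[OF v(1) \<delta>]
    show "\<forall>\<^sub>F u in F. dist (\<phi> (w \<otimes> \<theta> u) - \<phi> (\<theta> u \<otimes> (w \<otimes> \<theta> u))) 0 < e"
    proof eventually_elim
      case (elim u)
      note u = goodD[OF conjunct1[OF elim(1)]]
      \<comment> \<open>The adjoint of \<open>?a\<close> is \<open>(1 - \<theta> u) w\<close>, so
        Cauchy-Schwarz for \<open>?a\<close> and \<open>?d\<close> estimates exactly the cost of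
        replacing \<open>u\<close> by \<open>v\<close>. The norm of \<open>?a\<close> is at most
        twice that of \<open>w\<close>, whence the constant \<open>K\<close>.\<close>
      let ?d = "\<theta> u \<ominus> \<theta> v" and ?a = "adj A w \<ominus> adj A w \<otimes> \<theta> u"
      have m: "?d \<in> carrier A" "?a \<in> carrier A" "w \<otimes> \<theta> u \<in> carrier A" "w \<otimes> \<theta> v \<in> carrier A"
        "\<theta> u \<otimes> (w \<otimes> \<theta> u) \<in> carrier A" "\<theta> u \<otimes> (w \<otimes> \<theta> v) \<in> carrier A"
        using u vD w by auto
      have ad: "adj A ?a \<otimes> ?d = ((w \<otimes> \<theta> u) \<ominus> (w \<otimes> \<theta> v)) \<ominus> ((\<theta> u \<otimes> (w \<otimes> \<theta> u)) \<ominus> (\<theta> u \<otimes> (w \<otimes> \<theta> v)))"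
        using u(4,5) vD(4) w
        by (simp add: A.adj_minus A.adj_mult A.mult_minus_left A.mult_minus_right A.mult_assoc)
          (simp add: A.expand, rule A.linear_identity4[of "w \<otimes> \<theta> u" "w \<otimes> \<theta> v"
            "\<theta> u \<otimes> (w \<otimes> \<theta> u)" "\<theta> u \<otimes> (w \<otimes> \<theta> v)"], simp_all)
      have "vnorm A ?a \<le> 2 * vnorm A w"
        using A.norm_minus_le[of "adj A w" "adj A w \<otimes> \<theta> u"] A.norm_mult[of "adj A w" "\<theta> u"] u w
          mult_left_mono[OF u(6), of "vnorm A w"] by simp
      then have "(vnorm A ?a)\<^sup>2 \<le> (2 * vnorm A w)\<^sup>2" using m by (intro power_mono) auto
      moreover have "Re (\<phi> (adj A ?a \<otimes> ?a)) \<le> (vnorm A ?a)\<^sup>2"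
        using bound[of "adj A ?a \<otimes> ?a"] complex_Re_le_cmod[of "\<phi> (adj A ?a \<otimes> ?a)"] m(2)
          A.cstar_identity[OF m(2)] by simp
      ultimately have a: "Re (\<phi> (adj A ?a \<otimes> ?a)) \<le> K" by (simp add: K_def)
      have d0: "0 \<le> Re (\<phi> (adj A ?d \<otimes> ?d))"
        using A.positive_functional_square[OF positive m(1)] by (simp add: complex_nonneg_Reals_iff)
      have "(cmod (\<phi> (adj A ?a \<otimes> ?d)))\<^sup>2 \<le> Re (\<phi> (adj A ?a \<otimes> ?a)) * Re (\<phi> (adj A ?d \<otimes> ?d))"
        using A.Cauchy_Schwarz[OF positive m(2,1)] .
      also have "\<dots> \<le> K * (2 * (L - q v) + \<delta>)"
        using elim(1) d0 K by (intro mult_mono a) auto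
      also have "\<dots> < K * (4 * \<delta>)" using v(2) \<delta> K by (intro mult_strict_left_mono) auto
      also have "\<dots> = (e / 2)\<^sup>2" using K by (simp add: \<delta>_def)
      finally have "cmod (\<phi> (adj A ?a \<otimes> ?d)) < e / 2" by (rule power2_less_imp_less) (use e in simp)
      moreover have "\<phi> (adj A ?a \<otimes> ?d)
          = (\<phi> (w \<otimes> \<theta> u) - \<phi> (w \<otimes> \<theta> v)) - (\<phi> (\<theta> u \<otimes> (w \<otimes> \<theta> u)) - \<phi> (\<theta> u \<otimes> (w \<otimes> \<theta> v)))"
        unfolding ad using m by (simp add: \<phi>_simps)
      then have "\<phi> (w \<otimes> \<theta> u) - \<phi> (\<theta> u \<otimes> (w \<otimes> \<theta> u))
          = \<phi> (adj A ?a \<otimes> ?d) - (\<phi> (\<theta> u \<otimes> (w \<otimes> \<theta> v)) - \<phi> (w \<otimes> \<theta> v))"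
        by (simp add: algebra_simps)
      then have "cmod (\<phi> (w \<otimes> \<theta> u) - \<phi> (\<theta> u \<otimes> (w \<otimes> \<theta> u)))
          \<le> cmod (\<phi> (adj A ?a \<otimes> ?d)) + cmod (\<phi> (\<theta> u \<otimes> (w \<otimes> \<theta> v)) - \<phi> (w \<otimes> \<theta> v))"
        using norm_triangle_ineq4 by metis
      ultimately show ?case using elim(2) unfolding dist_norm by simp
    qed
  qed
  from tendsto_diff[OF tendsto_\<rho>[OF w] this] show ?thesis by simp
qed

lemma \<rho>_linear: "linear_functional A \<rho>"
  unfolding linear_functional_def
proof (intro conjI ballI allI)
  have c: "\<forall>\<^sub>F u in F. \<theta> u \<in> carrier A" using eventually_good by eventually_elim (rule goodD(4))
  fix x y assume x: "x \<in> carrier A" and y: "y \<in> carrier A"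
  show "\<rho> (x \<oplus> y) = \<rho> x + \<rho> y"
  proof (rule \<rho>_eqI)
    have "((\<lambda>u. \<phi> (x \<otimes> \<theta> u) + \<phi> (y \<otimes> \<theta> u)) \<longlongrightarrow> \<rho> x + \<rho> y) F"
      by (intro tendsto_add tendsto_\<rho> x y)
    then show "((\<lambda>u. \<phi> ((x \<oplus> y) \<otimes> \<theta> u)) \<longlongrightarrow> \<rho> x + \<rho> y) F"
      by (rule Lim_transform_eventually)
        (use c in eventually_elim, simp add: x y A.mult_add_left \<phi>_simps)
  qed (use x y in simp)
next
  have c: "\<forall>\<^sub>F u in F. \<theta> u \<in> carrier A" using eventually_good by eventually_elim (rule goodD(4))
  fix k x assume x: "x \<in> carrier A"
  show "\<rho> (k \<odot> x) = k * \<rho> x"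
  proof (rule \<rho>_eqI)
    have "((\<lambda>u. k * \<phi> (x \<otimes> \<theta> u)) \<longlongrightarrow> k * \<rho> x) F"
      by (intro tendsto_mult_left tendsto_\<rho> x)
    then show "((\<lambda>u. \<phi> ((k \<odot> x) \<otimes> \<theta> u)) \<longlongrightarrow> k * \<rho> x) F"
      by (rule Lim_transform_eventually)
        (use c in eventually_elim, simp add: x A.mult_scale_left \<phi>_simps)
  qed (use x in simp)
qed

text \<open>The two values are limits of \<open>\<phi>\<close> on the squares of
  \<open>b \<otimes> \<theta> u\<close> and of \<open>b \<ominus> b \<otimes> \<theta> u\<close>. In
  the second limit the terms \<open>\<rho>\<close>, \<open>cnj \<rho>\<close> and
  \<open>\<rho>\<close> appear with signs \<open>-\<close>, \<open>-\<close> and \<open>+\<close>;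
  as \<open>\<rho>\<close> is real there, they leave \<open>\<phi> - \<rho>\<close>.\<close>

lemma \<rho>_square:
  assumes b: "b \<in> carrier A"
  shows "\<rho> (adj A b \<otimes> b) \<in> \<real>\<^sub>\<ge>\<^sub>0" "\<phi> (adj A b \<otimes> b) - \<rho> (adj A b \<otimes> b) \<in> \<real>\<^sub>\<ge>\<^sub>0"
proof -
  let ?w = "adj A b \<otimes> b"
  have w: "?w \<in> carrier A" using b by simp
  show pos: "\<rho> ?w \<in> \<real>\<^sub>\<ge>\<^sub>0"
  proof (rule Lim_in_closed_set[OF closed_nonneg_Reals_complex _ F_nontrivial tendsto_compress[OF w]])
    show "\<forall>\<^sub>F u in F. \<phi> (\<theta> u \<otimes> (?w \<otimes> \<theta> u)) \<in> \<real>\<^sub>\<ge>\<^sub>0"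
      using eventually_good
    proof eventually_elim
      case (elim u)
      have "adj A (b \<otimes> \<theta> u) \<otimes> (b \<otimes> \<theta> u) = \<theta> u \<otimes> (?w \<otimes> \<theta> u)"
        using b goodD(4,5)[OF elim] by (simp add: A.adj_mult A.mult_assoc)
      then show ?case
        using A.positive_functional_square[OF positive, of "b \<otimes> \<theta> u"] b goodD(4)[OF elim] by simp
    qed
  qed
  have lim: "((\<lambda>u. (\<phi> ?w - \<phi> (?w \<otimes> \<theta> u)) - (cnj (\<phi> (?w \<otimes> \<theta> u)) - \<phi> (\<theta> u \<otimes> (?w \<otimes> \<theta> u))))
      \<longlongrightarrow> (\<phi> ?w - \<rho> ?w) - (cnj (\<rho> ?w) - \<rho> ?w)) F"
    by (intro tendsto_diff tendsto_const tendsto_cnj tendsto_\<rho> tendsto_compress w)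
  have "(\<phi> ?w - \<rho> ?w) - (cnj (\<rho> ?w) - \<rho> ?w) \<in> \<real>\<^sub>\<ge>\<^sub>0"
  proof (rule Lim_in_closed_set[OF closed_nonneg_Reals_complex _ F_nontrivial lim])
    show "\<forall>\<^sub>F u in F. (\<phi> ?w - \<phi> (?w \<otimes> \<theta> u)) - (cnj (\<phi> (?w \<otimes> \<theta> u)) - \<phi> (\<theta> u \<otimes> (?w \<otimes> \<theta> u))) \<in> \<real>\<^sub>\<ge>\<^sub>0"
      using eventually_good
    proof eventually_elim
      case (elim u)
      note u = goodD(4,5)[OF elim]
      have "adj A (b \<ominus> b \<otimes> \<theta> u) \<otimes> (b \<ominus> b \<otimes> \<theta> u) = (?w \<ominus> ?w \<otimes> \<theta> u) \<ominus> (\<theta> u \<otimes> ?w \<ominus> \<theta> u \<otimes> (?w \<otimes> \<theta> u))"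
        using b u
        by (simp add: A.adj_minus A.adj_mult A.mult_minus_left A.mult_minus_right A.mult_assoc)
          (simp add: A.expand, rule A.linear_identity4[of "adj A b \<otimes> b" "adj A b \<otimes> (b \<otimes> \<theta> u)"
            "\<theta> u \<otimes> (adj A b \<otimes> b)" "\<theta> u \<otimes> (adj A b \<otimes> (b \<otimes> \<theta> u))"], simp_all)
      then have "\<phi> (adj A (b \<ominus> b \<otimes> \<theta> u) \<otimes> (b \<ominus> b \<otimes> \<theta> u))
        = (\<phi> ?w - \<phi> (?w \<otimes> \<theta> u)) - (\<phi> (\<theta> u \<otimes> ?w) - \<phi> (\<theta> u \<otimes> (?w \<otimes> \<theta> u)))"
        using w u by (simp add: \<phi>_simps)
      moreover have "\<phi> (\<theta> u \<otimes> ?w) = cnj (\<phi> (?w \<otimes> \<theta> u))"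
        using A.positive_functional_hermitian[OF positive w u(1)] u b by (simp add: A.adj_mult)
      ultimately show ?case
        using A.positive_functional_square[OF positive, of "b \<ominus> b \<otimes> \<theta> u"] b u by simp
    qed
  qed
  moreover have "cnj (\<rho> ?w) = \<rho> ?w" using pos by (simp add: complex_nonneg_Reals_iff complex_eq_iff)
  ultimately show "\<phi> ?w - \<rho> ?w \<in> \<real>\<^sub>\<ge>\<^sub>0" by simp
qed

text \<open>Purity makes \<open>\<rho>\<close> a multiple of \<open>\<phi>\<close>. The factor is
  \<open>1\<close>, because the two functionals agree on the image of \<open>\<theta>\<close> and
  \<open>\<phi>\<close> does not vanish there.\<close>

lemma \<rho>_eq:
  assumes b: "b \<in> carrier A"
  shows "\<rho> b = \<phi> b"
proof -
  have "positive_functional A \<rho>"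
    using \<rho>_linear \<rho>_square(1) by (auto simp: positive_functional_def positive_elements_def)
  moreover have "positive_functional A (\<lambda>x. \<phi> x - \<rho> x)"
    using \<rho>_square(2) linear_functionalD[OF \<rho>_linear] \<phi>_simps(1,2)
    by (auto simp: positive_functional_def positive_elements_def linear_functional_def algebra_simps)
  ultimately obtain t where t: "\<And>x. x \<in> carrier A \<Longrightarrow> \<rho> x = of_real t * \<phi> x"
    using pure unfolding pure_state_def by blast
  obtain d where d: "d \<in> carrier D" "\<phi> (\<theta> d) \<noteq> 0" using nonzero by blast
  have "\<rho> (\<theta> d) = \<phi> (\<theta> d)"
  proof (rule \<rho>_eqI[OF \<theta>(1)[OF d(1)]])
    show "((\<lambda>u. \<phi> (\<theta> d \<otimes> \<theta> u)) \<longlongrightarrow> \<phi> (\<theta> d)) F"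
    proof (rule tendsto_if_norm_le[OF unit_right[OF d(1)], where K = 1])
      show "\<forall>\<^sub>F u in F. cmod (\<phi> (\<theta> d \<otimes> \<theta> u) - \<phi> (\<theta> d)) \<le> 1 * vnorm D (d \<otimes>\<^bsub>D\<^esub> u \<ominus>\<^bsub>D\<^esub> d)"
        using eventually_good
      proof eventually_elim
        case (elim u)
        then show ?case
          using \<phi>\<theta>_bound[of "d \<otimes>\<^bsub>D\<^esub> u \<ominus>\<^bsub>D\<^esub> d"] goodD(1,4)[OF elim] d(1) \<theta>(1)
          by (simp add: \<theta>_minus \<phi>_simps \<theta>(4))
      qed
    qed
  qed
  then have "of_real t = (1 :: complex)" using t[of "\<theta> d"] d \<theta>(1) by simp
  then show ?thesis using t[OF b] by simp
qed

text \<open>For \<open>b\<close> in the unit ball, \<open>\<phi> b\<close> is the limit of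
  \<open>\<phi> (b \<otimes> \<theta> u)\<close>, whose squared modulus is at most \<open>L\<close>
  by Cauchy-Schwarz; the supremum over all \<open>b\<close> is \<open>1\<close>.\<close>

lemma L_eq_1: "L = 1"
proof (rule antisym)
  show "L \<le> 1"
    unfolding L_def
  proof (rule cSUP_least)
    show "{d \<in> carrier D. vnorm D d \<le> 1} \<noteq> {}" by (auto intro!: exI[of _ "\<zero>\<^bsub>D\<^esub>"])
    show "cmod (\<phi> (\<theta> d)) \<le> 1" if "d \<in> {d \<in> carrier D. vnorm D d \<le> 1}" for d
      using \<phi>\<theta>_bound[of d] that by auto
  qed
  have b: "(cmod (\<phi> b))\<^sup>2 \<le> L" if b: "b \<in> carrier A" "vnorm A b \<le> 1" for b
  proof (rule tendsto_upperbound[OF _ _ F_nontrivial])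
    show "((\<lambda>u. (cmod (\<phi> (b \<otimes> \<theta> u)))\<^sup>2) \<longlongrightarrow> (cmod (\<phi> b))\<^sup>2) F"
      using tendsto_\<rho>[OF b(1)] unfolding \<rho>_eq[OF b(1)] by (intro tendsto_intros)
    show "\<forall>\<^sub>F u in F. (cmod (\<phi> (b \<otimes> \<theta> u)))\<^sup>2 \<le> L"
      using eventually_good
    proof eventually_elim
      case (elim u)
      note u = goodD[OF elim]
      have "(cmod (\<phi> (b \<otimes> \<theta> u)))\<^sup>2 \<le> Re (\<phi> (b \<otimes> adj A b)) * Re (\<phi> (\<theta> u \<otimes> \<theta> u))"
        using A.Cauchy_Schwarz[OF positive, of "adj A b" "\<theta> u"] b u by simp
      also have "\<dots> \<le> 1 * L"
      proof (rule mult_mono)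
        have "Re (\<phi> (b \<otimes> adj A b)) \<le> (vnorm A b)\<^sup>2"
          using bound[of "b \<otimes> adj A b"] complex_Re_le_cmod[of "\<phi> (b \<otimes> adj A b)"] b
          by (simp add: A.cstar_identity')
        also have "\<dots> \<le> 1" using b by (simp add: power_le_one)
        finally show "Re (\<phi> (b \<otimes> adj A b)) \<le> 1" .
        show "Re (\<phi> (\<theta> u \<otimes> \<theta> u)) \<le> L" using good_square[OF elim] u by (simp add: \<theta>(4))
        show "0 \<le> Re (\<phi> (\<theta> u \<otimes> \<theta> u))"
          using A.positive_functional_square[OF positive u(4)] u(5) by (simp add: complex_nonneg_Reals_iff)
      qed simp
      finally show ?case by simp
    qed
  qed
  have "Sup {cmod (\<phi> x) | x. x \<in> carrier A \<and> vnorm A x \<le> 1} \<le> sqrt L"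
    using b by (intro cSup_least) (auto intro!: exI[of _ "\<zero>"] real_le_rsqrt)
  then have "1 \<le> sqrt L" using state by (simp add: is_state_def)
  then show "1 \<le> L" by simp
qed

theorem unit_tendsto_1: "((\<lambda>u. q u) \<longlongrightarrow> 1) F"
  using q_tendsto by (simp add: L_eq_1)

text \<open>A quantitative form, obtained by letting \<open>u\<close> run to the limit in
  \<open>eventually_close_mult\<close>. The bound depends on \<open>b\<close> only through its norm,
  so \<open>b\<close> may later vary along a second approximate unit.\<close>

theorem mult_unit_close:
  assumes b: "b \<in> carrier A" and v: "good v"
  shows "(cmod (\<phi> b - \<phi> (b \<otimes> \<theta> v)))\<^sup>2 \<le> (vnorm A b)\<^sup>2 * (2 * (1 - q v))"
proof -
  have "(cmod (\<phi> b - \<phi> (b \<otimes> \<theta> v)))\<^sup>2 \<le> (vnorm A b)\<^sup>2 * (2 * (1 - q v) + e)" if e: "e > 0" for e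
  proof (rule tendsto_upperbound[OF _ _ F_nontrivial])
    show "((\<lambda>u. (cmod (\<phi> (b \<otimes> \<theta> u) - \<phi> (b \<otimes> \<theta> v)))\<^sup>2) \<longlongrightarrow> (cmod (\<phi> b - \<phi> (b \<otimes> \<theta> v)))\<^sup>2) F"
      using tendsto_\<rho>[OF b] unfolding \<rho>_eq[OF b] by (intro tendsto_intros)
    show "\<forall>\<^sub>F u in F. (cmod (\<phi> (b \<otimes> \<theta> u) - \<phi> (b \<otimes> \<theta> v)))\<^sup>2 \<le> (vnorm A b)\<^sup>2 * (2 * (1 - q v) + e)"
      using eventually_close_mult[OF b v e] unfolding L_eq_1 by eventually_elim blast
  qed
  then have *: "(cmod (\<phi> b - \<phi> (b \<otimes> \<theta> v)))\<^sup>2 \<le> (vnorm A b)\<^sup>2 * (2 * (1 - q v)) + (vnorm A b)\<^sup>2 * e" if "e > 0" for e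
    using that by (simp add: algebra_simps)
  show ?thesis
  proof (rule field_le_epsilon)
    fix \<delta> :: real assume \<delta>: "\<delta> > 0"
    have p: "(vnorm A b)\<^sup>2 + 1 > 0" by (simp add: add_nonneg_pos)
    have "(vnorm A b)\<^sup>2 * (\<delta> / ((vnorm A b)\<^sup>2 + 1)) \<le> \<delta>"
      using p \<delta> by (simp add: divide_simps)
    then show "(cmod (\<phi> b - \<phi> (b \<otimes> \<theta> v)))\<^sup>2 \<le> (vnorm A b)\<^sup>2 * (2 * (1 - q v)) + \<delta>"
      using *[of "\<delta> / ((vnorm A b)\<^sup>2 + 1)"] p \<delta> by simp
  qed
qed

end

section \<open>Products, generated subalgebras and isomorphisms\<close>

text \<open>The norm of the product is a supremum of reals, which has no useful value over an empty
  index set.\<close>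

locale cstar_family =
  fixes I :: "'i set" and C :: "'i \<Rightarrow> 'c star_algebra"
  assumes nonempty: "I \<noteq> {}" and algebras: "i \<in> I \<Longrightarrow> cstar_algebra (C i)"
begin

abbreviation P where "P \<equiv> cstar_product I C"

lemma component: "i \<in> I \<Longrightarrow> cstar_algebra (C i)" "i \<in> I \<Longrightarrow> banach_space (C i)"
  using algebras by (auto simp: cstar_algebra_def)

lemma product_simps:
  "vadd P = (\<lambda>x y. \<lambda>i \<in> I. x i \<oplus>\<^bsub>C i\<^esub> y i)" "vzero P = (\<lambda>i \<in> I. \<zero>\<^bsub>C i\<^esub>)"
  "vscale P = (\<lambda>c x. \<lambda>i \<in> I. c \<odot>\<^bsub>C i\<^esub> x i)" "vnorm P = (\<lambda>x. SUP i \<in> I. vnorm (C i) (x i))"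
  "amult P = (\<lambda>x y. \<lambda>i \<in> I. x i \<otimes>\<^bsub>C i\<^esub> y i)" "adj P = (\<lambda>x. \<lambda>i \<in> I. adj (C i) (x i))"
  by (simp_all add: cstar_product_def)

lemma carrierD:
  assumes "x \<in> carrier P"
  shows "i \<in> I \<Longrightarrow> x i \<in> carrier (C i)" "x \<in> extensional I"
    "bdd_above ((\<lambda>i. vnorm (C i) (x i)) ` I)" "i \<in> I \<Longrightarrow> vnorm (C i) (x i) \<le> vnorm P x"
proof -
  show b: "bdd_above ((\<lambda>i. vnorm (C i) (x i)) ` I)" using assms by (simp add: cstar_product_def)
  show "vnorm (C i) (x i) \<le> vnorm P x" if "i \<in> I"
    using cSUP_upper[OF that b] by (simp add: product_simps)
qed (use assms in \<open>auto simp: cstar_product_def PiE_def\<close>)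

lemma carrierI:
  "\<lbrakk>\<And>i. i \<in> I \<Longrightarrow> x i \<in> carrier (C i); x \<in> extensional I; \<And>i. i \<in> I \<Longrightarrow> vnorm (C i) (x i) \<le> K\<rbrakk>
    \<Longrightarrow> x \<in> carrier P"
  by (auto simp: cstar_product_def PiE_def intro!: bdd_aboveI2[of _ _ K])

lemma norm_leI: "(\<And>i. i \<in> I \<Longrightarrow> vnorm (C i) (x i) \<le> K) \<Longrightarrow> vnorm P x \<le> K"
  unfolding product_simps by (rule cSUP_least[OF nonempty])

lemma eqI: "\<lbrakk>x \<in> extensional I; y \<in> extensional I; \<And>i. i \<in> I \<Longrightarrow> x i = y i\<rbrakk> \<Longrightarrow> x = y"
  by (rule extensionalityI)

lemma norm_nonneg': "x \<in> carrier P \<Longrightarrow> 0 \<le> vnorm P x"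
  using nonempty carrierD(1,4)[of x] banach_space.norm_nonneg[OF component(2)]
  by (meson all_not_in_conv order_trans)

lemma closed_ops:
  assumes x: "x \<in> carrier P"
  shows "y \<in> carrier P \<Longrightarrow> vadd P x y \<in> carrier P" "vscale P c x \<in> carrier P"
    "y \<in> carrier P \<Longrightarrow> amult P x y \<in> carrier P" "adj P x \<in> carrier P"
proof -
  note xD = carrierD[OF x]
  show "vscale P c x \<in> carrier P"
  proof (rule carrierI[where K = "cmod c * vnorm P x"])
    fix i assume i: "i \<in> I"
    interpret cstar_algebra "C i" by (rule component(1)[OF i])
    show "vscale P c x i \<in> carrier (C i)" using i xD(1) by (simp add: product_simps)
    show "vnorm (C i) (vscale P c x i) \<le> cmod c * vnorm P x"
      using i xD(1)[OF i] mult_left_mono[OF xD(4)[OF i], of "cmod c"]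
      by (simp add: product_simps(3) norm_scale)
  qed (simp add: product_simps)
  show "adj P x \<in> carrier P"
  proof (rule carrierI[where K = "vnorm P x"])
    fix i assume i: "i \<in> I"
    interpret cstar_algebra "C i" by (rule component(1)[OF i])
    show "adj P x i \<in> carrier (C i)" using i xD(1) by (simp add: product_simps)
    show "vnorm (C i) (adj P x i) \<le> vnorm P x"
      using i xD(1)[OF i] xD(4)[OF i] by (simp add: product_simps(6))
  qed (simp add: product_simps)
  assume y: "y \<in> carrier P"
  note yD = carrierD[OF y]
  show "vadd P x y \<in> carrier P"
  proof (rule carrierI[where K = "vnorm P x + vnorm P y"])
    fix i assume i: "i \<in> I"
    interpret cstar_algebra "C i" by (rule component(1)[OF i])
    show "vadd P x y i \<in> carrier (C i)" using i xD(1) yD(1) by (simp add: product_simps)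
    show "vnorm (C i) (vadd P x y i) \<le> vnorm P x + vnorm P y"
      using i norm_triangle[OF xD(1)[OF i] yD(1)[OF i]] xD(4)[OF i] yD(4)[OF i]
      by (simp add: product_simps(1))
  qed (simp add: product_simps)
  show "amult P x y \<in> carrier P"
  proof (rule carrierI[where K = "vnorm P x * vnorm P y"])
    fix i assume i: "i \<in> I"
    interpret cstar_algebra "C i" by (rule component(1)[OF i])
    show "amult P x y i \<in> carrier (C i)" using i xD(1) yD(1) by (simp add: product_simps)
    show "vnorm (C i) (amult P x y i) \<le> vnorm P x * vnorm P y"
      using i norm_mult[OF xD(1)[OF i] yD(1)[OF i]] xD(1)[OF i] yD(1)[OF i]
        mult_mono[OF xD(4)[OF i] yD(4)[OF i]] norm_nonneg'[OF x]
      by (simp add: product_simps(5))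
  qed (simp add: product_simps)
qed

lemma minus_component: "i \<in> I \<Longrightarrow> (x \<ominus>\<^bsub>P\<^esub> y) i = x i \<ominus>\<^bsub>C i\<^esub> y i"
  by (simp add: vminus_def product_simps)

lemma minus_closed': "\<lbrakk>x \<in> carrier P; y \<in> carrier P\<rbrakk> \<Longrightarrow> x \<ominus>\<^bsub>P\<^esub> y \<in> carrier P"
  by (simp add: vminus_def closed_ops)

lemma extensional_ops [simp]:
  "vadd P x y \<in> extensional I" "vscale P c x \<in> extensional I" "amult P x y \<in> extensional I"
  "adj P x \<in> extensional I" "vzero P \<in> extensional I" "x \<ominus>\<^bsub>P\<^esub> y \<in> extensional I"
  by (simp_all add: product_simps vminus_def)

lemma norm_component_eq: "(\<And>i. i \<in> I \<Longrightarrow> vnorm (C i) (x i) = vnorm (C i) (y i)) \<Longrightarrow> vnorm P x = vnorm P y"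
  by (simp add: product_simps)

lemma Metric_space_product: "Metric_space (carrier P) (norm_dist P)"
proof
  show "0 \<le> norm_dist P x y" for x y
    by (simp add: norm_dist_def norm_nonneg' minus_closed')
  have comm: "vnorm P (x \<ominus>\<^bsub>P\<^esub> y) = vnorm P (y \<ominus>\<^bsub>P\<^esub> x)" if "x \<in> carrier P" "y \<in> carrier P" for x y
    using that carrierD(1) banach_space.norm_minus_commute[OF component(2)]
    by (intro norm_component_eq) (simp add: minus_component)
  then show "norm_dist P x y = norm_dist P y x" for x y by (simp add: norm_dist_def)
  show "norm_dist P x y = 0 \<longleftrightarrow> x = y" if xy: "x \<in> carrier P" "y \<in> carrier P" for x y
  proof
    assume 0: "norm_dist P x y = 0"
    show "x = y"
    proof (rule eqI)
      fix i assume i: "i \<in> I"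
      interpret cstar_algebra "C i" by (rule component(1)[OF i])
      have c: "x i \<in> carrier (C i)" "y i \<in> carrier (C i)" using xy carrierD(1) i by auto
      have "vnorm (C i) (x i \<ominus>\<^bsub>C i\<^esub> y i) \<le> 0"
        using carrierD(4)[OF minus_closed'[OF xy] i] 0 xy i by (simp add: norm_dist_def minus_component)
      then have "vnorm (C i) (x i \<ominus>\<^bsub>C i\<^esub> y i) = 0" using c by (intro antisym norm_nonneg) simp_all
      then show "x i = y i" using minus_eq_zero[OF c] c by (simp add: norm_eq_zero)
    qed (use xy carrierD(2) in auto)
  next
    assume xy': "x = y"
    have "vnorm P (x \<ominus>\<^bsub>P\<^esub> x) \<le> 0"
    proof (rule norm_leI)
      fix i assume i: "i \<in> I"
      interpret cstar_algebra "C i" by (rule component(1)[OF i])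
      show "vnorm (C i) ((x \<ominus>\<^bsub>P\<^esub> x) i) \<le> 0" using i xy carrierD(1) by (simp add: minus_component)
    qed
    then show "norm_dist P x y = 0"
      using xy xy' norm_nonneg'[OF minus_closed'[OF xy(1,1)]] by (simp add: norm_dist_def)
  qed
  show "norm_dist P x z \<le> norm_dist P x y + norm_dist P y z"
    if xyz: "x \<in> carrier P" "y \<in> carrier P" "z \<in> carrier P" for x y z
  proof -
    have "vnorm P (x \<ominus>\<^bsub>P\<^esub> z) \<le> vnorm P (x \<ominus>\<^bsub>P\<^esub> y) + vnorm P (y \<ominus>\<^bsub>P\<^esub> z)"
    proof (rule norm_leI)
      fix i assume i: "i \<in> I"
      interpret cstar_algebra "C i" by (rule component(1)[OF i])
      show "vnorm (C i) ((x \<ominus>\<^bsub>P\<^esub> z) i) \<le> vnorm P (x \<ominus>\<^bsub>P\<^esub> y) + vnorm P (y \<ominus>\<^bsub>P\<^esub> z)"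
        using norm_minus_triangle[of "x i" "y i" "z i"] xyz carrierD(1) i
          carrierD(4)[OF minus_closed'[OF xyz(1,2)] i] carrierD(4)[OF minus_closed'[OF xyz(2,3)] i]
        by (simp add: minus_component)
    qed
    then show ?thesis using xyz by (simp add: norm_dist_def)
  qed
qed

lemma mcomplete_product: "Metric_space.mcomplete (carrier P) (norm_dist P)"
proof -
  interpret M: Metric_space "carrier P" "norm_dist P" by (rule Metric_space_product)
  show ?thesis
    unfolding M.mcomplete_def
  proof (intro allI impI)
    fix \<sigma> assume \<sigma>: "M.MCauchy \<sigma>"
    have c: "\<sigma> n \<in> carrier P" for n using \<sigma> by (auto simp: M.MCauchy_def)
    have cau: "\<exists>N. \<forall>m\<ge>N. \<forall>n\<ge>N. vnorm P (\<sigma> m \<ominus>\<^bsub>P\<^esub> \<sigma> n) < e" if "e > 0" for e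
      using \<sigma> that c by (auto simp: M.MCauchy_def norm_dist_def)
    have le: "vnorm (C i) (\<sigma> m i \<ominus>\<^bsub>C i\<^esub> \<sigma> n i) \<le> vnorm P (\<sigma> m \<ominus>\<^bsub>P\<^esub> \<sigma> n)" if "i \<in> I" for i m n
      using carrierD(4)[OF minus_closed'[OF c c] that] that by (simp add: minus_component)
    have "\<exists>x \<in> carrier (C i). \<forall>e>0. \<exists>N. \<forall>n\<ge>N. vnorm (C i) (\<sigma> n i \<ominus>\<^bsub>C i\<^esub> x) < e" if i: "i \<in> I" for i
    proof (rule banach_space.Cauchy_limit[OF component(2)[OF i]])
      show "\<sigma> n i \<in> carrier (C i)" for n by (rule carrierD(1)[OF c i])
      fix e :: real assume "e > 0"
      then show "\<exists>N. \<forall>m\<ge>N. \<forall>n\<ge>N. vnorm (C i) (\<sigma> m i \<ominus>\<^bsub>C i\<^esub> \<sigma> n i) < e"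
        using cau[of e] le[OF i] by (meson le_less_trans)
    qed
    then obtain x where x: "\<And>i. i \<in> I \<Longrightarrow> x i \<in> carrier (C i)"
      "\<And>i e. \<lbrakk>i \<in> I; e > 0\<rbrakk> \<Longrightarrow> \<exists>N. \<forall>n\<ge>N. vnorm (C i) (\<sigma> n i \<ominus>\<^bsub>C i\<^esub> x i) < e"
      by metis
    define y where "y = (\<lambda>i \<in> I. x i)"
    \<comment> \<open>The auxiliary index \<open>?k\<close> depends on \<open>i\<close> but is
      eliminated by the triangle inequality, so the bound is uniform in \<open>i\<close> and
      survives the supremum.\<close>
    have lim: "vnorm (C i) (\<sigma> n i \<ominus>\<^bsub>C i\<^esub> x i) \<le> e"
      if N: "\<forall>m\<ge>N. \<forall>n\<ge>N. vnorm P (\<sigma> m \<ominus>\<^bsub>P\<^esub> \<sigma> n) < e" and n: "n \<ge> N" and i: "i \<in> I" for N n i e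
    proof (rule field_le_epsilon)
      interpret cstar_algebra "C i" by (rule component(1)[OF i])
      fix d :: real assume d: "d > 0"
      obtain K where K: "\<forall>k\<ge>K. vnorm (C i) (\<sigma> k i \<ominus>\<^bsub>C i\<^esub> x i) < d" using x(2)[OF i d] by blast
      let ?k = "max K N"
      have "vnorm (C i) (\<sigma> n i \<ominus>\<^bsub>C i\<^esub> x i)
          \<le> vnorm (C i) (\<sigma> n i \<ominus>\<^bsub>C i\<^esub> \<sigma> ?k i) + vnorm (C i) (\<sigma> ?k i \<ominus>\<^bsub>C i\<^esub> x i)"
        by (intro norm_minus_triangle carrierD(1)[OF c i] x(1) i)
      moreover have "vnorm (C i) (\<sigma> n i \<ominus>\<^bsub>C i\<^esub> \<sigma> ?k i) < e"
        using le[OF i, of n ?k] N n by (meson le_less_trans max.cobounded2)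
      ultimately show "vnorm (C i) (\<sigma> n i \<ominus>\<^bsub>C i\<^esub> x i) \<le> e + d"
        using K by (smt (verit) max.cobounded1)
    qed
    obtain N1 where N1: "\<forall>m\<ge>N1. \<forall>n\<ge>N1. vnorm P (\<sigma> m \<ominus>\<^bsub>P\<^esub> \<sigma> n) < 1" using cau[of 1] by auto
    have y: "y \<in> carrier P"
    proof (rule carrierI[where K = "1 + vnorm P (\<sigma> N1)"])
      fix i assume i: "i \<in> I"
      interpret cstar_algebra "C i" by (rule component(1)[OF i])
      show "y i \<in> carrier (C i)" using i x(1) by (simp add: y_def)
      have "vnorm (C i) (x i) \<le> vnorm (C i) (x i \<ominus>\<^bsub>C i\<^esub> \<sigma> N1 i) + vnorm (C i) (\<sigma> N1 i)"
        by (intro norm_le_minus x(1) carrierD(1)[OF c] i)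
      then show "vnorm (C i) (y i) \<le> 1 + vnorm P (\<sigma> N1)"
        using lim[OF N1 order_refl i] norm_minus_commute[OF x(1)[OF i] carrierD(1)[OF c i, of N1]]
          carrierD(4)[OF c i, of N1] i by (simp add: y_def)
    qed (simp add: y_def)
    have "\<exists>N. \<forall>n\<ge>N. norm_dist P (\<sigma> n) y < e" if e: "e > 0" for e
    proof -
      obtain N where N: "\<forall>m\<ge>N. \<forall>n\<ge>N. vnorm P (\<sigma> m \<ominus>\<^bsub>P\<^esub> \<sigma> n) < e / 2" using cau[of "e / 2"] e by auto
      have "norm_dist P (\<sigma> n) y < e" if "n \<ge> N" for n
      proof -
        have "vnorm P (\<sigma> n \<ominus>\<^bsub>P\<^esub> y) \<le> e / 2"
          by (rule norm_leI) (use lim[OF N that] in \<open>simp add: minus_component y_def\<close>)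
        then show ?thesis using e c y by (simp add: norm_dist_def)
      qed
      then show ?thesis by blast
    qed
    then have "limitin M.mtopology \<sigma> y sequentially"
      using y c by (auto simp: M.limit_metric_sequentially)
    then show "\<exists>x. limitin M.mtopology \<sigma> x sequentially" by blast
  qed
qed

theorem cstar_algebra_product: "cstar_algebra P"
proof
  note cD = carrierD(1)
  note b = banach_space.add_assoc[OF component(2)] banach_space.add_commute[OF component(2)]
    banach_space.add_zero[OF component(2)] banach_space.minus_self[OF component(2)]
    banach_space.scale_add_left[OF component(2)] banach_space.scale_add_right[OF component(2)]
    banach_space.scale_scale[OF component(2)] banach_space.scale_one[OF component(2)]
  note a = cstar_algebra.mult_assoc[OF component(1)] cstar_algebra.mult_add_left[OF component(1)]
    cstar_algebra.mult_add_right[OF component(1)] cstar_algebra.mult_scale_left[OF component(1)]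
    cstar_algebra.mult_scale_right[OF component(1)] cstar_algebra.adj_adj[OF component(1)]
    cstar_algebra.adj_add[OF component(1)] cstar_algebra.adj_scale[OF component(1)]
    cstar_algebra.adj_mult[OF component(1)]
  fix x y z :: "'i \<Rightarrow> 'c" and c d :: complex
  show "vzero P \<in> carrier P"
    by (rule carrierI[where K = 0])
      (simp_all add: product_simps banach_space.zero_closed[OF component(2)]
        banach_space.norm_zero[OF component(2)])
  assume x: "x \<in> carrier P"
  show "vscale P c x \<in> carrier P" "adj P x \<in> carrier P" using x closed_ops by auto
  show "x \<oplus>\<^bsub>P\<^esub> \<zero>\<^bsub>P\<^esub> = x" "x \<ominus>\<^bsub>P\<^esub> x = \<zero>\<^bsub>P\<^esub>" "(c + d) \<odot>\<^bsub>P\<^esub> x = c \<odot>\<^bsub>P\<^esub> x \<oplus>\<^bsub>P\<^esub> d \<odot>\<^bsub>P\<^esub> x"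
    "c \<odot>\<^bsub>P\<^esub> (d \<odot>\<^bsub>P\<^esub> x) = (c * d) \<odot>\<^bsub>P\<^esub> x" "1 \<odot>\<^bsub>P\<^esub> x = x" "adj P (adj P x) = x"
    "adj P (c \<odot>\<^bsub>P\<^esub> x) = cnj c \<odot>\<^bsub>P\<^esub> adj P x"
    unfolding atomize_conj
    by (intro conjI; rule eqI; simp add: product_simps minus_component x cD carrierD(2)[OF x] b a)
  show "vnorm P x = 0 \<longleftrightarrow> x = \<zero>\<^bsub>P\<^esub>"
  proof
    assume 0: "vnorm P x = 0"
    show "x = \<zero>\<^bsub>P\<^esub>"
    proof (rule eqI)
      fix i assume i: "i \<in> I"
      interpret cstar_algebra "C i" by (rule component(1)[OF i])
      have "vnorm (C i) (x i) = 0"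
        using carrierD(4)[OF x i] 0 cD[OF x i] by (intro antisym norm_nonneg) simp_all
      then show "x i = \<zero>\<^bsub>P\<^esub> i" using cD[OF x i] i by (simp add: norm_eq_zero product_simps)
    qed (simp_all add: x carrierD(2))
  next
    assume "x = \<zero>\<^bsub>P\<^esub>"
    then have "vnorm P x \<le> 0"
      by (intro norm_leI) (simp add: product_simps banach_space.norm_zero[OF component(2)])
    then show "vnorm P x = 0" using norm_nonneg'[OF x] by simp
  qed
  show "vnorm P (c \<odot>\<^bsub>P\<^esub> x) = cmod c * vnorm P x"
  proof (cases "c = 0")
    case True
    have "vnorm P (c \<odot>\<^bsub>P\<^esub> x) \<le> 0"
      by (rule norm_leI) (simp add: product_simps True banach_space.norm_scale[OF component(2)] x cD)
    then show ?thesis using norm_nonneg'[OF closed_ops(2)[OF x], of c] True by simp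
  next
    case False
    show ?thesis
    proof (rule antisym)
      show "vnorm P (c \<odot>\<^bsub>P\<^esub> x) \<le> cmod c * vnorm P x"
        using carrierD(4)[OF x]
        by (intro norm_leI)
          (simp add: product_simps(3) banach_space.norm_scale[OF component(2)] x cD mult_left_mono)
      have "vnorm P x \<le> vnorm P (c \<odot>\<^bsub>P\<^esub> x) / cmod c"
      proof (rule norm_leI)
        fix i assume i: "i \<in> I"
        show "vnorm (C i) (x i) \<le> vnorm P (c \<odot>\<^bsub>P\<^esub> x) / cmod c"
          using carrierD(4)[OF closed_ops(2)[OF x] i, of c] i False
          by (simp add: product_simps(3) banach_space.norm_scale[OF component(2)] x cD field_simps)
      qed
      then show "cmod c * vnorm P x \<le> vnorm P (c \<odot>\<^bsub>P\<^esub> x)" using False by (simp add: field_simps)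
    qed
  qed
  show "vnorm P (adj P x \<otimes>\<^bsub>P\<^esub> x) = (vnorm P x)\<^sup>2"
  proof (rule antisym)
    have "(vnorm (C i) (x i))\<^sup>2 \<le> (vnorm P x)\<^sup>2" if "i \<in> I" for i
      using carrierD(4)[OF x that] banach_space.norm_nonneg[OF component(2)[OF that] cD[OF x that]]
      by (intro power_mono)
    then show "vnorm P (adj P x \<otimes>\<^bsub>P\<^esub> x) \<le> (vnorm P x)\<^sup>2"
      by (intro norm_leI) (simp add: product_simps(5,6) cstar_algebra.cstar_identity[OF component(1)] x cD)
    have "vnorm P x \<le> sqrt (vnorm P (adj P x \<otimes>\<^bsub>P\<^esub> x))"
    proof (rule norm_leI)
      fix i assume i: "i \<in> I"
      have "(vnorm (C i) (x i))\<^sup>2 \<le> vnorm P (adj P x \<otimes>\<^bsub>P\<^esub> x)"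
        using carrierD(4)[OF closed_ops(3)[OF closed_ops(4)[OF x] x] i] i
        by (simp add: product_simps(5,6) cstar_algebra.cstar_identity[OF component(1)] x cD)
      then show "vnorm (C i) (x i) \<le> sqrt (vnorm P (adj P x \<otimes>\<^bsub>P\<^esub> x))" by (rule real_le_rsqrt)
    qed
    then have "(vnorm P x)\<^sup>2 \<le> (sqrt (vnorm P (adj P x \<otimes>\<^bsub>P\<^esub> x)))\<^sup>2"
      using norm_nonneg'[OF x] by (rule power_mono)
    then show "(vnorm P x)\<^sup>2 \<le> vnorm P (adj P x \<otimes>\<^bsub>P\<^esub> x)"
      using norm_nonneg'[OF closed_ops(3)[OF closed_ops(4)[OF x] x]] by simp
  qed
  assume y: "y \<in> carrier P"
  show "x \<oplus>\<^bsub>P\<^esub> y \<in> carrier P" "x \<otimes>\<^bsub>P\<^esub> y \<in> carrier P" using x y closed_ops by auto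
  show "x \<oplus>\<^bsub>P\<^esub> y = y \<oplus>\<^bsub>P\<^esub> x"
    by (rule eqI; simp add: product_simps x y cD b(2)[of _ "x _"])
  show "c \<odot>\<^bsub>P\<^esub> (x \<oplus>\<^bsub>P\<^esub> y) = c \<odot>\<^bsub>P\<^esub> x \<oplus>\<^bsub>P\<^esub> c \<odot>\<^bsub>P\<^esub> y"
    "(c \<odot>\<^bsub>P\<^esub> x) \<otimes>\<^bsub>P\<^esub> y = c \<odot>\<^bsub>P\<^esub> (x \<otimes>\<^bsub>P\<^esub> y)" "x \<otimes>\<^bsub>P\<^esub> (c \<odot>\<^bsub>P\<^esub> y) = c \<odot>\<^bsub>P\<^esub> (x \<otimes>\<^bsub>P\<^esub> y)"
    "adj P (x \<oplus>\<^bsub>P\<^esub> y) = adj P x \<oplus>\<^bsub>P\<^esub> adj P y" "adj P (x \<otimes>\<^bsub>P\<^esub> y) = adj P y \<otimes>\<^bsub>P\<^esub> adj P x"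
    unfolding atomize_conj
    by (intro conjI; rule eqI; simp add: product_simps x y cD b(6) a)
  show "vnorm P (x \<oplus>\<^bsub>P\<^esub> y) \<le> vnorm P x + vnorm P y"
  proof (rule norm_leI)
    fix i assume i: "i \<in> I"
    show "vnorm (C i) ((x \<oplus>\<^bsub>P\<^esub> y) i) \<le> vnorm P x + vnorm P y"
      using banach_space.norm_triangle[OF component(2)[OF i] cD[OF x i] cD[OF y i]]
        carrierD(4)[OF x i] carrierD(4)[OF y i] i by (simp add: product_simps(1))
  qed
  show "vnorm P (x \<otimes>\<^bsub>P\<^esub> y) \<le> vnorm P x * vnorm P y"
  proof (rule norm_leI)
    fix i assume i: "i \<in> I"
    show "vnorm (C i) ((x \<otimes>\<^bsub>P\<^esub> y) i) \<le> vnorm P x * vnorm P y"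
      using cstar_algebra.norm_mult[OF component(1)[OF i] cD[OF x i] cD[OF y i]]
        mult_mono[OF carrierD(4)[OF x i] carrierD(4)[OF y i] norm_nonneg'[OF x]]
        banach_space.norm_nonneg[OF component(2)[OF i] cD[OF y i]] i by (simp add: product_simps(5))
  qed
  assume z: "z \<in> carrier P"
  show "x \<oplus>\<^bsub>P\<^esub> y \<oplus>\<^bsub>P\<^esub> z = x \<oplus>\<^bsub>P\<^esub> (y \<oplus>\<^bsub>P\<^esub> z)" "x \<otimes>\<^bsub>P\<^esub> y \<otimes>\<^bsub>P\<^esub> z = x \<otimes>\<^bsub>P\<^esub> (y \<otimes>\<^bsub>P\<^esub> z)"
    "(x \<oplus>\<^bsub>P\<^esub> y) \<otimes>\<^bsub>P\<^esub> z = x \<otimes>\<^bsub>P\<^esub> z \<oplus>\<^bsub>P\<^esub> y \<otimes>\<^bsub>P\<^esub> z" "x \<otimes>\<^bsub>P\<^esub> (y \<oplus>\<^bsub>P\<^esub> z) = x \<otimes>\<^bsub>P\<^esub> y \<oplus>\<^bsub>P\<^esub> x \<otimes>\<^bsub>P\<^esub> z"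
    unfolding atomize_conj
    by (intro conjI; rule eqI; simp add: product_simps x y z cD b(1) a(1-3))
qed (rule mcomplete_product)

end

section \<open>Generated subalgebras\<close>

lemma (in cstar_algebra) cstar_subalgebra_carrier: "cstar_subalgebra A (carrier A)"
  unfolding cstar_subalgebra_def lin_subspace_def closedin_norm_iff by auto

lemma (in cstar_algebra) cstar_subalgebra_Inter:
  assumes "\<M> \<noteq> {}" "\<And>M. M \<in> \<M> \<Longrightarrow> cstar_subalgebra A M"
  shows "cstar_subalgebra A (\<Inter>\<M>)"
proof -
  have "closedin (norm_topology A) (\<Inter>\<M>)"
    using assms by (intro closedin_Inter) (auto simp: cstar_subalgebra_def)
  moreover have "lin_subspace A (\<Inter>\<M>)"
    using assms unfolding cstar_subalgebra_def lin_subspace_def by blast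
  ultimately show ?thesis
    using assms(2) unfolding cstar_subalgebra_def by blast
qed

locale generating_set = cstar_algebra A for A :: "'a star_algebra" (structure) +
  fixes X :: "'a set"
  assumes subset: "X \<subseteq> carrier A"
begin

abbreviation M where "M \<equiv> carrier (generated_cstar A X)"

lemma generated_cstar_eq: "generated_cstar A X = A\<lparr>carrier := M\<rparr>"
  by (simp add: generated_cstar_def)

lemma generated_subalgebra: "cstar_subalgebra A M"
  unfolding generated_cstar_def using cstar_subalgebra_carrier subset
  by (simp, intro cstar_subalgebra_Inter) auto

lemma generated_contains: "X \<subseteq> M"
  by (auto simp: generated_cstar_def)

lemma generated_least: "\<lbrakk>cstar_subalgebra A N; X \<subseteq> N\<rbrakk> \<Longrightarrow> M \<subseteq> N"
  by (auto simp: generated_cstar_def)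

lemma generated_subset: "M \<subseteq> carrier A"
  using cstar_subalgebra_carrier subset by (rule generated_least)

lemma cstar_algebra_generated: "cstar_algebra (generated_cstar A X)"
  using cstar_algebra_subalgebra[OF generated_subalgebra] by (subst generated_cstar_eq)

end

section \<open>Transport of subalgebras, states, GNS kernels and quotients along isometric
  isomorphisms\<close>

definition isometric_iso :: "'a star_algebra \<Rightarrow> 'b star_algebra \<Rightarrow> ('a \<Rightarrow> 'b) \<Rightarrow> bool" where
  "isometric_iso X Y T \<longleftrightarrow> star_iso X Y T \<and> (\<forall>x \<in> carrier X. vnorm Y (T x) = vnorm X x)"

locale isometric_isomorphism = X: cstar_algebra X + Y: cstar_algebra Y
  for X :: "'a star_algebra" and Y :: "'b star_algebra" +
  fixes T :: "'a \<Rightarrow> 'b"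
  assumes iso: "isometric_iso X Y T"
begin

lemma bij: "bij_betw T (carrier X) (carrier Y)" and hom: "star_hom X Y T"
  and T_norm: "x \<in> carrier X \<Longrightarrow> vnorm Y (T x) = vnorm X x"
  using iso by (auto simp: isometric_iso_def star_iso_def)

lemmas T = star_homD[OF hom]

lemma inj: "inj_on T (carrier X)" and image: "T ` carrier X = carrier Y"
  using bij by (auto simp: bij_betw_def)

lemma T_minus: "\<lbrakk>x \<in> carrier X; y \<in> carrier X\<rbrakk> \<Longrightarrow> T (x \<ominus>\<^bsub>X\<^esub> y) = T x \<ominus>\<^bsub>Y\<^esub> T y"
  by (simp add: vminus_def T)

lemma T_zero: "T \<zero>\<^bsub>X\<^esub> = \<zero>\<^bsub>Y\<^esub>"
  using T(3)[of "\<zero>\<^bsub>X\<^esub>" 0] T(1)[of "\<zero>\<^bsub>X\<^esub>"] by simp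

definition T' where "T' = inv_into (carrier X) T"

lemma T': "y \<in> carrier Y \<Longrightarrow> T' y \<in> carrier X" "y \<in> carrier Y \<Longrightarrow> T (T' y) = y"
  "x \<in> carrier X \<Longrightarrow> T' (T x) = x"
  unfolding T'_def using image inj
  by (auto simp: inv_into_into f_inv_into_f)

lemma surjE: assumes "y \<in> carrier Y" obtains x where "x \<in> carrier X" "y = T x"
  using assms image by auto

lemma inverse_isometric: "isometric_iso Y X T'"
proof -
  have "bij_betw T' (carrier Y) (carrier X)"
    unfolding T'_def using bij by (rule bij_betw_inv_into)
  moreover have "linear_map Y X T'"
    unfolding linear_map_def
    by (auto simp: T'(1) T'(3) elim!: surjE simp flip: T(2,3))
  moreover have "T' (y \<otimes>\<^bsub>Y\<^esub> z) = T' y \<otimes>\<^bsub>X\<^esub> T' z" if "y \<in> carrier Y" "z \<in> carrier Y" for y z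
    using that by (auto simp: T'(3) elim!: surjE simp flip: T(4))
  moreover have "T' (adj Y y) = adj X (T' y)" "vnorm X (T' y) = vnorm Y y" if "y \<in> carrier Y" for y
    using that by (auto simp: T'(3) T_norm elim!: surjE simp flip: T(5))
  ultimately show ?thesis by (auto simp: isometric_iso_def star_iso_def star_hom_def)
qed

lemma inverse: "isometric_isomorphism Y X T'"
  using inverse_isometric by unfold_locales

lemma preimage_subalgebra:
  assumes "cstar_subalgebra Y N"
  shows "cstar_subalgebra X {x \<in> carrier X. T x \<in> N}" (is "cstar_subalgebra X ?M")
proof -
  have N: "lin_subspace Y N" "closedin (norm_topology Y) N"
    "\<And>x y. \<lbrakk>x \<in> N; y \<in> N\<rbrakk> \<Longrightarrow> x \<otimes>\<^bsub>Y\<^esub> y \<in> N" "\<And>x. x \<in> N \<Longrightarrow> adj Y x \<in> N"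
    using assms by (auto simp: cstar_subalgebra_def)
  note NS = lin_subspaceD[OF N(1)]
  have "lin_subspace X ?M"
    unfolding lin_subspace_def using NS by (auto simp: T T_zero)
  moreover have "closedin (norm_topology X) ?M"
    unfolding X.closedin_norm_iff
  proof (intro conjI ballI impI)
    fix x assume x: "x \<in> carrier X" and lim: "\<forall>\<epsilon>>0. \<exists>y \<in> ?M. vnorm X (x \<ominus>\<^bsub>X\<^esub> y) < \<epsilon>"
    have "\<exists>y \<in> N. vnorm Y (T x \<ominus>\<^bsub>Y\<^esub> y) < \<epsilon>" if e: "\<epsilon> > 0" for \<epsilon>
    proof -
      obtain y where y: "y \<in> carrier X" "T y \<in> N" "vnorm X (x \<ominus>\<^bsub>X\<^esub> y) < \<epsilon>" using lim e by blast
      then have "vnorm Y (T x \<ominus>\<^bsub>Y\<^esub> T y) < \<epsilon>"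
        using T_norm[of "x \<ominus>\<^bsub>X\<^esub> y"] x by (simp add: T_minus)
      then show ?thesis using y by blast
    qed
    then show "x \<in> ?M" using N(2) T(1)[OF x] x unfolding Y.closedin_norm_iff by blast
  qed auto
  ultimately show ?thesis
    unfolding cstar_subalgebra_def using N by (auto simp: T)
qed

text \<open>Each inclusion follows from minimality of a generated subalgebra, applied to a preimage
  under \<open>T\<close> or under its inverse.\<close>

lemma image_generated:
  assumes G: "G \<subseteq> carrier X"
  shows "T ` carrier (generated_cstar X G) = carrier (generated_cstar Y (T ` G))"
proof -
  interpret GX: generating_set X G using G by unfold_locales
  interpret GY: generating_set Y "T ` G" using G T(1) by unfold_locales auto
  interpret I: isometric_isomorphism Y X T' by (rule inverse)
  have "GX.M \<subseteq> {x \<in> carrier X. T x \<in> GY.M}"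
    using G GY.generated_contains by (intro GX.generated_least preimage_subalgebra GY.generated_subalgebra) auto
  moreover have "GY.M \<subseteq> {y \<in> carrier Y. T' y \<in> GX.M}"
  proof (intro GY.generated_least I.preimage_subalgebra GX.generated_subalgebra subsetI)
    fix y assume "y \<in> T ` G"
    then obtain x where "x \<in> G" "y = T x" by blast
    then have "x \<in> carrier X" "x \<in> GX.M" "y = T x" using G GX.generated_contains by auto
    then show "y \<in> {y \<in> carrier Y. T' y \<in> GX.M}" using T(1)[of x] T'(3)[of x] by simp
  qed
  ultimately show ?thesis
    using T'(2) by (auto simp: image_iff subset_iff) metis
qed

lemma generated_isomorphism:
  assumes G: "G \<subseteq> carrier X"
  shows "isometric_isomorphism (generated_cstar X G) (generated_cstar Y (T ` G)) T"
proof -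
  interpret GX: generating_set X G using G by unfold_locales
  interpret GY: generating_set Y "T ` G" using G T(1) by unfold_locales auto
  have c: "\<And>x. x \<in> GX.M \<Longrightarrow> x \<in> carrier X" using GX.generated_subset by auto
  have "bij_betw T GX.M GY.M"
    using inj_on_subset[OF inj GX.generated_subset] image_generated[OF G] by (simp add: bij_betw_def)
  moreover have "\<And>x. x \<in> GX.M \<Longrightarrow> T x \<in> GY.M" using image_generated[OF G] by blast
  ultimately have "isometric_iso (X\<lparr>carrier := GX.M\<rparr>) (Y\<lparr>carrier := GY.M\<rparr>) T"
    by (simp add: isometric_iso_def star_iso_def star_hom_def linear_map_def T T_norm c)
  then show ?thesis
    unfolding isometric_isomorphism_def isometric_isomorphism_axioms_def
      GX.generated_cstar_eq[symmetric] GY.generated_cstar_eq[symmetric]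
    using GX.cstar_algebra_generated GY.cstar_algebra_generated by blast
qed

lemma star_isomorphic: "X \<cong>\<^sup>* Y"
  using iso by (auto simp: star_isomorphic_def isometric_iso_def)

text \<open>Functionals are total functions with arbitrary values outside the carrier, so they are
  matched by a relation on the carrier instead of being composed with an inverse.\<close>

lemma positive_functional_transfer:
  assumes \<phi>: "positive_functional X \<phi>" and rel: "\<And>x. x \<in> carrier X \<Longrightarrow> \<phi>' (T x) = \<phi> x"
  shows "positive_functional Y \<phi>'"
proof -
  have "linear_functional X \<phi>" using \<phi> by (simp add: positive_functional_def)
  then have "linear_functional Y \<phi>'"
    unfolding linear_functional_def by (auto simp: rel elim!: surjE simp flip: T(2,3))
  moreover have "\<phi>' (adj Y y \<otimes>\<^bsub>Y\<^esub> y) \<in> \<real>\<^sub>\<ge>\<^sub>0" if y: "y \<in> carrier Y" for y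
  proof -
    obtain x where x: "x \<in> carrier X" "y = T x" by (rule surjE[OF y])
    then show ?thesis
      using X.positive_functional_square[OF \<phi> x(1)] by (simp add: rel flip: T(4,5))
  qed
  ultimately show ?thesis by (auto simp: positive_functional_def positive_elements_def)
qed

lemma state_transfer:
  assumes \<phi>: "is_state X \<phi>" and rel: "\<And>x. x \<in> carrier X \<Longrightarrow> \<phi>' (T x) = \<phi> x"
  shows "is_state Y \<phi>'"
proof -
  have "{cmod (\<phi>' y) | y. y \<in> carrier Y \<and> vnorm Y y \<le> 1} = {cmod (\<phi> x) | x. x \<in> carrier X \<and> vnorm X x \<le> 1}"
  proof (intro equalityI subsetI)
    fix r assume "r \<in> {cmod (\<phi>' y) | y. y \<in> carrier Y \<and> vnorm Y y \<le> 1}"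
    then obtain y where y: "r = cmod (\<phi>' y)" "y \<in> carrier Y" "vnorm Y y \<le> 1" by blast
    obtain x where "x \<in> carrier X" "y = T x" by (rule surjE[OF y(2)])
    then show "r \<in> {cmod (\<phi> x) | x. x \<in> carrier X \<and> vnorm X x \<le> 1}" using y rel T_norm by auto
  next
    fix r assume "r \<in> {cmod (\<phi> x) | x. x \<in> carrier X \<and> vnorm X x \<le> 1}"
    then obtain x where x: "r = cmod (\<phi> x)" "x \<in> carrier X" "vnorm X x \<le> 1" by blast
    then show "r \<in> {cmod (\<phi>' y) | y. y \<in> carrier Y \<and> vnorm Y y \<le> 1}"
      using rel T_norm T(1) by (auto intro!: exI[of _ "T x"])
  qed
  then show ?thesis
    using \<phi> positive_functional_transfer[of \<phi> \<phi>', OF _ rel] by (auto simp: is_state_def)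
qed

lemma pure_state_transfer:
  assumes \<phi>: "pure_state X \<phi>" and rel: "\<And>x. x \<in> carrier X \<Longrightarrow> \<phi>' (T x) = \<phi> x"
  shows "pure_state Y \<phi>'"
  unfolding pure_state_def
proof (intro conjI allI impI)
  interpret I: isometric_isomorphism Y X T' by (rule inverse)
  show "is_state Y \<phi>'" using \<phi> state_transfer[of \<phi> \<phi>', OF _ rel] by (simp add: pure_state_def)
  fix \<rho> assume \<rho>: "positive_functional Y \<rho> \<and> positive_functional Y (\<lambda>x. \<phi>' x - \<rho> x)"
  have "positive_functional X (\<rho> \<circ> T)"
    by (rule I.positive_functional_transfer[of \<rho>]) (use \<rho> T'(2) in auto)
  moreover have "positive_functional X (\<lambda>x. \<phi> x - (\<rho> \<circ> T) x)"
    by (rule I.positive_functional_transfer[of "\<lambda>x. \<phi>' x - \<rho> x"])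
      (use \<rho> T'(1,2) rel[OF T'(1)] in auto)
  ultimately obtain t :: real where "t \<in> {0..1}" "\<forall>x \<in> carrier X. (\<rho> \<circ> T) x = of_real t * \<phi> x"
    using \<phi> unfolding pure_state_def by blast
  then show "\<exists>t \<in> {0..1::real}. \<forall>x \<in> carrier Y. \<rho> x = of_real t * \<phi>' x"
    by (auto simp: rel intro!: bexI[of _ t] elim!: surjE)
qed

lemma image_coset:
  assumes "N \<subseteq> carrier X" "x \<in> carrier X"
  shows "T ` coset X N x = coset Y (T ` N) (T x)"
proof -
  have "T (y \<ominus>\<^bsub>X\<^esub> x) \<in> T ` N \<longleftrightarrow> y \<ominus>\<^bsub>X\<^esub> x \<in> N" if "y \<in> carrier X" for y
    using inj_on_image_mem_iff[OF inj _ assms(1)] that assms(2) by simp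
  then have iff: "T y \<ominus>\<^bsub>Y\<^esub> T x \<in> T ` N \<longleftrightarrow> y \<ominus>\<^bsub>X\<^esub> x \<in> N" if "y \<in> carrier X" for y
    using that assms(2) by (simp add: T_minus)
  show ?thesis
  proof (intro equalityI subsetI)
    fix z assume "z \<in> T ` coset X N x"
    then show "z \<in> coset Y (T ` N) (T x)" by (auto simp: coset_def T(1) iff)
  next
    fix z assume z: "z \<in> coset Y (T ` N) (T x)"
    then have "z \<in> carrier Y" by (simp add: coset_def)
    then obtain y where "y \<in> carrier X" "z = T y" by (rule surjE)
    then show "z \<in> T ` coset X N x" using z by (auto simp: coset_def iff)
  qed
qed

lemma gns_transfer:
  assumes rel: "\<And>x. x \<in> carrier X \<Longrightarrow> \<psi>' (T x) = \<psi> x" and a: "a \<in> gns_kernel X \<psi>"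
  shows "T a \<in> gns_kernel Y \<psi>'"
proof -
  have aX: "a \<in> carrier X" using a by (simp add: gns_kernel_def)
  let ?N = "gns_null X \<psi>" and ?N' = "gns_null Y \<psi>'"
  have N: "?N \<subseteq> carrier X" by (auto simp: gns_null_def)
  have N': "?N' = T ` ?N"
  proof (intro equalityI subsetI)
    fix y assume "y \<in> ?N'"
    then have y: "y \<in> carrier Y" "\<psi>' (adj Y y \<otimes>\<^bsub>Y\<^esub> y) = 0" by (auto simp: gns_null_def)
    obtain x where x: "x \<in> carrier X" "y = T x" by (rule surjE[OF y(1)])
    then have "x \<in> ?N" using y(2) by (simp add: gns_null_def rel flip: T(4,5))
    then show "y \<in> T ` ?N" using x by blast
  next
    fix y assume "y \<in> T ` ?N"
    then show "y \<in> ?N'" by (auto simp: gns_null_def T(1) rel simp flip: T(4,5))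
  qed
  have rep: "gns_rep Y \<psi>' (T a) (T ` W) = T ` gns_rep X \<psi> a W" if W: "W \<subseteq> carrier X" for W
    using W aX
    by (simp add: gns_rep_def N' image_UN)
      (intro SUP_cong, auto simp: image_coset[OF N] T(4)[symmetric] subset_iff)
  have "gns_rep Y \<psi>' (T a) Z = coset Y ?N' \<zero>\<^bsub>Y\<^esub>" if "Z \<in> gns_space Y \<psi>'" for Z
  proof -
    obtain y where y: "y \<in> carrier Y" "Z = coset Y ?N' y" using \<open>Z \<in> _\<close> by (auto simp: gns_space_def)
    obtain x where x: "x \<in> carrier X" "y = T x" by (rule surjE[OF y(1)])
    have Z: "Z = T ` coset X ?N x" using image_coset[OF N x(1)] x y by (simp add: N')
    have "gns_rep X \<psi> a (coset X ?N x) = coset X ?N \<zero>\<^bsub>X\<^esub>"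
      using a x by (auto simp: gns_kernel_def gns_space_def)
    then show ?thesis
      unfolding Z using rep[of "coset X ?N x"] image_coset[OF N, of "\<zero>\<^bsub>X\<^esub>"]
      by (auto simp: coset_def N' T_zero)
  qed
  then show ?thesis using T(1)[OF aX] by (simp add: gns_kernel_def)
qed

text \<open>Elements of the quotient are cosets as sets, so the isomorphism is the direct image
  under \<open>T\<close>, and each quotient operation is a union that the direct image
  preserves.\<close>

lemma quotient_isomorphic:
  assumes J: "J \<subseteq> carrier X"
  shows "cstar_quotient X J \<cong>\<^sup>* cstar_quotient Y (T ` J)"
proof -
  let ?Q = "cstar_quotient X J" and ?R = "cstar_quotient Y (T ` J)"
  note ic = image_coset[OF J]
  have sub: "W \<subseteq> carrier X" if "W \<in> carrier ?Q" for W
    using that by (auto simp: cstar_quotient_def coset_def)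
  have car: "carrier ?R = image T ` carrier ?Q"
    unfolding cstar_quotient_def by (simp add: image_image ic flip: image cong: image_cong_simp)
  have "bij_betw (image T) (carrier ?Q) (carrier ?R)"
    unfolding bij_betw_def car using inj_on_image_eq_iff[OF inj] sub by (auto simp: inj_on_def)
  moreover have "linear_map ?Q ?R (image T)"
    unfolding linear_map_def
  proof (intro conjI ballI allI)
    show "T ` W \<in> carrier ?R" if "W \<in> carrier ?Q" for W using that car by blast
    show "T ` (V \<oplus>\<^bsub>?Q\<^esub> W) = T ` V \<oplus>\<^bsub>?R\<^esub> T ` W" if "V \<in> carrier ?Q" "W \<in> carrier ?Q" for V W
      using sub[OF that(1)] sub[OF that(2)]
      by (simp add: cstar_quotient_def image_UN) (intro SUP_cong, auto simp: ic T subset_iff)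
    show "T ` (c \<odot>\<^bsub>?Q\<^esub> W) = c \<odot>\<^bsub>?R\<^esub> T ` W" if "W \<in> carrier ?Q" for c W
      using sub[OF that]
      by (simp add: cstar_quotient_def image_UN) (intro SUP_cong, auto simp: ic T subset_iff)
  qed
  moreover have "T ` (V \<otimes>\<^bsub>?Q\<^esub> W) = T ` V \<otimes>\<^bsub>?R\<^esub> T ` W" if "V \<in> carrier ?Q" "W \<in> carrier ?Q" for V W
    using sub[OF that(1)] sub[OF that(2)]
    by (simp add: cstar_quotient_def image_UN) (intro SUP_cong, auto simp: ic T subset_iff)
  moreover have "T ` adj ?Q W = adj ?R (T ` W)" if "W \<in> carrier ?Q" for W
    using sub[OF that]
    by (simp add: cstar_quotient_def image_UN) (intro SUP_cong, auto simp: ic T subset_iff)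
  ultimately have "star_iso ?Q ?R (image T)" by (auto simp: star_iso_def star_hom_def)
  then show ?thesis by (auto simp: star_isomorphic_def)
qed

end

section \<open>The cross-sectional algebras of an action\<close>

text \<open>The operations need to agree only on the carrier: multiplication in a fiber over an
  idempotent is defined through the action and coincides with that of \<open>B\<close> only on the
  fiber.\<close>

lemma approximate_unit_cong:
  assumes "approximate_unit A F" "carrier A = carrier A'" "vadd A = vadd A'" "vscale A = vscale A'"
    "vnorm A = vnorm A'"
    "\<And>x y. \<lbrakk>x \<in> carrier A; y \<in> carrier A\<rbrakk> \<Longrightarrow> x \<otimes>\<^bsub>A\<^esub> y = x \<otimes>\<^bsub>A'\<^esub> y"
    "\<And>x. x \<in> carrier A \<Longrightarrow> adj A x = adj A' x" "\<And>x. x \<in> carrier A \<Longrightarrow> adj A x \<in> carrier A"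
  shows "approximate_unit A' F"
proof -
  have m: "vminus A = vminus A'" using assms(3,4) by (simp add: vminus_def fun_eq_iff)
  have p: "positive_elements A = positive_elements A'"
  proof -
    have "adj A x \<otimes>\<^bsub>A\<^esub> x = adj A' x \<otimes>\<^bsub>A'\<^esub> x" if "x \<in> carrier A" for x
      using assms(6)[OF assms(8)[OF that] that] assms(7)[OF that] by simp
    then show ?thesis unfolding positive_elements_def assms(2)[symmetric] by (intro Collect_cong) metis
  qed
  have ev: "\<forall>\<^sub>F u in F. u \<in> carrier A"
    using assms(1) by (auto simp: approximate_unit_def elim: eventually_mono)
  have "((\<lambda>u. vnorm A' (u \<otimes>\<^bsub>A'\<^esub> b \<ominus>\<^bsub>A'\<^esub> b)) \<longlongrightarrow> 0) F \<and> ((\<lambda>u. vnorm A' (b \<otimes>\<^bsub>A'\<^esub> u \<ominus>\<^bsub>A'\<^esub> b)) \<longlongrightarrow> 0) F"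
    if b: "b \<in> carrier A" for b
  proof -
    have t: "((\<lambda>u. vnorm A (u \<otimes>\<^bsub>A\<^esub> b \<ominus>\<^bsub>A\<^esub> b)) \<longlongrightarrow> 0) F" "((\<lambda>u. vnorm A (b \<otimes>\<^bsub>A\<^esub> u \<ominus>\<^bsub>A\<^esub> b)) \<longlongrightarrow> 0) F"
      using assms(1) b by (auto simp: approximate_unit_def)
    have e: "\<forall>\<^sub>F u in F. vnorm A (u \<otimes>\<^bsub>A\<^esub> b \<ominus>\<^bsub>A\<^esub> b) = vnorm A' (u \<otimes>\<^bsub>A'\<^esub> b \<ominus>\<^bsub>A'\<^esub> b)"
      "\<forall>\<^sub>F u in F. vnorm A (b \<otimes>\<^bsub>A\<^esub> u \<ominus>\<^bsub>A\<^esub> b) = vnorm A' (b \<otimes>\<^bsub>A'\<^esub> u \<ominus>\<^bsub>A'\<^esub> b)"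
      using ev by (eventually_elim, simp add: assms(5,6) b m)+
    show ?thesis using Lim_transform_eventually[OF t(1) e(1)] Lim_transform_eventually[OF t(2) e(2)] ..
  qed
  then show ?thesis
    using assms(1) unfolding approximate_unit_def p assms(2,5) by blast
qed

text \<open>It supplies a representation of every bundle, so that the product has a nonempty index
  set. Choosing \<open>undefined\<close> as the single element makes the zero maps agree with the
  default value demanded by the function spaces \<open>\<rightarrow>\<^sub>E\<close>.\<close>

definition zero_algebra :: "'c star_algebra" where
  "zero_algebra = \<lparr>carrier = {undefined}, vadd = (\<lambda>_ _. undefined), vzero = undefined,
    vscale = (\<lambda>_ _. undefined), vnorm = (\<lambda>_. 0), amult = (\<lambda>_ _. undefined), adj = (\<lambda>_. undefined)\<rparr>"

lemma cstar_algebra_zero_algebra: "cstar_algebra (zero_algebra :: 'c star_algebra)"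
proof -
  let ?Z = "zero_algebra :: 'c star_algebra"
  interpret M: Metric_space "carrier ?Z" "norm_dist ?Z"
    by unfold_locales (auto simp: zero_algebra_def norm_dist_def)
  have c: "carrier ?Z = {undefined}" by (simp add: zero_algebra_def)
  have "M.mcomplete"
    unfolding M.mcomplete_def
  proof (intro allI impI)
    fix \<sigma> assume "M.MCauchy \<sigma>"
    then have "range \<sigma> \<subseteq> carrier ?Z" unfolding M.MCauchy_def by (rule conjunct1)
    then have "range \<sigma> \<subseteq> {undefined}" unfolding c .
    then have s: "\<sigma> n = undefined" for n by blast
    have z: "norm_dist ?Z undefined undefined = 0" using M.zero[of undefined undefined] c by blast
    have "limitin M.mtopology \<sigma> undefined sequentially"
      unfolding M.limit_metric_sequentially s z using c by blast
    then show "\<exists>x. limitin M.mtopology \<sigma> x sequentially" by blast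
  qed
  then show ?thesis
    by unfold_locales (auto simp: zero_algebra_def vminus_def)
qed

section \<open>Representations of the bundle and its canonical algebras\<close>

locale crossed_product = semigroup_action S B \<alpha>
  for S :: "'s semigroup_str" and B :: "'b star_algebra" and \<alpha> :: "'s \<Rightarrow> 'b \<rightharpoonup> 'b" +
  fixes U :: "'c itself"
begin

abbreviation A where "A \<equiv> action_bundle S B \<alpha>"

lemma bundle_simps [simp]:
  "base A = S" "carrier (fiber A s) = ran (\<alpha> s)" "vadd (fiber A s) = vadd B" "vzero (fiber A s) = vzero B"
  "vscale (fiber A s) = vscale B" "vnorm (fiber A s) = vnorm B" "incl A t s a = a"
  by (simp_all add: action_bundle_def)

lemmas automorphismD = partial_automorphismD[OF automorphism]

lemma ran_carrier: "\<lbrakk>s \<in> elts S; a \<in> ran (\<alpha> s)\<rbrakk> \<Longrightarrow> a \<in> carrier B"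
  using closed_idealD(1)[OF automorphismD(2)] by blast

lemma ran_Some: "a \<in> ran (\<alpha> s) \<Longrightarrow> \<exists>x. \<alpha> s x = Some a"
  by (auto simp: ran_def)

lemma fmult_eq:
  assumes "s \<in> elts S" "\<alpha> s x = Some a" "\<alpha> s (x \<otimes>\<^bsub>B\<^esub> b) = Some z"
  shows "fmult A s t a b = z"
  using partial_inv_eq[OF automorphism[OF assms(1)] assms(2)] assms(3) by (simp add: action_bundle_def)

lemma fmult_closed:
  assumes s: "s \<in> elts S" and t: "t \<in> elts S" and x: "\<alpha> s x = Some a" and b: "b \<in> ran (\<alpha> t)"
  obtains z where "\<alpha> s (x \<otimes>\<^bsub>B\<^esub> b) = Some z" "fmult A s t a b = z" "z \<in> ran (\<alpha> (s \<cdot>\<^bsub>S\<^esub> t))"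
proof -
  have xc: "x \<in> carrier B" and bc: "b \<in> carrier B" using automorphismD(4)[OF s x] ran_carrier[OF t b] .
  have "x \<otimes>\<^bsub>B\<^esub> b \<in> dom (\<alpha> s)"
    using closed_idealD(5)[OF automorphismD(1)[OF s] bc] x by blast
  then obtain z where z: "\<alpha> s (x \<otimes>\<^bsub>B\<^esub> b) = Some z" by blast
  have "x \<otimes>\<^bsub>B\<^esub> b \<in> ran (\<alpha> t)"
    using closed_idealD(4)[OF automorphismD(2)[OF t] xc b] .
  then obtain w where "\<alpha> t w = Some (x \<otimes>\<^bsub>B\<^esub> b)" using ran_Some by blast
  then have "z \<in> ran (\<alpha> (s \<cdot>\<^bsub>S\<^esub> t))" using action_mult[OF s t _ z] ranI by metis
  then show ?thesis using that z fmult_eq[OF s x z] by blast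
qed

lemma fadj_eq:
  assumes "s \<in> elts S" "\<alpha> s x = Some a"
  shows "fadj A s a = adj B x" "adj B x \<in> ran (\<alpha> (inv_of S s))"
    "\<alpha> (inv_of S s) (adj B a) = Some (adj B x)"
proof -
  have 1: "\<alpha> s (adj B x) = Some (adj B a)" using automorphismD(9)[OF assms] .
  then show "fadj A s a = adj B x"
    using partial_inv_eq[OF automorphism[OF assms(1)]] by (simp add: action_bundle_def)
  show "\<alpha> (inv_of S s) (adj B a) = Some (adj B x)" using action_inv[OF assms(1) 1] .
  then show "adj B x \<in> ran (\<alpha> (inv_of S s))" by (rule ranI)
qed

lemma idempotent_Some: "\<lbrakk>e \<in> idempotents S; a \<in> ran (\<alpha> e)\<rbrakk> \<Longrightarrow> \<alpha> e a = Some a"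
  using ran_Some[of a e] action_idempotent by metis

lemma ran_mono: "\<lbrakk>nat_le S s t; a \<in> ran (\<alpha> s)\<rbrakk> \<Longrightarrow> a \<in> ran (\<alpha> t)"
  using ran_Some[of a s] action_mono ranI by metis

abbreviation fiber_ideal where "fiber_ideal e \<equiv> B\<lparr>carrier := ran (\<alpha> e)\<rparr>"

lemma cstar_algebra_fiber_ideal: "e \<in> elts S \<Longrightarrow> cstar_algebra (fiber_ideal e)"
  by (intro closed_ideal_cstar_algebra automorphismD(2))

lemma idempotent_fmult:
  assumes "e \<in> idempotents S" "a \<in> ran (\<alpha> e)" "b \<in> ran (\<alpha> e)"
  shows "fmult A e e a b = a \<otimes>\<^bsub>B\<^esub> b" "a \<otimes>\<^bsub>B\<^esub> b \<in> ran (\<alpha> e)"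
proof -
  have e: "e \<in> elts S" using assms idempotents_closed by blast
  have "\<alpha> e (a \<otimes>\<^bsub>B\<^esub> b) = Some (a \<otimes>\<^bsub>B\<^esub> b)"
    using automorphismD(8)[OF e] idempotent_Some assms by blast
  then show "fmult A e e a b = a \<otimes>\<^bsub>B\<^esub> b" "a \<otimes>\<^bsub>B\<^esub> b \<in> ran (\<alpha> e)"
    using fmult_eq[OF e idempotent_Some[OF assms(1,2)]] ranI by metis+
qed

lemma idempotent_fadj:
  assumes "e \<in> idempotents S" "a \<in> ran (\<alpha> e)"
  shows "fadj A e a = adj B a" "adj B a \<in> ran (\<alpha> e)"
  using fadj_eq[OF idempotents_closed[OF assms(1)] idempotent_Some[OF assms]]
    inv_of_idempotent[OF assms(1)] by auto

lemma approximate_unit_fiber: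
  assumes e: "e \<in> idempotents S"
  shows "approximate_unit (fiber_algebra A e) F \<longleftrightarrow> approximate_unit (fiber_ideal e) F"
proof
  assume F: "approximate_unit (fiber_algebra A e) F"
  show "approximate_unit (fiber_ideal e) F"
    by (rule approximate_unit_cong[OF F])
      (simp_all add: fiber_algebra_def idempotent_fmult[OF e] idempotent_fadj[OF e])
next
  assume F: "approximate_unit (fiber_ideal e) F"
  show "approximate_unit (fiber_algebra A e) F"
    by (rule approximate_unit_cong[OF F])
      (simp_all add: fiber_algebra_def idempotent_fmult[OF e] idempotent_fadj[OF e])
qed

lemma representationD:
  assumes "representation A C \<pi>"
  shows "\<lbrakk>s \<in> elts S; a \<in> ran (\<alpha> s)\<rbrakk> \<Longrightarrow> \<pi> s a \<in> carrier C"
    "\<lbrakk>s \<in> elts S; a \<in> ran (\<alpha> s); b \<in> ran (\<alpha> s)\<rbrakk> \<Longrightarrow> \<pi> s (a \<oplus>\<^bsub>B\<^esub> b) = \<pi> s a \<oplus>\<^bsub>C\<^esub> \<pi> s b"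
    "\<lbrakk>s \<in> elts S; a \<in> ran (\<alpha> s)\<rbrakk> \<Longrightarrow> \<pi> s (k \<odot>\<^bsub>B\<^esub> a) = k \<odot>\<^bsub>C\<^esub> \<pi> s a"
    "\<lbrakk>s \<in> elts S; t \<in> elts S; a \<in> ran (\<alpha> s); b \<in> ran (\<alpha> t)\<rbrakk> \<Longrightarrow>
      \<pi> s a \<otimes>\<^bsub>C\<^esub> \<pi> t b = \<pi> (s \<cdot>\<^bsub>S\<^esub> t) (fmult A s t a b)"
    "\<lbrakk>s \<in> elts S; a \<in> ran (\<alpha> s)\<rbrakk> \<Longrightarrow> adj C (\<pi> s a) = \<pi> (inv_of S s) (fadj A s a)"
    "\<lbrakk>nat_le S s t; a \<in> ran (\<alpha> s)\<rbrakk> \<Longrightarrow> \<pi> t a = \<pi> s a"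
    "\<pi> \<in> (\<Pi>\<^sub>E s \<in> elts S. ran (\<alpha> s) \<rightarrow>\<^sub>E carrier C)"
  using assms unfolding representation_def linear_map_def by (auto simp: PiE_def)

lemma representation_star_hom:
  assumes \<pi>: "representation A C \<pi>" and e: "e \<in> idempotents S"
  shows "star_hom (fiber_ideal e) C (\<pi> e)"
proof -
  have ec: "e \<in> elts S" using idempotents_closed[OF e] .
  show ?thesis
    using representationD(1-3)[OF \<pi> ec] representationD(4)[OF \<pi> ec ec] representationD(5)[OF \<pi> ec]
    by (simp add: star_hom_def linear_map_def idempotents_idem[OF e] inv_of_idempotent[OF e]
        idempotent_fmult[OF e] idempotent_fadj[OF e])
qed

text \<open>Representations are not assumed bounded. Over idempotents they are star homomorphisms
  and hence contractive; in general the norm identity passes from \<open>\<pi> s a\<close> to the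
  fiber over \<open>inv_of S s \<cdot> s\<close>. Without the bound the canonical families would not
  belong to the product.\<close>

lemma representation_bound:
  assumes C: "cstar_algebra C" and \<pi>: "representation A C \<pi>" and s: "s \<in> elts S" and a: "a \<in> ran (\<alpha> s)"
  shows "vnorm C (\<pi> s a) \<le> vnorm B a"
proof -
  interpret C: cstar_algebra C by fact
  let ?i = "inv_of S s" and ?e = "inv_of S s \<cdot>\<^bsub>S\<^esub> s"
  have e: "?e \<in> idempotents S" "?e \<in> elts S" "?i \<in> elts S"
    using s inv_of_mult_idempotent idempotents_closed by auto
  obtain x where x: "\<alpha> s x = Some a" using ran_Some[OF a] by blast
  note fa = fadj_eq[OF s x]
  have "\<alpha> ?i (adj B a \<otimes>\<^bsub>B\<^esub> a) = Some (adj B x \<otimes>\<^bsub>B\<^esub> x)"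
    using automorphismD(8)[OF e(3) fa(3) action_inv[OF s x]] .
  moreover obtain z where "\<alpha> ?i (adj B a \<otimes>\<^bsub>B\<^esub> a) = Some z" "fmult A ?i s (adj B x) a = z" "z \<in> ran (\<alpha> ?e)"
    using fmult_closed[OF e(3) s fa(3) a] .
  ultimately have z: "fmult A ?i s (adj B x) a = adj B x \<otimes>\<^bsub>B\<^esub> x" "adj B x \<otimes>\<^bsub>B\<^esub> x \<in> ran (\<alpha> ?e)" by simp_all
  have xn: "vnorm B x = vnorm B a" using partial_automorphism_norm[OF automorphism[OF s] x] by simp
  have xc: "x \<in> carrier B" using automorphismD(4)[OF s x] .
  show ?thesis
  proof (rule C.norm_eqI_cstar)
    show "\<pi> s a \<in> carrier C" using representationD(1)[OF \<pi> s a] .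
    have "adj C (\<pi> s a) \<otimes>\<^bsub>C\<^esub> \<pi> s a = \<pi> ?e (adj B x \<otimes>\<^bsub>B\<^esub> x)"
      using representationD(4)[OF \<pi> e(3) s fa(2) a] representationD(5)[OF \<pi> s a] fa(1) z by simp
    moreover have "vnorm C (\<pi> ?e (adj B x \<otimes>\<^bsub>B\<^esub> x)) \<le> vnorm (fiber_ideal ?e) (adj B x \<otimes>\<^bsub>B\<^esub> x)"
      using z by (intro star_hom_contractive[OF cstar_algebra_fiber_ideal[OF e(2)] C
            representation_star_hom[OF \<pi> e(1)]]) simp
    ultimately show "vnorm C (adj C (\<pi> s a) \<otimes>\<^bsub>C\<^esub> \<pi> s a) \<le> (vnorm B a)\<^sup>2"
      using cstar_identity[OF xc] xn by simp
    show "0 \<le> vnorm B a" using ran_carrier[OF s a] by simp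
  qed
qed

abbreviation R where "R \<equiv> all_reps U A"
abbreviation P where "P \<equiv> cstar_product R fst"
abbreviation canon where "canon \<equiv> canonical_rep U A"
abbreviation gens where "gens \<equiv> {canon s a | s a. s \<in> elts S \<and> a \<in> ran (\<alpha> s)}"
abbreviation idem_gens where "idem_gens \<equiv> {canon e a | e a. e \<in> idempotents S \<and> a \<in> ran (\<alpha> e)}"
abbreviation full where "full \<equiv> full_cstar U A"
abbreviation idem where "idem \<equiv> idempotent_cstar U A"

lemma full_eq: "full = generated_cstar P gens"
  by (simp add: full_cstar_def)

lemma idem_eq: "idem = generated_cstar full idem_gens"
  by (simp add: idempotent_cstar_def)

lemma repsD: "\<rho> \<in> R \<Longrightarrow> cstar_algebra (fst \<rho>)" "\<rho> \<in> R \<Longrightarrow> representation A (fst \<rho>) (snd \<rho>)"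
  by (auto simp: all_reps_def)

lemma zero_rep: "(zero_algebra, \<lambda>s \<in> elts S. \<lambda>_. undefined) \<in> R"
proof -
  have "representation A (zero_algebra :: 'c star_algebra) (\<lambda>s \<in> elts S. \<lambda>_. undefined)"
    by (auto simp: representation_def linear_map_def zero_algebra_def closed nat_le_def)
  then show ?thesis by (simp add: all_reps_def cstar_algebra_zero_algebra)
qed

lemma family: "cstar_family R fst"
  using zero_rep repsD(1) by (intro cstar_family.intro) blast+

sublocale F: cstar_family R fst by (rule family)

lemma canon_apply: "\<rho> \<in> R \<Longrightarrow> canon s a \<rho> = snd \<rho> s a"
  by (simp add: canonical_rep_def)

lemma canon_extensional [simp]: "canon s a \<in> extensional R"
  by (simp add: canonical_rep_def)

lemma canon_product:
  assumes "s \<in> elts S" "a \<in> ran (\<alpha> s)"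
  shows "canon s a \<in> carrier P" "vnorm P (canon s a) \<le> vnorm B a"
proof -
  have b: "vnorm (fst \<rho>) (canon s a \<rho>) \<le> vnorm B a" if "\<rho> \<in> R" for \<rho>
    using representation_bound[OF repsD(1,2) assms] that by (simp add: canon_apply)
  show "canon s a \<in> carrier P"
    using representationD(1)[OF repsD(2) assms] b by (intro F.carrierI) (auto simp: canon_apply)
  show "vnorm P (canon s a) \<le> vnorm B a" using b by (rule F.norm_leI)
qed

sublocale GP: generating_set P gens
proof -
  interpret P: cstar_algebra P by (rule F.cstar_algebra_product)
  show "generating_set P gens" by unfold_locales (auto simp: canon_product)
qed

lemma full_simps: "vadd full = vadd P" "vscale full = vscale P" "vzero full = vzero P" "vnorm full = vnorm P"
  "amult full = amult P" "adj full = adj P"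
  by (simp_all add: full_eq generated_cstar_def)

lemma canon_full: "\<lbrakk>s \<in> elts S; a \<in> ran (\<alpha> s)\<rbrakk> \<Longrightarrow> canon s a \<in> carrier full"
  using GP.generated_contains by (auto simp: full_eq)

lemma idem_gens_full: "idem_gens \<subseteq> carrier full"
  using canon_full idempotents_closed by auto

sublocale full: cstar_algebra full
  using GP.cstar_algebra_generated by (simp add: full_eq)

sublocale GE: generating_set full idem_gens
  by unfold_locales (rule idem_gens_full)

sublocale idem: cstar_algebra idem
  using GE.cstar_algebra_generated by (simp add: idem_eq)

lemma idem_simps: "vadd idem = vadd full" "vscale idem = vscale full" "vzero idem = vzero full"
  "vnorm idem = vnorm full" "amult idem = amult full" "adj idem = adj full"
  by (simp_all add: idem_eq generated_cstar_def)

lemma idem_subset: "carrier idem \<subseteq> carrier full"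
  using GE.generated_subset by (simp add: idem_eq)

lemma canon_idem: "\<lbrakk>e \<in> idempotents S; a \<in> ran (\<alpha> e)\<rbrakk> \<Longrightarrow> canon e a \<in> carrier idem"
  using GE.generated_contains by (auto simp: idem_eq)

lemma canon_norm: "\<lbrakk>s \<in> elts S; a \<in> ran (\<alpha> s)\<rbrakk> \<Longrightarrow> vnorm full (canon s a) \<le> vnorm B a"
  using canon_product(2) by (simp add: full_simps)

lemma canon_mult:
  "\<lbrakk>s \<in> elts S; t \<in> elts S; a \<in> ran (\<alpha> s); b \<in> ran (\<alpha> t)\<rbrakk> \<Longrightarrow>
    canon s a \<otimes>\<^bsub>full\<^esub> canon t b = canon (s \<cdot>\<^bsub>S\<^esub> t) (fmult A s t a b)"
  by (rule F.eqI) (simp_all add: full_simps F.product_simps canon_apply representationD(4)[OF repsD(2)])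

lemma canon_mono: "\<lbrakk>nat_le S s t; a \<in> ran (\<alpha> s)\<rbrakk> \<Longrightarrow> canon t a = canon s a"
  by (rule F.eqI) (simp_all add: canon_apply representationD(6)[OF repsD(2)])

lemma canon_star_hom:
  assumes e: "e \<in> idempotents S"
  shows "star_hom (fiber_ideal e) idem (canon e)"
proof -
  have ec: "e \<in> elts S" using idempotents_closed[OF e] .
  note h = star_homD[OF representation_star_hom[OF repsD(2) e], simplified]
  show ?thesis
    unfolding star_hom_def linear_map_def
  proof (intro conjI ballI allI)
    fix x assume "x \<in> carrier (fiber_ideal e)"
    then have x: "x \<in> ran (\<alpha> e)" by simp
    show "canon e x \<in> carrier idem" by (rule canon_idem[OF e x])
    show "canon e (k \<odot>\<^bsub>fiber_ideal e\<^esub> x) = k \<odot>\<^bsub>idem\<^esub> canon e x" for k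
      by (rule F.eqI) (simp_all add: idem_simps full_simps F.product_simps canon_apply h x)
    show "canon e (adj (fiber_ideal e) x) = adj idem (canon e x)"
      by (rule F.eqI) (simp_all add: idem_simps full_simps F.product_simps canon_apply h x)
    fix y assume "y \<in> carrier (fiber_ideal e)"
    then have y: "y \<in> ran (\<alpha> e)" by simp
    show "canon e (x \<oplus>\<^bsub>fiber_ideal e\<^esub> y) = canon e x \<oplus>\<^bsub>idem\<^esub> canon e y"
      "canon e (x \<otimes>\<^bsub>fiber_ideal e\<^esub> y) = canon e x \<otimes>\<^bsub>idem\<^esub> canon e y"
      by (rule F.eqI; simp add: idem_simps full_simps F.product_simps canon_apply h x y)+
  qed
qed

text \<open>Below \<open>s\<close>, the map \<open>\<alpha> s\<close> restricts to the identity on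
  the fiber over \<open>e\<close>, and \<open>s \<cdot> e = e\<close>. The products in the
  definition of an extended state are therefore canonical images of elements
  \<open>c \<otimes> u\<close> of the fiber over \<open>e\<close>, with \<open>c\<close> the
  preimage of \<open>a\<close>.\<close>

lemma canon_mult_idempotent:
  assumes le: "nat_le S e s" and e: "e \<in> idempotents S" and c: "\<alpha> s c = Some a" and u: "u \<in> ran (\<alpha> e)"
  shows "canon s a \<otimes>\<^bsub>full\<^esub> canon e u = canon e (c \<otimes>\<^bsub>B\<^esub> u)" "c \<otimes>\<^bsub>B\<^esub> u \<in> ran (\<alpha> e)"
proof -
  have s: "s \<in> elts S" "e \<in> elts S" using le by (auto simp: nat_le_def)
  have "c \<in> carrier B" using automorphismD(4)[OF s(1) c] .
  then show cu: "c \<otimes>\<^bsub>B\<^esub> u \<in> ran (\<alpha> e)"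
    using closed_idealD(4)[OF automorphismD(2)[OF s(2)]] u by blast
  then have "\<alpha> s (c \<otimes>\<^bsub>B\<^esub> u) = Some (c \<otimes>\<^bsub>B\<^esub> u)"
    using action_mono[OF le] idempotent_Some[OF e] by blast
  then have "fmult A s e a u = c \<otimes>\<^bsub>B\<^esub> u" by (rule fmult_eq[OF s(1) c])
  then show "canon s a \<otimes>\<^bsub>full\<^esub> canon e u = canon e (c \<otimes>\<^bsub>B\<^esub> u)"
    using canon_mult[OF s _ u, of a] ranI[of "\<alpha> s" c a, OF c] nat_le_idempotent_mult[OF le e] by simp
qed

text \<open>For a generator over \<open>f\<close> the product lies in the fiber over
  \<open>f \<cdot> e\<close>, which is included in the one over \<open>e\<close>. The elements
  \<open>b\<close> with the approximation property are closed under the algebra operations and under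
  limits.\<close>

lemma idem_ideal:
  assumes e: "e \<in> idempotents S" and b: "b \<in> carrier idem" and d: "d \<in> ran (\<alpha> e)" and \<epsilon>: "\<epsilon> > 0"
  shows "\<exists>d' \<in> ran (\<alpha> e). vnorm idem (b \<otimes>\<^bsub>idem\<^esub> canon e d \<ominus>\<^bsub>idem\<^esub> canon e d') < \<epsilon>"
proof -
  have ec: "e \<in> elts S" using idempotents_closed[OF e] .
  note h = star_homD[OF canon_star_hom[OF e], simplified]
  define N where "N = {b \<in> carrier idem. \<forall>d \<in> ran (\<alpha> e). \<forall>\<epsilon>>0. \<exists>d' \<in> ran (\<alpha> e).
    vnorm idem (b \<otimes>\<^bsub>idem\<^esub> canon e d \<ominus>\<^bsub>idem\<^esub> canon e d') < \<epsilon>}"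
  have sub: "x \<oplus>\<^bsub>B\<^esub> y \<in> ran (\<alpha> e)" "k \<odot>\<^bsub>B\<^esub> x \<in> ran (\<alpha> e)" if "x \<in> ran (\<alpha> e)" "y \<in> ran (\<alpha> e)" for x y k
    using that lin_subspaceD[OF closed_idealD(2)[OF automorphismD(2)[OF ec]]] by blast+
  have Nc: "b \<in> carrier idem" if "b \<in> N" for b using that by (simp add: N_def)
  have ND: "\<exists>d' \<in> ran (\<alpha> e). vnorm idem (b \<otimes>\<^bsub>idem\<^esub> canon e d \<ominus>\<^bsub>idem\<^esub> canon e d') < \<epsilon>"
    if "b \<in> N" "d \<in> ran (\<alpha> e)" "\<epsilon> > 0" for b d \<epsilon> using that by (simp add: N_def)
  have exact: "b \<in> N" if bi: "b \<in> carrier idem" and ex: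
    "\<And>d. d \<in> ran (\<alpha> e) \<Longrightarrow> \<exists>d' \<in> ran (\<alpha> e). b \<otimes>\<^bsub>idem\<^esub> canon e d = canon e d'" for b
    unfolding N_def
  proof (intro CollectI conjI ballI allI impI bi)
    fix d and \<epsilon> :: real assume "d \<in> ran (\<alpha> e)" "\<epsilon> > 0"
    then obtain d' where "d' \<in> ran (\<alpha> e)" "b \<otimes>\<^bsub>idem\<^esub> canon e d = canon e d'" using ex by blast
    then show "\<exists>d' \<in> ran (\<alpha> e). vnorm idem (b \<otimes>\<^bsub>idem\<^esub> canon e d \<ominus>\<^bsub>idem\<^esub> canon e d') < \<epsilon>"
      using h(1) \<open>\<epsilon> > 0\<close> by (intro bexI[of _ d']) simp_all
  qed
  have add: "b \<oplus>\<^bsub>idem\<^esub> c \<in> N" if bc: "b \<in> N" "c \<in> N" for b c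
    unfolding N_def
  proof (intro CollectI conjI ballI allI impI)
    show "b \<oplus>\<^bsub>idem\<^esub> c \<in> carrier idem" using bc Nc by simp
    fix d and \<epsilon> :: real assume d: "d \<in> ran (\<alpha> e)" and e': "\<epsilon> > 0"
    obtain d1 where d1: "d1 \<in> ran (\<alpha> e)" "vnorm idem (b \<otimes>\<^bsub>idem\<^esub> canon e d \<ominus>\<^bsub>idem\<^esub> canon e d1) < \<epsilon> / 2"
      using ND[OF bc(1) d, of "\<epsilon> / 2"] e' by auto
    obtain d2 where d2: "d2 \<in> ran (\<alpha> e)" "vnorm idem (c \<otimes>\<^bsub>idem\<^esub> canon e d \<ominus>\<^bsub>idem\<^esub> canon e d2) < \<epsilon> / 2"
      using ND[OF bc(2) d, of "\<epsilon> / 2"] e' by auto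
    let ?x = "b \<otimes>\<^bsub>idem\<^esub> canon e d" and ?y = "c \<otimes>\<^bsub>idem\<^esub> canon e d"
    have m: "?x \<in> carrier idem" "?y \<in> carrier idem" "canon e d1 \<in> carrier idem" "canon e d2 \<in> carrier idem"
      using bc Nc d d1 d2 h(1) by simp_all
    have "(b \<oplus>\<^bsub>idem\<^esub> c) \<otimes>\<^bsub>idem\<^esub> canon e d \<ominus>\<^bsub>idem\<^esub> canon e (d1 \<oplus>\<^bsub>B\<^esub> d2)
      = (?x \<ominus>\<^bsub>idem\<^esub> canon e d1) \<oplus>\<^bsub>idem\<^esub> (?y \<ominus>\<^bsub>idem\<^esub> canon e d2)"
      using bc Nc d d1 d2 h(1,2)
      by (simp add: idem.mult_add_left) (rule idem.linear_identity4[OF m], simp add: vminus_def)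
    then have "vnorm idem ((b \<oplus>\<^bsub>idem\<^esub> c) \<otimes>\<^bsub>idem\<^esub> canon e d \<ominus>\<^bsub>idem\<^esub> canon e (d1 \<oplus>\<^bsub>B\<^esub> d2)) < \<epsilon>"
      using idem.norm_triangle[of "?x \<ominus>\<^bsub>idem\<^esub> canon e d1" "?y \<ominus>\<^bsub>idem\<^esub> canon e d2"] d1(2) d2(2) m by simp
    then show "\<exists>d' \<in> ran (\<alpha> e). vnorm idem ((b \<oplus>\<^bsub>idem\<^esub> c) \<otimes>\<^bsub>idem\<^esub> canon e d \<ominus>\<^bsub>idem\<^esub> canon e d') < \<epsilon>"
      using sub(1)[OF d1(1) d2(1)] by blast
  qed
  have scale: "k \<odot>\<^bsub>idem\<^esub> b \<in> N" if b: "b \<in> N" for k b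
    unfolding N_def
  proof (intro CollectI conjI ballI allI impI)
    show "k \<odot>\<^bsub>idem\<^esub> b \<in> carrier idem" using b Nc by simp
    fix d and \<epsilon> :: real assume d: "d \<in> ran (\<alpha> e)" and e': "\<epsilon> > 0"
    have p: "\<epsilon> / (cmod k + 1) > 0" using e' by (simp add: add_nonneg_pos)
    obtain d1 where d1: "d1 \<in> ran (\<alpha> e)"
      "vnorm idem (b \<otimes>\<^bsub>idem\<^esub> canon e d \<ominus>\<^bsub>idem\<^esub> canon e d1) < \<epsilon> / (cmod k + 1)"
      using ND[OF b d p] by auto
    let ?x = "b \<otimes>\<^bsub>idem\<^esub> canon e d"
    have m: "?x \<in> carrier idem" "canon e d1 \<in> carrier idem" using b Nc d d1 h(1) by simp_all
    have "(k \<odot>\<^bsub>idem\<^esub> b) \<otimes>\<^bsub>idem\<^esub> canon e d \<ominus>\<^bsub>idem\<^esub> canon e (k \<odot>\<^bsub>B\<^esub> d1) = k \<odot>\<^bsub>idem\<^esub> (?x \<ominus>\<^bsub>idem\<^esub> canon e d1)"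
      using b Nc d d1 h(1,3) m
      by (simp add: idem.mult_scale_left vminus_def idem.scale_add_right idem.scale_scale)
    then have "vnorm idem ((k \<odot>\<^bsub>idem\<^esub> b) \<otimes>\<^bsub>idem\<^esub> canon e d \<ominus>\<^bsub>idem\<^esub> canon e (k \<odot>\<^bsub>B\<^esub> d1))
        = cmod k * vnorm idem (?x \<ominus>\<^bsub>idem\<^esub> canon e d1)"
      using m by (simp add: idem.norm_scale)
    also have "\<dots> \<le> cmod k * (\<epsilon> / (cmod k + 1))" using d1 by (intro mult_left_mono) auto
    also have "\<dots> < \<epsilon>" using e' by (simp add: divide_simps add_nonneg_pos)
    finally show "\<exists>d' \<in> ran (\<alpha> e). vnorm idem ((k \<odot>\<^bsub>idem\<^esub> b) \<otimes>\<^bsub>idem\<^esub> canon e d \<ominus>\<^bsub>idem\<^esub> canon e d') < \<epsilon>"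
      using sub(2)[OF d1(1) d1(1)] by blast
  qed
  have mult: "b \<otimes>\<^bsub>idem\<^esub> c \<in> N" if bc: "b \<in> N" "c \<in> N" for b c
    unfolding N_def
  proof (intro CollectI conjI ballI allI impI)
    show "b \<otimes>\<^bsub>idem\<^esub> c \<in> carrier idem" using bc Nc by simp
    fix d and \<epsilon> :: real assume d: "d \<in> ran (\<alpha> e)" and e': "\<epsilon> > 0"
    have p: "\<epsilon> / 2 / (vnorm idem b + 1) > 0" using e' Nc[OF bc(1)] by (simp add: add_nonneg_pos)
    obtain d1 where d1: "d1 \<in> ran (\<alpha> e)"
      "vnorm idem (c \<otimes>\<^bsub>idem\<^esub> canon e d \<ominus>\<^bsub>idem\<^esub> canon e d1) < \<epsilon> / 2 / (vnorm idem b + 1)"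
      using ND[OF bc(2) d p] by auto
    obtain d2 where d2: "d2 \<in> ran (\<alpha> e)" "vnorm idem (b \<otimes>\<^bsub>idem\<^esub> canon e d1 \<ominus>\<^bsub>idem\<^esub> canon e d2) < \<epsilon> / 2"
      using ND[OF bc(1) d1(1), of "\<epsilon> / 2"] e' by auto
    let ?y = "c \<otimes>\<^bsub>idem\<^esub> canon e d"
    have m: "b \<in> carrier idem" "c \<in> carrier idem" "?y \<in> carrier idem" "canon e d \<in> carrier idem"
      "canon e d1 \<in> carrier idem" "canon e d2 \<in> carrier idem"
      using bc Nc d d1 d2 h(1) by simp_all
    have n: "0 \<le> vnorm idem b" using m by simp
    have "vnorm idem (b \<otimes>\<^bsub>idem\<^esub> ?y \<ominus>\<^bsub>idem\<^esub> b \<otimes>\<^bsub>idem\<^esub> canon e d1)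
        \<le> vnorm idem b * vnorm idem (?y \<ominus>\<^bsub>idem\<^esub> canon e d1)"
      using idem.norm_mult[of b "?y \<ominus>\<^bsub>idem\<^esub> canon e d1"] m by (simp add: idem.mult_minus_right)
    also have "\<dots> \<le> vnorm idem b * (\<epsilon> / 2 / (vnorm idem b + 1))" using d1 n by (intro mult_left_mono) auto
    also have "\<dots> < \<epsilon> / 2" using e' n by (simp add: divide_simps add_nonneg_pos)
    finally have "vnorm idem (b \<otimes>\<^bsub>idem\<^esub> ?y \<ominus>\<^bsub>idem\<^esub> canon e d2) < \<epsilon>"
      using idem.norm_minus_triangle[of "b \<otimes>\<^bsub>idem\<^esub> ?y" "b \<otimes>\<^bsub>idem\<^esub> canon e d1" "canon e d2"] m d2(2) by simp
    then show "\<exists>d' \<in> ran (\<alpha> e). vnorm idem ((b \<otimes>\<^bsub>idem\<^esub> c) \<otimes>\<^bsub>idem\<^esub> canon e d \<ominus>\<^bsub>idem\<^esub> canon e d') < \<epsilon>"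
      using d2(1) m by (simp add: idem.mult_assoc) blast
  qed
  have closedN: "x \<in> N" if x: "x \<in> carrier idem" and lim: "\<forall>\<epsilon>>0. \<exists>y \<in> N. vnorm idem (x \<ominus>\<^bsub>idem\<^esub> y) < \<epsilon>" for x
    unfolding N_def
  proof (intro CollectI conjI ballI allI impI x)
    fix d and \<epsilon> :: real assume d: "d \<in> ran (\<alpha> e)" and e': "\<epsilon> > 0"
    have m: "canon e d \<in> carrier idem" using d h(1) by simp
    have n: "0 \<le> vnorm idem (canon e d)" using m by simp
    have p: "\<epsilon> / 2 / (vnorm idem (canon e d) + 1) > 0" using e' m by (simp add: add_nonneg_pos)
    obtain y where y: "y \<in> N" "vnorm idem (x \<ominus>\<^bsub>idem\<^esub> y) < \<epsilon> / 2 / (vnorm idem (canon e d) + 1)"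
      using lim p by blast
    obtain d1 where d1: "d1 \<in> ran (\<alpha> e)" "vnorm idem (y \<otimes>\<^bsub>idem\<^esub> canon e d \<ominus>\<^bsub>idem\<^esub> canon e d1) < \<epsilon> / 2"
      using ND[OF y(1) d, of "\<epsilon> / 2"] e' by auto
    have m1: "y \<in> carrier idem" "canon e d1 \<in> carrier idem" using Nc y d1 h(1) by simp_all
    have "vnorm idem (x \<otimes>\<^bsub>idem\<^esub> canon e d \<ominus>\<^bsub>idem\<^esub> y \<otimes>\<^bsub>idem\<^esub> canon e d)
        \<le> vnorm idem (x \<ominus>\<^bsub>idem\<^esub> y) * vnorm idem (canon e d)"
      using idem.norm_mult[of "x \<ominus>\<^bsub>idem\<^esub> y" "canon e d"] m m1 x by (simp add: idem.mult_minus_left)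
    also have "\<dots> \<le> \<epsilon> / 2 / (vnorm idem (canon e d) + 1) * vnorm idem (canon e d)"
      using y n by (intro mult_right_mono) auto
    also have "\<dots> < \<epsilon> / 2" using e' n by (simp add: divide_simps add_nonneg_pos)
    finally have "vnorm idem (x \<otimes>\<^bsub>idem\<^esub> canon e d \<ominus>\<^bsub>idem\<^esub> canon e d1) < \<epsilon>"
      using idem.norm_minus_triangle[of "x \<otimes>\<^bsub>idem\<^esub> canon e d" "y \<otimes>\<^bsub>idem\<^esub> canon e d" "canon e d1"] m m1 x d1(2) by simp
    then show "\<exists>d' \<in> ran (\<alpha> e). vnorm idem (x \<otimes>\<^bsub>idem\<^esub> canon e d \<ominus>\<^bsub>idem\<^esub> canon e d') < \<epsilon>" using d1(1) by blast
  qed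
  have gensN: "canon f b \<in> N" if f: "f \<in> idempotents S" and b: "b \<in> ran (\<alpha> f)" for f b
  proof (rule exact)
    show "canon f b \<in> carrier idem" by (rule canon_idem[OF f b])
    fix d assume d: "d \<in> ran (\<alpha> e)"
    have fc: "f \<in> elts S" using idempotents_closed[OF f] .
    obtain z where z: "\<alpha> f (b \<otimes>\<^bsub>B\<^esub> d) = Some z" "fmult A f e b d = z" "z \<in> ran (\<alpha> (f \<cdot>\<^bsub>S\<^esub> e))"
      using fmult_closed[OF fc ec idempotent_Some[OF f b] d] .
    have le: "nat_le S (f \<cdot>\<^bsub>S\<^esub> e) e" by (rule idempotent_nat_le(2)[OF f e])
    have "canon f b \<otimes>\<^bsub>idem\<^esub> canon e d = canon e z"
      using canon_mult[OF fc ec b d] z canon_mono[OF le z(3)] by (simp add: idem_simps)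
    then show "\<exists>d' \<in> ran (\<alpha> e). canon f b \<otimes>\<^bsub>idem\<^esub> canon e d = canon e d'"
      using ran_mono[OF le z(3)] by blast
  qed
  \<comment> \<open>\<open>N\<close> is defined by multiplication from the left and is not visibly
    closed under adjoints, so membership of the adjoint is imposed as well.\<close>
  let ?M = "{b \<in> carrier idem. b \<in> N \<and> adj idem b \<in> N}"
  have zN: "\<zero>\<^bsub>idem\<^esub> \<in> N"
  proof (rule exact)
    fix d assume "d \<in> ran (\<alpha> e)"
    then show "\<exists>d' \<in> ran (\<alpha> e). \<zero>\<^bsub>idem\<^esub> \<otimes>\<^bsub>idem\<^esub> canon e d = canon e d'"
      using h(1,3)[of d] sub(2)[of d d 0] by (intro bexI[of _ "0 \<odot>\<^bsub>B\<^esub> d"]) simp_all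
  qed simp
  have subM: "cstar_subalgebra idem ?M"
    unfolding cstar_subalgebra_def
  proof (intro conjI ballI)
    show "lin_subspace idem ?M"
      unfolding lin_subspace_def using zN add scale by (auto simp: idem.adj_add idem.adj_scale)
    show "x \<otimes>\<^bsub>idem\<^esub> y \<in> ?M" if "x \<in> ?M" "y \<in> ?M" for x y
      using that mult by (auto simp: idem.adj_mult)
    show "adj idem x \<in> ?M" if "x \<in> ?M" for x using that by auto
    show "closedin (norm_topology idem) ?M"
      unfolding idem.closedin_norm_iff
    proof (intro conjI ballI impI)
      fix x assume x: "x \<in> carrier idem" and lim: "\<forall>\<epsilon>>0. \<exists>y \<in> ?M. vnorm idem (x \<ominus>\<^bsub>idem\<^esub> y) < \<epsilon>"
      have "x \<in> N" using lim by (intro closedN x) blast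
      moreover have "adj idem x \<in> N"
      proof (rule closedN)
        show "\<forall>\<epsilon>>0. \<exists>y \<in> N. vnorm idem (adj idem x \<ominus>\<^bsub>idem\<^esub> y) < \<epsilon>"
        proof (intro allI impI)
          fix \<epsilon> :: real assume "\<epsilon> > 0"
          then obtain y where y: "y \<in> ?M" "vnorm idem (x \<ominus>\<^bsub>idem\<^esub> y) < \<epsilon>" using lim by blast
          then have "vnorm idem (adj idem x \<ominus>\<^bsub>idem\<^esub> adj idem y) < \<epsilon>"
            using idem.norm_adj[of "x \<ominus>\<^bsub>idem\<^esub> y"] x by (simp add: idem.adj_minus)
          then show "\<exists>y \<in> N. vnorm idem (adj idem x \<ominus>\<^bsub>idem\<^esub> y) < \<epsilon>" using y by blast
        qed
      qed (use x in simp)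
      ultimately show "x \<in> ?M" using x by simp
    qed auto
  qed
  have "idem_gens \<subseteq> ?M"
  proof
    fix y assume "y \<in> idem_gens"
    then obtain f b where f: "y = canon f b" "f \<in> idempotents S" "b \<in> ran (\<alpha> f)" by blast
    have "adj idem (canon f b) = canon f (adj B b)"
      using star_homD(5)[OF canon_star_hom[OF f(2)], of b] f by simp
    then show "y \<in> ?M" using f canon_idem gensN idempotent_fadj(2)[OF f(2,3)] by simp
  qed
  \<comment> \<open>Minimality of \<open>idem\<close> refers to subalgebras of \<open>full\<close>.
    Closedness passes from \<open>idem\<close> to \<open>full\<close> because the carrier of
    \<open>idem\<close> is closed in \<open>full\<close>.\<close>
  moreover have "cstar_subalgebra full ?M"
  proof -
    have "closedin (norm_topology full) ?M"
      unfolding full.closedin_norm_iff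
    proof (intro conjI ballI impI)
      show "?M \<subseteq> carrier full" using idem_subset by blast
      fix x assume x: "x \<in> carrier full" and lim: "\<forall>\<epsilon>>0. \<exists>y \<in> ?M. vnorm full (x \<ominus>\<^bsub>full\<^esub> y) < \<epsilon>"
      have "closedin (norm_topology full) (carrier idem)"
        using GE.generated_subalgebra by (simp add: cstar_subalgebra_def idem_eq)
      then have xi: "x \<in> carrier idem"
        using x lim unfolding full.closedin_norm_iff by blast
      have vm: "vminus full = vminus idem" by (simp add: vminus_def fun_eq_iff idem_simps)
      show "x \<in> ?M"
        using subM lim xi unfolding cstar_subalgebra_def idem.closedin_norm_iff vm idem_simps(4) by blast
    qed
    then show ?thesis
      using subM idem_subset unfolding cstar_subalgebra_def lin_subspace_def idem_simps by blast
  qed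
  ultimately have "carrier idem \<subseteq> ?M" using GE.generated_least by (simp add: idem_eq)
  then show ?thesis using ND[of b d \<epsilon>] b d \<epsilon> by blast
qed

end

section \<open>Representations over \<open>G\<close> and over \<open>Pr(G)\<close>\<close>

lemma (in crossed_product) representationI:
  assumes "\<pi> \<in> (\<Pi>\<^sub>E s \<in> elts S. ran (\<alpha> s) \<rightarrow>\<^sub>E carrier C)"
    and "\<And>s a b. \<lbrakk>s \<in> elts S; a \<in> ran (\<alpha> s); b \<in> ran (\<alpha> s)\<rbrakk> \<Longrightarrow> \<pi> s (a \<oplus>\<^bsub>B\<^esub> b) = \<pi> s a \<oplus>\<^bsub>C\<^esub> \<pi> s b"
    and "\<And>s a k. \<lbrakk>s \<in> elts S; a \<in> ran (\<alpha> s)\<rbrakk> \<Longrightarrow> \<pi> s (k \<odot>\<^bsub>B\<^esub> a) = k \<odot>\<^bsub>C\<^esub> \<pi> s a"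
    and "\<And>s t a b. \<lbrakk>s \<in> elts S; t \<in> elts S; a \<in> ran (\<alpha> s); b \<in> ran (\<alpha> t)\<rbrakk> \<Longrightarrow>
      \<pi> s a \<otimes>\<^bsub>C\<^esub> \<pi> t b = \<pi> (s \<cdot>\<^bsub>S\<^esub> t) (fmult A s t a b)"
    and "\<And>s a. \<lbrakk>s \<in> elts S; a \<in> ran (\<alpha> s)\<rbrakk> \<Longrightarrow> adj C (\<pi> s a) = \<pi> (inv_of S s) (fadj A s a)"
    and "\<And>s t a. \<lbrakk>nat_le S s t; a \<in> ran (\<alpha> s)\<rbrakk> \<Longrightarrow> \<pi> t a = \<pi> s a"
  shows "representation A C \<pi>"
proof -
  have "\<pi> s a \<in> carrier C" if "s \<in> elts S" "a \<in> ran (\<alpha> s)" for s a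
    using PiE_mem[OF PiE_mem[OF assms(1) that(1)] that(2)] .
  then show ?thesis
    unfolding representation_def linear_map_def using assms by simp
qed

lemma semigroup_hom_partial_hom:
  assumes "inverse_semigroup S" "semigroup_hom S T h"
  shows "partial_hom S T h"
proof -
  interpret inverse_semigroup S by fact
  show ?thesis
    unfolding partial_hom_def
    using assms(2)
    by (auto simp: semigroup_hom_closed closed inv_of_properties assoc[symmetric] simp flip: semigroup_hom_mult[OF assms(2)])
qed

text \<open>Both bundles share the carrier type \<open>U\<close>, so that corresponding
  representations can have the very same target algebra.\<close>

locale partial_action_extension =
  L: crossed_product G B \<beta> U + Q: crossed_product "Pr G" B \<beta>' U
  for G :: "'g semigroup_str" and B :: "'b star_algebra" and \<beta> :: "'g \<Rightarrow> 'b \<rightharpoonup> 'b"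
    and \<beta>' :: "'g list set \<Rightarrow> 'b \<rightharpoonup> 'b" and U :: "'c itself" +
  assumes gen: "s \<in> elts G \<Longrightarrow> \<beta>' (pr_gen G s) = \<beta> s"
    and hom: "semigroup_hom (Pr G) (PAut B) \<beta>'"
begin

abbreviation g where "g \<equiv> pr_gen G"
abbreviation d where "d \<equiv> L.Pr_retract"

lemmas g_closed = L.pr_gen_closed
lemmas d_closed = L.Pr_retract_closed
lemmas d_g = L.Pr_retract_gen
lemmas le_gd = L.nat_le_Pr_gen_retract

lemma d_mult: "\<lbrakk>x \<in> elts (Pr G); y \<in> elts (Pr G)\<rbrakk> \<Longrightarrow> d (x \<cdot>\<^bsub>Pr G\<^esub> y) = d x \<cdot>\<^bsub>G\<^esub> d y"
  by (rule semigroup_hom_mult[OF L.Pr_retract_hom])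

lemma extends: "\<lbrakk>x \<in> elts (Pr G); \<beta>' x y = Some z\<rbrakk> \<Longrightarrow> \<beta> (d x) y = Some z"
  using Q.action_mono[OF le_gd] gen[OF d_closed] by metis

lemma ran_extends: "\<lbrakk>x \<in> elts (Pr G); a \<in> ran (\<beta>' x)\<rbrakk> \<Longrightarrow> a \<in> ran (\<beta> (d x))"
  using extends Q.ran_Some ranI by metis

text \<open>As \<open>\<beta>' x\<close> is a restriction of \<open>\<beta> (d x)\<close>, the same
  preimage of \<open>a\<close> computes both products.\<close>

lemma fmult_extends:
  assumes x: "x \<in> elts (Pr G)" and y: "y \<in> elts (Pr G)" and a: "a \<in> ran (\<beta>' x)" and b: "b \<in> ran (\<beta>' y)"
  shows "fmult L.A (d x) (d y) a b = fmult Q.A x y a b" "fmult Q.A x y a b \<in> ran (\<beta>' (x \<cdot>\<^bsub>Pr G\<^esub> y))"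
proof -
  obtain u where u: "\<beta>' x u = Some a" using Q.ran_Some[OF a] by blast
  obtain z where z: "\<beta>' x (u \<otimes>\<^bsub>B\<^esub> b) = Some z" "fmult Q.A x y a b = z" "z \<in> ran (\<beta>' (x \<cdot>\<^bsub>Pr G\<^esub> y))"
    using Q.fmult_closed[OF x y u b] .
  then show "fmult Q.A x y a b \<in> ran (\<beta>' (x \<cdot>\<^bsub>Pr G\<^esub> y))" by simp
  show "fmult L.A (d x) (d y) a b = fmult Q.A x y a b"
    using L.fmult_eq[OF d_closed[OF x] extends[OF x u] extends[OF x z(1)]] z(2) by simp
qed

lemma fadj_extends:
  assumes x: "x \<in> elts (Pr G)" and a: "a \<in> ran (\<beta>' x)"
  shows "fadj L.A (d x) a = fadj Q.A x a" "fadj Q.A x a \<in> ran (\<beta>' (inv_of (Pr G) x))"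
proof -
  obtain u where u: "\<beta>' x u = Some a" using Q.ran_Some[OF a] by blast
  show "fadj Q.A x a \<in> ran (\<beta>' (inv_of (Pr G) x))" using Q.fadj_eq[OF x u] by simp
  show "fadj L.A (d x) a = fadj Q.A x a"
    using L.fadj_eq(1)[OF d_closed[OF x] extends[OF x u]] Q.fadj_eq(1)[OF x u] by simp
qed

text \<open>Restriction to generators. The target algebra stays fixed, so components indexed by
  \<open>\<rho>\<close> and by \<open>\<Phi> \<rho>\<close> lie in the same algebra.\<close>

definition \<Phi> :: "'c star_algebra \<times> ('g list set \<Rightarrow> 'b \<Rightarrow> 'c) \<Rightarrow> 'c star_algebra \<times> ('g \<Rightarrow> 'b \<Rightarrow> 'c)" where
  "\<Phi> \<rho> = (fst \<rho>, \<lambda>s \<in> elts G. snd \<rho> (g s))"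

definition \<Psi> :: "'c star_algebra \<times> ('g \<Rightarrow> 'b \<Rightarrow> 'c) \<Rightarrow> 'c star_algebra \<times> ('g list set \<Rightarrow> 'b \<Rightarrow> 'c)" where
  "\<Psi> \<rho> = (fst \<rho>, \<lambda>x \<in> elts (Pr G). \<lambda>a \<in> ran (\<beta>' x). snd \<rho> (d x) a)"

lemma \<Phi>_rep:
  assumes "\<rho> \<in> Q.R"
  shows "\<Phi> \<rho> \<in> L.R"
proof -
  define C where "C = fst \<rho>"
  define \<pi> where "\<pi> = snd \<rho>"
  have C: "cstar_algebra C" and \<pi>: "representation Q.A C \<pi>"
    using Q.repsD[OF assms] by (auto simp: C_def \<pi>_def)
  note D = Q.representationD[OF \<pi>]
  have ran: "ran (\<beta>' (g s)) = ran (\<beta> s)" if "s \<in> elts G" for s using gen[OF that] by simp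
  have "representation L.A C (\<lambda>s \<in> elts G. \<pi> (g s))"
  proof (rule L.representationI)
    show "(\<lambda>s \<in> elts G. \<pi> (g s)) \<in> (\<Pi>\<^sub>E s \<in> elts G. ran (\<beta> s) \<rightarrow>\<^sub>E carrier C)"
    proof (rule restrict_PiE_iff[THEN iffD2], intro ballI)
      fix s assume s: "s \<in> elts G"
      show "\<pi> (g s) \<in> ran (\<beta> s) \<rightarrow>\<^sub>E carrier C"
        using PiE_mem[OF D(7) g_closed[OF s]] by (simp only: ran[OF s])
    qed
  next
    fix s a assume s: "s \<in> elts G" and a: "a \<in> ran (\<beta> s)"
    have a': "a \<in> ran (\<beta>' (g s))" using a ran[OF s] by simp
    show "(\<lambda>s \<in> elts G. \<pi> (g s)) s (k \<odot>\<^bsub>B\<^esub> a) = k \<odot>\<^bsub>C\<^esub> (\<lambda>s \<in> elts G. \<pi> (g s)) s a" for k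
      using D(3)[OF g_closed[OF s] a'] s by simp
    show "adj C ((\<lambda>s \<in> elts G. \<pi> (g s)) s a) = (\<lambda>s \<in> elts G. \<pi> (g s)) (inv_of G s) (fadj L.A s a)"
      using D(5)[OF g_closed[OF s] a'] fadj_extends(1)[OF g_closed[OF s] a'] s
      by (simp add: L.Pr_inv_of_gen d_g)
    show "(\<lambda>s \<in> elts G. \<pi> (g s)) s (a \<oplus>\<^bsub>B\<^esub> b)
        = (\<lambda>s \<in> elts G. \<pi> (g s)) s a \<oplus>\<^bsub>C\<^esub> (\<lambda>s \<in> elts G. \<pi> (g s)) s b" if "b \<in> ran (\<beta> s)" for b
      using D(2)[OF g_closed[OF s] a', of b] that ran[OF s] s by simp
    fix t b assume t: "t \<in> elts G" and b: "b \<in> ran (\<beta> t)"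
    have b': "b \<in> ran (\<beta>' (g t))" using b ran[OF t] by simp
    have "\<pi> (g s) a \<otimes>\<^bsub>C\<^esub> \<pi> (g t) b = \<pi> (g s \<cdot>\<^bsub>Pr G\<^esub> g t) (fmult Q.A (g s) (g t) a b)"
      by (rule D(4)[OF g_closed[OF s] g_closed[OF t] a' b'])
    \<comment> \<open>The generators do not multiply: the product lies in the fiber over
      \<open>[s][t]\<close>, and compatibility with the inclusion for
      \<open>[s][t] \<le> [st]\<close> moves it to the generator of the product.\<close>
    also have "\<dots> = \<pi> (g (s \<cdot>\<^bsub>G\<^esub> t)) (fmult Q.A (g s) (g t) a b)"
      using D(6)[OF L.Pr_gen_mult_nat_le[OF s t] fmult_extends(2)[OF g_closed[OF s] g_closed[OF t] a' b']] by simp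
    also have "fmult Q.A (g s) (g t) a b = fmult L.A s t a b"
      using fmult_extends(1)[OF g_closed[OF s] g_closed[OF t] a' b'] s t by (simp add: d_g)
    finally show "(\<lambda>s \<in> elts G. \<pi> (g s)) s a \<otimes>\<^bsub>C\<^esub> (\<lambda>s \<in> elts G. \<pi> (g s)) t b
        = (\<lambda>s \<in> elts G. \<pi> (g s)) (s \<cdot>\<^bsub>G\<^esub> t) (fmult L.A s t a b)"
      using s t by (simp add: L.closed)
  next
    fix s t a assume st: "nat_le G s t" and a: "a \<in> ran (\<beta> s)"
    have s: "s \<in> elts G" "t \<in> elts G" using st by (auto simp: nat_le_def)
    show "(\<lambda>s \<in> elts G. \<pi> (g s)) t a = (\<lambda>s \<in> elts G. \<pi> (g s)) s a"
      using D(6)[OF L.Pr_gen_nat_le[OF st], of a] a ran[OF s(1)] s by simp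
  qed
  then show ?thesis using C by (simp add: all_reps_def \<Phi>_def C_def \<pi>_def)
qed

lemma \<Psi>_rep:
  assumes "\<rho> \<in> L.R"
  shows "\<Psi> \<rho> \<in> Q.R"
proof -
  define C where "C = fst \<rho>"
  define \<pi> where "\<pi> = snd \<rho>"
  have C: "cstar_algebra C" and \<pi>: "representation L.A C \<pi>"
    using L.repsD[OF assms] by (auto simp: C_def \<pi>_def)
  note D = L.representationD[OF \<pi>]
  let ?\<pi> = "\<lambda>x \<in> elts (Pr G). \<lambda>a \<in> ran (\<beta>' x). \<pi> (d x) a"
  have ap: "?\<pi> x a = \<pi> (d x) a" if "x \<in> elts (Pr G)" "a \<in> ran (\<beta>' x)" for x a using that by simp
  have "representation Q.A C ?\<pi>"
  proof (rule Q.representationI)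
    show "?\<pi> \<in> (\<Pi>\<^sub>E x \<in> elts (Pr G). ran (\<beta>' x) \<rightarrow>\<^sub>E carrier C)"
      using D(1)[OF d_closed ran_extends] by (simp add: restrict_PiE_iff)
  next
    fix x a assume x: "x \<in> elts (Pr G)" and a: "a \<in> ran (\<beta>' x)"
    note sub = lin_subspaceD[OF closed_idealD(2)[OF Q.automorphismD(2)[OF x]]]
    note da = d_closed[OF x] ran_extends[OF x a]
    show "?\<pi> x (k \<odot>\<^bsub>B\<^esub> a) = k \<odot>\<^bsub>C\<^esub> ?\<pi> x a" for k
      using D(3)[OF da] ap[OF x] a sub(4)[OF a] by simp
    show "?\<pi> x (a \<oplus>\<^bsub>B\<^esub> b) = ?\<pi> x a \<oplus>\<^bsub>C\<^esub> ?\<pi> x b" if "b \<in> ran (\<beta>' x)" for b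
      using D(2)[OF da ran_extends[OF x that]] ap[OF x] a that sub(3)[OF a that] by simp
    show "adj C (?\<pi> x a) = ?\<pi> (inv_of (Pr G) x) (fadj Q.A x a)"
      using D(5)[OF da] ap[OF x a] ap[OF Q.inv_of_closed[OF x] fadj_extends(2)[OF x a]]
        fadj_extends(1)[OF x a] L.Pr_retract_inv_of[OF x] by simp
    fix y b assume y: "y \<in> elts (Pr G)" and b: "b \<in> ran (\<beta>' y)"
    show "?\<pi> x a \<otimes>\<^bsub>C\<^esub> ?\<pi> y b = ?\<pi> (x \<cdot>\<^bsub>Pr G\<^esub> y) (fmult Q.A x y a b)"
      using D(4)[OF da(1) d_closed[OF y] da(2) ran_extends[OF y b]] ap[OF x a] ap[OF y b]
        ap[OF Q.closed[OF x y] fmult_extends(2)[OF x y a b]] fmult_extends(1)[OF x y a b] d_mult[OF x y]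
      by simp
  next
    fix x y a assume xy: "nat_le (Pr G) x y" and a: "a \<in> ran (\<beta>' x)"
    have x: "x \<in> elts (Pr G)" "y \<in> elts (Pr G)" using xy by (auto simp: nat_le_def)
    show "?\<pi> y a = ?\<pi> x a"
      using D(6)[OF semigroup_hom_nat_le[OF L.Pr_retract_hom xy] ran_extends[OF x(1) a]]
        ap[OF x(1) a] ap[OF x(2) Q.ran_mono[OF xy a]] by simp
  qed
  then show ?thesis using C by (simp add: all_reps_def \<Psi>_def C_def \<pi>_def)
qed

lemma \<Phi>\<Psi>:
  assumes "\<rho> \<in> L.R"
  shows "\<Phi> (\<Psi> \<rho>) = \<rho>"
proof -
  note P = L.representationD(7)[OF L.repsD(2)[OF assms]]
  have "(\<lambda>s \<in> elts G. (\<lambda>x \<in> elts (Pr G). \<lambda>a \<in> ran (\<beta>' x). snd \<rho> (d x) a) (g s)) = snd \<rho>"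
  proof (rule extensionalityI[of _ "elts G"])
    show "snd \<rho> \<in> extensional (elts G)" using P by (simp add: PiE_def)
    fix s assume s: "s \<in> elts G"
    have "(\<lambda>a \<in> ran (\<beta> s). snd \<rho> s a) = snd \<rho> s"
      using PiE_mem[OF P s] by (intro extensional_restrict) (simp add: PiE_def)
    then show "(\<lambda>s \<in> elts G. (\<lambda>x \<in> elts (Pr G). \<lambda>a \<in> ran (\<beta>' x). snd \<rho> (d x) a) (g s)) s = snd \<rho> s"
      using s g_closed[OF s] by (simp add: d_g gen)
  qed simp
  then show ?thesis by (simp add: \<Phi>_def \<Psi>_def prod_eq_iff)
qed

text \<open>Compatibility with the inclusion for \<open>x \<le> [d x]\<close> leaves no freedom: the
  value of a representation at \<open>x\<close> is determined by its value at a generator.\<close>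

lemma \<Psi>\<Phi>:
  assumes "\<rho> \<in> Q.R"
  shows "\<Psi> (\<Phi> \<rho>) = \<rho>"
proof -
  note D = Q.representationD[OF Q.repsD(2)[OF assms]]
  have "(\<lambda>x \<in> elts (Pr G). \<lambda>a \<in> ran (\<beta>' x). (\<lambda>s \<in> elts G. snd \<rho> (g s)) (d x) a) = snd \<rho>"
  proof (rule extensionalityI[of _ "elts (Pr G)"])
    show "snd \<rho> \<in> extensional (elts (Pr G))" using D(7) by (simp add: PiE_def)
    fix x assume x: "x \<in> elts (Pr G)"
    have "(\<lambda>a \<in> ran (\<beta>' x). (\<lambda>s \<in> elts G. snd \<rho> (g s)) (d x) a) = snd \<rho> x"
    proof (rule extensionalityI[of _ "ran (\<beta>' x)"])
      show "snd \<rho> x \<in> extensional (ran (\<beta>' x))" using PiE_mem[OF D(7) x] by (simp add: PiE_def)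
      fix a assume a: "a \<in> ran (\<beta>' x)"
      show "(\<lambda>a \<in> ran (\<beta>' x). (\<lambda>s \<in> elts G. snd \<rho> (g s)) (d x) a) a = snd \<rho> x a"
        using D(6)[OF le_gd[OF x] a] a d_closed[OF x] by simp
    qed simp
    then show "(\<lambda>x \<in> elts (Pr G). \<lambda>a \<in> ran (\<beta>' x). (\<lambda>s \<in> elts G. snd \<rho> (g s)) (d x) a) x = snd \<rho> x"
      using x by simp
  qed simp
  then show ?thesis by (simp add: \<Phi>_def \<Psi>_def prod_eq_iff)
qed

lemma \<Phi>_image: "\<Phi> ` Q.R = L.R"
  using \<Phi>_rep \<Psi>_rep \<Phi>\<Psi> by (auto simp: image_iff) metis

lemma fst_\<Phi> [simp]: "fst (\<Phi> \<rho>) = fst \<rho>"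
  by (simp add: \<Phi>_def)

lemma fst_\<Psi> [simp]: "fst (\<Psi> \<rho>) = fst \<rho>"
  by (simp add: \<Psi>_def)

text \<open>Reindexing along \<open>\<Phi>\<close>. All operations and the norm of the product are
  componentwise, so a bijection of the index sets that preserves the components gives an isometric
  isomorphism.\<close>

definition T :: "('g, 'b, 'c) rep_family \<Rightarrow> ('g list set, 'b, 'c) rep_family" where
  "T x = (\<lambda>\<rho> \<in> Q.R. x (\<Phi> \<rho>))"

definition T_inv :: "('g list set, 'b, 'c) rep_family \<Rightarrow> ('g, 'b, 'c) rep_family" where
  "T_inv x = (\<lambda>\<rho> \<in> L.R. x (\<Psi> \<rho>))"

lemma T_product: "isometric_isomorphism L.P Q.P T"
proof -
  have car: "T x \<in> carrier Q.P" if x: "x \<in> carrier L.P" for x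
    using L.F.carrierD(1,4)[OF x \<Phi>_rep]
    by (intro Q.F.carrierI[where K = "vnorm L.P x"]) (simp_all add: T_def)
  have car': "T_inv x \<in> carrier L.P" if x: "x \<in> carrier Q.P" for x
    using Q.F.carrierD(1,4)[OF x \<Psi>_rep]
    by (intro L.F.carrierI[where K = "vnorm Q.P x"]) (simp_all add: T_inv_def)
  have inv: "T_inv (T x) = x" if x: "x \<in> carrier L.P" for x
    by (rule L.F.eqI) (simp_all add: T_def T_inv_def L.F.carrierD(2)[OF x] \<Phi>\<Psi> \<Psi>_rep)
  have inv': "T (T_inv x) = x" if x: "x \<in> carrier Q.P" for x
    by (rule Q.F.eqI) (simp_all add: T_def T_inv_def Q.F.carrierD(2)[OF x] \<Psi>\<Phi> \<Phi>_rep)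
  have bij: "bij_betw T (carrier L.P) (carrier Q.P)"
    by (rule bij_betwI[of T _ _ T_inv]) (use car car' inv inv' in auto)
  have norm: "vnorm Q.P (T x) = vnorm L.P x" for x
  proof -
    have "(\<lambda>\<rho>. vnorm (fst \<rho>) (T x \<rho>)) ` Q.R = (\<lambda>\<rho>. vnorm (fst \<rho>) (x \<rho>)) ` L.R"
      unfolding \<Phi>_image[symmetric] image_image by (intro image_cong) (simp_all add: T_def)
    then show ?thesis unfolding L.F.product_simps Q.F.product_simps by (rule arg_cong)
  qed
  have ops: "T (x \<oplus>\<^bsub>L.P\<^esub> y) = T x \<oplus>\<^bsub>Q.P\<^esub> T y" "T (c \<odot>\<^bsub>L.P\<^esub> x) = c \<odot>\<^bsub>Q.P\<^esub> T x"
    "T (x \<otimes>\<^bsub>L.P\<^esub> y) = T x \<otimes>\<^bsub>Q.P\<^esub> T y" "T (adj L.P x) = adj Q.P (T x)" for x y c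
    by (rule Q.F.eqI; simp add: T_def L.F.product_simps Q.F.product_simps \<Phi>_rep)+
  have "isometric_iso L.P Q.P T"
    by (simp add: isometric_iso_def star_iso_def star_hom_def linear_map_def bij norm ops car)
  then show ?thesis
    by (intro isometric_isomorphism.intro isometric_isomorphism_axioms.intro
        L.F.cstar_algebra_product Q.F.cstar_algebra_product)
qed

lemma T_canon: "s \<in> elts G \<Longrightarrow> T (L.canon s a) = Q.canon (g s) a"
  by (rule Q.F.eqI) (simp_all add: T_def L.canon_apply Q.canon_apply \<Phi>_rep, simp add: \<Phi>_def)

lemma canon_retract: "\<lbrakk>x \<in> elts (Pr G); a \<in> ran (\<beta>' x)\<rbrakk> \<Longrightarrow> Q.canon x a = T (L.canon (d x) a)"
  using Q.canon_mono[OF le_gd] T_canon[OF d_closed] by metis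

lemma d_idempotent: "e \<in> idempotents (Pr G) \<Longrightarrow> d e \<in> idempotents G"
  by (rule semigroup_hom_idempotent[OF L.Pr_retract_hom])

lemma T_gens: "T ` L.gens = Q.gens"
proof (intro equalityI subsetI)
  fix y assume "y \<in> T ` L.gens"
  then obtain s a where s: "s \<in> elts G" "a \<in> ran (\<beta> s)" "y = T (L.canon s a)" by blast
  then have "y = Q.canon (g s) a" "a \<in> ran (\<beta>' (g s))" using T_canon[of s a] gen[OF s(1)] by simp_all
  then show "y \<in> Q.gens" using g_closed[OF s(1)] by blast
next
  fix y assume "y \<in> Q.gens"
  then obtain x a where x: "x \<in> elts (Pr G)" "a \<in> ran (\<beta>' x)" "y = Q.canon x a" by blast
  then show "y \<in> T ` L.gens" using canon_retract[OF x(1,2)] d_closed[OF x(1)] ran_extends[OF x(1,2)] by blast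
qed

lemma T_idem_gens: "T ` L.idem_gens = Q.idem_gens"
proof (intro equalityI subsetI)
  fix y assume "y \<in> T ` L.idem_gens"
  then obtain s a where s: "s \<in> idempotents G" "a \<in> ran (\<beta> s)" "y = T (L.canon s a)" by blast
  have "s \<in> elts G" using L.idempotents_closed s by blast
  then have "y = Q.canon (g s) a" "a \<in> ran (\<beta>' (g s))" using T_canon[of s a] gen[of s] s by simp_all
  then show "y \<in> Q.idem_gens" using L.Pr_gen_idempotent[OF s(1)] by blast
next
  fix y assume "y \<in> Q.idem_gens"
  then obtain x a where x: "x \<in> idempotents (Pr G)" "a \<in> ran (\<beta>' x)" "y = Q.canon x a" by blast
  have "x \<in> elts (Pr G)" using Q.idempotents_closed x by blast
  then show "y \<in> T ` L.idem_gens"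
    using canon_retract[of x a] d_idempotent[OF x(1)] ran_extends[of x a] x by blast
qed

lemma T_full: "isometric_isomorphism L.full Q.full T"
  using isometric_isomorphism.generated_isomorphism[OF T_product L.GP.subset]
  by (simp only: T_gens L.full_eq Q.full_eq)

lemma T_idem: "isometric_isomorphism L.idem Q.idem T"
  using isometric_isomorphism.generated_isomorphism[OF T_full L.idem_gens_full]
  by (simp only: T_idem_gens L.idem_eq Q.idem_eq)

sublocale TF: isometric_isomorphism L.full Q.full T by (rule T_full)

sublocale TE: isometric_isomorphism L.idem Q.idem T by (rule T_idem)

end

section \<open>Extended states over \<open>G\<close> and over \<open>Pr G\<close>\<close>

context partial_action_extension
begin

text \<open>The value \<open>z\<close> is known along a unit of the larger ideal over
  \<open>d e'\<close> and is wanted along a unit of the smaller ideal over \<open>e'\<close>. As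
  \<open>c\<close> need not lie in either ideal, it has no canonical image to which
  \<open>mult_unit_close\<close> could be applied; the products \<open>c \<otimes> u0\<close> with
  \<open>u0\<close> from \<open>F0\<close> are used instead.\<close>

lemma limit_along_smaller_unit:
  assumes pure: "pure_state Q.idem \<phi>"
    and e': "e' \<in> idempotents (Pr G)" and nz: "\<exists>b \<in> ran (\<beta>' e'). \<phi> (Q.canon e' b) \<noteq> 0"
    and F: "approximate_unit (Q.fiber_ideal e') F"
    and F0: "approximate_unit (L.fiber_ideal (d e')) F0"
    and c: "c \<in> carrier B"
    and lim: "((\<lambda>u. \<phi> (Q.canon (g (d e')) (c \<otimes>\<^bsub>B\<^esub> u))) \<longlongrightarrow> z) F0"
  shows "((\<lambda>u. \<phi> (Q.canon e' (c \<otimes>\<^bsub>B\<^esub> u))) \<longlongrightarrow> z) F"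
proof -
  have e'c: "e' \<in> elts (Pr G)" using Q.idempotents_closed[OF e'] .
  have e: "d e' \<in> idempotents G" "d e' \<in> elts G" using d_idempotent[OF e'] d_closed[OF e'c] .
  let ?e = "g (d e')"
  have ge: "?e \<in> idempotents (Pr G)" "?e \<in> elts (Pr G)" "\<beta>' ?e = \<beta> (d e')"
    using L.Pr_gen_idempotent[OF e(1)] g_closed[OF e(2)] gen[OF e(2)] .
  interpret X: pure_state_on_ideal Q.idem "Q.fiber_ideal e'" "Q.canon e'" \<phi> F
  proof (intro pure_state_on_ideal.intro pure_state_on_ideal_axioms.intro)
    show "cstar_algebra Q.idem" by (rule Q.idem.cstar_algebra_axioms)
    show "cstar_algebra (Q.fiber_ideal e')" by (rule Q.cstar_algebra_fiber_ideal[OF e'c])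
    show "star_hom (Q.fiber_ideal e') Q.idem (Q.canon e')" by (rule Q.canon_star_hom[OF e'])
    show "pure_state Q.idem \<phi>" "approximate_unit (Q.fiber_ideal e') F" by (rule pure F)+
    show "\<exists>d' \<in> carrier (Q.fiber_ideal e').
        vnorm Q.idem (b \<otimes>\<^bsub>Q.idem\<^esub> Q.canon e' a \<ominus>\<^bsub>Q.idem\<^esub> Q.canon e' d') < \<epsilon>"
      if "b \<in> carrier Q.idem" "a \<in> carrier (Q.fiber_ideal e')" "\<epsilon> > 0" for b a \<epsilon>
      using Q.idem_ideal[OF e' that(1) _ that(3)] that(2) by simp
    show "\<exists>b \<in> carrier (Q.fiber_ideal e'). \<phi> (Q.canon e' b) \<noteq> 0" using nz by simp
  qed
  define f where "f v = \<phi> (Q.canon ?e v)" for v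
  have ran: "v \<in> ran (\<beta> (d e'))" if "v \<in> ran (\<beta>' e')" for v using ran_extends[OF e'c that] .
  have ce: "Q.canon e' v = Q.canon ?e v" if "v \<in> ran (\<beta>' e')" for v
    using Q.canon_mono[OF le_gd[OF e'c] that] by simp
  note he = star_homD[OF Q.canon_star_hom[OF ge(1)], unfolded ge(3), simplified]
  have idl: "x \<otimes>\<^bsub>B\<^esub> v \<in> ran (\<beta> (d e'))" "v \<otimes>\<^bsub>B\<^esub> x \<in> ran (\<beta> (d e'))"
    if "v \<in> ran (\<beta> (d e'))" "x \<in> carrier B" for v x
    using closed_idealD(4,5)[OF L.automorphismD(2)[OF e(2)] that(2,1)] .
  have idl': "x \<otimes>\<^bsub>B\<^esub> v \<in> ran (\<beta>' e')" if "v \<in> ran (\<beta>' e')" "x \<in> carrier B" for v x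
    using closed_idealD(4)[OF Q.automorphismD(2)[OF e'c] that(2,1)] .
  have rc: "v \<in> carrier B" if "v \<in> ran (\<beta> (d e'))" for v using L.ran_carrier[OF e(2) that] .
  have bound: "cmod (f v) \<le> vnorm B v" if v: "v \<in> ran (\<beta> (d e'))" for v
  proof -
    have "cmod (f v) \<le> vnorm Q.idem (Q.canon ?e v)" unfolding f_def by (rule X.bound[OF he(1)[OF v]])
    also have "\<dots> \<le> vnorm B v" using Q.canon_norm[OF ge(2), of v] v ge(3) by (simp add: Q.idem_simps)
    finally show ?thesis .
  qed
  have fminus: "f v - f w = f (v \<ominus>\<^bsub>B\<^esub> w)" if "v \<in> ran (\<beta> (d e'))" "w \<in> ran (\<beta> (d e'))" for v w
  proof -
    note sub = lin_subspaceD[OF closed_idealD(2)[OF L.automorphismD(2)[OF e(2)]]]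
    have "Q.canon ?e (v \<ominus>\<^bsub>B\<^esub> w) = Q.canon ?e v \<ominus>\<^bsub>Q.idem\<^esub> Q.canon ?e w"
      using that sub(4) by (simp add: vminus_def he(2,3))
    then show ?thesis using that he(1) by (simp add: f_def X.\<phi>_simps)
  qed
  have F0D: "F0 \<noteq> bot" "\<forall>\<^sub>F u in F0. u \<in> ran (\<beta> (d e')) \<and> vnorm B u \<le> 1"
    "\<And>b. b \<in> ran (\<beta> (d e')) \<Longrightarrow> ((\<lambda>u. vnorm B (u \<otimes>\<^bsub>B\<^esub> b \<ominus>\<^bsub>B\<^esub> b)) \<longlongrightarrow> 0) F0"
    using F0 unfolding approximate_unit_def by (auto elim: eventually_mono)
  \<comment> \<open>For fixed \<open>u\<close> the estimate holds for each
    \<open>c \<otimes> u0\<close> and passes to the limit along \<open>F0\<close>; afterwards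
    \<open>X.q u\<close> tends to \<open>1\<close> along \<open>F\<close>.\<close>
  have main: "(cmod (z - f (c \<otimes>\<^bsub>B\<^esub> u)))\<^sup>2 \<le> (vnorm B c)\<^sup>2 * (2 * (1 - X.q u))" if u: "X.good u" for u
  proof (rule tendsto_upperbound[OF _ _ F0D(1)])
    have ur: "u \<in> ran (\<beta>' e')" using X.goodD(1)[OF u] by simp
    have ur': "u \<in> ran (\<beta> (d e'))" "u \<in> carrier B" using ran[OF ur] rc by auto
    \<comment> \<open>Since \<open>u\<close> also lies in the larger ideal, \<open>F0\<close> acts
      on it as a left unit in the limit.\<close>
    have "((\<lambda>u0. f (c \<otimes>\<^bsub>B\<^esub> u0 \<otimes>\<^bsub>B\<^esub> u)) \<longlongrightarrow> f (c \<otimes>\<^bsub>B\<^esub> u)) F0"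
    proof (rule tendsto_if_norm_le[OF F0D(3)[OF ur'(1)], where K = "vnorm B c"])
      show "\<forall>\<^sub>F u0 in F0. cmod (f (c \<otimes>\<^bsub>B\<^esub> u0 \<otimes>\<^bsub>B\<^esub> u) - f (c \<otimes>\<^bsub>B\<^esub> u)) \<le> vnorm B c * vnorm B (u0 \<otimes>\<^bsub>B\<^esub> u \<ominus>\<^bsub>B\<^esub> u)"
        using F0D(2)
      proof eventually_elim
        case (elim u0)
        have u0: "u0 \<in> carrier B" using rc elim by blast
        have m: "c \<otimes>\<^bsub>B\<^esub> u0 \<otimes>\<^bsub>B\<^esub> u \<in> ran (\<beta> (d e'))" "c \<otimes>\<^bsub>B\<^esub> u \<in> ran (\<beta> (d e'))"
          using idl ur' u0 c by simp_all
        have eq: "c \<otimes>\<^bsub>B\<^esub> u0 \<otimes>\<^bsub>B\<^esub> u \<ominus>\<^bsub>B\<^esub> c \<otimes>\<^bsub>B\<^esub> u = c \<otimes>\<^bsub>B\<^esub> (u0 \<otimes>\<^bsub>B\<^esub> u \<ominus>\<^bsub>B\<^esub> u)"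
          using c u0 ur' by (simp add: L.mult_minus_right L.mult_assoc)
        have "c \<otimes>\<^bsub>B\<^esub> (u0 \<otimes>\<^bsub>B\<^esub> u \<ominus>\<^bsub>B\<^esub> u) \<in> ran (\<beta> (d e'))"
          using lin_subspaceD(5)[OF closed_idealD(2)[OF L.automorphismD(2)[OF e(2)]]] idl ur' u0 c by simp
        then show ?case
          unfolding fminus[OF m] eq
          using bound L.norm_mult[of c "u0 \<otimes>\<^bsub>B\<^esub> u \<ominus>\<^bsub>B\<^esub> u"] c u0 ur' by fastforce
      qed
    qed
    then show "((\<lambda>u0. (cmod (f (c \<otimes>\<^bsub>B\<^esub> u0) - f (c \<otimes>\<^bsub>B\<^esub> u0 \<otimes>\<^bsub>B\<^esub> u)))\<^sup>2) \<longlongrightarrow> (cmod (z - f (c \<otimes>\<^bsub>B\<^esub> u)))\<^sup>2) F0"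
      using lim unfolding f_def by (intro tendsto_intros)
    show "\<forall>\<^sub>F u0 in F0. (cmod (f (c \<otimes>\<^bsub>B\<^esub> u0) - f (c \<otimes>\<^bsub>B\<^esub> u0 \<otimes>\<^bsub>B\<^esub> u)))\<^sup>2 \<le> (vnorm B c)\<^sup>2 * (2 * (1 - X.q u))"
      using F0D(2)
    proof eventually_elim
      case (elim u0)
      have u0: "u0 \<in> carrier B" using rc elim by blast
      have m: "c \<otimes>\<^bsub>B\<^esub> u0 \<in> ran (\<beta> (d e'))" using idl elim c by simp
      let ?Y = "Q.canon ?e (c \<otimes>\<^bsub>B\<^esub> u0)"
      have Yu: "?Y \<otimes>\<^bsub>Q.idem\<^esub> Q.canon e' u = Q.canon ?e (c \<otimes>\<^bsub>B\<^esub> u0 \<otimes>\<^bsub>B\<^esub> u)"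
        using he(4)[OF m ur'(1)] ce[OF ur] by simp
      have "vnorm Q.idem ?Y \<le> vnorm B (c \<otimes>\<^bsub>B\<^esub> u0)"
        using Q.canon_norm[OF ge(2)] m ge(3) by (simp add: Q.idem_simps)
      also have "\<dots> \<le> vnorm B c * vnorm B u0" by (rule L.norm_mult[OF c u0])
      also have "\<dots> \<le> vnorm B c * 1" using elim c by (intro mult_left_mono) simp_all
      finally have "(vnorm Q.idem ?Y)\<^sup>2 \<le> (vnorm B c)\<^sup>2" using he(1)[OF m] by (intro power_mono) simp_all
      moreover have "0 \<le> 1 - X.q u" using X.q_le_L[OF u] by (simp add: X.L_eq_1)
      ultimately have "(vnorm Q.idem ?Y)\<^sup>2 * (2 * (1 - X.q u)) \<le> (vnorm B c)\<^sup>2 * (2 * (1 - X.q u))"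
        by (intro mult_right_mono) simp_all
      then show ?case
        using X.mult_unit_close[OF he(1)[OF m] u] unfolding Yu f_def by simp
    qed
  qed
  have "((\<lambda>u. sqrt ((vnorm B c)\<^sup>2 * (2 * (1 - X.q u)))) \<longlongrightarrow> sqrt ((vnorm B c)\<^sup>2 * (2 * (1 - 1)))) F"
    by (intro tendsto_intros X.unit_tendsto_1)
  then have s: "((\<lambda>u. sqrt ((vnorm B c)\<^sup>2 * (2 * (1 - X.q u)))) \<longlongrightarrow> 0) F" by simp
  show ?thesis
  proof (rule tendsto_if_norm_le[OF s, where K = 1])
    show "\<forall>\<^sub>F u in F. cmod (\<phi> (Q.canon e' (c \<otimes>\<^bsub>B\<^esub> u)) - z) \<le> 1 * sqrt ((vnorm B c)\<^sup>2 * (2 * (1 - X.q u)))"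
      using X.eventually_good
    proof eventually_elim
      case (elim u)
      have "u \<in> ran (\<beta>' e')" using X.goodD(1)[OF elim] by simp
      then have "\<phi> (Q.canon e' (c \<otimes>\<^bsub>B\<^esub> u)) = f (c \<otimes>\<^bsub>B\<^esub> u)"
        using ce[OF idl'[OF _ c]] by (simp add: f_def)
      then show ?case using real_le_rsqrt[OF main[OF elim]] by (simp add: norm_minus_commute)
    qed
  qed
qed

text \<open>The retraction preserves idempotents and order, and the canonical elements over
  \<open>e'\<close> are images under \<open>T\<close> of those over \<open>d e'\<close>.\<close>

lemma supports_retract:
  assumes rel: "\<And>y. y \<in> carrier L.full \<Longrightarrow> \<phi>' (T y) = \<phi> y"
    and s: "supports U Q.A \<phi>' x e'" and x: "x \<in> elts (Pr G)"
  shows "supports U L.A \<phi> (d x) (d e')"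
proof -
  have e': "e' \<in> idempotents (Pr G)" "nat_le (Pr G) e' x"
    using s by (auto simp: supports_def)
  obtain a where a: "a \<in> ran (\<beta>' e')" "\<phi>' (Q.canon e' a) \<noteq> 0"
    using s by (auto simp: supports_def)
  have c: "e' \<in> elts (Pr G)" using Q.idempotents_closed[OF e'(1)] .
  have "\<phi> (L.canon (d e') a) = \<phi>' (Q.canon e' a)"
    using rel[OF L.canon_full[OF d_closed[OF c] ran_extends[OF c a(1)]]] canon_retract[OF c a(1)] by simp
  then have "\<exists>a \<in> ran (\<beta> (d e')). \<phi> (L.canon (d e') a) \<noteq> 0" using a ran_extends[OF c a(1)] by metis
  then show ?thesis
    using d_idempotent[OF e'(1)] semigroup_hom_nat_le[OF L.Pr_retract_hom e'(2)] by (simp add: supports_def)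
qed

lemma supports_gen:
  assumes rel: "\<And>y. y \<in> carrier L.full \<Longrightarrow> \<phi>' (T y) = \<phi> y"
    and s: "supports U L.A \<phi> s e"
  shows "supports U Q.A \<phi>' (g s) (g e)"
proof -
  have e: "e \<in> idempotents G" "nat_le G e s" using s by (auto simp: supports_def)
  obtain a where a: "a \<in> ran (\<beta> e)" "\<phi> (L.canon e a) \<noteq> 0" using s by (auto simp: supports_def)
  have c: "e \<in> elts G" using L.idempotents_closed[OF e(1)] .
  have "\<phi>' (Q.canon (g e) a) \<noteq> 0"
    using rel[OF L.canon_full[OF c a(1)]] T_canon[OF c] a(2) by simp
  then show ?thesis
    using L.Pr_gen_idempotent[OF e(1)] L.Pr_gen_nat_le[OF e(2)] a(1) gen[OF c] by (auto simp: supports_def)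
qed

lemma fiber_mult_gen:
  assumes rel: "\<And>y. y \<in> carrier L.full \<Longrightarrow> \<phi>' (T y) = \<phi> y"
    and s: "s \<in> elts G" and a: "a \<in> ran (\<beta> s)" and e: "e \<in> elts G" and u: "u \<in> ran (\<beta> e)"
  shows "\<phi> (L.canon s a \<otimes>\<^bsub>L.full\<^esub> L.canon e u) = \<phi>' (Q.canon (g s) a \<otimes>\<^bsub>Q.full\<^esub> Q.canon (g e) u)"
  using rel[of "L.canon s a \<otimes>\<^bsub>L.full\<^esub> L.canon e u"] L.canon_full[OF s a] L.canon_full[OF e u]
  by (simp add: TF.T(4) T_canon[OF s] T_canon[OF e])

lemma eventually_fiber: "approximate_unit (L.fiber_ideal e) F \<Longrightarrow> \<forall>\<^sub>F u in F. u \<in> ran (\<beta> e)"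
  by (auto simp: approximate_unit_def elim: eventually_mono)

lemma eventually_fiber': "approximate_unit (Q.fiber_ideal e) F \<Longrightarrow> \<forall>\<^sub>F u in F. u \<in> ran (\<beta>' e)"
  by (auto simp: approximate_unit_def elim: eventually_mono)

text \<open>The conditions over \<open>G\<close> at \<open>s\<close> and \<open>e\<close> are
  instances of those over \<open>Pr G\<close> at \<open>[s]\<close> and \<open>[e]\<close>, where
  the fibers coincide. If nothing supports \<open>s\<close>, then nothing supports
  \<open>[s]\<close>, because a supporting idempotent would retract to one.\<close>

lemma extended_state_restrict:
  assumes rel: "\<And>y. y \<in> carrier L.full \<Longrightarrow> \<phi>' (T y) = \<phi> y" "\<And>y. y \<in> carrier L.full \<Longrightarrow> \<psi>' (T y) = \<psi> y"
    and ext: "extended_state U Q.A \<phi>' \<psi>'"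
  shows "extended_state U L.A \<phi> \<psi>"
  unfolding extended_state_def L.bundle_simps
proof (intro conjI ballI allI impI)
  interpret I: isometric_isomorphism Q.full L.full TF.T' by (rule TF.inverse)
  show "is_state L.full \<psi>"
    using ext TF.T'(1,2) rel(2)[OF TF.T'(1)]
    by (intro I.state_transfer[of \<psi>']) (auto simp: extended_state_def)
  fix s a assume s: "s \<in> elts G" and a: "a \<in> ran (\<beta> s)"
  have a': "a \<in> ran (\<beta>' (g s))" using a gen[OF s] by simp
  have \<psi>: "\<psi> (L.canon s a) = \<psi>' (Q.canon (g s) a)"
    using rel(2)[OF L.canon_full[OF s a]] T_canon[OF s] by simp
  note E = ext[unfolded extended_state_def Q.bundle_simps, THEN conjunct2, rule_format, OF g_closed[OF s] a']
  show "\<psi> (L.canon s a) = 0" if none: "\<nexists>e. supports U L.A \<phi> s e"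
  proof -
    have "\<not> supports U Q.A \<phi>' (g s) e'" for e'
      using supports_retract[of \<phi>' \<phi>, OF rel(1) _ g_closed[OF s], of e'] none d_g[OF s] by metis
    then show ?thesis using conjunct2[OF E] \<psi> by simp
  qed
  fix e F assume eF: "supports U L.A \<phi> s e \<and> approximate_unit (fiber_algebra L.A e) F"
  then have e: "e \<in> idempotents G" by (simp add: supports_def)
  then have ec: "e \<in> elts G" using L.idempotents_closed by blast
  have F: "approximate_unit (L.fiber_ideal e) F" using eF L.approximate_unit_fiber[OF e] by simp
  then have "approximate_unit (fiber_algebra Q.A (g e)) F"
    using Q.approximate_unit_fiber[OF L.Pr_gen_idempotent[OF e]] gen[OF ec] by simp
  then have "((\<lambda>u. \<phi>' (Q.canon (g s) a \<otimes>\<^bsub>Q.full\<^esub> Q.canon (g e) u)) \<longlongrightarrow> \<psi>' (Q.canon (g s) a)) F"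
    using conjunct1[OF E] supports_gen[of \<phi>' \<phi>, OF rel(1) conjunct1[OF eF]] by blast
  then show "((\<lambda>u. \<phi> (L.canon s a \<otimes>\<^bsub>L.full\<^esub> L.canon e u)) \<longlongrightarrow> \<psi> (L.canon s a)) F"
    unfolding \<psi>
    by (rule Lim_transform_eventually)
      (use eventually_fiber[OF F] in eventually_elim, simp add: fiber_mult_gen[of \<phi>' \<phi>, OF rel(1) s a ec])
qed

text \<open>The prescribed value at \<open>x\<close> is the one at \<open>d x\<close>. A supporting
  \<open>e'\<close> below \<open>x\<close> retracts to a supporting \<open>d e'\<close>; some
  approximate unit of the larger fiber expresses the value as a limit, and purity carries the limit
  over to the given unit of the smaller fiber.\<close>

lemma extended_state_extend:
  assumes pure: "pure_state Q.idem \<phi>'"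
    and rel: "\<And>y. y \<in> carrier L.full \<Longrightarrow> \<phi>' (T y) = \<phi> y" "\<And>y. y \<in> carrier L.full \<Longrightarrow> \<psi>' (T y) = \<psi> y"
    and ext: "extended_state U L.A \<phi> \<psi>"
  shows "extended_state U Q.A \<phi>' \<psi>'"
  unfolding extended_state_def Q.bundle_simps
proof (intro conjI ballI allI impI)
  show "is_state Q.full \<psi>'"
    using ext rel(2) by (intro TF.state_transfer[of \<psi>]) (auto simp: extended_state_def)
  fix x a assume x: "x \<in> elts (Pr G)" and a: "a \<in> ran (\<beta>' x)"
  let ?s = "d x"
  have s: "?s \<in> elts G" and a': "a \<in> ran (\<beta> ?s)" using d_closed[OF x] ran_extends[OF x a] .
  obtain c where c: "\<beta>' x c = Some a" using Q.ran_Some[OF a] by blast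
  have cs: "\<beta> ?s c = Some a" using extends[OF x c] .
  have cB: "c \<in> carrier B" using L.automorphismD(4)[OF s cs] .
  have \<psi>: "\<psi>' (Q.canon x a) = \<psi> (L.canon ?s a)"
    using rel(2)[OF L.canon_full[OF s a']] canon_retract[OF x a] by simp
  note E = ext[unfolded extended_state_def L.bundle_simps, THEN conjunct2, rule_format, OF s a']
  have limit: "\<exists>F0. approximate_unit (L.fiber_ideal e) F0 \<and>
      ((\<lambda>u. \<phi>' (Q.canon (g e) (c \<otimes>\<^bsub>B\<^esub> u))) \<longlongrightarrow> \<psi>' (Q.canon x a)) F0"
    if sup: "supports U L.A \<phi> ?s e" for e
  proof -
    have e: "e \<in> idempotents G" and le: "nat_le G e ?s" using sup by (auto simp: supports_def)
    have ec: "e \<in> elts G" using L.idempotents_closed[OF e] .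
    obtain F0 where F0: "approximate_unit (L.fiber_ideal e) F0"
      using cstar_algebra.approximate_unit_exists[OF L.cstar_algebra_fiber_ideal[OF ec]] by blast
    then have "((\<lambda>u. \<phi> (L.canon ?s a \<otimes>\<^bsub>L.full\<^esub> L.canon e u)) \<longlongrightarrow> \<psi> (L.canon ?s a)) F0"
      using conjunct1[OF E] sup L.approximate_unit_fiber[OF e] by blast
    then have "((\<lambda>u. \<phi>' (Q.canon (g e) (c \<otimes>\<^bsub>B\<^esub> u))) \<longlongrightarrow> \<psi>' (Q.canon x a)) F0"
      unfolding \<psi>
    proof (rule Lim_transform_eventually)
      show "\<forall>\<^sub>F u in F0. \<phi> (L.canon ?s a \<otimes>\<^bsub>L.full\<^esub> L.canon e u) = \<phi>' (Q.canon (g e) (c \<otimes>\<^bsub>B\<^esub> u))"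
        using eventually_fiber[OF F0]
      proof eventually_elim
        case (elim u)
        have "L.canon ?s a \<otimes>\<^bsub>L.full\<^esub> L.canon e u = L.canon e (c \<otimes>\<^bsub>B\<^esub> u)" "c \<otimes>\<^bsub>B\<^esub> u \<in> ran (\<beta> e)"
          using L.canon_mult_idempotent[OF le e cs elim] .
        then show ?case using rel(1)[OF L.canon_full[OF ec, of "c \<otimes>\<^bsub>B\<^esub> u"]] T_canon[OF ec] by simp
      qed
    qed
    then show ?thesis using F0 by blast
  qed
  show "\<psi>' (Q.canon x a) = 0" if none: "\<nexists>e'. supports U Q.A \<phi>' x e'"
  proof (cases "\<exists>e. supports U L.A \<phi> ?s e")
    case False
    then show ?thesis using conjunct2[OF E] \<psi> by simp
  next
    case True
    then obtain e where sup: "supports U L.A \<phi> ?s e" by blast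
    then have e: "e \<in> idempotents G" and le: "nat_le G e ?s" by (auto simp: supports_def)
    have ec: "e \<in> elts G" using L.idempotents_closed[OF e] .
    have ge: "g e \<in> idempotents (Pr G)" "g e \<in> elts (Pr G)" using L.Pr_gen_idempotent[OF e] g_closed[OF ec] .
    obtain F0 where F0: "approximate_unit (L.fiber_ideal e) F0"
      "((\<lambda>u. \<phi>' (Q.canon (g e) (c \<otimes>\<^bsub>B\<^esub> u))) \<longlongrightarrow> \<psi>' (Q.canon x a)) F0"
      using limit[OF sup] by blast
    \<comment> \<open>\<open>\<phi>\<close> may be supported below \<open>d x\<close> though
      \<open>\<phi>'\<close> is not supported below \<open>x\<close>. Multiplication by
      \<open>x\<close> cuts \<open>[e]\<close> down to an idempotent below \<open>x\<close>. For
      \<open>u\<close> in the fiber over \<open>e\<close>, the product \<open>c \<otimes> u\<close>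
      is in the domain of \<open>\<beta>' x\<close>, hence in the fiber over \<open>?e\<close>,
      where \<open>\<phi>'\<close> vanishes; so the limit is \<open>0\<close>.\<close>
    let ?e = "x \<cdot>\<^bsub>Pr G\<^esub> g e"
    obtain f where f: "f \<in> idempotents (Pr G)" "x = g ?s \<cdot>\<^bsub>Pr G\<^esub> f"
      using le_gd[OF x] by (auto simp: nat_le_def)
    have "?e = g ?s \<cdot>\<^bsub>Pr G\<^esub> (f \<cdot>\<^bsub>Pr G\<^esub> g e)"
      using f Q.idempotents_closed[OF f(1)] ge(2) g_closed[OF s] by (metis Q.assoc)
    also have "\<dots> = g ?s \<cdot>\<^bsub>Pr G\<^esub> g e \<cdot>\<^bsub>Pr G\<^esub> f"
      unfolding Q.idempotents_commute[OF f(1) ge(1)]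
      using Q.idempotents_closed[OF f(1)] ge(2) g_closed[OF s] by (simp add: Q.assoc)
    also have "g ?s \<cdot>\<^bsub>Pr G\<^esub> g e = g e"
      using semigroup_partial_hom.pi_mult_idempotent[OF L.Pr_semigroup_partial_hom s e]
        L.nat_le_idempotent_mult[OF le e] by simp
    finally have eq: "?e = g e \<cdot>\<^bsub>Pr G\<^esub> f" .
    have ei: "?e \<in> idempotents (Pr G)" unfolding eq by (rule Q.idempotents_mult[OF ge(1) f(1)])
    have ele: "nat_le (Pr G) ?e (g e)" unfolding eq by (rule Q.nat_leI[OF ge(2) f(1)])
    have elx: "nat_le (Pr G) ?e x" by (rule Q.nat_leI[OF x ge(1)])
    have "\<forall>\<^sub>F u in F0. \<phi>' (Q.canon (g e) (c \<otimes>\<^bsub>B\<^esub> u)) = 0"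
      using eventually_fiber[OF F0(1)]
    proof eventually_elim
      case (elim u)
      have uB: "u \<in> carrier B" using L.ran_carrier[OF ec elim] .
      have "c \<otimes>\<^bsub>B\<^esub> u \<in> ran (\<beta> e)" using closed_idealD(4)[OF L.automorphismD(2)[OF ec] cB elim] .
      then have 1: "\<beta>' (g e) (c \<otimes>\<^bsub>B\<^esub> u) = Some (c \<otimes>\<^bsub>B\<^esub> u)"
        using L.idempotent_Some[OF e] gen[OF ec] by simp
      have "c \<otimes>\<^bsub>B\<^esub> u \<in> dom (\<beta>' x)"
        using closed_idealD(5)[OF Q.automorphismD(1)[OF x] uB, of c] c by blast
      then obtain w where w: "\<beta>' x (c \<otimes>\<^bsub>B\<^esub> u) = Some w" by blast
      have "\<beta>' ?e (c \<otimes>\<^bsub>B\<^esub> u) = Some w" using Q.action_mult[OF x ge(2) 1 w] .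
      then have r: "c \<otimes>\<^bsub>B\<^esub> u \<in> ran (\<beta>' ?e)" using Q.action_idempotent[OF ei] ranI by metis
      have "\<not> supports U Q.A \<phi>' x ?e" using none by blast
      then have "\<phi>' (Q.canon ?e (c \<otimes>\<^bsub>B\<^esub> u)) = 0" using ei elx r by (auto simp: supports_def)
      then show ?case using Q.canon_mono[OF ele r] by simp
    qed
    then have "((\<lambda>u. \<phi>' (Q.canon (g e) (c \<otimes>\<^bsub>B\<^esub> u))) \<longlongrightarrow> 0) F0" by (rule tendsto_eventually)
    moreover have "F0 \<noteq> bot" using F0(1) by (simp add: approximate_unit_def)
    ultimately show ?thesis using tendsto_unique[OF _ F0(2)] by blast
  qed
  fix e' F assume eF: "supports U Q.A \<phi>' x e' \<and> approximate_unit (fiber_algebra Q.A e') F"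
  then have e': "e' \<in> idempotents (Pr G)" and le: "nat_le (Pr G) e' x"
    and nz: "\<exists>b \<in> ran (\<beta>' e'). \<phi>' (Q.canon e' b) \<noteq> 0"
    by (auto simp: supports_def)
  have F: "approximate_unit (Q.fiber_ideal e') F" using eF Q.approximate_unit_fiber[OF e'] by simp
  obtain F0 where F0: "approximate_unit (L.fiber_ideal (d e')) F0"
    "((\<lambda>u. \<phi>' (Q.canon (g (d e')) (c \<otimes>\<^bsub>B\<^esub> u))) \<longlongrightarrow> \<psi>' (Q.canon x a)) F0"
    using limit[OF supports_retract[of \<phi>' \<phi>, OF rel(1) conjunct1[OF eF] x]] by blast
  have "((\<lambda>u. \<phi>' (Q.canon e' (c \<otimes>\<^bsub>B\<^esub> u))) \<longlongrightarrow> \<psi>' (Q.canon x a)) F"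
    by (rule limit_along_smaller_unit[OF pure e' nz F F0(1) cB F0(2)])
  then show "((\<lambda>u. \<phi>' (Q.canon x a \<otimes>\<^bsub>Q.full\<^esub> Q.canon e' u)) \<longlongrightarrow> \<psi>' (Q.canon x a)) F"
    by (rule Lim_transform_eventually)
      (use eventually_fiber'[OF F] in eventually_elim, simp add: Q.canon_mult_idempotent(1)[OF le e' c])
qed

abbreviation kernel_L where "kernel_L \<equiv> {x \<in> carrier L.full. \<forall>\<phi> \<psi>.
  pure_state L.idem \<phi> \<and> extended_state U L.A \<phi> \<psi> \<longrightarrow> x \<in> gns_kernel L.full \<psi>}"

abbreviation kernel_Q where "kernel_Q \<equiv> {x \<in> carrier Q.full. \<forall>\<phi> \<psi>.
  pure_state Q.idem \<phi> \<and> extended_state U Q.A \<phi> \<psi> \<longrightarrow> x \<in> gns_kernel Q.full \<psi>}"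

lemma kernel_image: "T ` kernel_L = kernel_Q"
proof (intro equalityI subsetI)
  interpret IE: isometric_isomorphism Q.idem L.idem TE.T' by (rule TE.inverse)
  fix y assume "y \<in> T ` kernel_L"
  then obtain x where x: "x \<in> kernel_L" "y = T x" by blast
  have "y \<in> gns_kernel Q.full \<psi>'" if pe: "pure_state Q.idem \<phi>'" "extended_state U Q.A \<phi>' \<psi>'" for \<phi>' \<psi>'
  proof -
    have "pure_state L.idem (\<phi>' \<circ> T)"
      using TE.T'(2) by (intro IE.pure_state_transfer[OF pe(1)]) simp
    moreover have "extended_state U L.A (\<phi>' \<circ> T) (\<psi>' \<circ> T)"
      by (rule extended_state_restrict[OF _ _ pe(2)]) simp_all
    ultimately have "x \<in> gns_kernel L.full (\<psi>' \<circ> T)" using x by blast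
    then show ?thesis using TF.gns_transfer[of \<psi>' "\<psi>' \<circ> T" x] x by simp
  qed
  moreover have "y \<in> carrier Q.full" using x TF.T(1) by simp
  ultimately show "y \<in> kernel_Q" by blast
next
  interpret IF: isometric_isomorphism Q.full L.full TF.T' by (rule TF.inverse)
  fix y assume y: "y \<in> kernel_Q"
  let ?x = "TF.T' y"
  have x: "?x \<in> carrier L.full" "T ?x = y" using y TF.T' by auto
  have "?x \<in> gns_kernel L.full \<psi>" if pe: "pure_state L.idem \<phi>" "extended_state U L.A \<phi> \<psi>" for \<phi> \<psi>
  proof -
    have T': "TF.T' (T z) = z" if "z \<in> carrier L.full" for z using TF.T'(3)[OF that] .
    \<comment> \<open>The inverse on the full algebra is used for both functionals, since
      \<open>extended_state_extend\<close> needs the relation between \<open>\<phi>\<close> and its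
      transport on all of \<open>carrier L.full\<close>.\<close>
    have "pure_state Q.idem (\<phi> \<circ> TF.T')"
      using T' L.idem_subset by (intro TE.pure_state_transfer[OF pe(1)]) auto
    moreover from this have "extended_state U Q.A (\<phi> \<circ> TF.T') (\<psi> \<circ> TF.T')"
      using T' by (intro extended_state_extend[OF _ _ _ pe(2)]) simp_all
    ultimately have "y \<in> gns_kernel Q.full (\<psi> \<circ> TF.T')" using y by blast
    then show ?thesis by (intro IF.gns_transfer[of \<psi> "\<psi> \<circ> TF.T'"]) simp_all
  qed
  then have "?x \<in> kernel_L" using x(1) by blast
  then show "y \<in> T ` kernel_L" by (rule image_eqI[where f = T and x = ?x, OF x(2)[symmetric]])
qed

theorem full_isomorphic: "full_crossed_product U G B \<beta> \<cong>\<^sup>* full_crossed_product U (Pr G) B \<beta>'"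
  unfolding full_crossed_product_def by (rule TF.star_isomorphic)

theorem reduced_isomorphic: "reduced_crossed_product U G B \<beta> \<cong>\<^sup>* reduced_crossed_product U (Pr G) B \<beta>'"
  unfolding reduced_crossed_product_def reduced_cstar_def kernel_image[symmetric]
  by (rule TF.quotient_isomorphic) blast

end

section \<open>The action induced by a partial action\<close>

lemma partial_action_extension_induced:
  assumes "inverse_semigroup G" "cstar_algebra B" "partial_hom G (PAut B) \<beta>"
  shows "partial_action_extension G B \<beta> (induced_hom G (PAut B) \<beta>)"
proof -
  interpret G: inverse_semigroup G by fact
  note act = semigroup_action_of_partial_hom[OF assms]
  note ind = semigroup_partial_hom.induced_hom[OF act(2)]
  \<comment> \<open>A homomorphism from an inverse semigroup is a partial homomorphism, so the
    induced action falls under the same lemma as \<open>\<beta>\<close>.\<close>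
  have "semigroup_action (Pr G) B (induced_hom G (PAut B) \<beta>)"
    using semigroup_action_of_partial_hom(1)[OF G.Pr_inverse_semigroup assms(2)
        semigroup_hom_partial_hom[OF G.Pr_inverse_semigroup ind(1)]] .
  then show ?thesis
    using act(1) ind
    by (intro partial_action_extension.intro crossed_product.intro partial_action_extension_axioms.intro)
qed

theorem corollary8p3:
  fixes G :: "'g semigroup_str" and B :: "'b star_algebra" and \<beta> :: "'g \<Rightarrow> 'b \<rightharpoonup> 'b"
  assumes "inverse_semigroup G" and "cstar_algebra B" and "partial_action G B \<beta>"
  shows "full_crossed_product TYPE(('g, 'b) rep_univ) G B \<beta>
           \<cong>\<^sup>* full_crossed_product TYPE(('g, 'b) rep_univ) (Pr G) B (induced_hom G (PAut B) \<beta>)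
         \<and> reduced_crossed_product TYPE(('g, 'b) rep_univ) G B \<beta>
           \<cong>\<^sup>* reduced_crossed_product TYPE(('g, 'b) rep_univ) (Pr G) B (induced_hom G (PAut B) \<beta>)"
proof -
  have "partial_hom G (PAut B) \<beta>" using assms(3) by (simp add: partial_action_def)
  from partial_action_extension_induced[OF assms(1,2) this]
  interpret partial_action_extension G B \<beta> "induced_hom G (PAut B) \<beta>" "TYPE(('g, 'b) rep_univ)" .
  show ?thesis using full_isomorphic reduced_isomorphic ..
qed

end
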